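(* For every $\mathbf a=\binom{a_1}{a_2}\in\mathbb{Q}^2\setminus\mathbb{Z}^2$, the holomorphic projection $H(E_{\mathbf a}(\tau,X)^2)$ lies in $\widetilde{\mathcal E}_2$, i.e. each coefficient of $X^n$ in $H(E_{\mathbf a}^2)$ lies in the Eisenstein subspace $\mathcal E_{n+2}(\Gamma)$ for a congruence subgroup $\Gamma$ independent of $n$.
   Context: For $k\ge1$, $\phi_k(z,\tau)$ is the value at $s=0$ of the analytic continuation of $\sum_{\omega\in\mathbb{Z}\tau+\mathbb{Z}}{}'(z+\omega)^{-k}|z+\omega|^{-s}$ (term $\omega=-z$ omitted if present). For $\mathbf a\in\mathbb{Q}^2\setminus\mathbb{Z}^2$ set $E_{k,\mathbf a}(\tau)=\phi_k(a_1\tau+a_2,\tau)$ and $E_{\mathbf a}(\tau,X)=\sum_{n\ge0}E_{n+1,\mathbf a}(\tau)(-X)^n$; the coefficient of $X^n$ in $E_{\mathbf a}^2$ is a nearly holomorphic modular form of weight $n+2$ for $\Gamma(N)$ where $N\mathbf a\in\mathbb{Z}^2$. A nearly holomorphic modular form of weight $k$ for a congruence subgroup $\Gamma$ is a $C^\infty$ function $f$ on $\mathcal H$, slowly increasing at the cusps, killed by a power of $\epsilon=(\tau-\bar\tau)^2\partial/\partial\bar\tau$, with $f(\gamma\tau)(c\tau+d)^{-k}=f(\tau)$ for $\gamma\in\Gamma$; their space is $\mathcal N_k(\Gamma)$. With $\delta_k=\partial_\tau+k/(\tau-\bar\tau)$, the holomorphic projection $H:\mathcal N_k(\Gamma)\to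 M_k(\Gamma)$ is the linear map with $H(f)=f$ for holomorphic $f$ and, for $k\ge3$, $H(\delta_{k-2}g)=0$ for $g\in\mathcal N_{k-2}(\Gamma)$ (using $\mathcal N_k(\Gamma)=M_k(\Gamma)\oplus\delta_{k-2}\mathcal N_{k-2}(\Gamma)$ for $k\ge3$); it is applied to power series coefficientwise. $\mathcal E_k(\Gamma)\subseteq M_k(\Gamma)$ denotes the holomorphic Eisenstein subspace, and $\widetilde{\mathcal E}_2$ the set of power series whose $X^n$-coefficients lie in $\mathcal E_{n+2}(\Gamma)$ for a common congruence subgroup $\Gamma$. *)

theory Defs
  imports
    "HOL-Analysis.Analysis"
    "HOL-Complex_Analysis.Complex_Analysis"
    "HOL-Computational_Algebra.Formal_Power_Series"
    "HOL-Number_Theory.Cong"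
    "HOL-Algebra.Group"
begin

definition upper_half_plane :: "complex set" where
  "upper_half_plane = {\<tau>. Im \<tau> > 0}"

text \<open>
  Functions on the upper half plane are represented by their extension by zero to all
  complex numbers; membership in each of the spaces below includes this normalisation, so that
  equality of functions means equality on the upper half plane.
\<close>

definition vanishes_off_uhp :: "(complex \<Rightarrow> complex) \<Rightarrow> bool" where
  "vanishes_off_uhp f \<longleftrightarrow> (\<forall>\<tau>. \<tau> \<notin> upper_half_plane \<longrightarrow> f \<tau> = 0)"

definition SL2Z :: "(int^2^2) monoid" where
  "SL2Z = \<lparr>carrier = {A. det A = 1}, mult = (**), one = mat 1\<rparr>"

definition principal_congruence_subgroup :: "nat \<Rightarrow> (int^2^2) set" where
  "principal_congruence_subgroup N =
     {A \<in> carrier SL2Z. \<forall>i j. [A $ i $ j = (mat 1 :: int^2^2) $ i $ j] (mod int N)}"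

definition congruence_subgroup :: "(int^2^2) set \<Rightarrow> bool" where
  "congruence_subgroup \<Gamma> \<longleftrightarrow>
     subgroup \<Gamma> SL2Z \<and> (\<exists>N>0. principal_congruence_subgroup N \<subseteq> \<Gamma>)"

definition automorphy_factor :: "int^2^2 \<Rightarrow> complex \<Rightarrow> complex" where
  "automorphy_factor A \<tau> = of_int (A $ 2 $ 1) * \<tau> + of_int (A $ 2 $ 2)"

definition moebius :: "int^2^2 \<Rightarrow> complex \<Rightarrow> complex" where
  "moebius A \<tau> = (of_int (A $ 1 $ 1) * \<tau> + of_int (A $ 1 $ 2)) / automorphy_factor A \<tau>"

definition slash :: "nat \<Rightarrow> (complex \<Rightarrow> complex) \<Rightarrow> int^2^2 \<Rightarrow> complex \<Rightarrow> complex" where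
  "slash k f A \<tau> = f (moebius A \<tau>) / automorphy_factor A \<tau> ^ k"

definition slash_invariant :: "(int^2^2) set \<Rightarrow> nat \<Rightarrow> (complex \<Rightarrow> complex) \<Rightarrow> bool" where
  "slash_invariant \<Gamma> k f \<longleftrightarrow> (\<forall>A\<in>\<Gamma>. \<forall>\<tau>\<in>upper_half_plane. slash k f A \<tau> = f \<tau>)"

definition partial_x :: "(complex \<Rightarrow> complex) \<Rightarrow> complex \<Rightarrow> complex" where
  "partial_x f z = frechet_derivative f (at z) 1"

definition partial_y :: "(complex \<Rightarrow> complex) \<Rightarrow> complex \<Rightarrow> complex" where
  "partial_y f z = frechet_derivative f (at z) \<i>"

text \<open>Real differentiability of order \<open>n\<close>; only meaningful for open sets.\<close>

fun Cn_on :: "nat \<Rightarrow> (complex \<Rightarrow> complex) \<Rightarrow> complex set \<Rightarrow> bool" where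
  "Cn_on 0 f S \<longleftrightarrow> continuous_on S f"
| "Cn_on (Suc n) f S \<longleftrightarrow>
     (\<forall>z\<in>S. f differentiable (at z)) \<and> Cn_on n (partial_x f) S \<and> Cn_on n (partial_y f) S"

definition Cinfinity_on :: "(complex \<Rightarrow> complex) \<Rightarrow> complex set \<Rightarrow> bool" where
  "Cinfinity_on f S \<longleftrightarrow> (\<forall>n. Cn_on n f S)"

definition d_tau :: "(complex \<Rightarrow> complex) \<Rightarrow> complex \<Rightarrow> complex" where
  "d_tau f z = (partial_x f z - \<i> * partial_y f z) / 2"

definition d_taubar :: "(complex \<Rightarrow> complex) \<Rightarrow> complex \<Rightarrow> complex" where
  "d_taubar f z = (partial_x f z + \<i> * partial_y f z) / 2"

definition eps_op :: "(complex \<Rightarrow> complex) \<Rightarrow> complex \<Rightarrow> complex" where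
  "eps_op f \<tau> = (\<tau> - cnj \<tau>)\<^sup>2 * d_taubar f \<tau>"

definition delta_op :: "nat \<Rightarrow> (complex \<Rightarrow> complex) \<Rightarrow> complex \<Rightarrow> complex" where
  "delta_op k f \<tau> =
     (if \<tau> \<in> upper_half_plane then d_tau f \<tau> + of_nat k / (\<tau> - cnj \<tau>) * f \<tau> else 0)"

definition slowly_increasing_at_cusps :: "nat \<Rightarrow> (complex \<Rightarrow> complex) \<Rightarrow> bool" where
  "slowly_increasing_at_cusps k f \<longleftrightarrow>
     (\<forall>A\<in>carrier SL2Z. \<exists>B>0. \<exists>C c :: real. \<forall>\<tau>. Im \<tau> > B \<longrightarrow>
        norm (slash k f A \<tau>) \<le> C * Im \<tau> powr c)"

definition bounded_at_cusps :: "nat \<Rightarrow> (complex \<Rightarrow> complex) \<Rightarrow> bool" where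
  "bounded_at_cusps k f \<longleftrightarrow>
     (\<forall>A\<in>carrier SL2Z. \<exists>B>0. \<exists>C :: real. \<forall>\<tau>. Im \<tau> > B \<longrightarrow> norm (slash k f A \<tau>) \<le> C)"

definition nearly_holomorphic_forms :: "(int^2^2) set \<Rightarrow> nat \<Rightarrow> (complex \<Rightarrow> complex) set" where
  "nearly_holomorphic_forms \<Gamma> k =
     {f. vanishes_off_uhp f \<and> Cinfinity_on f upper_half_plane \<and>
         slowly_increasing_at_cusps k f \<and>
         (\<exists>m. \<forall>\<tau>\<in>upper_half_plane. (eps_op ^^ m) f \<tau> = 0) \<and>
         slash_invariant \<Gamma> k f}"

definition modular_forms :: "(int^2^2) set \<Rightarrow> nat \<Rightarrow> (complex \<Rightarrow> complex) set" where
  "modular_forms \<Gamma> k =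
     {f. vanishes_off_uhp f \<and> f holomorphic_on upper_half_plane \<and>
         bounded_at_cusps k f \<and> slash_invariant \<Gamma> k f}"

definition is_holomorphic_projection ::
    "(int^2^2) set \<Rightarrow> nat \<Rightarrow> ((complex \<Rightarrow> complex) \<Rightarrow> (complex \<Rightarrow> complex)) \<Rightarrow> bool" where
  "is_holomorphic_projection \<Gamma> k H \<longleftrightarrow>
     (\<forall>f\<in>nearly_holomorphic_forms \<Gamma> k. H f \<in> modular_forms \<Gamma> k) \<and>
     (\<forall>f\<in>nearly_holomorphic_forms \<Gamma> k. \<forall>g\<in>nearly_holomorphic_forms \<Gamma> k.
        H (\<lambda>\<tau>. f \<tau> + g \<tau>) = (\<lambda>\<tau>. H f \<tau> + H g \<tau>)) \<and>
     (\<forall>c. \<forall>f\<in>nearly_holomorphic_forms \<Gamma> k. H (\<lambda>\<tau>. c * f \<tau>) = (\<lambda>\<tau>. c * H f \<tau>)) \<and>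
     (\<forall>f\<in>modular_forms \<Gamma> k. H f = f) \<and>
     (k \<ge> 3 \<longrightarrow> (\<forall>g\<in>nearly_holomorphic_forms \<Gamma> (k - 2). H (delta_op (k - 2) g) = (\<lambda>\<tau>. 0)))"

text \<open>
  For \<open>k \<ge> 3\<close> the conditions determine the map on nearly holomorphic forms, because these are the
  direct sum of the modular forms and the image of \<open>delta_op (k - 2)\<close>.  In weight 2 they
  determine it on holomorphic forms only.
\<close>

definition hol_proj ::
    "(int^2^2) set \<Rightarrow> nat \<Rightarrow> (complex \<Rightarrow> complex) \<Rightarrow> (complex \<Rightarrow> complex)" where
  "hol_proj \<Gamma> k = (SOME H. is_holomorphic_projection \<Gamma> k H)"

definition period_lattice :: "complex \<Rightarrow> complex set" where
  "period_lattice \<tau> = {of_int m * \<tau> + of_int n | m n :: int. True}"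

definition phi_sum :: "nat \<Rightarrow> complex \<Rightarrow> complex \<Rightarrow> complex \<Rightarrow> complex" where
  "phi_sum k z \<tau> s =
     (\<Sum>\<^sub>\<infinity>\<omega>\<in>period_lattice \<tau> - {-z}.
        inverse ((z + \<omega>) ^ k) * complex_of_real (norm (z + \<omega>)) powr (- s))"

text \<open>
  The series converges absolutely exactly for \<open>Re s > 2 - k\<close>.  Its continuation is taken on some
  open right half plane containing 0, which makes the value at 0 unique.
\<close>

definition phi :: "nat \<Rightarrow> complex \<Rightarrow> complex \<Rightarrow> complex" where
  "phi k z \<tau> = (THE v. \<exists>c<0. \<exists>F.
     F holomorphic_on {s. Re s > c} \<and>
     (\<forall>s. Re s > c \<and> Re s > 2 - real k \<longrightarrow> F s = phi_sum k z \<tau> s) \<and>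
     F 0 = v)"

definition eisenstein :: "nat \<Rightarrow> rat \<times> rat \<Rightarrow> complex \<Rightarrow> complex" where
  "eisenstein k a \<tau> =
     (if \<tau> \<in> upper_half_plane then phi k (of_rat (fst a) * \<tau> + of_rat (snd a)) \<tau> else 0)"

text \<open>A power series in \<open>X\<close> whose coefficients are functions of \<open>\<tau>\<close> is a map from \<open>\<tau>\<close> to
  complex power series.\<close>

definition eisenstein_series :: "rat \<times> rat \<Rightarrow> complex \<Rightarrow> complex fps" where
  "eisenstein_series a \<tau> = Abs_fps (\<lambda>n. eisenstein (n + 1) a \<tau> * (- 1) ^ n)"

text \<open>
  The holomorphic Eisenstein subspace: the linear combinations of Eisenstein series of weight \<open>k\<close>
  that are (holomorphic) modular forms for \<open>\<Gamma>\<close>.  Requiring modularity of the combination matters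
  in weight 2, where the individual series are not holomorphic.
\<close>

definition eisenstein_space :: "(int^2^2) set \<Rightarrow> nat \<Rightarrow> (complex \<Rightarrow> complex) set" where
  "eisenstein_space \<Gamma> k =
     {f \<in> modular_forms \<Gamma> k.
        \<exists>(S :: (rat \<times> rat) set) c. finite S \<and> f = (\<lambda>\<tau>. \<Sum>b\<in>S. c b * eisenstein k b \<tau>)}"

definition hol_proj_series ::
    "(int^2^2) set \<Rightarrow> (complex \<Rightarrow> complex fps) \<Rightarrow> complex \<Rightarrow> complex fps" where
  "hol_proj_series \<Gamma> F \<tau> = Abs_fps (\<lambda>n. hol_proj \<Gamma> (n + 2) (\<lambda>t. fps_nth (F t) n) \<tau>)"

definition eisenstein_series_space :: "(complex \<Rightarrow> complex fps) set" where
  "eisenstein_series_space =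
     {F. \<exists>\<Gamma>. congruence_subgroup \<Gamma> \<and> (\<forall>n. (\<lambda>\<tau>. fps_nth (F \<tau>) n) \<in> eisenstein_space \<Gamma> (n + 2))}"

end

theory Submission
  imports Defs "HOL-Real_Asymp.Real_Asymp" "HOL-Analysis.Kronecker_Approximation_Theorem"
    "HOL-Library.Function_Algebras"
begin

text \<open>
  Write \<open>E\<^sub>k\<close> for \<open>eisenstein k a\<close>.  With \<open>q = exp (2 \<pi> i \<tau>)\<close> and \<open>x = exp (2 \<pi> i (a\<^sub>1 \<tau> + a\<^sub>2))\<close> the
  analytic continuation is computed by summing over rows of the lattice, and up to a constant factor \<open>E\<^sub>k\<close> is the
  \<open>(k - 1)\<close>-st derivative \<open>(x d/dx) ^ (k - 1)\<close> of the Lambert series \<open>J\<^sub>0 = 1/2 + x/(1 - x) + \<dots>\<close>,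
  corrected by \<open>a\<^sub>1\<close> for \<open>k = 1\<close> and by a multiple of \<open>1/(\<tau> - cnj \<tau>)\<close> for \<open>k = 2\<close>.

  The square of \<open>J\<^sub>0\<close> differs from \<open>J\<^sub>1\<close> minus twice a Lambert series \<open>\<Psi>\<^sub>0\<close> by a function that is holomorphic and
  invariant under \<open>x \<mapsto> q x\<close>, hence constant in \<open>x\<close>.  Differentiating this \<open>n \<ge> 1\<close> times and recognising
  \<open>\<Psi>\<^sub>n\<close> as part of a \<open>\<tau>\<close>-derivative gives
  \<open>(\<Sum>i\<le>n. E\<^sub>i\<^sub>+\<^sub>1 * E\<^sub>n\<^sub>-\<^sub>i\<^sub>+\<^sub>1) = (n + 1) * E\<^sub>n\<^sub>+\<^sub>2 + c * \<delta>\<^sub>n E\<^sub>n\<close>,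
  so the \<open>n\<close>-th coefficient projects to a multiple of \<open>E\<^sub>n\<^sub>+\<^sub>2\<close>.

  For \<open>n = 0\<close> the form \<open>E\<^sub>1\<^sup>2\<close> is already holomorphic, and \<open>E\<^sub>1\<^sup>2 - E\<^sub>2\<close> involves \<open>\<Psi>\<^sub>0 + a\<^sub>1 J\<^sub>0\<close>, which is the
  finite Fourier transform over the \<open>N\<close>-torsion of the series for \<open>E\<^sub>2\<close>.  Thus \<open>E\<^sub>1\<^sup>2\<close> is an explicit linear combination
  of weight 2 Eisenstein series plus a constant, and the constant vanishes because it is modular of weight 2.
\<close>

section \<open>Nearly holomorphic functions as polynomials in \<open>1/(\<tau> - cnj \<tau>)\<close>\<close>

text \<open>\<open>hol_proj\<close> is a choice operator, so nothing follows about it until a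
  projection exists. By linear algebra one exists as soon as the holomorphic forms of weight
  \<open>k\<close> meet the image of \<open>delta_op (k - 2)\<close> only in 0. Suppose a
  holomorphic form is \<open>delta_op w g\<close>. Comparing powers of 1/(\<tau> - cnj \<tau>) shows
  that \<open>g\<close> has degree at most \<open>w\<close>, and its coefficient of degree
  \<open>w\<close> is a form of weight \<open>- w\<close> with moderate growth, hence 0; the other
  coefficients then vanish in turn. In weights 1 and 2 the lattice sum does not converge absolutely
  at \<open>s = 0\<close>. From \<open>1 - s / 2\<close> times each summand a difference is
  subtracted that sums to 0 far to the right and makes the remainder absolutely summable near 0.
  Summed by rows, the remainder keeps the values of the telescoping sums at infinity. These are the
  corrections by \<open>a1\<close> in weight 1 and by 1/(\<tau> - cnj \<tau>) in weight 2.\<close>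

abbreviation uhp :: "complex set" where "uhp \<equiv> upper_half_plane"

lemma uhp_iff: "\<tau> \<in> uhp \<longleftrightarrow> Im \<tau> > 0"
  by (simp add: upper_half_plane_def)

lemma open_uhp: "open uhp"
  by (simp add: upper_half_plane_def open_halfspace_Im_gt)

section \<open>Wirtinger derivatives and real differentiability on open sets\<close>

lemma has_derivative_cong_open:
  assumes "open S" "z \<in> S" "\<And>w. w \<in> S \<Longrightarrow> f w = g w"
  shows "(f has_derivative D) (at z) \<longleftrightarrow> (g has_derivative D) (at z)"
  using has_derivative_transform_within_open[of f D z UNIV S g]
    has_derivative_transform_within_open[of g D z UNIV S f] assms by auto

lemma partials_cong_open:
  assumes "open S" "z \<in> S" "\<And>w. w \<in> S \<Longrightarrow> f w = g w"
  shows "partial_x f z = partial_x g z" "partial_y f z = partial_y g z"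
    "f differentiable (at z) \<longleftrightarrow> g differentiable (at z)"
  using has_derivative_cong_open[OF assms]
  by (simp_all add: partial_x_def partial_y_def frechet_derivative_def differentiable_def)

lemma d_tau_cong_open:
  assumes "open S" "z \<in> S" "\<And>w. w \<in> S \<Longrightarrow> f w = g w"
  shows "d_tau f z = d_tau g z" "d_taubar f z = d_taubar g z" "eps_op f z = eps_op g z"
  using partials_cong_open[OF assms] by (simp_all add: d_tau_def d_taubar_def eps_op_def)

lemma Cn_on_cong:
  assumes "open S" "\<And>w. w \<in> S \<Longrightarrow> f w = g w"
  shows "Cn_on n f S \<longleftrightarrow> Cn_on n g S"
  using assms(2)
proof (induction n arbitrary: f g)
  case 0
  then show ?case using continuous_on_cong[of S S f g] by simp
next
  case (Suc n)
  have "Cn_on n (partial_x f) S \<longleftrightarrow> Cn_on n (partial_x g) S"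
    "Cn_on n (partial_y f) S \<longleftrightarrow> Cn_on n (partial_y g) S"
    using partials_cong_open[OF assms(1) _ Suc.prems] by (auto intro!: Suc.IH)
  then show ?case
    using partials_cong_open(3)[OF assms(1) _ Suc.prems] by auto
qed

lemma Cn_on_Suc_imp: "Cn_on (Suc n) f S \<Longrightarrow> Cn_on n f S"
proof (induction n arbitrary: f)
  case 0
  then have "f differentiable_on S"
    by (auto simp: differentiable_on_def intro: differentiable_at_withinI)
  then show ?case by (simp add: differentiable_imp_continuous_on)
next
  case (Suc n)
  then show ?case by (meson Cn_on.simps(2))
qed

lemma partials_has_derivative:
  assumes "(f has_derivative D) (at z)"
  shows "partial_x f z = D 1" "partial_y f z = D \<i>"
  using frechet_derivative_at[OF assms] by (simp_all add: partial_x_def partial_y_def)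

lemma Cn_on_const: "Cn_on n (\<lambda>_. c) S"
proof (induction n arbitrary: c)
  case (Suc n)
  have "partial_x (\<lambda>_. c) = (\<lambda>_. 0)" "partial_y (\<lambda>_. c) = (\<lambda>_. 0)"
    by (auto simp: partial_x_def partial_y_def)
  then show ?case using Suc by auto
qed auto

lemma Cn_on_add:
  assumes "open S" "Cn_on n f S" "Cn_on n g S"
  shows "Cn_on n (\<lambda>z. f z + g z) S"
  using assms(2,3)
proof (induction n arbitrary: f g)
  case 0
  then show ?case by (auto intro: continuous_intros)
next
  case (Suc n)
  have d: "((\<lambda>z. f z + g z) has_derivative
      (\<lambda>v. frechet_derivative f (at z) v + frechet_derivative g (at z) v)) (at z)" if "z \<in> S" for z
    using Suc.prems that by (intro has_derivative_add) (auto simp: frechet_derivative_works)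
  have "Cn_on n (partial_x (\<lambda>z. f z + g z)) S \<longleftrightarrow> Cn_on n (\<lambda>z. partial_x f z + partial_x g z) S"
    "Cn_on n (partial_y (\<lambda>z. f z + g z)) S \<longleftrightarrow> Cn_on n (\<lambda>z. partial_y f z + partial_y g z) S"
    using partials_has_derivative[OF d]
    by (auto intro!: Cn_on_cong[OF assms(1)] simp: partial_x_def partial_y_def)
  then show ?case using Suc d by (auto simp: differentiable_def)
qed

lemma Cn_on_mult:
  assumes "open S" "Cn_on n f S" "Cn_on n g S"
  shows "Cn_on n (\<lambda>z. f z * g z) S"
  using assms(2,3)
proof (induction n arbitrary: f g)
  case 0
  then show ?case by (auto intro: continuous_intros)
next
  case (Suc n)
  have d: "((\<lambda>z. f z * g z) has_derivative
      (\<lambda>v. f z * frechet_derivative g (at z) v + frechet_derivative f (at z) v * g z)) (at z)" if "z \<in> S" for z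
    using Suc.prems that by (intro has_derivative_mult) (auto simp: frechet_derivative_works)
  have "Cn_on n (partial_x (\<lambda>z. f z * g z)) S \<longleftrightarrow>
        Cn_on n (\<lambda>z. f z * partial_x g z + partial_x f z * g z) S"
    "Cn_on n (partial_y (\<lambda>z. f z * g z)) S \<longleftrightarrow>
        Cn_on n (\<lambda>z. f z * partial_y g z + partial_y f z * g z) S"
    using partials_has_derivative[OF d]
    by (auto intro!: Cn_on_cong[OF assms(1)] simp: partial_x_def partial_y_def)
  moreover have "Cn_on n (\<lambda>z. f z * partial_x g z + partial_x f z * g z) S"
    "Cn_on n (\<lambda>z. f z * partial_y g z + partial_y f z * g z) S"
    using Suc Cn_on_Suc_imp[of n f S] Cn_on_Suc_imp[of n g S] by (auto intro!: Cn_on_add[OF assms(1)])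
  ultimately show ?case using d by (auto simp: differentiable_def)
qed

lemma Cn_on_diff_cnj: "Cn_on n (\<lambda>z. z - cnj z) S"
proof (cases n)
  case 0
  then show ?thesis by (auto intro: continuous_intros)
next
  case (Suc m)
  have d: "((\<lambda>z. z - cnj z) has_derivative (\<lambda>v. v - cnj v)) (at z)" for z
    by (auto intro!: derivative_eq_intros)
  have "partial_x (\<lambda>z. z - cnj z) = (\<lambda>_. 0)" "partial_y (\<lambda>z. z - cnj z) = (\<lambda>_. 2 * \<i>)"
    using partials_has_derivative[OF d] by auto
  moreover have "(\<lambda>z. z - cnj z) differentiable (at z)" for z
    using d differentiable_def by blast
  ultimately show ?thesis using Suc Cn_on_const by auto
qed

lemma Cinfinity_on_eps_op:
  assumes "Cinfinity_on f S" "open S"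
  shows "Cinfinity_on (eps_op f) S"
  unfolding Cinfinity_on_def
proof
  fix n
  have *: "Cn_on n (partial_x f) S" "Cn_on n (partial_y f) S"
    using assms by (auto simp: Cinfinity_on_def dest: spec[of _ "Suc n"])
  have "eps_op f = (\<lambda>z. ((z - cnj z) * (z - cnj z)) * ((1/2) * (partial_x f z + \<i> * partial_y f z)))"
    by (auto simp: eps_op_def d_taubar_def power2_eq_square)
  then show "Cn_on n (eps_op f) S"
    by (simp only:) (intro Cn_on_mult Cn_on_add Cn_on_diff_cnj Cn_on_const * assms)
qed

section \<open>Algebra and derivatives of near-holomorphic functions\<close>

definition inv_2iy :: "complex \<Rightarrow> complex" where
  "inv_2iy \<tau> = 1 / (\<tau> - cnj \<tau>)"

lemma diff_cnj_nonzero: "\<tau> \<in> uhp \<Longrightarrow> \<tau> - cnj \<tau> \<noteq> 0"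
  by (auto simp: uhp_iff complex_eq_iff)

definition near_hol_coeffs :: "nat \<Rightarrow> (nat \<Rightarrow> complex \<Rightarrow> complex) \<Rightarrow> (complex \<Rightarrow> complex) \<Rightarrow> bool" where
  "near_hol_coeffs r g f \<longleftrightarrow> (\<forall>j. g j holomorphic_on uhp) \<and>
     (\<forall>\<tau>\<in>uhp. f \<tau> = (\<Sum>j\<le>r. g j \<tau> * inv_2iy \<tau> ^ j))"

definition near_hol :: "(complex \<Rightarrow> complex) \<Rightarrow> bool" where
  "near_hol f \<longleftrightarrow> (\<exists>r g. near_hol_coeffs r g f)"

lemma near_hol_cong: "near_hol f \<Longrightarrow> (\<And>\<tau>. \<tau> \<in> uhp \<Longrightarrow> g \<tau> = f \<tau>) \<Longrightarrow> near_hol g"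
  by (auto simp: near_hol_def near_hol_coeffs_def)

text \<open>Viewing the coefficient family as a polynomial in \<open>inv_2iy \<tau>\<close> lets
  sums and products reuse polynomial arithmetic. The degree bound is uniform in
  \<open>\<tau>\<close>, so that a single \<open>r\<close> can be recovered.\<close>

lemma near_hol_poly_iff:
  "near_hol f \<longleftrightarrow> (\<exists>p r. (\<forall>j. (\<lambda>\<tau>. coeff (p \<tau>) j) holomorphic_on uhp) \<and> (\<forall>\<tau>. degree (p \<tau>) \<le> r) \<and>
     (\<forall>\<tau>\<in>uhp. f \<tau> = poly (p \<tau>) (inv_2iy \<tau>)))" (is "_ \<longleftrightarrow> ?R")
proof
  assume "near_hol f"
  then obtain r g where g: "\<And>j. g j holomorphic_on uhp"
    "\<And>\<tau>. \<tau> \<in> uhp \<Longrightarrow> f \<tau> = (\<Sum>j\<le>r. g j \<tau> * inv_2iy \<tau> ^ j)"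
    by (auto simp: near_hol_def near_hol_coeffs_def)
  define p where "p \<tau> = (\<Sum>j\<le>r. monom (g j \<tau>) j)" for \<tau>
  have c: "coeff (p \<tau>) j = (if j \<le> r then g j \<tau> else 0)" for \<tau> j
    by (simp add: p_def coeff_sum)
  have "(\<lambda>\<tau>. coeff (p \<tau>) j) holomorphic_on uhp" for j
    by (cases "j \<le> r") (auto simp: c g)
  moreover have "degree (p \<tau>) \<le> r" for \<tau>
    by (rule degree_le) (simp add: c)
  moreover have "f \<tau> = poly (p \<tau>) (inv_2iy \<tau>)" if "\<tau> \<in> uhp" for \<tau>
    by (simp add: p_def poly_sum poly_monom g that)
  ultimately show ?R by blast
next
  assume ?R
  then obtain p r where p: "\<And>j. (\<lambda>\<tau>. coeff (p \<tau>) j) holomorphic_on uhp" "\<And>\<tau>. degree (p \<tau>) \<le> r"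
     "\<And>\<tau>. \<tau> \<in> uhp \<Longrightarrow> f \<tau> = poly (p \<tau>) (inv_2iy \<tau>)" by blast
  have "poly (p \<tau>) x = (\<Sum>j\<le>r. coeff (p \<tau>) j * x ^ j)" for \<tau> x
    unfolding poly_altdef using p(2)[of \<tau>]
    by (intro sum.mono_neutral_left) (auto simp: coeff_eq_0)
  then have "near_hol_coeffs r (\<lambda>j \<tau>. coeff (p \<tau>) j) f"
    using p by (auto simp: near_hol_coeffs_def)
  then show "near_hol f" by (auto simp: near_hol_def)
qed

lemma near_hol_holomorphic: "f holomorphic_on uhp \<Longrightarrow> near_hol f"
  unfolding near_hol_def near_hol_coeffs_def by (intro exI[of _ 0] exI[of _ "\<lambda>_. f"]) auto

lemma near_hol_inv_2iy: "near_hol inv_2iy"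
  unfolding near_hol_poly_iff by (intro exI[of _ "\<lambda>_. [:0,1:]"] exI[of _ 1]) auto

lemma near_hol_add: "near_hol f \<Longrightarrow> near_hol g \<Longrightarrow> near_hol (\<lambda>\<tau>. f \<tau> + g \<tau>)"
  unfolding near_hol_poly_iff
  apply (elim exE conjE)
  subgoal for p q r s
    by (intro exI[of _ "\<lambda>\<tau>. p \<tau> + q \<tau>"] exI[of _ "max r s"])
      (auto intro!: holomorphic_intros degree_add_le intro: max.coboundedI1 max.coboundedI2)
  done

lemma near_hol_mult: "near_hol f \<Longrightarrow> near_hol g \<Longrightarrow> near_hol (\<lambda>\<tau>. f \<tau> * g \<tau>)"
  unfolding near_hol_poly_iff
  apply (elim exE conjE)
  subgoal for p q r s
    by (intro exI[of _ "\<lambda>\<tau>. p \<tau> * q \<tau>"] exI[of _ "r + s"])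
      (auto intro!: holomorphic_intros order.trans[OF degree_mult_le] add_mono simp: coeff_mult)
  done

lemma near_hol_const: "near_hol (\<lambda>_. c)"
  by (auto intro!: near_hol_holomorphic)

lemma near_hol_sum: "(\<And>i. i \<in> I \<Longrightarrow> near_hol (f i)) \<Longrightarrow> near_hol (\<lambda>\<tau>. \<Sum>i\<in>I. f i \<tau>)"
  by (induction I rule: infinite_finite_induct) (auto intro: near_hol_const near_hol_add)

lemma near_hol_power: "near_hol f \<Longrightarrow> near_hol (\<lambda>\<tau>. f \<tau> ^ n)"
  by (induction n) (auto intro: near_hol_const near_hol_mult)

lemma has_derivative_inv_2iy:
  assumes "\<tau> \<in> uhp"
  shows "(inv_2iy has_derivative (\<lambda>v. - 2 * \<i> * inv_2iy \<tau> ^ 2 * of_real (Im v))) (at \<tau>)"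
proof -
  have "inv_2iy = (\<lambda>\<tau>. inverse (\<tau> - cnj \<tau>))"
    by (auto simp: inv_2iy_def inverse_eq_divide)
  moreover have "((\<lambda>\<tau>. inverse (\<tau> - cnj \<tau>)) has_derivative
      (\<lambda>v. - (inverse (\<tau> - cnj \<tau>) * (v - cnj v) * inverse (\<tau> - cnj \<tau>)))) (at \<tau>)"
    using diff_cnj_nonzero[OF assms] by (auto intro!: derivative_eq_intros)
  moreover have "(\<lambda>v. - (inverse (\<tau> - cnj \<tau>) * (v - cnj v) * inverse (\<tau> - cnj \<tau>))) =
      (\<lambda>v. - 2 * \<i> * inv_2iy \<tau> ^ 2 * of_real (Im v))"
  proof
    fix v
    have "v - cnj v = 2 * \<i> * of_real (Im v)"
      by (simp add: complex_eq_iff)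
    then show "- (inverse (\<tau> - cnj \<tau>) * (v - cnj v) * inverse (\<tau> - cnj \<tau>)) =
      - 2 * \<i> * inv_2iy \<tau> ^ 2 * of_real (Im v)"
      unfolding inv_2iy_def divide_inverse power2_eq_square
      by (simp only: mult_1_left) (simp add: mult_ac del: complex_diff_cnj)
  qed
  ultimately show ?thesis by simp
qed

lemma has_derivative_near_hol:
  assumes "near_hol_coeffs r g f" "\<tau> \<in> uhp"
  shows "(f has_derivative (\<lambda>v. (\<Sum>j\<le>r. deriv (g j) \<tau> * inv_2iy \<tau> ^ j) * v +
      (\<Sum>j\<le>r. of_nat j * g j \<tau> * inv_2iy \<tau> ^ Suc j) * (- 2 * \<i> * of_real (Im v)))) (at \<tau>)"
proof -
  have pw: "((\<lambda>\<tau>. inv_2iy \<tau> ^ j) has_derivative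
      (\<lambda>v. of_nat j * (- 2 * \<i> * inv_2iy \<tau> ^ 2 * of_real (Im v)) * inv_2iy \<tau> ^ (j - 1))) (at \<tau>)" for j
    by (rule has_derivative_power[OF has_derivative_inv_2iy[OF assms(2)]])
  have pw': "of_nat j * (- 2 * \<i> * inv_2iy \<tau> ^ 2 * of_real (Im v)) * inv_2iy \<tau> ^ (j - 1)
      = of_nat j * inv_2iy \<tau> ^ Suc j * (- 2 * \<i> * of_real (Im v))" for j v
    by (cases j) (auto simp: power2_eq_square)
  have g: "(g j has_derivative (\<lambda>v. deriv (g j) \<tau> * v)) (at \<tau>)" for j
  proof -
    have "(g j has_field_derivative deriv (g j) \<tau>) (at \<tau>)"
      using assms by (auto simp: near_hol_coeffs_def intro: holomorphic_derivI[OF _ open_uhp])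
    then show ?thesis by (simp add: has_field_derivative_def)
  qed
  have "((\<lambda>\<tau>. \<Sum>j\<le>r. g j \<tau> * inv_2iy \<tau> ^ j) has_derivative
     (\<lambda>v. \<Sum>j\<le>r. g j \<tau> * (of_nat j * (- 2 * \<i> * inv_2iy \<tau> ^ 2 * of_real (Im v)) * inv_2iy \<tau> ^ (j - 1))
         + deriv (g j) \<tau> * v * inv_2iy \<tau> ^ j)) (at \<tau>)"
    by (intro has_derivative_sum has_derivative_mult g pw)
  also have "(\<lambda>v. \<Sum>j\<le>r. g j \<tau> * (of_nat j * (- 2 * \<i> * inv_2iy \<tau> ^ 2 * of_real (Im v)) * inv_2iy \<tau> ^ (j - 1))
         + deriv (g j) \<tau> * v * inv_2iy \<tau> ^ j) = (\<lambda>v. (\<Sum>j\<le>r. deriv (g j) \<tau> * inv_2iy \<tau> ^ j) * v +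
      (\<Sum>j\<le>r. of_nat j * g j \<tau> * inv_2iy \<tau> ^ Suc j) * (- 2 * \<i> * of_real (Im v)))"
    unfolding pw' sum.distrib sum_distrib_right by (intro ext) (simp add: mult_ac add.commute)
  finally show ?thesis
    by (subst has_derivative_cong_open[OF open_uhp assms(2)]) 
      (use assms in \<open>auto simp: near_hol_coeffs_def\<close>)
qed

lemma partials_near_hol:
  assumes "near_hol_coeffs r g f" "\<tau> \<in> uhp"
  shows "partial_x f \<tau> = (\<Sum>j\<le>r. deriv (g j) \<tau> * inv_2iy \<tau> ^ j)"
    and "partial_y f \<tau> = \<i> * (\<Sum>j\<le>r. deriv (g j) \<tau> * inv_2iy \<tau> ^ j) -
            2 * \<i> * (\<Sum>j\<le>r. of_nat j * g j \<tau> * inv_2iy \<tau> ^ Suc j)"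
  using partials_has_derivative[OF has_derivative_near_hol[OF assms]] by (simp_all add: mult_ac)

text \<open>With \<open>u = inv_2iy\<close> the Wirtinger derivatives of \<open>u\<close> are
  \<open>- u\<^sup>2\<close> in \<tau> and \<open>u\<^sup>2\<close> in the conjugate variable; the
  holomorphic coefficients contribute to the first only.\<close>

lemma d_tau_near_hol:
  assumes "near_hol_coeffs r g f" "\<tau> \<in> uhp"
  shows "d_tau f \<tau> = (\<Sum>j\<le>r. deriv (g j) \<tau> * inv_2iy \<tau> ^ j) - (\<Sum>j\<le>r. of_nat j * g j \<tau> * inv_2iy \<tau> ^ Suc j)"
    and "d_taubar f \<tau> = (\<Sum>j\<le>r. of_nat j * g j \<tau> * inv_2iy \<tau> ^ Suc j)"
proof -
  have *: "(A - \<i> * (\<i> * A - 2 * \<i> * B)) / 2 = A - B" "(A + \<i> * (\<i> * A - 2 * \<i> * B)) / 2 = B" for A B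
    by (simp_all add: field_simps)
  show "d_tau f \<tau> = (\<Sum>j\<le>r. deriv (g j) \<tau> * inv_2iy \<tau> ^ j) - (\<Sum>j\<le>r. of_nat j * g j \<tau> * inv_2iy \<tau> ^ Suc j)"
    and "d_taubar f \<tau> = (\<Sum>j\<le>r. of_nat j * g j \<tau> * inv_2iy \<tau> ^ Suc j)"
    unfolding d_tau_def d_taubar_def partials_near_hol[OF assms] by (rule *)+
qed

text \<open>On polynomials in \<open>inv_2iy\<close> the operator is formal differentiation: the
  factor \<open>(\<tau> - cnj \<tau>)\<^sup>2\<close> removes the two extra powers that
  \<open>d_taubar\<close> leaves.\<close>

lemma eps_op_near_hol:
  assumes "near_hol_coeffs r g f"
  shows "r > 0 \<Longrightarrow> near_hol_coeffs (r - 1) (\<lambda>j \<tau>. of_nat (Suc j) * g (Suc j) \<tau>) (eps_op f)"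
    and "\<tau> \<in> uhp \<Longrightarrow> r = 0 \<Longrightarrow> eps_op f \<tau> = 0"
proof -
  have e: "eps_op f \<tau> = (\<Sum>j\<le>r. of_nat j * g j \<tau> * (inv_2iy \<tau> ^ Suc j * (\<tau> - cnj \<tau>)\<^sup>2))" if "\<tau> \<in> uhp" for \<tau>
    unfolding eps_op_def d_tau_near_hol[OF assms that] sum_distrib_left by (simp add: mult_ac)
  show "near_hol_coeffs (r - 1) (\<lambda>j \<tau>. of_nat (Suc j) * g (Suc j) \<tau>) (eps_op f)" if "r > 0"
    unfolding near_hol_coeffs_def
  proof safe
    fix j
    show "(\<lambda>\<tau>. of_nat (Suc j) * g (Suc j) \<tau>) holomorphic_on uhp"
      using assms by (auto simp: near_hol_coeffs_def intro!: holomorphic_intros)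
  next
    fix \<tau> assume t: "\<tau> \<in> uhp"
    obtain s where s: "r = Suc s" using \<open>r > 0\<close> by (cases r) auto
    have u: "inv_2iy \<tau> ^ Suc (Suc j) * (\<tau> - cnj \<tau>)\<^sup>2 = inv_2iy \<tau> ^ j" for j
      using diff_cnj_nonzero[OF t] by (simp add: inv_2iy_def power2_eq_square)
    show "eps_op f \<tau> = (\<Sum>j\<le>r - 1. of_nat (Suc j) * g (Suc j) \<tau> * inv_2iy \<tau> ^ j)"
      unfolding e[OF t] s sum.atMost_Suc_shift u by simp
  qed
  show "\<tau> \<in> uhp \<Longrightarrow> r = 0 \<Longrightarrow> eps_op f \<tau> = 0"
    using e by simp
qed

lemma near_hol_Cinfinity:
  assumes "near_hol f"
  shows "Cinfinity_on f uhp"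
  unfolding Cinfinity_on_def
proof
  fix n
  show "Cn_on n f uhp" using assms
  proof (induction n arbitrary: f)
    case 0
    then obtain r g where g: "near_hol_coeffs r g f" by (auto simp: near_hol_def)
    then have "f differentiable_on uhp"
      using has_derivative_near_hol[OF g] unfolding differentiable_on_def differentiable_def
      by (meson has_derivative_at_withinI)
    then show ?case by (simp add: differentiable_imp_continuous_on)
  next
    case (Suc n)
    then obtain r g where g: "near_hol_coeffs r g f" by (auto simp: near_hol_def)
    have h: "g j holomorphic_on uhp" for j using g by (simp add: near_hol_coeffs_def)
    have dh: "deriv (g j) holomorphic_on uhp" for j
      by (intro holomorphic_deriv h open_uhp)
    have A: "near_hol (\<lambda>\<tau>. \<Sum>j\<le>r. deriv (g j) \<tau> * inv_2iy \<tau> ^ j)"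
      by (intro near_hol_sum near_hol_mult near_hol_power near_hol_inv_2iy near_hol_holomorphic dh)
    have B: "near_hol (\<lambda>\<tau>. \<Sum>j\<le>r. of_nat j * g j \<tau> * inv_2iy \<tau> ^ Suc j)"
      by (intro near_hol_sum near_hol_mult near_hol_power near_hol_inv_2iy near_hol_holomorphic h) auto
    have "near_hol (partial_x f)"
      by (rule near_hol_cong[OF A]) (rule partials_near_hol[OF g])
    moreover have "near_hol (partial_y f)"
      by (rule near_hol_cong[OF near_hol_add[OF near_hol_mult[OF near_hol_const[of \<i>] A]
            near_hol_mult[OF near_hol_const[of "-2 * \<i>"] B]]]) (subst partials_near_hol[OF g], auto)
    ultimately show ?case
      using Suc.IH has_derivative_near_hol[OF g] by (auto simp: differentiable_def)
  qed
qed

lemma near_hol_eps_nilpotent: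
  assumes "near_hol f"
  shows "\<exists>m. \<forall>\<tau>\<in>uhp. (eps_op ^^ m) f \<tau> = 0"
proof -
  obtain r g where "near_hol_coeffs r g f" using assms by (auto simp: near_hol_def)
  then have "\<forall>\<tau>\<in>uhp. (eps_op ^^ Suc r) f \<tau> = 0"
  proof (induction r arbitrary: f g)
    case 0
    then show ?case using eps_op_near_hol(2) by auto
  next
    case (Suc r)
    then show ?case using eps_op_near_hol(1)[OF Suc.prems] Suc.IH by (simp add: funpow_swap1)
  qed
  then show ?thesis by blast
qed

text \<open>\<open>eps_op\<close> differentiates the vanishing polynomial formally, so by induction
  all coefficients except the zeroth vanish, and then that one does as well.\<close>

lemma near_hol_coeffs_unique_0:
  assumes "near_hol_coeffs r g f" "\<And>\<tau>. \<tau> \<in> uhp \<Longrightarrow> f \<tau> = 0"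
    and "j \<le> r" "\<tau> \<in> uhp"
  shows "g j \<tau> = 0"
  using assms
proof (induction r arbitrary: f g j \<tau>)
  case 0
  have "f \<tau> = (\<Sum>j\<le>0. g j \<tau> * inv_2iy \<tau> ^ j)"
    using 0 unfolding near_hol_coeffs_def by blast
  then show ?case using 0(2)[OF 0(4)] 0(3) by simp
next
  case (Suc r)
  have "eps_op f \<tau> = eps_op (\<lambda>_. 0) \<tau>" if "\<tau> \<in> uhp" for \<tau>
    by (rule d_tau_cong_open(3)[OF open_uhp that]) (rule Suc.prems(2))
  then have z: "eps_op f \<tau> = 0" if "\<tau> \<in> uhp" for \<tau>
    using that by (simp add: eps_op_def d_taubar_def partial_x_def partial_y_def)
  have "near_hol_coeffs r (\<lambda>j \<tau>. of_nat (Suc j) * g (Suc j) \<tau>) (eps_op f)"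
    using eps_op_near_hol(1)[OF Suc.prems(1)] by simp
  note IH = Suc.IH[OF this z]
  have s: "g (Suc i) \<tau> = 0" if "i \<le> r" "\<tau> \<in> uhp" for i \<tau>
    using IH[OF _ that] by (simp del: of_nat_Suc)
  have "0 = (\<Sum>j\<le>Suc r. g j \<tau> * inv_2iy \<tau> ^ j)"
    using Suc.prems(1) Suc.prems(2)[OF Suc.prems(4)] Suc.prems(4) unfolding near_hol_coeffs_def by metis
  also have "\<dots> = g 0 \<tau>"
    using s \<open>\<tau> \<in> uhp\<close> by (simp add: sum.atMost_Suc_shift del: sum.atMost_Suc)
  finally show ?case using s Suc.prems by (cases j) auto
qed

text \<open>Vanishing of \<open>d_taubar\<close> is the Cauchy-Riemann equation
  \<open>?D \<i> = \<i> * ?D 1\<close>, which makes the real derivative complex linear.\<close>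

lemma d_taubar_0_imp_holomorphic:
  assumes "\<And>z. z \<in> S \<Longrightarrow> f differentiable (at z)" "\<And>z. z \<in> S \<Longrightarrow> d_taubar f z = 0" "open S"
  shows "f holomorphic_on S"
proof -
  have "f field_differentiable at z" if "z \<in> S" for z
  proof -
    let ?D = "frechet_derivative f (at z)"
    have D: "(f has_derivative ?D) (at z)"
      using assms that frechet_derivative_works by blast
    then interpret bounded_linear ?D by (rule has_derivative_bounded_linear)
    have "?D 1 + \<i> * ?D \<i> = 0"
      using assms(2)[OF that] by (simp add: d_taubar_def partial_x_def partial_y_def)
    then have "\<i> * (?D 1 + \<i> * ?D \<i>) = 0" by simp
    then have i: "?D \<i> = \<i> * ?D 1" by (simp add: algebra_simps)
    have "?D v = ?D 1 * v" for v
    proof -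
      have "?D v = ?D (Re v *\<^sub>R 1 + Im v *\<^sub>R \<i>)"
        by (rule arg_cong[of _ _ ?D]) (simp add: complex_eq_iff)
      also have "\<dots> = Re v *\<^sub>R ?D 1 + Im v *\<^sub>R ?D \<i>" by (simp add: add scaleR)
      also have "\<dots> = ?D 1 * (of_real (Re v) + \<i> * of_real (Im v))"
        unfolding i by (simp add: scaleR_conv_of_real algebra_simps)
      also have "of_real (Re v) + \<i> * of_real (Im v) = v" by (simp add: complex_eq_iff)
      finally show ?thesis .
    qed
    then have "?D = (*) (?D 1)" by (rule ext)
    with D show ?thesis unfolding field_differentiable_def has_field_derivative_def by metis
  qed
  then show ?thesis using assms(3) by (simp add: holomorphic_on_def field_differentiable_at_within)
qed

text \<open>Converse of \<open>near_hol_Cinfinity\<close> and \<open>near_hol_eps_nilpotent\<close>.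
  Once \<open>eps_op f\<close> is a polynomial in \<open>inv_2iy\<close>, a formal antiderivative
  \<open>F\<close> has the same \<open>eps_op\<close> as \<open>f\<close>, so \<open>f - F\<close>
  is holomorphic.\<close>

lemma near_hol_if_eps_nilpotent:
  assumes "Cinfinity_on f uhp" "\<forall>\<tau>\<in>uhp. (eps_op ^^ m) f \<tau> = 0"
  shows "near_hol f"
  using assms
proof (induction m arbitrary: f)
  case 0
  then show ?case by (intro near_hol_cong[OF near_hol_const[of 0]]) auto
next
  case (Suc m)
  have "near_hol (eps_op f)"
    using Suc.prems Cinfinity_on_eps_op[OF _ open_uhp] by (intro Suc.IH) (auto simp: funpow_swap1)
  then obtain r g where g: "near_hol_coeffs r g (eps_op f)" by (auto simp: near_hol_def)
  define G where "G j \<tau> = (case j of 0 \<Rightarrow> 0 | Suc i \<Rightarrow> g i \<tau> / of_nat (Suc i))" for j \<tau>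
  define F where "F \<tau> = (\<Sum>j\<le>Suc r. G j \<tau> * inv_2iy \<tau> ^ j)" for \<tau>
  have "G j holomorphic_on uhp" for j
    using g by (cases j)
      (auto simp: G_def[abs_def] near_hol_coeffs_def intro!: holomorphic_intros simp del: of_nat_Suc)
  then have F: "near_hol_coeffs (Suc r) G F" by (auto simp: near_hol_coeffs_def F_def)
  have eF: "eps_op F \<tau> = eps_op f \<tau>" if "\<tau> \<in> uhp" for \<tau>
  proof -
    have "of_nat (Suc j) * G (Suc j) \<tau> = g j \<tau>" for j
      by (simp add: G_def del: of_nat_Suc)
    then show ?thesis
      using eps_op_near_hol(1)[OF F] g that by (simp add: near_hol_coeffs_def del: of_nat_Suc)
  qed
  have fd: "f differentiable (at z)" if "z \<in> uhp" for z
    using Suc.prems(1) that by (auto simp: Cinfinity_on_def dest: spec[of _ "Suc 0"])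
  have Fd: "F differentiable (at z)" if "z \<in> uhp" for z
    using has_derivative_near_hol[OF F that] by (auto simp: differentiable_def)
  have d: "((\<lambda>z. f z - F z) has_derivative
      (\<lambda>v. frechet_derivative f (at z) v - frechet_derivative F (at z) v)) (at z)" if "z \<in> uhp" for z
    using fd[OF that] Fd[OF that] by (intro has_derivative_diff) (auto simp: frechet_derivative_works)
  have "(\<lambda>z. f z - F z) holomorphic_on uhp"
  proof (rule d_taubar_0_imp_holomorphic[OF _ _ open_uhp])
    fix z assume z: "z \<in> uhp"
    show "(\<lambda>z. f z - F z) differentiable (at z)"
      using d[OF z] by (auto simp: differentiable_def)
    have "d_taubar f z = d_taubar F z"
      using eF[OF z] diff_cnj_nonzero[OF z] by (simp add: eps_op_def)
    moreover have "d_taubar (\<lambda>z. f z - F z) z = d_taubar f z - d_taubar F z"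
      unfolding d_taubar_def partials_has_derivative[OF d[OF z]]
      by (simp add: partial_x_def partial_y_def algebra_simps diff_divide_distrib add_divide_distrib)
    ultimately show "d_taubar (\<lambda>z. f z - F z) z = 0" by simp
  qed
  from near_hol_holomorphic[OF this] have "near_hol (\<lambda>z. (f z - F z) + F z)"
    by (rule near_hol_add) (use F near_hol_def in blast)
  then show ?case by simp
qed

section \<open>The modular group\<close>

no_notation fps_nth (infixl "$" 75)

lemma carrier_SL2Z: "A \<in> carrier SL2Z \<longleftrightarrow> A$1$1 * A$2$2 - A$1$2 * A$2$1 = 1"
  by (simp add: SL2Z_def det_2)

lemma mat2_eq_iff: "(A::int^2^2) = B \<longleftrightarrow> A$1$1 = B$1$1 \<and> A$1$2 = B$1$2 \<and> A$2$1 = B$2$1 \<and> A$2$2 = B$2$2"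
  by (auto simp: vec_eq_iff forall_2)

lemma mat2_mult:
  fixes A B :: "int^2^2"
  shows "(A ** B)$1$1 = A$1$1 * B$1$1 + A$1$2 * B$2$1" "(A ** B)$1$2 = A$1$1 * B$1$2 + A$1$2 * B$2$2"
    "(A ** B)$2$1 = A$2$1 * B$1$1 + A$2$2 * B$2$1" "(A ** B)$2$2 = A$2$1 * B$1$2 + A$2$2 * B$2$2"
  by (simp_all add: matrix_matrix_mult_def sum_2)

lemma SL2Z_mult: "A \<in> carrier SL2Z \<Longrightarrow> B \<in> carrier SL2Z \<Longrightarrow> A ** B \<in> carrier SL2Z"
  by (simp add: SL2Z_def det_mul)

definition mat2 :: "int \<Rightarrow> int \<Rightarrow> int \<Rightarrow> int \<Rightarrow> int^2^2" where
  "mat2 a b c d = vector [vector [a, b], vector [c, d]]"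

lemma mat2_nth [simp]: "mat2 a b c d $1$1 = a" "mat2 a b c d $1$2 = b" "mat2 a b c d $2$1 = c" "mat2 a b c d $2$2 = d"
  by (simp_all add: mat2_def)

lemma mat_1_nth [simp]: "(mat 1 :: int^2^2)$1$1 = 1" "(mat 1 :: int^2^2)$1$2 = 0" "(mat 1 :: int^2^2)$2$1 = 0" "(mat 1 :: int^2^2)$2$2 = 1"
  by (simp_all add: mat_def)

definition adjugate2 :: "int^2^2 \<Rightarrow> int^2^2" where
  "adjugate2 A = mat2 (A$2$2) (- (A$1$2)) (- (A$2$1)) (A$1$1)"

lemma adjugate2_SL2Z: "A \<in> carrier SL2Z \<Longrightarrow> adjugate2 A \<in> carrier SL2Z"
  by (simp add: carrier_SL2Z adjugate2_def mult.commute)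

lemma adjugate2_inverse:
  assumes "A \<in> carrier SL2Z" shows "adjugate2 A ** A = mat 1" "A ** adjugate2 A = mat 1"
proof -
  have d: "A$1$1 * A$2$2 = 1 + A$1$2 * A$2$1" using assms by (simp add: carrier_SL2Z)
  have d': "A$2$2 * A$1$1 = 1 + A$1$2 * A$2$1" using d by (simp add: mult.commute)
  show "adjugate2 A ** A = mat 1" "A ** adjugate2 A = mat 1"
    by (simp_all add: mat2_eq_iff mat2_mult adjugate2_def d d' mult.commute[of "A$2$1"] mult.commute[of "A$1$2" "A$1$1"]
       mult.commute[of "A$2$2" "A$1$2"])
qed

lemma principal_congruence_subgroup_iff:
  "A \<in> principal_congruence_subgroup N \<longleftrightarrow> A \<in> carrier SL2Z \<and> int N dvd A$1$1 - 1 \<and>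
     int N dvd A$1$2 \<and> int N dvd A$2$1 \<and> int N dvd A$2$2 - 1"
  by (simp add: principal_congruence_subgroup_def forall_2 cong_iff_dvd_diff)

lemma dvd_mat_product:
  fixes n :: int
  assumes "n dvd a - a'" "n dvd b - b'" "n dvd c - c'" "n dvd d - d'"
  shows "n dvd (a * b + c * d) - (a' * b' + c' * d')"
proof -
  have "(a * b + c * d) - (a' * b' + c' * d') = a * (b - b') + (a - a') * b' + (c * (d - d') + (c - c') * d')"
    by (simp add: algebra_simps)
  then show ?thesis using assms by (simp del: add_diff_eq)
qed

lemma principal_congruence_mult:
  assumes "A \<in> principal_congruence_subgroup N" "B \<in> principal_congruence_subgroup N"
  shows "A ** B \<in> principal_congruence_subgroup N"
  unfolding principal_congruence_subgroup_iff
proof (intro conjI)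
  note ab = assms[unfolded principal_congruence_subgroup_iff]
  show "A ** B \<in> carrier SL2Z" using ab SL2Z_mult by blast
  show "int N dvd (A ** B)$1$1 - 1" "int N dvd (A ** B)$2$2 - 1"
    "int N dvd (A ** B)$1$2" "int N dvd (A ** B)$2$1"
    using ab dvd_mat_product[of "int N" "A$1$1" 1 "B$1$1" 1 "A$1$2" 0 "B$2$1" 0]
      dvd_mat_product[of "int N" "A$2$2" 1 "B$2$2" 1 "A$2$1" 0 "B$1$2" 0]
    by (auto simp: mat2_mult add.commute)
qed

lemma principal_congruence_adjugate:
  "A \<in> principal_congruence_subgroup N \<Longrightarrow> adjugate2 A \<in> principal_congruence_subgroup N"
  using adjugate2_SL2Z by (auto simp: principal_congruence_subgroup_iff adjugate2_def)

lemma monoid_SL2Z: "monoid SL2Z"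
  by (rule monoidI) (auto simp: SL2Z_def det_mul matrix_mul_assoc)

lemma inv_SL2Z:
  assumes "A \<in> carrier SL2Z"
  shows "m_inv SL2Z A = adjugate2 A"
  using monoid.inv_unique'[OF monoid_SL2Z assms adjugate2_SL2Z[OF assms]] adjugate2_inverse[OF assms]
  by (simp add: SL2Z_def)

lemma congruence_subgroup_principal:
  assumes "N > 0"
  shows "congruence_subgroup (principal_congruence_subgroup N)"
proof -
  have sub: "principal_congruence_subgroup N \<subseteq> carrier SL2Z"
    by (auto simp: principal_congruence_subgroup_iff)
  have "subgroup (principal_congruence_subgroup N) SL2Z"
  proof (rule subgroup.intro[OF sub])
    show "x \<otimes>\<^bsub>SL2Z\<^esub> y \<in> principal_congruence_subgroup N"
      if "x \<in> principal_congruence_subgroup N" "y \<in> principal_congruence_subgroup N" for x y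
      using principal_congruence_mult[OF that] by (simp add: SL2Z_def)
    show "\<one>\<^bsub>SL2Z\<^esub> \<in> principal_congruence_subgroup N"
      by (simp add: principal_congruence_subgroup_iff carrier_SL2Z) (simp add: SL2Z_def)
    show "inv\<^bsub>SL2Z\<^esub> x \<in> principal_congruence_subgroup N" if "x \<in> principal_congruence_subgroup N" for x
      using principal_congruence_adjugate[OF that] inv_SL2Z[of x] sub that by auto
  qed
  with assms show ?thesis by (auto simp: congruence_subgroup_def)
qed

section \<open>The Moebius action and its automorphy factor\<close>

lemma automorphy_factor_nonzero:
  assumes "A \<in> carrier SL2Z" "\<tau> \<in> uhp"
  shows "automorphy_factor A \<tau> \<noteq> 0"
proof
  assume *: "automorphy_factor A \<tau> = 0"
  then have "Im (automorphy_factor A \<tau>) = 0" "Re (automorphy_factor A \<tau>) = 0" by simp_all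
  then have "A$2$1 = 0" "A$2$2 = 0"
    using assms(2) by (auto simp: automorphy_factor_def uhp_iff)
  with assms(1) show False by (simp add: carrier_SL2Z)
qed

lemma SL2Z_det_of_int:
  assumes "A \<in> carrier SL2Z"
  shows "of_int (A$1$1) * of_int (A$2$2) - of_int (A$1$2) * of_int (A$2$1) = (1::'a::comm_ring_1)"
  using assms unfolding carrier_SL2Z by (simp flip: of_int_mult of_int_diff)

lemma moebius_diff_cnj:
  assumes "A \<in> carrier SL2Z" "\<tau> \<in> uhp"
  shows "moebius A \<tau> - cnj (moebius A \<tau>) = (\<tau> - cnj \<tau>) / (automorphy_factor A \<tau> * cnj (automorphy_factor A \<tau>))"
proof -
  define a b c d where "a = (of_int (A$1$1) :: complex)" "b = (of_int (A$1$2) :: complex)"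
    "c = (of_int (A$2$1) :: complex)" "d = (of_int (A$2$2) :: complex)"
  note abcd = this
  have det: "a * d - b * c = 1" using SL2Z_det_of_int[OF assms(1)] by (simp add: abcd)
  have r: "cnj a = a" "cnj b = b" "cnj c = c" "cnj d = d" by (simp_all add: abcd)
  have nz: "c * \<tau> + d \<noteq> 0" using automorphy_factor_nonzero[OF assms] by (simp add: automorphy_factor_def abcd)
  then have nz': "c * cnj \<tau> + d \<noteq> 0"
    by (metis complex_cnj_add complex_cnj_mult complex_cnj_zero_iff r(3,4))
  have "(a * \<tau> + b) / (c * \<tau> + d) - (a * cnj \<tau> + b) / (c * cnj \<tau> + d)
       = ((a * \<tau> + b) * (c * cnj \<tau> + d) - (a * cnj \<tau> + b) * (c * \<tau> + d)) / ((c * \<tau> + d) * (c * cnj \<tau> + d))"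
    using nz nz' by (simp add: field_simps)
  also have "(a * \<tau> + b) * (c * cnj \<tau> + d) - (a * cnj \<tau> + b) * (c * \<tau> + d) = (a * d - b * c) * (\<tau> - cnj \<tau>)"
    by (simp add: algebra_simps)
  finally show ?thesis
    by (simp add: moebius_def automorphy_factor_def abcd[symmetric] r det del: complex_diff_cnj)
qed

lemma Im_moebius:
  assumes "A \<in> carrier SL2Z" "\<tau> \<in> uhp"
  shows "Im (moebius A \<tau>) = Im \<tau> / (cmod (automorphy_factor A \<tau>))\<^sup>2"
proof -
  have "Im (moebius A \<tau> - cnj (moebius A \<tau>)) = Im ((\<tau> - cnj \<tau>) / of_real ((cmod (automorphy_factor A \<tau>))\<^sup>2))"
    unfolding moebius_diff_cnj[OF assms] complex_norm_square by simp
  then show ?thesis by (simp only: Im_divide_of_real) simp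
qed

lemma moebius_uhp:
  assumes "A \<in> carrier SL2Z" "\<tau> \<in> uhp"
  shows "moebius A \<tau> \<in> uhp"
  using Im_moebius[OF assms] assms automorphy_factor_nonzero[OF assms] by (simp add: uhp_iff)

lemma automorphy_factor_mult:
  assumes "B \<in> carrier SL2Z" "\<tau> \<in> uhp"
  shows "automorphy_factor (A ** B) \<tau> = automorphy_factor A (moebius B \<tau>) * automorphy_factor B \<tau>"
proof -
  have "moebius B \<tau> * automorphy_factor B \<tau> = of_int (B$1$1) * \<tau> + of_int (B$1$2)"
    using automorphy_factor_nonzero[OF assms] by (simp add: moebius_def)
  then have "automorphy_factor A (moebius B \<tau>) * automorphy_factor B \<tau> =
      of_int (A$2$1) * (of_int (B$1$1) * \<tau> + of_int (B$1$2)) + of_int (A$2$2) * automorphy_factor B \<tau>"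
    unfolding automorphy_factor_def[of A] by (simp add: distrib_right mult.assoc)
  then show ?thesis by (simp add: automorphy_factor_def mat2_mult algebra_simps)
qed

lemma moebius_mult:
  assumes "B \<in> carrier SL2Z" "\<tau> \<in> uhp" "A \<in> carrier SL2Z"
  shows "moebius (A ** B) \<tau> = moebius A (moebius B \<tau>)"
proof -
  let ?j = "automorphy_factor B \<tau>" and ?t = "moebius B \<tau>"
  have nz: "?j \<noteq> 0" "automorphy_factor A ?t \<noteq> 0"
    using automorphy_factor_nonzero moebius_uhp assms by blast+
  have "?t * ?j = of_int (B$1$1) * \<tau> + of_int (B$1$2)" using nz by (simp add: moebius_def)
  then have "of_int ((A ** B)$1$1) * \<tau> + of_int ((A ** B)$1$2) = (of_int (A$1$1) * ?t + of_int (A$1$2)) * ?j"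
    by (simp add: distrib_right mult.assoc) (simp add: automorphy_factor_def mat2_mult algebra_simps)
  then show ?thesis
    using nz by (simp add: moebius_def[of "A ** B"] moebius_def[of A] automorphy_factor_mult[OF assms(1,2)])
qed

text \<open>A transformation law of weight 2 with an additive anomaly. It is affine in
  \<open>inv_2iy \<tau>\<close>, so the slash action sends polynomials in \<open>inv_2iy\<close> to
  polynomials of no larger degree.\<close>

lemma inv_2iy_moebius:
  assumes "A \<in> carrier SL2Z" "\<tau> \<in> uhp"
  shows "inv_2iy (moebius A \<tau>) = automorphy_factor A \<tau> ^ 2 * inv_2iy \<tau> - of_int (A$2$1) * automorphy_factor A \<tau>"
proof -
  define v j where "v = \<tau> - cnj \<tau>" and "j = automorphy_factor A \<tau>"
  have "v \<noteq> 0" using diff_cnj_nonzero[OF assms(2)] by (simp add: v_def)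
  have c: "cnj j = j - of_int (A$2$1) * v"
    by (simp add: automorphy_factor_def algebra_simps v_def j_def del: complex_diff_cnj)
  have "1 / (v / (j * cnj j)) = j ^ 2 * (1 / v) - of_int (A$2$1) * j"
    unfolding c using \<open>v \<noteq> 0\<close> by (simp add: field_simps power2_eq_square)
  then show ?thesis
    unfolding inv_2iy_def moebius_diff_cnj[OF assms] v_def j_def .
qed

lemma moebius_holomorphic:
  assumes "A \<in> carrier SL2Z"
  shows "automorphy_factor A holomorphic_on uhp" "moebius A holomorphic_on uhp"
proof -
  show "automorphy_factor A holomorphic_on uhp"
    unfolding automorphy_factor_def[abs_def] by (intro holomorphic_intros)
  then show "moebius A holomorphic_on uhp"
    unfolding moebius_def[abs_def] using automorphy_factor_nonzero[OF assms]
    by (intro holomorphic_intros) auto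
qed

text \<open>Matrices congruent modulo \<open>N\<close> differ by a left factor in the principal
  subgroup, so slashes of an invariant function fall into finitely many classes.\<close>

lemma congruent_mod_principal:
  assumes "A \<in> carrier SL2Z" "B \<in> carrier SL2Z"
    "int N dvd B$1$1 - A$1$1" "int N dvd B$1$2 - A$1$2" "int N dvd B$2$1 - A$2$1" "int N dvd B$2$2 - A$2$2"
  shows "B ** adjugate2 A \<in> principal_congruence_subgroup N" "(B ** adjugate2 A) ** A = B"
proof -
  note d = adjugate2_inverse(2)[OF assms(1), unfolded mat2_eq_iff mat2_mult mat_1_nth]
  show "B ** adjugate2 A \<in> principal_congruence_subgroup N"
    unfolding principal_congruence_subgroup_iff
  proof (intro conjI)
    show "B ** adjugate2 A \<in> carrier SL2Z" using assms adjugate2_SL2Z SL2Z_mult by blast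
    show "int N dvd (B ** adjugate2 A)$1$1 - 1" "int N dvd (B ** adjugate2 A)$2$2 - 1"
      "int N dvd (B ** adjugate2 A)$1$2" "int N dvd (B ** adjugate2 A)$2$1"
      using dvd_mat_product[OF assms(3) _ assms(4), of "adjugate2 A$1$1" "adjugate2 A$1$1" "adjugate2 A$2$1" "adjugate2 A$2$1"]
        dvd_mat_product[OF assms(5) _ assms(6), of "adjugate2 A$1$2" "adjugate2 A$1$2" "adjugate2 A$2$2" "adjugate2 A$2$2"]
        dvd_mat_product[OF assms(3) _ assms(4), of "adjugate2 A$1$2" "adjugate2 A$1$2" "adjugate2 A$2$2" "adjugate2 A$2$2"]
        dvd_mat_product[OF assms(5) _ assms(6), of "adjugate2 A$1$1" "adjugate2 A$1$1" "adjugate2 A$2$1" "adjugate2 A$2$1"]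
      using d by (auto simp: mat2_mult)
  qed
  show "(B ** adjugate2 A) ** A = B"
    by (simp add: matrix_mul_assoc[symmetric] adjugate2_inverse[OF assms(1)])
qed

text \<open>An instance of normality of the principal subgroup: it gives every slash of an invariant
  function the period \<open>N\<close>.\<close>

lemma conjugate_translation_principal:
  assumes "A \<in> carrier SL2Z"
  shows "A ** mat2 1 (int N) 0 1 ** adjugate2 A \<in> principal_congruence_subgroup N"
proof -
  have "mat2 1 (int N) 0 1 \<in> carrier SL2Z" by (simp add: carrier_SL2Z)
  then show ?thesis
    by (intro congruent_mod_principal assms SL2Z_mult) (simp_all add: mat2_mult)
qed

section \<open>Growth of the coefficients\<close>

lemma periodic_int:
  fixes h :: "complex \<Rightarrow> complex" and N :: nat
  assumes "\<And>\<tau>. \<tau> \<in> uhp \<Longrightarrow> h (\<tau> + of_nat N) = h \<tau>" "\<tau> \<in> uhp"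
  shows "h (\<tau> + of_int k * of_nat N) = h \<tau>"
proof -
  have nat: "h (\<tau> + of_nat n * of_nat N) = h \<tau>" if "\<tau> \<in> uhp" for \<tau> n
  proof (induction n)
    case (Suc n)
    have "h ((\<tau> + of_nat n * of_nat N) + of_nat N) = h (\<tau> + of_nat n * of_nat N)"
      using that by (intro assms(1)) (simp add: uhp_iff)
    with Suc show ?case by (simp add: algebra_simps)
  qed auto
  show ?thesis
  proof (cases "k \<ge> 0")
    case True
    then show ?thesis using nat[OF assms(2), of "nat k"] by simp
  next
    case False
    have "\<tau> + of_int k * of_nat N \<in> uhp" using assms(2) by (simp add: uhp_iff)
    from nat[OF this, of "nat (-k)"] False show ?thesis by simp
  qed
qed

text \<open>Periodicity makes \<open>h\<close> composed with the logarithm a single-valued function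
  \<open>G\<close> on the punctured disc. Growth like a power of \<open>Im \<tau>\<close>, that is
  of \<open>- ln (cmod q)\<close> up to a factor, forces \<open>q * G q\<close> to 0, so the
  singularity at 0 is removable.\<close>

lemma periodic_factor_unit_disc:
  fixes h :: "complex \<Rightarrow> complex" and N :: nat and B C c :: real
  assumes "N > 0" and hol: "h holomorphic_on uhp"
    and per: "\<And>\<tau>. \<tau> \<in> uhp \<Longrightarrow> h (\<tau> + of_nat N) = h \<tau>"
    and bd: "\<And>\<tau>. \<tau> \<in> uhp \<Longrightarrow> Im \<tau> > B \<Longrightarrow> cmod (h \<tau>) \<le> C * Im \<tau> powr c"
  obtains G where "G holomorphic_on ball 0 1"
    "\<And>\<tau>. \<tau> \<in> uhp \<Longrightarrow> h \<tau> = G (exp (2 * pi * \<i> * \<tau> / of_nat N))"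
proof -
  define G where "G q = h (of_nat N * Ln q / (2 * pi * \<i>))" for q
  have Gexp: "G (exp w) = h (of_nat N * w / (2 * pi * \<i>))"
    if w: "of_nat N * w / (2 * pi * \<i>) \<in> uhp" for w :: complex
  proof -
    have "exp (Ln (exp w)) = exp w" by simp
    then obtain k :: int where k: "Ln (exp w) = w + (of_int (2 * k) * pi) * \<i>"
      unfolding exp_eq by blast
    have "of_nat N * Ln (exp w) / (2 * pi * \<i>) = of_nat N * w / (2 * pi * \<i>) + of_int k * of_nat N"
      unfolding k by (simp add: field_simps)
    then show ?thesis unfolding G_def using periodic_int[of h N, OF per w, of k] by simp
  qed
  have ImL: "Im (of_nat N * w / (2 * pi * \<i>)) = - (real N * Re w / (2 * pi))" for w :: complex
  proof -
    have "of_nat N * w / (2 * pi * \<i>) = of_real (real N / (2 * pi)) * (- \<i> * w)"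
      by (simp add: field_simps)
    then show ?thesis by (simp only: Im_complex_of_real Re_complex_of_real times_complex.sel) simp
  qed
  have L: "of_nat N * w / (2 * pi * \<i>) \<in> uhp" if "cmod (exp w) < 1" for w :: complex
  proof -
    have "Re w < 0" using that by (simp add: norm_exp_eq_Re)
    then show ?thesis unfolding uhp_iff ImL using \<open>N > 0\<close> by (simp add: divide_neg_pos mult_pos_neg)
  qed
  have "G holomorphic_on (ball 0 1 - {0})"
  proof -
    have "G field_differentiable (at q0)" if q0: "q0 \<in> ball 0 1 - {0}" for q0
    proof -
      \<comment> \<open>\<open>Ln\<close> jumps across the negative axis. This branch is holomorphic
        near \<open>q0\<close>, and \<open>Gexp\<close> says that \<open>G\<close> does not see the
        choice of branch.\<close>
      define l where "l q = Ln (q / q0) + Ln q0" for q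
      define U where "U = {q. Re (q / q0) > 0} \<inter> ball 0 1"
      have "open {q. Re (q / q0) > 0}"
        by (intro open_Collect_less continuous_intros) (use q0 in auto)
      then have "open U" unfolding U_def by auto
      have "q0 \<in> U" using q0 by (auto simp: U_def)
      have U0: "q \<noteq> 0" if "q \<in> U" for q using that by (auto simp: U_def)
      have el: "exp (l q) = q" if "q \<in> U" for q
        using U0[OF that] q0 by (simp add: l_def exp_add)
      have lhol: "(\<lambda>q. of_nat N * l q / (2 * pi * \<i>)) holomorphic_on U"
        unfolding l_def using q0
        by (intro holomorphic_intros) (auto simp: U_def complex_nonpos_Reals_iff)
      have "(\<lambda>q. of_nat N * l q / (2 * pi * \<i>)) ` U \<subseteq> uhp"
      proof safe
        fix q assume q: "q \<in> U"
        have "cmod (exp (l q)) < 1" using el[OF q] q by (simp add: U_def)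
        then show "of_nat N * l q / (2 * pi * \<i>) \<in> uhp" by (rule L)
      qed
      then have "(h \<circ> (\<lambda>q. of_nat N * l q / (2 * pi * \<i>))) holomorphic_on U"
        using holomorphic_on_compose[OF lhol] hol holomorphic_on_subset by blast
      then have "G holomorphic_on U"
      proof (rule holomorphic_transform)
        fix q assume q: "q \<in> U"
        have "cmod (exp (l q)) < 1" using el[OF q] q by (simp add: U_def)
        from Gexp[OF L[OF this]] show "(h \<circ> (\<lambda>q. of_nat N * l q / (2 * pi * \<i>))) q = G q"
          by (simp add: el[OF q])
      qed
      then show ?thesis using \<open>open U\<close> \<open>q0 \<in> U\<close> by (simp add: holomorphic_on_imp_differentiable_at)
    qed
    then show ?thesis by (auto simp: holomorphic_on_def intro: field_differentiable_at_within)
  qed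
  moreover have "(\<lambda>q. (q - 0) * G q) \<midarrow>0\<rightarrow> 0"
  proof (rule Lim_null_comparison)
    define F where "F r = r * (\<bar>C\<bar> * (- real N * ln r / (2 * pi)) powr c)" for r :: real
    have "filterlim F (nhds 0) (at_right 0)"
      unfolding F_def using \<open>N > 0\<close> by real_asymp
    moreover have "filterlim (\<lambda>q::complex. cmod q) (at_right 0) (at 0)"
      by (rule filterlim_at_withinI) (auto intro!: tendsto_norm_zero simp: eventually_at_filter)
    ultimately show "((\<lambda>q. F (cmod q)) \<longlongrightarrow> 0) (at 0)"
      by (rule filterlim_compose)
    \<comment> \<open>Within this radius the corresponding point has imaginary part above
      \<open>\<bar>B\<bar>\<close>, where the growth hypothesis applies.\<close>
    define \<delta> where "\<delta> = min 1 (exp (- 2 * pi * \<bar>B\<bar> / real N))"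
    have "\<delta> > 0" by (simp add: \<delta>_def)
    show "\<forall>\<^sub>F q in at 0. norm ((q - 0) * G q) \<le> F (cmod q)"
      unfolding eventually_at
    proof (intro exI conjI ballI impI, rule \<open>\<delta> > 0\<close>)
      fix q :: complex assume q: "q \<noteq> 0 \<and> dist q 0 < \<delta>"
      have r: "Re (Ln q) = ln (cmod q)" using q by simp
      have "ln (cmod q) < ln (exp (- 2 * pi * \<bar>B\<bar> / real N))"
        using q by (subst ln_less_cancel_iff) (auto simp: \<delta>_def)
      then have "ln (cmod q) < - 2 * pi * \<bar>B\<bar> / real N" by simp
      then have "\<bar>B\<bar> < - (real N * ln (cmod q) / (2 * pi))"
        using \<open>N > 0\<close> by (simp add: field_simps)
      then have "Im (of_nat N * Ln q / (2 * pi * \<i>)) > \<bar>B\<bar>" unfolding ImL r .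
      then have "cmod (G q) \<le> C * (Im (of_nat N * Ln q / (2 * pi * \<i>))) powr c"
        unfolding G_def by (intro bd) (auto simp: uhp_iff)
      also have "\<dots> \<le> \<bar>C\<bar> * (Im (of_nat N * Ln q / (2 * pi * \<i>))) powr c"
        by (intro mult_right_mono) auto
      finally have "cmod (G q) \<le> \<bar>C\<bar> * (- real N * ln (cmod q) / (2 * pi)) powr c"
        unfolding ImL r by simp
      then show "norm ((q - 0) * G q) \<le> F (cmod q)"
        by (simp add: F_def norm_mult mult_left_mono)
    qed
  qed
  ultimately obtain g where g: "g holomorphic_on ball 0 1" "\<forall>z\<in>ball 0 1 - {0}. g z = G z"
    using holomorphic_on_extend_lim[of G "ball 0 1" 0] by auto
  show ?thesis
  proof (rule that[OF g(1)])
    fix \<tau> assume t: "\<tau> \<in> uhp"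
    define w where "w = 2 * pi * \<i> * \<tau> / of_nat N"
    have *: "of_nat N * w / (2 * pi * \<i>) = \<tau>" using \<open>N > 0\<close> by (simp add: w_def)
    have "Re w < 0" using t \<open>N > 0\<close> by (simp add: w_def uhp_iff)
    then have "exp w \<in> ball 0 1 - {0}" by (simp add: norm_exp_eq_Re)
    then have "g (exp w) = G (exp w)" using g by blast
    also have "\<dots> = h \<tau>" using Gexp[of w, unfolded *] t by simp
    finally show "h \<tau> = g (exp (2 * pi * \<i> * \<tau> / of_nat N))" by (simp add: w_def)
  qed
qed

text \<open>The factor \<open>(\<tau> - t) ^ (r - 1)\<close> makes every term but the zeroth one holomorphic on the circle, where
  \<open>cnj \<tau> = cnj t + \<rho>\<^sup>2 / (\<tau> - t)\<close>.\<close>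

lemma near_hol_coeff_0_integral:
  fixes g :: "nat \<Rightarrow> complex \<Rightarrow> complex" and t :: complex and \<rho> :: real
  assumes "\<And>j. g j holomorphic_on uhp" "\<rho> > 0" "Im t > \<rho>"
  shows "((\<lambda>\<tau>. (\<Sum>j\<le>r. g j \<tau> * (\<tau> - cnj \<tau>) ^ (r - j)) * (\<tau> - t) ^ r / (\<tau> - t)) has_contour_integral
    2 * of_real pi * \<i> * (g 0 t * (- of_real (\<rho>\<^sup>2)) ^ r)) (circlepath t \<rho>)"
proof -
  define P where "P \<tau> = (\<tau> - t)\<^sup>2 + 2 * \<i> * Im t * (\<tau> - t) - of_real (\<rho>\<^sup>2)" for \<tau>
  define f where "f \<tau> = (\<Sum>j\<le>r. g j \<tau> * P \<tau> ^ (r - j) * (\<tau> - t) ^ j)" for \<tau>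
  have sub: "cball t \<rho> \<subseteq> uhp"
  proof
    fix z assume "z \<in> cball t \<rho>"
    then have "\<bar>Im (t - z)\<bar> \<le> \<rho>" using abs_Im_le_cmod[of "t - z"] by (simp add: dist_norm)
    then show "z \<in> uhp" using assms by (simp add: uhp_iff)
  qed
  have "f holomorphic_on cball t \<rho>"
    unfolding f_def P_def by (intro holomorphic_intros holomorphic_on_subset[OF assms(1) sub])
  then have "((\<lambda>\<tau>. f \<tau> / (\<tau> - t)) has_contour_integral 2 * of_real pi * \<i> * f t) (circlepath t \<rho>)"
    using assms(2) by (intro Cauchy_integral_circlepath_simple) auto
  moreover have "f t = g 0 t * (- of_real (\<rho>\<^sup>2)) ^ r"
  proof -
    have "f t = (\<Sum>j\<le>r. if j = 0 then g 0 t * (- of_real (\<rho>\<^sup>2)) ^ r else 0)"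
      unfolding f_def by (intro sum.cong) (auto simp: P_def)
    then show ?thesis by simp
  qed
  ultimately have "((\<lambda>\<tau>. f \<tau> / (\<tau> - t)) has_contour_integral
      2 * of_real pi * \<i> * (g 0 t * (- of_real (\<rho>\<^sup>2)) ^ r)) (circlepath t \<rho>)" by simp
  then show ?thesis
  proof (rule has_contour_integral_eq)
    fix \<tau> assume "\<tau> \<in> path_image (circlepath t \<rho>)"
    then have n: "cmod (\<tau> - t) = \<rho>" using assms(2) by (simp add: dist_norm norm_minus_commute)
    define v where "v = \<tau> - t"
    have vv: "v * cnj v = of_real (\<rho>\<^sup>2)" using n unfolding v_def by (simp only: complex_norm_square[symmetric])
    have "(\<tau> - cnj \<tau>) * v = P \<tau>"
    proof -
      have "\<tau> - cnj \<tau> = v - cnj v + (t - cnj t)" by (simp add: v_def)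
      also have "t - cnj t = 2 * \<i> * Im t" by (simp add: complex_eq_iff)
      finally have *: "\<tau> - cnj \<tau> = v - cnj v + 2 * \<i> * Im t" .
      have "(v - cnj v + 2 * \<i> * Im t) * v = v * v + 2 * \<i> * Im t * v - v * cnj v"
        by (simp add: algebra_simps)
      then show ?thesis unfolding * vv by (simp add: P_def v_def[symmetric] power2_eq_square)
    qed
    then have *: "(\<tau> - cnj \<tau>) ^ (r - j) * v ^ r = P \<tau> ^ (r - j) * v ^ j" if "j \<le> r" for j
    proof -
      have "v ^ r = v ^ (r - j) * v ^ j" using that by (simp flip: power_add)
      then show ?thesis using \<open>(\<tau> - cnj \<tau>) * v = P \<tau>\<close> by (metis mult.assoc power_mult_distrib)
    qed
    have "(\<Sum>j\<le>r. g j \<tau> * (\<tau> - cnj \<tau>) ^ (r - j)) * v ^ r = f \<tau>"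
      unfolding f_def sum_distrib_right v_def[symmetric]
      by (intro sum.cong refl) (simp only: mult.assoc atMost_iff *)
    then show "f \<tau> / (\<tau> - t) = (\<Sum>j\<le>r. g j \<tau> * (\<tau> - cnj \<tau>) ^ (r - j)) * (\<tau> - t) ^ r / (\<tau> - t)"
      by (simp add: v_def)
  qed
qed

section \<open>Polynomial growth at infinity\<close>

definition poly_growth :: "(complex \<Rightarrow> complex) \<Rightarrow> bool" where
  "poly_growth f \<longleftrightarrow> (\<exists>B>0. \<exists>C c :: real. \<forall>\<tau>. Im \<tau> > B \<longrightarrow> norm (f \<tau>) \<le> C * Im \<tau> powr c)"

lemma poly_growth_iff:
  "poly_growth f \<longleftrightarrow> (\<exists>B\<ge>1. \<exists>C\<ge>0. \<exists>n::nat. \<forall>\<tau>. Im \<tau> > B \<longrightarrow> norm (f \<tau>) \<le> C * Im \<tau> ^ n)"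
proof
  assume "poly_growth f"
  then obtain B C c where b: "B > 0" "\<And>\<tau>. Im \<tau> > B \<Longrightarrow> norm (f \<tau>) \<le> C * Im \<tau> powr c"
    unfolding poly_growth_def by blast
  have "norm (f \<tau>) \<le> \<bar>C\<bar> * Im \<tau> ^ nat \<lceil>\<bar>c\<bar>\<rceil>" if "Im \<tau> > max 1 B" for \<tau>
  proof -
    have "norm (f \<tau>) \<le> C * Im \<tau> powr c" using that b by auto
    also have "\<dots> \<le> \<bar>C\<bar> * Im \<tau> powr c" by (intro mult_right_mono) auto
    also have "\<dots> \<le> \<bar>C\<bar> * Im \<tau> powr real (nat \<lceil>\<bar>c\<bar>\<rceil>)"
      using that by (intro mult_left_mono powr_mono) linarith+
    also have "\<dots> = \<bar>C\<bar> * Im \<tau> ^ nat \<lceil>\<bar>c\<bar>\<rceil>" using that by (subst powr_realpow) auto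
    finally show ?thesis .
  qed
  then show "\<exists>B\<ge>1. \<exists>C\<ge>0. \<exists>n::nat. \<forall>\<tau>. Im \<tau> > B \<longrightarrow> norm (f \<tau>) \<le> C * Im \<tau> ^ n"
    by (intro exI[of _ "max 1 B"] conjI exI[of _ "\<bar>C\<bar>"] exI[of _ "nat \<lceil>\<bar>c\<bar>\<rceil>"]) auto
next
  assume "\<exists>B\<ge>1. \<exists>C\<ge>0. \<exists>n::nat. \<forall>\<tau>. Im \<tau> > B \<longrightarrow> norm (f \<tau>) \<le> C * Im \<tau> ^ n"
  then obtain B C n where "B \<ge> 1" "\<And>\<tau>. Im \<tau> > B \<Longrightarrow> norm (f \<tau>) \<le> C * Im \<tau> ^ n" by blast
  then show "poly_growth f"
    unfolding poly_growth_def
    by (intro exI[of _ B] conjI exI[of _ C] exI[of _ "real n"]) (auto simp: powr_realpow)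
qed

lemma poly_growth_add:
  assumes "poly_growth f" "poly_growth g" shows "poly_growth (\<lambda>\<tau>. f \<tau> + g \<tau>)"
proof -
  obtain B C n B' C' n' where *: "B \<ge> 1" "C \<ge> 0" "\<And>\<tau>. Im \<tau> > B \<Longrightarrow> norm (f \<tau>) \<le> C * Im \<tau> ^ n"
    "B' \<ge> 1" "C' \<ge> 0" "\<And>\<tau>. Im \<tau> > B' \<Longrightarrow> norm (g \<tau>) \<le> C' * Im \<tau> ^ n'"
    using assms unfolding poly_growth_iff by blast
  have "norm (f \<tau> + g \<tau>) \<le> (C + C') * Im \<tau> ^ max n n'" if "Im \<tau> > max B B'" for \<tau>
  proof -
    have "norm (f \<tau> + g \<tau>) \<le> C * Im \<tau> ^ n + C' * Im \<tau> ^ n'"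
      using that * by (intro order.trans[OF norm_triangle_ineq] add_mono) auto
    also have "\<dots> \<le> C * Im \<tau> ^ max n n' + C' * Im \<tau> ^ max n n'"
      using that * by (intro add_mono mult_left_mono power_increasing) auto
    finally show ?thesis by (simp add: algebra_simps)
  qed
  then show ?thesis unfolding poly_growth_iff using *
    by (intro exI[of _ "max B B'"] conjI exI[of _ "C + C'"] exI[of _ "max n n'"]) auto
qed

lemma poly_growth_mult:
  assumes "poly_growth f" "poly_growth g" shows "poly_growth (\<lambda>\<tau>. f \<tau> * g \<tau>)"
proof -
  obtain B C n B' C' n' where *: "B \<ge> 1" "C \<ge> 0" "\<And>\<tau>. Im \<tau> > B \<Longrightarrow> norm (f \<tau>) \<le> C * Im \<tau> ^ n"
    "B' \<ge> 1" "C' \<ge> 0" "\<And>\<tau>. Im \<tau> > B' \<Longrightarrow> norm (g \<tau>) \<le> C' * Im \<tau> ^ n'"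
    using assms unfolding poly_growth_iff by blast
  have "norm (f \<tau> * g \<tau>) \<le> (C * C') * Im \<tau> ^ (n + n')" if "Im \<tau> > max B B'" for \<tau>
  proof -
    have "norm (f \<tau> * g \<tau>) \<le> (C * Im \<tau> ^ n) * (C' * Im \<tau> ^ n')"
      unfolding norm_mult using that * by (intro mult_mono) auto
    then show ?thesis by (simp add: power_add mult_ac)
  qed
  then show ?thesis unfolding poly_growth_iff using *
    by (intro exI[of _ "max B B'"] conjI exI[of _ "C * C'"] exI[of _ "n + n'"]) auto
qed

lemma poly_growth_const: "poly_growth (\<lambda>_. c)"
  unfolding poly_growth_iff by (intro exI[of _ 1] conjI exI[of _ "norm c"] exI[of _ 0]) auto

lemma poly_growth_power: "poly_growth f \<Longrightarrow> poly_growth (\<lambda>\<tau>. f \<tau> ^ n)"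
  by (induction n) (auto intro: poly_growth_mult poly_growth_const)

lemma poly_growth_diff_cnj: "poly_growth (\<lambda>\<tau>. \<tau> - cnj \<tau>)"
proof -
  have "norm (\<tau> - cnj \<tau>) = 2 * \<bar>Im \<tau>\<bar>" for \<tau>
    unfolding complex_diff_cnj by (simp add: norm_mult)
  then show ?thesis
    unfolding poly_growth_iff by (intro exI[of _ 1] conjI exI[of _ 2] exI[of _ 1]) auto
qed

lemma poly_growth_cong:
  assumes "poly_growth f" "\<And>\<tau>. \<tau> \<in> uhp \<Longrightarrow> g \<tau> = f \<tau>" shows "poly_growth g"
proof -
  obtain B C n where "B \<ge> 1" "C \<ge> 0" "\<And>\<tau>. Im \<tau> > B \<Longrightarrow> norm (f \<tau>) \<le> C * Im \<tau> ^ n"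
    using assms(1) unfolding poly_growth_iff by blast
  then show ?thesis
    unfolding poly_growth_iff using assms(2)
    by (intro exI[of _ B] conjI exI[of _ C] exI[of _ n]) (auto simp: uhp_iff)
qed

text \<open>The contour formula with radius 1: on the circle around \<open>t\<close> the imaginary
  part changes by at most 1, so growth of the whole sum bounds the zeroth coefficient.\<close>

lemma poly_growth_near_hol_coeff_0:
  fixes g :: "nat \<Rightarrow> complex \<Rightarrow> complex"
  assumes hol: "\<And>j. g j holomorphic_on uhp"
    and gr: "poly_growth (\<lambda>\<tau>. \<Sum>j\<le>r. g j \<tau> * (\<tau> - cnj \<tau>) ^ (r - j))" (is "poly_growth ?F")
  shows "poly_growth (g 0)"
proof -
  obtain B C n where *: "B \<ge> 1" "C \<ge> 0" "\<And>\<tau>. Im \<tau> > B \<Longrightarrow> norm (?F \<tau>) \<le> C * Im \<tau> ^ n"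
    using gr unfolding poly_growth_iff by blast
  have "norm (g 0 t) \<le> (C * 2 ^ n) * Im t ^ n" if t: "Im t > B + 1" for t
  proof -
    have "norm (2 * of_real pi * \<i> * (g 0 t * (- of_real (1\<^sup>2)) ^ r)) \<le> (C * (2 * Im t) ^ n) * (2 * pi * 1)"
    proof (rule has_contour_integral_bound_circlepath[OF near_hol_coeff_0_integral[OF hol]])
      fix x assume x: "norm (x - t) = 1"
      then have "\<bar>Im (x - t)\<bar> \<le> 1" using abs_Im_le_cmod[of "x - t"] by simp
      then have i: "Im x > B" "Im x \<le> 2 * Im t" "0 \<le> Im x" using t * by auto
      have "norm (?F x * (x - t) ^ r / (x - t)) = norm (?F x)"
        using x by (simp add: norm_mult norm_divide norm_power)
      also have "\<dots> \<le> C * Im x ^ n" using * i by blast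
      also have "\<dots> \<le> C * (2 * Im t) ^ n" using * i by (intro mult_left_mono power_mono) auto
      finally show "norm (?F x * (x - t) ^ r / (x - t)) \<le> C * (2 * Im t) ^ n" .
    qed (use t * in auto)
    then have "2 * pi * norm (g 0 t) \<le> (C * (2 * Im t) ^ n) * (2 * pi)"
      by (simp add: norm_mult norm_power)
    then show ?thesis by (simp add: power_mult_distrib mult_ac)
  qed
  then show ?thesis
    unfolding poly_growth_iff using *
    by (intro exI[of _ "B + 1"] conjI exI[of _ "C * 2 ^ n"] exI[of _ n]) auto
qed

text \<open>Slow increase is known for the whole polynomial only, but the top coefficient is the one
  with a clean transformation law. Clearing denominators bounds the zeroth coefficient; subtracting
  it and dividing by \<open>inv_2iy\<close> lowers the degree.\<close>

lemma poly_growth_near_hol_top: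
  fixes g :: "nat \<Rightarrow> complex \<Rightarrow> complex"
  assumes "\<And>j. g j holomorphic_on uhp" "poly_growth (\<lambda>\<tau>. \<Sum>j\<le>r. g j \<tau> * inv_2iy \<tau> ^ j)"
  shows "poly_growth (g r)"
  using assms
proof (induction r arbitrary: g)
  case 0
  then show ?case by simp
next
  case (Suc r)
  let ?F = "\<lambda>\<tau>. \<Sum>j\<le>Suc r. g j \<tau> * inv_2iy \<tau> ^ j"
  have "poly_growth (\<lambda>\<tau>. ?F \<tau> * (\<tau> - cnj \<tau>) ^ Suc r)"
    by (intro poly_growth_mult Suc.prems poly_growth_power poly_growth_diff_cnj)
  then have "poly_growth (\<lambda>\<tau>. \<Sum>j\<le>Suc r. g j \<tau> * (\<tau> - cnj \<tau>) ^ (Suc r - j))"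
  proof (rule poly_growth_cong)
    fix \<tau> assume t: "\<tau> \<in> uhp"
    define v where "v = \<tau> - cnj \<tau>"
    have v: "v \<noteq> 0" using diff_cnj_nonzero[OF t] by (simp add: v_def)
    show "(\<Sum>j\<le>Suc r. g j \<tau> * (\<tau> - cnj \<tau>) ^ (Suc r - j)) = ?F \<tau> * (\<tau> - cnj \<tau>) ^ Suc r"
      unfolding sum_distrib_right inv_2iy_def v_def[symmetric]
      by (intro sum.cong refl) (use v in \<open>auto simp: power_diff power_divide simp del: power_Suc\<close>)
  qed
  then have g0: "poly_growth (g 0)" by (rule poly_growth_near_hol_coeff_0[OF Suc.prems(1)])
  have "poly_growth (\<lambda>\<tau>. (?F \<tau> + (- 1) * g 0 \<tau>) * (\<tau> - cnj \<tau>))"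
    by (intro poly_growth_mult poly_growth_add Suc.prems poly_growth_diff_cnj poly_growth_const g0)
  then have "poly_growth (\<lambda>\<tau>. \<Sum>j\<le>r. g (Suc j) \<tau> * inv_2iy \<tau> ^ j)"
  proof (rule poly_growth_cong)
    fix \<tau> assume t: "\<tau> \<in> uhp"
    have v: "inv_2iy \<tau> * (\<tau> - cnj \<tau>) = 1" using diff_cnj_nonzero[OF t] by (simp add: inv_2iy_def)
    have "(?F \<tau> + (- 1) * g 0 \<tau>) * (\<tau> - cnj \<tau>) =
        (\<Sum>j\<le>r. g (Suc j) \<tau> * inv_2iy \<tau> ^ Suc j) * (\<tau> - cnj \<tau>)"
      by (simp add: sum.atMost_Suc_shift del: sum.atMost_Suc power_Suc complex_diff_cnj)
    also have "\<dots> = (\<Sum>j\<le>r. g (Suc j) \<tau> * inv_2iy \<tau> ^ j)"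
      unfolding sum_distrib_right power_Suc2 mult.assoc v by simp
    finally show "(\<Sum>j\<le>r. g (Suc j) \<tau> * inv_2iy \<tau> ^ j) = (?F \<tau> + (- 1) * g 0 \<tau>) * (\<tau> - cnj \<tau>)" ..
  qed
  then show ?case using Suc.prems by (intro Suc.IH[of "\<lambda>j. g (Suc j)"])
qed

section \<open>A holomorphic form in the image of \<open>\<delta>\<close> vanishes\<close>

text \<open>Dirichlet approximation takes the place of reduction to a fundamental domain: a bottom
  row \<open>(q, - p)\<close> with \<open>q\<close> of size about \<open>1 / sqrt y\<close> makes
  the automorphy factor small.\<close>

lemma exists_moebius_Im_ge:
  assumes "\<tau> \<in> uhp"
  shows "\<exists>A \<in> carrier SL2Z. Im (moebius A \<tau>) \<ge> 1 / 5"
proof (cases "Im \<tau> \<ge> 1 / 5")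
  case True
  have "mat 1 \<in> carrier SL2Z" by (simp add: carrier_SL2Z)
  then show ?thesis using True by (intro bexI[of _ "mat 1"]) (auto simp: moebius_def automorphy_factor_def)
next
  case False
  define x y where "x = Re \<tau>" and "y = Im \<tau>"
  have y: "0 < y" "y < 1" using assms False by (auto simp: uhp_iff y_def)
  \<comment> \<open>This size balances the two squares in the norm of the automorphy factor: one is
    at most \<open>y\<close>, the other at most \<open>4 * y\<close>, whence the constant 5.\<close>
  define Q where "Q = nat \<lceil>1 / sqrt y\<rceil>"
  have s: "sqrt y > 0" "sqrt y \<le> 1" using y by auto
  have Q1: "1 / sqrt y \<le> real Q" unfolding Q_def by linarith
  have Q2: "real Q \<le> 2 / sqrt y"
  proof -
    have "1 \<le> 1 / sqrt y" using s by simp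
    moreover have "real Q = of_int \<lceil>1 / sqrt y\<rceil>" using calculation by (simp add: Q_def)
    moreover have "of_int \<lceil>1 / sqrt y\<rceil> \<le> 1 / sqrt y + 1" by (rule of_int_ceiling_le_add_one)
    moreover have "2 / sqrt y = 1 / sqrt y + 1 / sqrt y" by simp
    ultimately show ?thesis by linarith
  qed
  have "Q > 0" using Q1 s by (metis divide_pos_pos of_nat_0_less_iff order_less_le_trans zero_less_one)
  then obtain p q where pq: "coprime p q" "0 < q" "q \<le> int Q" "\<bar>of_int q * x - of_int p\<bar> < 1 / Q"
    using Dirichlet_approx_coprime by blast
  obtain a b where ab: "a * p + b * q = 1"
    using bezout_int[of p q] pq(1) by (auto simp: coprime_iff_gcd_eq_1 mult.commute)
  define A where "A = mat2 (- a) (- b) q (- p)"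
  have A: "A \<in> carrier SL2Z" using ab by (simp add: A_def carrier_SL2Z)
  have j: "automorphy_factor A \<tau> = of_int q * \<tau> - of_int p" by (simp add: A_def automorphy_factor_def)
  have n: "(cmod (automorphy_factor A \<tau>))\<^sup>2 = (of_int q * x - of_int p)\<^sup>2 + (of_int q * y)\<^sup>2"
    unfolding j cmod_power2 by (simp add: x_def y_def)
  have "(of_int q * x - of_int p)\<^sup>2 \<le> (1 / real Q)\<^sup>2"
    using pq(4) by (metis abs_le_square_iff abs_of_nonneg less_imp_le divide_nonneg_nonneg of_nat_0_le_iff zero_le_one)
  also have "\<dots> \<le> (sqrt y)\<^sup>2"
    using Q1 s \<open>Q > 0\<close> by (intro power_mono) (auto simp: field_simps)
  finally have 1: "(of_int q * x - of_int p)\<^sup>2 \<le> y" using y by simp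
  have "of_int q * y \<le> 2 / sqrt y * y"
    using pq(3) Q2 y by (intro mult_right_mono) linarith+
  also have "\<dots> = 2 * sqrt y" using s y by (simp add: field_simps)
  finally have "(of_int q * y)\<^sup>2 \<le> (2 * sqrt y)\<^sup>2" using pq y by (intro power_mono) auto
  then have 2: "(of_int q * y)\<^sup>2 \<le> 4 * y" using y by (simp add: power_mult_distrib)
  have "(cmod (automorphy_factor A \<tau>))\<^sup>2 \<le> 5 * y" unfolding n using 1 2 by linarith
  moreover have "(cmod (automorphy_factor A \<tau>))\<^sup>2 > 0" using automorphy_factor_nonzero[OF A assms] by simp
  ultimately have "Im (moebius A \<tau>) \<ge> 1 / 5"
    unfolding Im_moebius[OF A assms] y_def[symmetric] by (simp add: field_simps)
  with A show ?thesis by blast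
qed

text \<open>\<open>h\<close> is a form of weight \<open>- w\<close>. One constant bounds all its
  slashes where the imaginary part is at least 1/5, and every point can be moved there; so the
  square of \<open>norm (h \<tau>)\<close> is at most a constant times \<open>Im \<tau> ^ w\<close>.
  This tends to 0 at the real line, and the maximum principle in the variable \<open>q\<close>
  forces \<open>h\<close> to vanish.\<close>

lemma negative_weight_zero:
  fixes h :: "complex \<Rightarrow> complex" and N w :: nat
  assumes N: "N > 0" and w: "w > 0" and hol: "h holomorphic_on uhp"
    and inv: "\<And>A \<tau>. A \<in> principal_congruence_subgroup N \<Longrightarrow> \<tau> \<in> uhp \<Longrightarrow>
        automorphy_factor A \<tau> ^ w * h (moebius A \<tau>) = h \<tau>"
    and gr: "\<And>A. A \<in> carrier SL2Z \<Longrightarrow> poly_growth (\<lambda>\<tau>. automorphy_factor A \<tau> ^ w * h (moebius A \<tau>))"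
    and t0: "t0 \<in> uhp"
  shows "h t0 = 0"
proof -
  define H where "H A \<tau> = automorphy_factor A \<tau> ^ w * h (moebius A \<tau>)" for A \<tau>
  have Hmult: "H (B ** A) \<tau> = automorphy_factor A \<tau> ^ w * H B (moebius A \<tau>)"
    if "A \<in> carrier SL2Z" "B \<in> carrier SL2Z" "\<tau> \<in> uhp" for A B \<tau>
    by (simp add: H_def moebius_mult[OF that(1,3,2)] automorphy_factor_mult[OF that(1,3)] power_mult_distrib)
  have Hinv: "H (B ** A) \<tau> = H A \<tau>"
    if "A \<in> carrier SL2Z" "B \<in> principal_congruence_subgroup N" "\<tau> \<in> uhp" for A B \<tau>
  proof -
    have "B \<in> carrier SL2Z" using that by (simp add: principal_congruence_subgroup_iff)
    moreover have "H B (moebius A \<tau>) = h (moebius A \<tau>)"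
      unfolding H_def using that by (intro inv moebius_uhp)
    ultimately show ?thesis using Hmult[of A B \<tau>] that by (simp add: H_def)
  qed
  have Hhol: "H A holomorphic_on uhp" if "A \<in> carrier SL2Z" for A
  proof -
    have "(h \<circ> moebius A) holomorphic_on uhp"
      using moebius_uhp[OF that] by (intro holomorphic_on_compose moebius_holomorphic that holomorphic_on_subset[OF hol]) auto
    then show ?thesis unfolding H_def[abs_def]
      by (intro holomorphic_intros moebius_holomorphic that) (simp add: o_def)
  qed
  have Hper: "H A (\<tau> + of_nat N) = H A \<tau>" if A: "A \<in> carrier SL2Z" and t: "\<tau> \<in> uhp" for A \<tau>
  proof -
    let ?T = "mat2 1 (int N) 0 1"
    have T: "?T \<in> carrier SL2Z" by (simp add: carrier_SL2Z)
    have "H (A ** ?T) \<tau> = H A (\<tau> + of_nat N)"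
      using Hmult[OF T A t] by (simp add: automorphy_factor_def moebius_def)
    moreover have "A ** ?T = (A ** ?T ** adjugate2 A) ** A"
      by (simp add: matrix_mul_assoc[symmetric] adjugate2_inverse[OF A])
    ultimately show ?thesis
      using Hinv[OF A conjugate_translation_principal[OF A] t] by simp
  qed
  have Hfac: "\<exists>G. G holomorphic_on ball 0 1 \<and> (\<forall>\<tau>\<in>uhp. H A \<tau> = G (exp (2 * pi * \<i> * \<tau> / of_nat N)))"
    if A: "A \<in> carrier SL2Z" for A
  proof -
    obtain B C c where "\<And>\<tau>. Im \<tau> > B \<Longrightarrow> norm (H A \<tau>) \<le> C * Im \<tau> powr c"
      using gr[OF A] unfolding poly_growth_def H_def by blast
    then show ?thesis
      using periodic_factor_unit_disc[OF N Hhol[OF A] Hper[OF A], of B C c] by metis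
  qed
  have Hbd: "\<exists>K. \<forall>\<tau>. Im \<tau> \<ge> 1 / 5 \<longrightarrow> norm (H A \<tau>) \<le> K" if A: "A \<in> carrier SL2Z" for A
  proof -
    obtain G where G: "G holomorphic_on ball 0 1"
      "\<And>\<tau>. \<tau> \<in> uhp \<Longrightarrow> H A \<tau> = G (exp (2 * pi * \<i> * \<tau> / of_nat N))" using Hfac[OF A] by blast
    define R where "R = exp (- 2 * pi / (5 * N))"
    have "R < 1" using N by (simp add: R_def)
    then have "continuous_on (cball 0 R) G"
      by (intro holomorphic_on_imp_continuous_on holomorphic_on_subset[OF G(1)]) auto
    then have "bounded (G ` cball 0 R)" by (intro compact_imp_bounded compact_continuous_image) auto
    then obtain K where "\<forall>x\<in>G ` cball 0 R. norm x \<le> K" unfolding bounded_iff by blast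
    then have K: "\<And>q. q \<in> cball 0 R \<Longrightarrow> norm (G q) \<le> K" by blast
    have "norm (H A \<tau>) \<le> K" if "Im \<tau> \<ge> 1 / 5" for \<tau>
    proof -
      have "cmod (exp (2 * pi * \<i> * \<tau> / of_nat N)) = exp (- 2 * pi * Im \<tau> / N)" by (simp add: norm_exp_eq_Re)
      also have "\<dots> \<le> R" unfolding R_def using N that by (simp add: field_simps)
      finally show ?thesis using K G(2)[of \<tau>] that by (simp add: uhp_iff)
    qed
    then show ?thesis by blast
  qed
  have "\<exists>K. \<forall>A\<in>carrier SL2Z. \<forall>\<tau>. Im \<tau> \<ge> 1 / 5 \<longrightarrow> norm (H A \<tau>) \<le> K"
  proof -
    \<comment> \<open>\<open>H A\<close> depends only on the entries of \<open>A\<close> modulo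
      \<open>N\<close>, so finitely many classes share one bound.\<close>
    define cls where "cls A = (A$1$1 mod int N, A$1$2 mod int N, A$2$1 mod int N, A$2$2 mod int N)" for A :: "int^2^2"
    have "cls ` carrier SL2Z \<subseteq> {0..<int N} \<times> {0..<int N} \<times> {0..<int N} \<times> {0..<int N}"
      using N by (auto simp: cls_def)
    then have fin: "finite (cls ` carrier SL2Z)" by (rule finite_subset) auto
    have "\<forall>c\<in>cls ` carrier SL2Z. \<exists>K. \<forall>A\<in>carrier SL2Z. cls A = c \<longrightarrow> (\<forall>\<tau>. Im \<tau> \<ge> 1 / 5 \<longrightarrow> norm (H A \<tau>) \<le> K)"
    proof
      fix c assume "c \<in> cls ` carrier SL2Z"
      then obtain B where B: "B \<in> carrier SL2Z" and c: "c = cls B" by blast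
      obtain K where K: "\<And>\<tau>. Im \<tau> \<ge> 1 / 5 \<Longrightarrow> norm (H B \<tau>) \<le> K" using Hbd[OF B] by blast
      have "norm (H A \<tau>) \<le> K" if A: "A \<in> carrier SL2Z" "cls A = cls B" "Im \<tau> \<ge> 1 / 5" for A \<tau>
      proof -
        have m: "int N dvd A$1$1 - B$1$1" "int N dvd A$1$2 - B$1$2" "int N dvd A$2$1 - B$2$1" "int N dvd A$2$2 - B$2$2"
          using A(2) by (auto simp: cls_def mod_eq_dvd_iff)
        have "\<tau> \<in> uhp" using A(3) by (simp add: uhp_iff)
        then have "H A \<tau> = H B \<tau>"
          using Hinv[OF B congruent_mod_principal(1)[OF B A(1) m]] congruent_mod_principal(2)[OF B A(1) m] by simp
        then show ?thesis using K A(3) by simp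
      qed
      then show "\<exists>K. \<forall>A\<in>carrier SL2Z. cls A = c \<longrightarrow> (\<forall>\<tau>. Im \<tau> \<ge> 1 / 5 \<longrightarrow> norm (H A \<tau>) \<le> K)"
        unfolding c by blast
    qed
    from bchoice[OF this] obtain K where "\<forall>c\<in>cls ` carrier SL2Z. \<forall>A\<in>carrier SL2Z. cls A = c \<longrightarrow>
        (\<forall>\<tau>. Im \<tau> \<ge> 1 / 5 \<longrightarrow> norm (H A \<tau>) \<le> K c)" by blast
    then have K: "norm (H A \<tau>) \<le> K (cls A)" if "A \<in> carrier SL2Z" "Im \<tau> \<ge> 1 / 5" for A \<tau>
      using that by blast
    have "norm (H A \<tau>) \<le> Max (K ` cls ` carrier SL2Z)" if "A \<in> carrier SL2Z" "Im \<tau> \<ge> 1 / 5" for A \<tau>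
      using K[OF that] fin that(1) by (meson Max_ge finite_imageI imageI order_trans)
    then show ?thesis by blast
  qed
  then obtain K where K: "\<And>A \<tau>. A \<in> carrier SL2Z \<Longrightarrow> Im \<tau> \<ge> 1 / 5 \<Longrightarrow> norm (H A \<tau>) \<le> K" by blast
  have hbd: "(norm (h \<tau>))\<^sup>2 \<le> K\<^sup>2 * (5 * Im \<tau>) ^ w" if t: "\<tau> \<in> uhp" for \<tau>
  proof -
    obtain A where A: "A \<in> carrier SL2Z" "Im (moebius A \<tau>) \<ge> 1 / 5" using exists_moebius_Im_ge[OF t] by blast
    have 1: "mat 1 = adjugate2 A ** A" using adjugate2_inverse[OF A(1)] by simp
    have "h \<tau> = H (mat 1) \<tau>" by (simp add: H_def automorphy_factor_def moebius_def)
    also have "\<dots> = automorphy_factor A \<tau> ^ w * H (adjugate2 A) (moebius A \<tau>)"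
      unfolding 1 by (rule Hmult[OF A(1) adjugate2_SL2Z[OF A(1)] t])
    finally have "norm (h \<tau>) \<le> cmod (automorphy_factor A \<tau>) ^ w * K"
      using K[OF adjugate2_SL2Z[OF A(1)] A(2)] by (simp add: norm_mult norm_power mult_left_mono)
    then have "(norm (h \<tau>))\<^sup>2 \<le> (cmod (automorphy_factor A \<tau>) ^ w * K)\<^sup>2" by (rule power_mono) auto
    also have "\<dots> = K\<^sup>2 * ((cmod (automorphy_factor A \<tau>))\<^sup>2) ^ w"
      by (simp add: power_mult_distrib power_mult[symmetric] mult.commute)
    also have "\<dots> \<le> K\<^sup>2 * (5 * Im \<tau>) ^ w"
    proof (intro mult_left_mono power_mono)
      have "(cmod (automorphy_factor A \<tau>))\<^sup>2 > 0" using automorphy_factor_nonzero[OF A(1) t] by simp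
      then show "(cmod (automorphy_factor A \<tau>))\<^sup>2 \<le> 5 * Im \<tau>"
        using A(2) unfolding Im_moebius[OF A(1) t] by (simp add: field_simps)
    qed auto
    finally show ?thesis .
  qed
  have one: "mat 1 \<in> carrier SL2Z" by (simp add: carrier_SL2Z)
  have H1: "H (mat 1) = h" by (auto simp: H_def automorphy_factor_def moebius_def)
  obtain G where G: "G holomorphic_on ball 0 1"
    "\<And>\<tau>. \<tau> \<in> uhp \<Longrightarrow> h \<tau> = G (exp (2 * pi * \<i> * \<tau> / of_nat N))"
    using Hfac[OF one] unfolding H1 by blast
  have main: "(norm (h t0))\<^sup>2 \<le> K\<^sup>2 * (5 * y) ^ w" if y: "0 < y" "y < Im t0" for y
  proof -
    \<comment> \<open>The circle of this radius is the image of the line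
      \<open>Im \<tau> = y\<close>, where \<open>hbd\<close> applies; as \<open>y\<close> tends to 0
      it expands to the unit circle.\<close>
    define R where "R = exp (- 2 * pi * y / N)"
    have R: "0 < R" "R < 1" using N y by (auto simp: R_def)
    define q0 where "q0 = exp (2 * pi * \<i> * t0 / of_nat N)"
    have "cmod q0 = exp (- 2 * pi * Im t0 / N)" by (simp add: q0_def norm_exp_eq_Re)
    also have "\<dots> \<le> R" unfolding R_def using N y by (simp add: field_simps)
    finally have q0: "q0 \<in> cball 0 R" by simp
    have "norm (G q0) \<le> sqrt (K\<^sup>2 * (5 * y) ^ w)"
    proof (rule maximum_modulus_frontier[of G "cball 0 R"])
      show "G holomorphic_on interior (cball 0 R)" "continuous_on (closure (cball 0 R)) G" "bounded (cball 0 R)"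
        using R by (auto intro!: holomorphic_on_subset[OF G(1)] holomorphic_on_imp_continuous_on)
      show "q0 \<in> cball 0 R" by (rule q0)
      fix q assume "q \<in> frontier (cball 0 R :: complex set)"
      then have q: "cmod q = R" using R by (simp add: frontier_cball)
      then have "q \<noteq> 0" using R by auto
      define \<tau> where "\<tau> = of_nat N * Ln q / (2 * pi * \<i>)"
      have e: "exp (2 * pi * \<i> * \<tau> / of_nat N) = q" using N \<open>q \<noteq> 0\<close> by (simp add: \<tau>_def)
      have "exp (- 2 * pi * Im \<tau> / N) = R" using arg_cong[OF e, of cmod] q by (simp add: norm_exp_eq_Re)
      then have "Im \<tau> = y" using N by (simp add: R_def)
      then have t: "\<tau> \<in> uhp" using y by (simp add: uhp_iff)
      have "norm (G q) = norm (h \<tau>)" using G(2)[OF t] by (simp only: e)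
      also have "\<dots> \<le> sqrt (K\<^sup>2 * (5 * y) ^ w)"
        using hbd[OF t] \<open>Im \<tau> = y\<close> by (intro real_le_rsqrt) simp
      finally show "norm (G q) \<le> sqrt (K\<^sup>2 * (5 * y) ^ w)" .
    qed
    then have "norm (h t0) \<le> sqrt (K\<^sup>2 * (5 * y) ^ w)" using G(2)[OF t0] by (simp add: q0_def)
    then have "(norm (h t0))\<^sup>2 \<le> (sqrt (K\<^sup>2 * (5 * y) ^ w))\<^sup>2" by (rule power_mono) auto
    then show ?thesis using y by simp
  qed
  have "(norm (h t0))\<^sup>2 \<le> K\<^sup>2 * (5 * 0) ^ w"
  proof (rule tendsto_lowerbound)
    show "((\<lambda>y. K\<^sup>2 * (5 * y) ^ w) \<longlongrightarrow> K\<^sup>2 * (5 * 0) ^ w) (at_right 0)"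
      by (intro tendsto_intros)
    show "\<forall>\<^sub>F y in at_right 0. (norm (h t0))\<^sup>2 \<le> K\<^sup>2 * (5 * y) ^ w"
      using t0 main unfolding eventually_at_right_field uhp_iff by blast
  qed auto
  then show ?thesis using w by (simp add: zero_power)
qed

lemma holomorphic_coeff_power:
  fixes P :: "complex \<Rightarrow> complex poly"
  assumes "\<And>i. (\<lambda>\<tau>. coeff (P \<tau>) i) holomorphic_on S"
  shows "(\<lambda>\<tau>. coeff (P \<tau> ^ n) i) holomorphic_on S"
proof (induction n arbitrary: i)
  case 0
  then show ?case by (cases "i = 0") auto
next
  case (Suc n)
  then show ?case using assms by (auto simp: coeff_mult intro!: holomorphic_intros)
qed

text \<open>Substitute the law for \<open>inv_2iy\<close>. The coefficient of degree
  \<open>w\<close> arises only from the term of degree \<open>w\<close>, where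
  \<open>J ^ (2 * w)\<close> meets the denominator \<open>J ^ w\<close>; thus the top coefficient
  transforms with weight \<open>- w\<close>.\<close>

lemma slash_near_hol_coeffs:
  assumes g: "near_hol_coeffs w g f" and A: "A \<in> carrier SL2Z"
  obtains g' where "near_hol_coeffs w g' (slash w f A)"
    "\<And>\<tau>. \<tau> \<in> uhp \<Longrightarrow> g' w \<tau> = automorphy_factor A \<tau> ^ w * g w (moebius A \<tau>)"
proof -
  define J where "J = automorphy_factor A"
  \<comment> \<open>\<open>inv_2iy (moebius A \<tau>)\<close> as a linear polynomial in
    \<open>inv_2iy \<tau>\<close>.\<close>
  define L where "L \<tau> = [: - of_int (A$2$1) * J \<tau>, J \<tau> ^ 2 :]" for \<tau>
  define p where "p \<tau> = (\<Sum>j\<le>w. smult (g j (moebius A \<tau>) / J \<tau> ^ w) (L \<tau> ^ j))" for \<tau>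
  have Jnz: "J \<tau> \<noteq> 0" if "\<tau> \<in> uhp" for \<tau> using automorphy_factor_nonzero[OF A that] by (simp add: J_def)
  have Jhol: "J holomorphic_on uhp" unfolding J_def by (rule moebius_holomorphic[OF A])
  have ghol: "(\<lambda>\<tau>. g j (moebius A \<tau>)) holomorphic_on uhp" for j
    using holomorphic_on_compose_gen[OF moebius_holomorphic(2)[OF A], of "g j" uhp] g moebius_uhp[OF A]
    by (auto simp: near_hol_coeffs_def o_def)
  have "(\<lambda>\<tau>. coeff (L \<tau>) i) holomorphic_on uhp" for i
    unfolding L_def coeff_pCons using Jhol by (cases i; cases "i - 1") (auto intro!: holomorphic_intros)
  then have Lhol: "(\<lambda>\<tau>. coeff (L \<tau> ^ j) i) holomorphic_on uhp" for i j
    by (rule holomorphic_coeff_power)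
  have degL: "degree (L \<tau>) \<le> 1" for \<tau> unfolding L_def by (rule degree_le) (auto simp: coeff_pCons split: nat.splits)
  have degLj: "degree (L \<tau> ^ j) \<le> j" for \<tau> j
    using degL[of \<tau>] by (metis degree_power_le mult.commute mult_le_mono2 nat_mult_1_right order_trans)
  have coeffLj: "coeff (L \<tau> ^ j) j = J \<tau> ^ (2 * j)" for \<tau> j
  proof (induction j)
    case (Suc j)
    have "coeff (L \<tau> * L \<tau> ^ j) (Suc j) = J \<tau> ^ 2 * coeff (L \<tau> ^ j) j - of_int (A$2$1) * J \<tau> * coeff (L \<tau> ^ j) (Suc j)"
      by (simp add: L_def mult_pCons_left)
    also have "coeff (L \<tau> ^ j) (Suc j) = 0" using degLj[of \<tau> j] by (intro coeff_eq_0) simp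
    finally show ?case using Suc by (simp flip: power_add)
  qed auto
  have degp: "degree (p \<tau>) \<le> w" for \<tau>
    unfolding p_def by (rule degree_sum_le) (auto intro: order.trans[OF degree_smult_le] order.trans[OF degLj])
  show ?thesis
  proof (rule that[of "\<lambda>j \<tau>. coeff (p \<tau>) j"])
    show "near_hol_coeffs w (\<lambda>j \<tau>. coeff (p \<tau>) j) (slash w f A)"
      unfolding near_hol_coeffs_def
    proof safe
      fix j show "(\<lambda>\<tau>. coeff (p \<tau>) j) holomorphic_on uhp"
        unfolding p_def coeff_sum coeff_smult
        by (intro holomorphic_intros ghol Lhol Jhol) (use Jnz in auto)
    next
      fix \<tau> assume t: "\<tau> \<in> uhp"
      have "(\<Sum>j\<le>w. coeff (p \<tau>) j * inv_2iy \<tau> ^ j) = poly (p \<tau>) (inv_2iy \<tau>)"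
        unfolding poly_altdef using degp[of \<tau>]
        by (intro sum.mono_neutral_right) (auto simp: coeff_eq_0)
      also have "\<dots> = (\<Sum>j\<le>w. g j (moebius A \<tau>) / J \<tau> ^ w * inv_2iy (moebius A \<tau>) ^ j)"
        unfolding inv_2iy_moebius[OF A t] by (simp add: p_def poly_sum L_def J_def algebra_simps)
      also have "\<dots> = slash w f A \<tau>"
        using g moebius_uhp[OF A t] by (simp add: slash_def near_hol_coeffs_def J_def sum_divide_distrib)
      finally show "slash w f A \<tau> = (\<Sum>j\<le>w. coeff (p \<tau>) j * inv_2iy \<tau> ^ j)" ..
    qed
    fix \<tau> assume t: "\<tau> \<in> uhp"
    have "coeff (p \<tau>) w = (\<Sum>j\<le>w. if j = w then g w (moebius A \<tau>) / J \<tau> ^ w * J \<tau> ^ (2 * w) else 0)"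
      unfolding p_def coeff_sum coeff_smult
    proof (intro sum.cong refl)
      fix j assume "j \<in> {..w}"
      moreover have "coeff (L \<tau> ^ j) w = 0" if "j < w" using degLj[of \<tau> j] that by (intro coeff_eq_0) simp
      ultimately show "g j (moebius A \<tau>) / J \<tau> ^ w * coeff (L \<tau> ^ j) w =
         (if j = w then g w (moebius A \<tau>) / J \<tau> ^ w * J \<tau> ^ (2 * w) else 0)"
        by (auto simp: coeffLj)
    qed
    also have "\<dots> = J \<tau> ^ w * g w (moebius A \<tau>)"
      using Jnz[OF t] by (simp add: mult_2 power_add)
    finally show "coeff (p \<tau>) w = automorphy_factor A \<tau> ^ w * g w (moebius A \<tau>)" by (simp add: J_def)
  qed
qed

text \<open>Let \<open>G j\<close> be the coefficients of \<open>g\<close>. Comparing powers of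
  \<open>inv_2iy\<close> shows that \<open>G 0\<close> has derivative \<open>f\<close> and
  \<open>G (Suc j)\<close> has derivative \<open>(j - w) * G j\<close>. Descending from high degree,
  this kills every \<open>G j\<close> with \<open>j > w\<close>. At \<open>j = w\<close> the factor
  vanishes, and \<open>negative_weight_zero\<close> has to step in. Below \<open>w\<close> the
  recursion works again, down to \<open>f\<close>.\<close>

lemma holomorphic_delta_op_zero:
  assumes N: "N > 0" and k: "k \<ge> 3"
    and f: "f \<in> modular_forms (principal_congruence_subgroup N) k"
    and g: "g \<in> nearly_holomorphic_forms (principal_congruence_subgroup N) (k - 2)"
    and fg: "f = delta_op (k - 2) g"
  shows "f = (\<lambda>_. 0)"
proof -
  define w where "w = k - 2"
  have w: "w > 0" using k by (simp add: w_def)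
  have "near_hol g"
    using g near_hol_if_eps_nilpotent by (auto simp: nearly_holomorphic_forms_def)
  then obtain r0 c where c: "near_hol_coeffs r0 c g" by (auto simp: near_hol_def)
  \<comment> \<open>Padding by zeros makes the recursion available at every index, so that the
    descent has a start.\<close>
  define G where "G j = (if j \<le> r0 then c j else (\<lambda>_. 0))" for j
  have Ghol: "G j holomorphic_on uhp" for j using c by (auto simp: G_def near_hol_coeffs_def)
  have Gsum: "near_hol_coeffs r G g" if "r \<ge> r0" for r
    unfolding near_hol_coeffs_def
  proof safe
    fix \<tau> assume "\<tau> \<in> uhp"
    then have "g \<tau> = (\<Sum>j\<le>r0. c j \<tau> * inv_2iy \<tau> ^ j)" using c by (simp add: near_hol_coeffs_def)
    also have "\<dots> = (\<Sum>j\<le>r0. G j \<tau> * inv_2iy \<tau> ^ j)" by (simp add: G_def)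
    also have "\<dots> = (\<Sum>j\<le>r. G j \<tau> * inv_2iy \<tau> ^ j)"
      using that by (intro sum.mono_neutral_left) (auto simp: G_def)
    finally show "g \<tau> = (\<Sum>j\<le>r. G j \<tau> * inv_2iy \<tau> ^ j)" .
  qed (rule Ghol)
  have fhol: "f holomorphic_on uhp" using f by (simp add: modular_forms_def)
  have rel: "deriv (G 0) \<tau> = f \<tau>" "deriv (G (Suc j)) \<tau> = (of_nat j - of_nat w) * G j \<tau>"
    if t: "\<tau> \<in> uhp" for \<tau> j
  proof -
    define r where "r = r0 + j"
    \<comment> \<open>The coefficients of the vanishing function
      \<open>delta_op w g - f\<close>.\<close>
    define C where "C i \<tau> = (case i of 0 \<Rightarrow> deriv (G 0) \<tau> - f \<tau> | Suc i \<Rightarrow> deriv (G (Suc i)) \<tau> + (of_nat w - of_nat i) * G i \<tau>)" for i \<tau>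
    have "near_hol_coeffs (Suc r) C (\<lambda>_. 0)"
      unfolding near_hol_coeffs_def
    proof safe
      fix i show "C i holomorphic_on uhp"
        unfolding C_def[abs_def] by (cases i) (auto intro!: holomorphic_intros Ghol fhol holomorphic_deriv open_uhp)
    next
      fix \<tau> assume t: "\<tau> \<in> uhp"
      let ?u = "inv_2iy \<tau>"
      have "f \<tau> = d_tau g \<tau> + of_nat w / (\<tau> - cnj \<tau>) * g \<tau>"
        using t by (simp add: fg delta_op_def w_def del: complex_diff_cnj)
      also have "\<dots> = (\<Sum>j\<le>r. deriv (G j) \<tau> * ?u ^ j) - (\<Sum>j\<le>r. of_nat j * G j \<tau> * ?u ^ Suc j)
         + of_nat w * ?u * (\<Sum>j\<le>r. G j \<tau> * ?u ^ j)"
        using d_tau_near_hol(1)[OF Gsum[of r] t] Gsum[of r] t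
        by (simp add: r_def near_hol_coeffs_def inv_2iy_def del: complex_diff_cnj)
      also have "(\<Sum>j\<le>r. deriv (G j) \<tau> * ?u ^ j) = (\<Sum>j\<le>Suc r. deriv (G j) \<tau> * ?u ^ j)"
        by (simp add: G_def r_def)
      also have "\<dots> = deriv (G 0) \<tau> + (\<Sum>j\<le>r. deriv (G (Suc j)) \<tau> * ?u ^ Suc j)"
        by (simp add: sum.atMost_Suc_shift del: sum.atMost_Suc power_Suc)
      also have "deriv (G 0) \<tau> + (\<Sum>j\<le>r. deriv (G (Suc j)) \<tau> * ?u ^ Suc j) - (\<Sum>j\<le>r. of_nat j * G j \<tau> * ?u ^ Suc j)
         + of_nat w * ?u * (\<Sum>j\<le>r. G j \<tau> * ?u ^ j) = deriv (G 0) \<tau> + (\<Sum>j\<le>r. C (Suc j) \<tau> * ?u ^ Suc j)"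
      proof -
        have "(\<Sum>j\<le>r. C (Suc j) \<tau> * ?u ^ Suc j) = (\<Sum>j\<le>r. deriv (G (Suc j)) \<tau> * ?u ^ Suc j
            + of_nat w * ?u * (G j \<tau> * ?u ^ j) - of_nat j * G j \<tau> * ?u ^ Suc j)"
          by (intro sum.cong refl) (simp add: C_def algebra_simps)
        then show ?thesis by (simp only: sum.distrib sum_subtractf sum_distrib_left) simp
      qed
      finally have "0 = C 0 \<tau> + (\<Sum>j\<le>r. C (Suc j) \<tau> * ?u ^ Suc j)" by (simp add: C_def)
      then show "0 = (\<Sum>j\<le>Suc r. C j \<tau> * ?u ^ j)"
        by (simp add: sum.atMost_Suc_shift del: sum.atMost_Suc power_Suc)
    qed
    from near_hol_coeffs_unique_0[OF this, of 0] near_hol_coeffs_unique_0[OF this, of "Suc j"] t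
    show "deriv (G 0) \<tau> = f \<tau>" "deriv (G (Suc j)) \<tau> = (of_nat j - of_nat w) * G j \<tau>"
      by (simp_all add: C_def r_def algebra_simps)
  qed
  have deriv0: "deriv (G j) \<tau> = 0" if "\<And>\<tau>. \<tau> \<in> uhp \<Longrightarrow> G j \<tau> = 0" "\<tau> \<in> uhp" for j \<tau>
  proof -
    have "deriv (G j) \<tau> = deriv (\<lambda>_. 0) \<tau>"
    proof (rule deriv_cong_ev)
      show "\<forall>\<^sub>F x in nhds \<tau>. G j x = 0"
        using eventually_nhds_in_open[OF open_uhp that(2)] by (rule eventually_mono) (rule that(1))
    qed auto
    then show ?thesis by simp
  qed
  have top: "\<forall>j>w. r0 < j + i \<longrightarrow> (\<forall>\<tau>\<in>uhp. G j \<tau> = 0)" for i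
  proof (induction i)
    case 0
    then show ?case by (auto simp: G_def)
  next
    case (Suc i)
    show ?case
    proof safe
      fix j \<tau> assume j: "w < j" "r0 < j + Suc i" "\<tau> \<in> uhp"
      have "deriv (G (Suc j)) \<tau> = 0" using Suc j by (intro deriv0) auto
      then show "G j \<tau> = 0" using rel(2)[OF j(3), of j] j by simp
    qed
  qed
  have top: "G j \<tau> = 0" if "j > w" "\<tau> \<in> uhp" for j \<tau> using top[of "Suc r0"] that by auto
  have Gw: "near_hol_coeffs w G g"
    unfolding near_hol_coeffs_def
  proof safe
    fix \<tau> assume t: "\<tau> \<in> uhp"
    have "g \<tau> = (\<Sum>j\<le>r0 + w. G j \<tau> * inv_2iy \<tau> ^ j)" using Gsum[of "r0 + w"] t by (simp add: near_hol_coeffs_def)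
    also have "\<dots> = (\<Sum>j\<le>w. G j \<tau> * inv_2iy \<tau> ^ j)"
      using top t by (intro sum.mono_neutral_right) auto
    finally show "g \<tau> = (\<Sum>j\<le>w. G j \<tau> * inv_2iy \<tau> ^ j)" .
  qed (rule Ghol)
  have "G w \<tau> = 0" if "\<tau> \<in> uhp" for \<tau>
  proof (rule negative_weight_zero[OF N w Ghol _ _ that])
    fix A \<tau> assume A: "A \<in> principal_congruence_subgroup N" and t: "\<tau> \<in> uhp"
    have A': "A \<in> carrier SL2Z" using A by (simp add: principal_congruence_subgroup_iff)
    obtain g' where g': "near_hol_coeffs w g' (slash w g A)"
      "\<And>\<tau>. \<tau> \<in> uhp \<Longrightarrow> g' w \<tau> = automorphy_factor A \<tau> ^ w * G w (moebius A \<tau>)"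
      using slash_near_hol_coeffs[OF Gw A'] by blast
    have inv: "slash w g A \<tau> = g \<tau>" if "\<tau> \<in> uhp" for \<tau>
      using g A that by (auto simp: nearly_holomorphic_forms_def slash_invariant_def w_def)
    have "near_hol_coeffs w (\<lambda>j \<tau>. g' j \<tau> - G j \<tau>) (\<lambda>_. 0)"
      using g'(1) Gw inv unfolding near_hol_coeffs_def
      by (auto intro!: holomorphic_intros simp: left_diff_distrib sum_subtractf)
    from near_hol_coeffs_unique_0[OF this _ order_refl t]
    show "automorphy_factor A \<tau> ^ w * G w (moebius A \<tau>) = G w \<tau>" using g'(2)[OF t] by simp
  next
    fix A assume A: "A \<in> carrier SL2Z"
    obtain g' where g': "near_hol_coeffs w g' (slash w g A)"
      "\<And>\<tau>. \<tau> \<in> uhp \<Longrightarrow> g' w \<tau> = automorphy_factor A \<tau> ^ w * G w (moebius A \<tau>)"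
      using slash_near_hol_coeffs[OF Gw A] by blast
    have "poly_growth (slash w g A)"
      using g A by (auto simp: nearly_holomorphic_forms_def slowly_increasing_at_cusps_def poly_growth_def w_def)
    then have "poly_growth (\<lambda>\<tau>. \<Sum>j\<le>w. g' j \<tau> * inv_2iy \<tau> ^ j)"
      by (rule poly_growth_cong) (use g'(1) in \<open>simp add: near_hol_coeffs_def\<close>)
    then have "poly_growth (g' w)"
      by (rule poly_growth_near_hol_top[of g' w, rotated]) (use g'(1) in \<open>simp add: near_hol_coeffs_def\<close>)
    then show "poly_growth (\<lambda>\<tau>. automorphy_factor A \<tau> ^ w * G w (moebius A \<tau>))"
      by (rule poly_growth_cong) (simp add: g'(2))
  qed
  then have "\<forall>\<tau>\<in>uhp. G (w - i) \<tau> = 0" for i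
  proof (induction i)
    case (Suc i)
    show ?case
    proof (cases "i < w")
      case True
      then have e: "Suc (w - Suc i) = w - i" by simp
      show ?thesis
      proof
        fix \<tau> assume t: "\<tau> \<in> uhp"
        have "deriv (G (w - i)) \<tau> = 0" using Suc t by (intro deriv0) auto
        then have "(of_nat (w - Suc i) - of_nat w) * G (w - Suc i) \<tau> = 0"
          using rel(2)[OF t, of "w - Suc i"] e by simp
        moreover have "of_nat (w - Suc i) - of_nat w \<noteq> (0::complex)" using True by (simp only: right_minus_eq of_nat_eq_iff)
        ultimately show "G (w - Suc i) \<tau> = 0" by simp
      qed
    qed (use Suc in auto)
  qed auto
  from this[of w] have "\<And>\<tau>. \<tau> \<in> uhp \<Longrightarrow> G 0 \<tau> = 0" by simp
  then have "f \<tau> = 0" if "\<tau> \<in> uhp" for \<tau> using deriv0[of 0 \<tau>] rel(1)[OF that] that by simp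
  moreover have "f \<tau> = 0" if "\<tau> \<notin> uhp" for \<tau> using f that by (auto simp: modular_forms_def vanishes_off_uhp_def)
  ultimately show ?thesis by blast
qed

section \<open>Existence of the holomorphic projection\<close>

text \<open>Extend a basis \<open>C\<close> of \<open>D\<close> by vectors of \<open>M\<close> to a
  basis \<open>B\<close> of the span of both, and let \<open>p\<close> kill \<open>C\<close> and fix
  the other basis vectors. For \<open>x\<close> in \<open>M\<close> the component along
  \<open>C\<close> lies in \<open>M\<close> and in \<open>D\<close>, hence is 0.\<close>

lemma (in vector_space) exists_projection:
  assumes "subspace M" "subspace D" "M \<inter> D \<subseteq> {0}"
  shows "\<exists>p. Vector_Spaces.linear scale scale p \<and> (\<forall>x. p x \<in> M) \<and> (\<forall>x\<in>M. p x = x) \<and> (\<forall>x\<in>D. p x = 0)"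
proof -
  interpret vector_space_pair scale scale ..
  obtain C where C: "C \<subseteq> D" "independent C" "D \<subseteq> span C"
    by (rule maximal_independent_subset)
  have spanC: "span C = D" using C assms(2) by (metis span_minimal subset_antisym)
  obtain B where B: "C \<subseteq> B" "B \<subseteq> C \<union> M" "independent B" "C \<union> M \<subseteq> span B"
    by (rule maximal_independent_subset_extend[of C "C \<union> M"]) (use C in auto)
  define p where "p = construct B (\<lambda>b. if b \<in> C then 0 else b)"
  have lin: "Vector_Spaces.linear scale scale p"
    unfolding p_def using B by (intro linear_construct)
  have pB: "p b = (if b \<in> C then 0 else b)" if "b \<in> B" for b
    unfolding p_def using construct_basis[OF B(3) that] by simp
  have pM: "p x \<in> M" for x
  proof -
    have "p x \<in> span ((\<lambda>b. if b \<in> C then 0 else b) ` B)"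
      unfolding p_def by (rule construct_in_span[OF B(3)])
    also have "\<dots> \<subseteq> M"
      using B(2) assms(1) subspace_0 by (intro span_minimal) auto
    finally show ?thesis .
  qed
  have pC: "p c = 0" if "c \<in> C" for c using pB B(1) that by auto
  have pD: "p x = 0" if "x \<in> D" for x
    using module_hom_eq_on_span[OF lin module_hom_zero, of C x] pC spanC that by blast
  have pid: "p x = x" if "x \<in> M" for x
  proof -
    have "B = C \<union> (B - C)" using B by blast
    then have "x \<in> span (C \<union> (B - C))" using B that by auto
    then obtain d m where dm: "x = d + m" "d \<in> span C" "m \<in> span (B - C)" unfolding span_Un by blast
    have "span (B - C) \<subseteq> M" using B assms(1) by (intro span_minimal) auto
    then have "m \<in> M" using dm by blast
    then have "d \<in> M" using dm(1) that assms(1) subspace_diff[of M x m] by simp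
    then have "d = 0" using dm(2) spanC assms(3) by blast
    have "p m = m"
      using module_hom_eq_on_span[OF lin module_hom_ident, of "B - C" m] pB dm by auto
    then show ?thesis using dm \<open>d = 0\<close> by simp
  qed
  show ?thesis using lin pM pid pD by blast
qed

section \<open>Closure properties of the spaces of forms\<close>

lemma nearly_holomorphic_forms_iff:
  "f \<in> nearly_holomorphic_forms \<Gamma> k \<longleftrightarrow> vanishes_off_uhp f \<and> near_hol f \<and>
     (\<forall>A\<in>carrier SL2Z. poly_growth (slash k f A)) \<and> slash_invariant \<Gamma> k f"
  using near_hol_Cinfinity near_hol_eps_nilpotent near_hol_if_eps_nilpotent
  unfolding nearly_holomorphic_forms_def slowly_increasing_at_cusps_def poly_growth_def by blast

lemma nearly_holomorphic_forms_add:
  assumes "f \<in> nearly_holomorphic_forms \<Gamma> k" "g \<in> nearly_holomorphic_forms \<Gamma> k"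
  shows "(\<lambda>\<tau>. f \<tau> + g \<tau>) \<in> nearly_holomorphic_forms \<Gamma> k"
proof -
  have "slash k (\<lambda>\<tau>. f \<tau> + g \<tau>) A = (\<lambda>\<tau>. slash k f A \<tau> + slash k g A \<tau>)" for A
    by (auto simp: slash_def add_divide_distrib)
  then show ?thesis
    using assms by (auto simp: nearly_holomorphic_forms_iff vanishes_off_uhp_def slash_invariant_def
        intro: near_hol_add poly_growth_add)
qed

lemma nearly_holomorphic_forms_scale:
  assumes "f \<in> nearly_holomorphic_forms \<Gamma> k"
  shows "(\<lambda>\<tau>. c * f \<tau>) \<in> nearly_holomorphic_forms \<Gamma> k"
proof -
  have "slash k (\<lambda>\<tau>. c * f \<tau>) A = (\<lambda>\<tau>. c * slash k f A \<tau>)" for A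
    by (auto simp: slash_def)
  then show ?thesis
    using assms by (auto simp: nearly_holomorphic_forms_iff vanishes_off_uhp_def slash_invariant_def
        intro: near_hol_mult poly_growth_mult near_hol_const poly_growth_const)
qed

lemma nearly_holomorphic_forms_0: "(\<lambda>_. 0) \<in> nearly_holomorphic_forms \<Gamma> k"
proof -
  have "slash k (\<lambda>_. 0) A = (\<lambda>_. 0)" for A by (auto simp: slash_def)
  then show ?thesis
    by (auto simp: nearly_holomorphic_forms_iff vanishes_off_uhp_def slash_invariant_def near_hol_const poly_growth_const)
qed

lemma nearly_holomorphic_forms_sum:
  "(\<And>i. i \<in> I \<Longrightarrow> f i \<in> nearly_holomorphic_forms \<Gamma> k) \<Longrightarrow> (\<lambda>\<tau>. \<Sum>i\<in>I. f i \<tau>) \<in> nearly_holomorphic_forms \<Gamma> k"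
  by (induction I rule: infinite_finite_induct)
    (auto intro: nearly_holomorphic_forms_0 nearly_holomorphic_forms_add)

lemma nearly_holomorphic_forms_mult:
  assumes "f \<in> nearly_holomorphic_forms \<Gamma> k" "g \<in> nearly_holomorphic_forms \<Gamma> l"
  shows "(\<lambda>\<tau>. f \<tau> * g \<tau>) \<in> nearly_holomorphic_forms \<Gamma> (k + l)"
proof -
  have "slash (k + l) (\<lambda>\<tau>. f \<tau> * g \<tau>) A = (\<lambda>\<tau>. slash k f A \<tau> * slash l g A \<tau>)" for A
    by (auto simp: slash_def power_add)
  then show ?thesis
    using assms by (auto simp: nearly_holomorphic_forms_iff vanishes_off_uhp_def slash_invariant_def
        intro: near_hol_mult poly_growth_mult)
qed

lemma modular_forms_subset: "f \<in> modular_forms \<Gamma> k \<Longrightarrow> f \<in> nearly_holomorphic_forms \<Gamma> k"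
  unfolding modular_forms_def nearly_holomorphic_forms_iff bounded_at_cusps_def poly_growth_iff mem_Collect_eq
proof (elim conjE, intro conjI ballI near_hol_holomorphic)
  fix A assume "\<forall>A\<in>carrier SL2Z. \<exists>B>0. \<exists>C. \<forall>\<tau>. B < Im \<tau> \<longrightarrow> cmod (slash k f A \<tau>) \<le> C" "A \<in> carrier SL2Z"
  then obtain B C where "B > 0" "\<And>\<tau>. B < Im \<tau> \<Longrightarrow> cmod (slash k f A \<tau>) \<le> C" by blast
  then show "\<exists>B\<ge>1. \<exists>C\<ge>0. \<exists>n. \<forall>\<tau>. B < Im \<tau> \<longrightarrow> cmod (slash k f A \<tau>) \<le> C * Im \<tau> ^ n"
    by (intro exI[of _ "max 1 B"] conjI exI[of _ "\<bar>C\<bar>"] exI[of _ 0]) (auto intro: order.trans[OF _ abs_ge_self])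
qed

lemma modular_forms_boundedE:
  assumes "f \<in> modular_forms \<Gamma> k" "A \<in> carrier SL2Z"
  obtains B C where "B > 0" "\<And>\<tau>. B < Im \<tau> \<Longrightarrow> cmod (slash k f A \<tau>) \<le> C"
proof -
  have "bounded_at_cusps k f" using assms by (simp add: modular_forms_def)
  then show ?thesis using that assms(2) unfolding bounded_at_cusps_def by meson
qed

lemma modular_forms_scale:
  assumes "f \<in> modular_forms \<Gamma> k" shows "(\<lambda>\<tau>. c * f \<tau>) \<in> modular_forms \<Gamma> k"
proof -
  have s: "slash k (\<lambda>\<tau>. c * f \<tau>) A = (\<lambda>\<tau>. c * slash k f A \<tau>)" for A
    by (auto simp: slash_def)
  have "\<exists>B>0. \<exists>C. \<forall>\<tau>. B < Im \<tau> \<longrightarrow> cmod (c * slash k f A \<tau>) \<le> C" if A: "A \<in> carrier SL2Z" for A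
  proof -
    obtain B C where "B > 0" "\<And>\<tau>. B < Im \<tau> \<Longrightarrow> cmod (slash k f A \<tau>) \<le> C"
      using modular_forms_boundedE[OF assms A] by metis
    then show ?thesis
      by (intro exI[of _ B] conjI exI[of _ "cmod c * C"]) (auto simp: norm_mult intro: mult_left_mono)
  qed
  moreover have "(\<lambda>\<tau>. c * f \<tau>) holomorphic_on uhp"
    using assms by (intro holomorphic_intros) (auto simp: modular_forms_def)
  ultimately show ?thesis
    using assms by (simp add: modular_forms_def bounded_at_cusps_def s slash_invariant_def vanishes_off_uhp_def)
qed

lemma modular_forms_add:
  assumes "f \<in> modular_forms \<Gamma> k" "g \<in> modular_forms \<Gamma> k"
  shows "(\<lambda>\<tau>. f \<tau> + g \<tau>) \<in> modular_forms \<Gamma> k"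
proof -
  have s: "slash k (\<lambda>\<tau>. f \<tau> + g \<tau>) A = (\<lambda>\<tau>. slash k f A \<tau> + slash k g A \<tau>)" for A
    by (auto simp: slash_def add_divide_distrib)
  have "\<exists>B>0. \<exists>C. \<forall>\<tau>. B < Im \<tau> \<longrightarrow> cmod (slash k f A \<tau> + slash k g A \<tau>) \<le> C" if A: "A \<in> carrier SL2Z" for A
  proof -
    obtain B C B' C' where "B > 0" "\<And>\<tau>. B < Im \<tau> \<Longrightarrow> cmod (slash k f A \<tau>) \<le> C"
      "B' > 0" "\<And>\<tau>. B' < Im \<tau> \<Longrightarrow> cmod (slash k g A \<tau>) \<le> C'"
      using modular_forms_boundedE[OF assms(1) A] modular_forms_boundedE[OF assms(2) A] by metis
    then show ?thesis
      by (intro exI[of _ "max B B'"] conjI exI[of _ "C + C'"]) (auto intro!: order.trans[OF norm_triangle_ineq] add_mono)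
  qed
  moreover have "(\<lambda>\<tau>. f \<tau> + g \<tau>) holomorphic_on uhp"
    using assms by (intro holomorphic_intros) (auto simp: modular_forms_def)
  ultimately show ?thesis
    using assms by (simp add: modular_forms_def bounded_at_cusps_def s slash_invariant_def vanishes_off_uhp_def)
qed

lemma modular_forms_mult:
  assumes "f \<in> modular_forms \<Gamma> k" "g \<in> modular_forms \<Gamma> l"
  shows "(\<lambda>\<tau>. f \<tau> * g \<tau>) \<in> modular_forms \<Gamma> (k + l)"
proof -
  have s: "slash (k + l) (\<lambda>\<tau>. f \<tau> * g \<tau>) A = (\<lambda>\<tau>. slash k f A \<tau> * slash l g A \<tau>)" for A
    by (auto simp: slash_def power_add)
  have "\<exists>B>0. \<exists>C. \<forall>\<tau>. B < Im \<tau> \<longrightarrow> cmod (slash k f A \<tau> * slash l g A \<tau>) \<le> C" if A: "A \<in> carrier SL2Z" for A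
  proof -
    obtain B C B' C' where *: "B > 0" "\<And>\<tau>. B < Im \<tau> \<Longrightarrow> cmod (slash k f A \<tau>) \<le> C"
      "B' > 0" "\<And>\<tau>. B' < Im \<tau> \<Longrightarrow> cmod (slash l g A \<tau>) \<le> C'"
      using modular_forms_boundedE[OF assms(1) A] modular_forms_boundedE[OF assms(2) A] by metis
    have "cmod (slash k f A \<tau> * slash l g A \<tau>) \<le> C * C'" if "max B B' < Im \<tau>" for \<tau>
      unfolding norm_mult using *(2)[of \<tau>] *(4)[of \<tau>] that by (intro mult_mono) (auto intro: order.trans[OF norm_ge_zero])
    then show ?thesis using *(1) by (intro exI[of _ "max B B'"] conjI exI[of _ "C * C'"]) auto
  qed
  moreover have "(\<lambda>\<tau>. f \<tau> * g \<tau>) holomorphic_on uhp"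
    using assms by (intro holomorphic_intros) (auto simp: modular_forms_def)
  ultimately show ?thesis
    using assms by (simp add: modular_forms_def bounded_at_cusps_def s slash_invariant_def vanishes_off_uhp_def)
qed

lemma modular_forms_0: "(\<lambda>_. 0) \<in> modular_forms \<Gamma> k"
  by (auto simp: modular_forms_def bounded_at_cusps_def slash_invariant_def slash_def vanishes_off_uhp_def
      intro!: exI[of _ "1::real"])

lemma near_hol_differentiable: "near_hol f \<Longrightarrow> \<tau> \<in> uhp \<Longrightarrow> f differentiable (at \<tau>)"
  unfolding near_hol_def differentiable_def by (meson has_derivative_near_hol)

lemma delta_op_add:
  assumes "near_hol f" "near_hol g"
  shows "delta_op k (\<lambda>\<tau>. f \<tau> + g \<tau>) = (\<lambda>\<tau>. delta_op k f \<tau> + delta_op k g \<tau>)"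
proof
  fix \<tau>
  show "delta_op k (\<lambda>\<tau>. f \<tau> + g \<tau>) \<tau> = delta_op k f \<tau> + delta_op k g \<tau>"
  proof (cases "\<tau> \<in> uhp")
    case True
    have "((\<lambda>z. f z + g z) has_derivative
      (\<lambda>v. frechet_derivative f (at \<tau>) v + frechet_derivative g (at \<tau>) v)) (at \<tau>)"
      using near_hol_differentiable assms True by (intro has_derivative_add) (auto simp: frechet_derivative_works)
    from partials_has_derivative[OF this]
    have "d_tau (\<lambda>\<tau>. f \<tau> + g \<tau>) \<tau> = d_tau f \<tau> + d_tau g \<tau>"
      by (simp add: d_tau_def partial_x_def partial_y_def field_simps)
    then show ?thesis by (simp add: delta_op_def algebra_simps add_divide_distrib)
  qed (simp add: delta_op_def)
qed

lemma delta_op_scale: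
  assumes "near_hol f"
  shows "delta_op k (\<lambda>\<tau>. c * f \<tau>) = (\<lambda>\<tau>. c * delta_op k f \<tau>)"
proof
  fix \<tau>
  show "delta_op k (\<lambda>\<tau>. c * f \<tau>) \<tau> = c * delta_op k f \<tau>"
  proof (cases "\<tau> \<in> uhp")
    case True
    have "((\<lambda>z. c * f z) has_derivative (\<lambda>v. c * frechet_derivative f (at \<tau>) v)) (at \<tau>)"
      using near_hol_differentiable assms True by (intro has_derivative_mult_right) (auto simp: frechet_derivative_works)
    from partials_has_derivative[OF this]
    have "d_tau (\<lambda>\<tau>. c * f \<tau>) \<tau> = c * d_tau f \<tau>"
      by (simp add: d_tau_def partial_x_def partial_y_def field_simps)
    then show ?thesis by (simp add: delta_op_def algebra_simps)
  qed (simp add: delta_op_def)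
qed

lemma exists_holomorphic_projection:
  assumes N: "N > 0"
  defines "\<Gamma> \<equiv> principal_congruence_subgroup N"
  shows "\<exists>H. is_holomorphic_projection \<Gamma> k H"
proof -
  interpret V: vector_space "\<lambda>(c::complex) (f::complex \<Rightarrow> complex) x. c * f x"
    by unfold_locales (auto simp: fun_eq_iff algebra_simps)
  define M where "M = modular_forms \<Gamma> k"
  \<comment> \<open>Below weight 3 the definition imposes no condition on the image of
    \<open>delta_op\<close>, so there is nothing to kill.\<close>
  define D where "D = (if k \<ge> 3 then delta_op (k - 2) ` nearly_holomorphic_forms \<Gamma> (k - 2) else {0})"
  have M: "V.subspace M"
    unfolding V.subspace_def M_def plus_fun_def zero_fun_def
    by (auto intro: modular_forms_add modular_forms_scale modular_forms_0)
  have D: "V.subspace D"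
  proof (cases "k \<ge> 3")
    case True
    have nh: "near_hol f" if "f \<in> nearly_holomorphic_forms \<Gamma> (k - 2)" for f
      using that by (simp add: nearly_holomorphic_forms_iff)
    have "delta_op (k - 2) (\<lambda>\<tau>. 0 * 0) = (\<lambda>\<tau>. 0 * delta_op (k - 2) (\<lambda>_. 0) \<tau>)"
      by (rule delta_op_scale[OF near_hol_const])
    then have "(\<lambda>_. 0) = delta_op (k - 2) (\<lambda>_. 0)" by simp
    then have "(\<lambda>_. 0) \<in> delta_op (k - 2) ` nearly_holomorphic_forms \<Gamma> (k - 2)"
      using nearly_holomorphic_forms_0 by blast
    then show ?thesis
      unfolding V.subspace_def D_def plus_fun_def zero_fun_def using True
      by (auto simp: delta_op_add[symmetric] delta_op_scale[symmetric] nh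
          intro: imageI nearly_holomorphic_forms_add nearly_holomorphic_forms_scale)
  qed (simp add: D_def V.subspace_def zero_fun_def)
  have "M \<inter> D \<subseteq> {0}"
    using holomorphic_delta_op_zero[OF N, of k] by (auto simp: M_def D_def \<Gamma>_def zero_fun_def)
  then obtain p where p: "Vector_Spaces.linear (\<lambda>c f x. c * f x) (\<lambda>c f x. c * f x) p"
    "\<And>x. p x \<in> M" "\<And>x. x \<in> M \<Longrightarrow> p x = x" "\<And>x. x \<in> D \<Longrightarrow> p x = 0"
    using V.exists_projection[OF M D] by blast
  interpret L: Vector_Spaces.linear "\<lambda>c f x. c * f x" "\<lambda>c f x. c * f x" p by (rule p(1))
  have "p (\<lambda>\<tau>. f \<tau> + g \<tau>) = (\<lambda>\<tau>. p f \<tau> + p g \<tau>)" for f g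
    using L.add[of f g] by (simp add: plus_fun_def)
  moreover have "p (\<lambda>\<tau>. c * f \<tau>) = (\<lambda>\<tau>. c * p f \<tau>)" for c f
    using L.scale[of c f] by simp
  moreover have "p (delta_op (k - 2) g) = (\<lambda>_. 0)" if "k \<ge> 3" "g \<in> nearly_holomorphic_forms \<Gamma> (k - 2)" for g
    using p(4)[of "delta_op (k - 2) g"] that by (simp add: D_def zero_fun_def)
  ultimately have "is_holomorphic_projection \<Gamma> k p"
    unfolding is_holomorphic_projection_def using p(2,3) unfolding M_def by blast
  then show ?thesis by blast
qed

lemma hol_proj_is_projection:
  "N > 0 \<Longrightarrow> is_holomorphic_projection (principal_congruence_subgroup N) k (hol_proj (principal_congruence_subgroup N) k)"
  unfolding hol_proj_def using someI_ex[OF exists_holomorphic_projection] .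

lemma hol_proj_modular_form:
  "N > 0 \<Longrightarrow> f \<in> modular_forms (principal_congruence_subgroup N) k \<Longrightarrow>
     hol_proj (principal_congruence_subgroup N) k f = f"
  using hol_proj_is_projection[of N k] by (simp add: is_holomorphic_projection_def)

lemma hol_proj_add_delta:
  fixes N n :: nat
  defines "\<Gamma> \<equiv> principal_congruence_subgroup N"
  assumes N: "N > 0" and n: "n \<ge> 1" and F: "F \<in> nearly_holomorphic_forms \<Gamma> (n + 2)"
    and f: "f \<in> modular_forms \<Gamma> (n + 2)" and g: "g \<in> nearly_holomorphic_forms \<Gamma> n"
    and eq: "F = (\<lambda>\<tau>. f \<tau> + c * delta_op n g \<tau>)"
  shows "hol_proj \<Gamma> (n + 2) F = f"
proof -
  define H where "H = hol_proj \<Gamma> (n + 2)"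
  have H: "is_holomorphic_projection \<Gamma> (n + 2) H"
    unfolding H_def \<Gamma>_def by (rule hol_proj_is_projection[OF N])
  have f': "f \<in> nearly_holomorphic_forms \<Gamma> (n + 2)" by (rule modular_forms_subset[OF f])
  define G where "G = (\<lambda>\<tau>. c * g \<tau>)"
  have G: "G \<in> nearly_holomorphic_forms \<Gamma> n" unfolding G_def by (rule nearly_holomorphic_forms_scale[OF g])
  have dG: "delta_op n G = (\<lambda>\<tau>. c * delta_op n g \<tau>)"
    unfolding G_def using g by (intro delta_op_scale) (simp add: nearly_holomorphic_forms_iff)
  \<comment> \<open>\<open>H\<close> is additive on nearly holomorphic forms only. That
    \<open>delta_op n G\<close> is one follows from its being the difference of \<open>F\<close> and
    \<open>f\<close>.\<close>
  have "delta_op n G = (\<lambda>\<tau>. F \<tau> + (- 1) * f \<tau>)" unfolding dG eq by auto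
  then have dGn: "delta_op n G \<in> nearly_holomorphic_forms \<Gamma> (n + 2)"
    using nearly_holomorphic_forms_add[OF F nearly_holomorphic_forms_scale[OF f', of "-1"]] by simp
  have "H F = H (\<lambda>\<tau>. f \<tau> + delta_op n G \<tau>)" unfolding eq dG ..
  also have "\<dots> = (\<lambda>\<tau>. H f \<tau> + H (delta_op n G) \<tau>)"
    using H f' dGn unfolding is_holomorphic_projection_def by blast
  also have "H f = f" using H f unfolding is_holomorphic_projection_def by blast
  also have "H (delta_op n G) = (\<lambda>_. 0)"
  proof -
    have "n + 2 \<ge> 3" "n + 2 - 2 = n" using n by auto
    then show ?thesis using H G unfolding is_holomorphic_projection_def by metis
  qed
  finally show ?thesis by (simp add: H_def)
qed

section \<open>Analytic continuation of the lattice sums\<close>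

lemma summable_on_int_powr:
  assumes "\<sigma> > 1"
  shows "(\<lambda>m::int. (1 + \<bar>real_of_int m\<bar>) powr (- \<sigma>)) summable_on UNIV" (is "?f summable_on UNIV")
proof -
  have s0: "summable (\<lambda>n. real n powr (- \<sigma>))" using assms by (simp add: summable_real_powr_iff)
  have s: "summable (\<lambda>n. real (n + k) powr (- \<sigma>))" for k
    using summable_ignore_initial_segment[OF s0, of k] by simp
  have "(?f \<circ> int) summable_on UNIV"
    using s[of 1] by (intro summable_nonneg_imp_summable_on) (auto simp: o_def add_ac)
  then have A: "?f summable_on range int" by (subst summable_on_reindex) auto
  have "(?f \<circ> (\<lambda>n. - 1 - int n)) summable_on UNIV"
    using s[of 2] by (intro summable_nonneg_imp_summable_on) (auto simp: o_def add_ac abs_if)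
  then have B: "?f summable_on range (\<lambda>n. - 1 - int n)"
    by (subst summable_on_reindex) (auto simp: inj_on_def)
  have "UNIV = range int \<union> range (\<lambda>n. - 1 - int n)"
  proof (intro equalityI subsetI)
    fix x :: int
    show "x \<in> range int \<union> range (\<lambda>n. - 1 - int n)"
    proof (cases "x \<ge> 0")
      case True
      then show ?thesis by (metis UnI1 nat_0_le rangeI)
    next
      case False
      then have "x = - 1 - int (nat (- 1 - x))" by simp
      then show ?thesis by blast
    qed
  qed auto
  moreover have "range int \<inter> range (\<lambda>n. - 1 - int n) = {}" by auto
  ultimately show ?thesis using summable_on_Un_disjoint[OF A B] by simp
qed

text \<open>Since \<open>(1 + a) * (1 + b) \<le> (1 + a + b)\<^sup>2\<close>, the summand is
  dominated by a product of two one-variable summands with exponent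
  \<open>\<sigma> / 2 > 1\<close>.\<close>

lemma summable_on_int2_powr:
  assumes "\<sigma> > 2"
  shows "(\<lambda>(m::int, n::int). (1 + \<bar>real_of_int m\<bar> + \<bar>real_of_int n\<bar>) powr (- \<sigma>)) summable_on UNIV"
proof -
  define h where "h m = (1 + \<bar>real_of_int m\<bar>) powr (- (\<sigma> / 2))" for m
  have h: "h summable_on UNIV" unfolding h_def using assms by (intro summable_on_int_powr) auto
  have "(\<lambda>(m, n). h m * h n) summable_on UNIV \<times> UNIV"
  proof (rule summable_on_SigmaI)
    show "((\<lambda>n. (case (m, n) of (m, n) \<Rightarrow> h m * h n)) has_sum h m * infsum h UNIV) UNIV" for m
      using has_sum_cmult_right[OF has_sum_infsum[OF h], of "h m"] by simp
    show "(\<lambda>m. h m * infsum h UNIV) summable_on UNIV" by (intro summable_on_cmult_left h)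
  qed (auto simp: h_def)
  then have "(\<lambda>(m, n). h m * h n) summable_on UNIV" by simp
  then show ?thesis
  proof (rule summable_on_comparison_test)
    fix x :: "int \<times> int"
    obtain m n where x: "x = (m, n)" by (cases x)
    define a b where "a = \<bar>real_of_int m\<bar>" and "b = \<bar>real_of_int n\<bar>"
    have ab: "a \<ge> 0" "b \<ge> 0" by (auto simp: a_def b_def)
    have "((1 + a) * (1 + b)) \<le> (1 + a + b)\<^sup>2" using ab by (simp add: power2_eq_square algebra_simps)
    then have "((1 + a + b)\<^sup>2) powr (- (\<sigma> / 2)) \<le> ((1 + a) * (1 + b)) powr (- (\<sigma> / 2))"
      using ab assms by (intro powr_mono2') auto
    moreover have "((1 + a + b)\<^sup>2) powr (- (\<sigma> / 2)) = (1 + a + b) powr (- \<sigma>)"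
    proof -
      have "(1 + a + b)\<^sup>2 = (1 + a + b) powr 2" using ab by (simp add: powr_numeral)
      then show ?thesis by (simp add: powr_powr)
    qed
    ultimately show "(case x of (m, n) \<Rightarrow> (1 + \<bar>real_of_int m\<bar> + \<bar>real_of_int n\<bar>) powr (- \<sigma>)) \<le> (case x of (m, n) \<Rightarrow> h m * h n)"
      using ab by (simp add: x h_def a_def b_def powr_mult)
  qed auto
qed

text \<open>Domination off a finite set suffices because each exceptional term is bounded on a
  compact disc. In the applications \<open>F\<close> collects the lattice points near 0, where the
  estimates for large \<open>norm w\<close> fail.\<close>

lemma holomorphic_infsum:
  fixes f :: "'a \<Rightarrow> complex \<Rightarrow> complex"
  assumes S: "open S" and hol: "\<And>x. x \<in> X \<Longrightarrow> f x holomorphic_on S"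
    and bd: "\<And>s0. s0 \<in> S \<Longrightarrow> \<exists>r>0. \<exists>F M. finite F \<and> M summable_on X \<and>
        (\<forall>x\<in>X - F. \<forall>s\<in>cball s0 r \<inter> S. norm (f x s) \<le> M x)"
  shows "(\<lambda>s. \<Sum>\<^sub>\<infinity>x\<in>X. f x s) holomorphic_on S"
    and "s \<in> S \<Longrightarrow> (\<lambda>x. norm (f x s)) summable_on X"
proof -
  have main: "\<exists>r>0. \<exists>M. cball s0 r \<subseteq> S \<and> M summable_on X \<and> (\<forall>x\<in>X. \<forall>s\<in>cball s0 r. norm (f x s) \<le> M x)"
    if s0: "s0 \<in> S" for s0
  proof -
    obtain r F M where r: "r > 0" "finite F" "M summable_on X" "\<forall>x\<in>X - F. \<forall>s\<in>cball s0 r \<inter> S. norm (f x s) \<le> M x"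
      using bd[OF s0] by blast
    obtain r' where r': "r' > 0" "cball s0 r' \<subseteq> S" using S s0 open_contains_cball by blast
    define \<rho> where "\<rho> = min r r'"
    have sub: "cball s0 \<rho> \<subseteq> S" "cball s0 \<rho> \<subseteq> cball s0 r" "\<rho> > 0" using r r' by (auto simp: \<rho>_def)
    have "\<forall>x\<in>X. \<exists>K. \<forall>s\<in>cball s0 \<rho>. norm (f x s) \<le> K"
    proof
      fix x assume "x \<in> X"
      then have "continuous_on (cball s0 \<rho>) (f x)"
        using hol sub by (meson holomorphic_on_imp_continuous_on holomorphic_on_subset)
      then have "bounded (f x ` cball s0 \<rho>)" by (intro compact_imp_bounded compact_continuous_image) auto
      then show "\<exists>K. \<forall>s\<in>cball s0 \<rho>. norm (f x s) \<le> K" unfolding bounded_iff by blast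
    qed
    from bchoice[OF this] obtain K where K: "\<forall>x\<in>X. \<forall>s\<in>cball s0 \<rho>. norm (f x s) \<le> K x" by blast
    define M' where "M' x = (if x \<in> F then K x else M x)" for x
    have "(\<lambda>x. M x + (if x \<in> F then K x - M x else 0)) summable_on X"
    proof (rule summable_on_add[OF r(3)])
      have "(\<lambda>x. K x - M x) summable_on (F \<inter> X)" using r(2) by (intro summable_on_finite) auto
      then show "(\<lambda>x. if x \<in> F then K x - M x else 0) summable_on X"
        by (subst summable_on_cong_neutral[where T = "F \<inter> X" and g = "\<lambda>x. K x - M x"]) auto
    qed
    also have "(\<lambda>x. M x + (if x \<in> F then K x - M x else 0)) = M'" by (auto simp: M'_def)
    finally have "M' summable_on X" .
    moreover have "\<forall>x\<in>X. \<forall>s\<in>cball s0 \<rho>. norm (f x s) \<le> M' x"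
    proof (intro ballI)
      fix x s assume xs: "x \<in> X" "s \<in> cball s0 \<rho>"
      then have "s \<in> cball s0 r \<inter> S" using sub by blast
      then show "norm (f x s) \<le> M' x" using xs K r(4) unfolding M'_def by (cases "x \<in> F") auto
    qed
    ultimately show ?thesis using sub by blast
  qed
  show "(\<lambda>s. \<Sum>\<^sub>\<infinity>x\<in>X. f x s) holomorphic_on S"
    unfolding holomorphic_on_open[OF S]
  proof
    fix s0 assume s0: "s0 \<in> S"
    obtain r M where r: "r > 0" "cball s0 r \<subseteq> S" "M summable_on X" "\<forall>x\<in>X. \<forall>s\<in>cball s0 r. norm (f x s) \<le> M x"
      using main[OF s0] by blast
    have u: "uniform_limit (cball s0 r) (\<lambda>F s. \<Sum>x\<in>F. f x s) (\<lambda>s. \<Sum>\<^sub>\<infinity>x\<in>X. f x s) (finite_subsets_at_top X)"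
      using r by (intro Weierstrass_m_test_general) auto
    have c: "\<forall>\<^sub>F F in finite_subsets_at_top X. continuous_on (cball s0 r) (\<lambda>s. \<Sum>x\<in>F. f x s) \<and>
        (\<lambda>s. \<Sum>x\<in>F. f x s) holomorphic_on ball s0 r"
    proof (rule eventually_mono[OF eventually_finite_subsets_at_top_weakI[of X "\<lambda>F. finite F \<and> F \<subseteq> X"]])
      fix F assume F: "finite F \<and> F \<subseteq> X"
      have "(\<lambda>s. \<Sum>x\<in>F. f x s) holomorphic_on cball s0 r"
        using F by (intro holomorphic_on_sum) (use hol r(2) in \<open>auto intro: holomorphic_on_subset\<close>)
      then show "continuous_on (cball s0 r) (\<lambda>s. \<Sum>x\<in>F. f x s) \<and> (\<lambda>s. \<Sum>x\<in>F. f x s) holomorphic_on ball s0 r"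
        by (auto intro: holomorphic_on_imp_continuous_on holomorphic_on_subset)
    qed auto
    have "(\<lambda>s. \<Sum>\<^sub>\<infinity>x\<in>X. f x s) holomorphic_on ball s0 r"
      using holomorphic_uniform_limit[OF c u finite_subsets_at_top_neq_bot] by blast
    then have "(\<lambda>s. \<Sum>\<^sub>\<infinity>x\<in>X. f x s) field_differentiable at s0"
      using r(1) by (auto intro: holomorphic_on_imp_differentiable_at)
    then show "\<exists>f'. ((\<lambda>s. \<Sum>\<^sub>\<infinity>x\<in>X. f x s) has_field_derivative f') (at s0)"
      by (simp add: field_differentiable_def)
  qed
  show "(\<lambda>x. norm (f x s)) summable_on X" if sS: "s \<in> S"
  proof -
    obtain r M where r: "r > 0" "cball s r \<subseteq> S" "M summable_on X" "\<forall>x\<in>X. \<forall>s'\<in>cball s r. norm (f x s') \<le> M x"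
      using main[OF sS] by blast
    show ?thesis
      by (rule summable_on_comparison_test[OF r(3)]) (use r in auto)
  qed
qed

section \<open>Uniform Taylor estimates for the summand\<close>

lemma powr_1_plus_bound:
  fixes R :: real
  shows "\<exists>C. \<forall>b v :: complex. norm b \<le> R \<and> norm v \<le> 1/2 \<longrightarrow> norm ((1 + v) powr b) \<le> C"
proof (intro exI allI impI)
  fix b v :: complex assume *: "norm b \<le> R \<and> norm v \<le> 1/2"
  have "1 - norm v \<le> norm (1 + v)" "norm (1 + v) \<le> 1 + norm v"
    using norm_triangle_ineq[of 1 v] norm_diff_ineq[of 1 v] by simp_all
  then have n: "1/2 \<le> norm (1 + v)" "norm (1 + v) \<le> 2" using * by auto
  then have "1 + v \<noteq> 0" by auto
  have "\<bar>ln (norm (1 + v))\<bar> \<le> ln 2"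
  proof (rule abs_leI)
    show "ln (norm (1 + v)) \<le> ln 2" using n by (subst ln_le_cancel_iff) auto
    have "ln (1/2) \<le> ln (norm (1 + v))" using n by (subst ln_le_cancel_iff) auto
    then show "- ln (norm (1 + v)) \<le> ln 2" by (simp add: ln_div)
  qed
  then have "\<bar>Re (Ln (1 + v))\<bar> \<le> ln 2" using \<open>1 + v \<noteq> 0\<close> by simp
  moreover have "\<bar>Im (Ln (1 + v))\<bar> \<le> pi"
    using Im_Ln_le_pi[OF \<open>1 + v \<noteq> 0\<close>] mpi_less_Im_Ln[OF \<open>1 + v \<noteq> 0\<close>] by auto
  ultimately have L: "norm (Ln (1 + v)) \<le> ln 2 + pi"
    using cmod_le[of "Ln (1 + v)"] by linarith
  have "norm ((1 + v) powr b) = exp (Re (b * Ln (1 + v)))"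
    using \<open>1 + v \<noteq> 0\<close> by (simp add: powr_def norm_exp_eq_Re)
  also have "\<dots> \<le> exp (R * (ln 2 + pi))"
  proof -
    have "Re (b * Ln (1 + v)) \<le> norm b * norm (Ln (1 + v))"
      using complex_Re_le_cmod[of "b * Ln (1 + v)"] by (simp add: norm_mult)
    also have "\<dots> \<le> R * (ln 2 + pi)" using * L order.trans[OF norm_ge_zero] by (intro mult_mono) auto
    finally show ?thesis by simp
  qed
  finally show "norm ((1 + v) powr b) \<le> exp (R * (ln 2 + pi))" .
qed

text \<open>The exponents in question depend on \<open>s\<close>, so the constant has to be uniform
  for \<open>b\<close> in a disc.\<close>

lemma powr_1_plus_taylor:
  fixes R :: real
  shows "\<exists>C\<ge>0. \<forall>b v :: complex. norm b \<le> R \<and> norm v \<le> 1/2 \<longrightarrow>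
    norm ((1 + v) powr b - (1 + b * v + b * (b - 1) / 2 * v ^ 2)) \<le> C * norm v ^ 3"
proof -
  obtain C where C: "\<And>b v :: complex. norm b \<le> R + 3 \<Longrightarrow> norm v \<le> 1/2 \<Longrightarrow> norm ((1 + v) powr b) \<le> C"
    using powr_1_plus_bound[of "R + 3"] by blast
  define B where "B = \<bar>R * (R + 1) * (R + 2) * C\<bar>"
  have "norm ((1 + v) powr b - (1 + b * v + b * (b - 1) / 2 * v ^ 2)) \<le> (B / 2) * norm v ^ 3"
    if bv: "norm b \<le> R" "norm v \<le> 1/2" for b v :: complex
  proof -
    define f where "f i x = (\<Prod>j<i. b - of_nat j) * (1 + x) powr (b - of_nat i)" for i x
    have "cmod (f 0 v - (\<Sum>i\<le>2. f i 0 * (v - 0) ^ i / fact i)) \<le> B * cmod (v - 0) ^ Suc 2 / fact 2"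
    proof (rule complex_Taylor[of "cball 0 (1/2)"])
      fix i x assume x: "x \<in> cball (0::complex) (1/2)"
      have "norm x < 1" using x by simp
      then have re: "Re (1 + x) > 0" using abs_Re_le_cmod[of x] by auto
      then have nr: "1 + x \<notin> \<real>\<^sub>\<le>\<^sub>0" by (auto simp: complex_nonpos_Reals_iff)
      have "((\<lambda>x. (1 + x) powr (b - of_nat i)) has_field_derivative
          (b - of_nat i) * (1 + x) powr (b - of_nat i - 1)) (at x)"
        by (rule derivative_eq_intros refl nr)+ simp
      then have "(f i has_field_derivative (\<Prod>j<i. b - of_nat j) * ((b - of_nat i) * (1 + x) powr (b - of_nat i - 1))) (at x)"
        unfolding f_def[abs_def] by (rule DERIV_cmult)
      then have "(f i has_field_derivative f (Suc i) x) (at x)"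
        by (simp add: f_def algebra_simps)
      then show "(f i has_field_derivative f (Suc i) x) (at x within cball 0 (1/2))"
        by (rule has_field_derivative_at_within)
    next
      fix x assume x: "x \<in> cball (0::complex) (1/2)"
      have R: "R \<ge> 0" using bv(1) norm_ge_zero order_trans by blast
      have n1: "norm (b - 1) \<le> R + 1" using norm_triangle_ineq4[of b 1] bv by simp
      have n2: "norm (b - 2) \<le> R + 2" using norm_triangle_ineq4[of b 2] bv by simp
      have n3: "norm (b - 3) \<le> R + 3" using norm_triangle_ineq4[of b 3] bv by simp
      have "norm (f (Suc 2) x) = norm b * norm (b - 1) * norm (b - 2) * norm ((1 + x) powr (b - 3))"
        by (simp add: f_def norm_mult numeral_3_eq_3 numeral_2_eq_2 lessThan_Suc mult_ac)
      also have "\<dots> \<le> R * (R + 1) * (R + 2) * C"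
        using bv n1 n2 R C[OF n3] x by (intro mult_mono) auto
      also have "\<dots> \<le> B" by (simp add: B_def)
      finally show "norm (f (Suc 2) x) \<le> B" .
    qed (use bv in auto)
    moreover have "(\<Sum>i\<le>2. f i 0 * (v - 0) ^ i / fact i) = 1 + b * v + b * (b - 1) / 2 * v ^ 2"
      by (simp add: f_def numeral_2_eq_2 atMost_Suc lessThan_Suc algebra_simps)
    moreover have "f 0 v = (1 + v) powr b" by (simp add: f_def)
    ultimately show ?thesis by (simp add: numeral_3_eq_3)
  qed
  then show ?thesis by (intro exI[of _ "B / 2"]) (auto simp: B_def)
qed

definition lat_f :: "nat \<Rightarrow> complex \<Rightarrow> complex \<Rightarrow> complex" where
  "lat_f k s w = inverse (w ^ k) * complex_of_real (norm w) powr (- s)"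

definition lat_g :: "nat \<Rightarrow> complex \<Rightarrow> complex \<Rightarrow> complex" where
  "lat_g k s w = cnj w * lat_f k s w"

lemma lat_f_mult: "w \<noteq> 0 \<Longrightarrow> v \<noteq> 0 \<Longrightarrow> lat_f k s (w * v) = lat_f k s w * lat_f k s v"
  by (simp add: lat_f_def norm_mult power_mult_distrib powr_times_real)

lemma lat_g_mult: "w \<noteq> 0 \<Longrightarrow> v \<noteq> 0 \<Longrightarrow> lat_g k s (w * v) = lat_g k s w * lat_g k s v"
  by (simp add: lat_g_def lat_f_mult)

lemma norm_lat_f: "w \<noteq> 0 \<Longrightarrow> norm (lat_f k s w) = norm w powr (- real k - Re s)"
proof -
  assume w: "w \<noteq> 0"
  have "norm (complex_of_real (norm w) powr (- s)) = norm w powr (- Re s)"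
    by (subst norm_powr_real_powr) auto
  moreover have "norm (inverse (w ^ k)) = norm w powr (- real k)"
    using w by (simp add: norm_inverse norm_power powr_minus powr_realpow)
  ultimately show ?thesis by (simp add: lat_f_def norm_mult powr_add[symmetric])
qed

lemma norm_lat_g: "w \<noteq> 0 \<Longrightarrow> norm (lat_g k s w) = norm w powr (1 - real k - Re s)"
  using powr_add[of "norm w" 1 "- real k - Re s"] by (simp add: lat_g_def norm_mult norm_lat_f add_diff_eq)

text \<open>The square of \<open>norm (1 + v)\<close> is \<open>(1 + v) * (1 + cnj v)\<close>. So
  this real-analytic function splits into a power of \<open>1 + v\<close> and a power of
  \<open>1 + cnj v\<close>, each with its own binomial expansion.\<close>

lemma lat_g_1_plus:
  assumes "norm v < 1"
  shows "lat_g k s (1 + v) = (1 + v) powr (- of_nat k - s / 2) * (1 + cnj v) powr (1 - s / 2)"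
proof -
  have re: "Re (1 + v) > 0" using assms abs_Re_le_cmod[of v] by auto
  then have nz: "1 + v \<noteq> 0" by (metis less_irrefl zero_complex.sel(1))
  then have nz': "1 + cnj v \<noteq> 0" by (metis complex_cnj_add complex_cnj_one complex_cnj_zero_iff)
  have nr: "1 + v \<notin> \<real>\<^sub>\<le>\<^sub>0" using re by (auto simp: complex_nonpos_Reals_iff)
  have cL: "Ln (1 + cnj v) = cnj (Ln (1 + v))" using cnj_Ln[OF nr] by simp
  have "Ln (1 + v) + cnj (Ln (1 + v)) = of_real (2 * ln (norm (1 + v)))"
    using nz by (simp add: complex_add_cnj)
  then have L: "complex_of_real (ln (norm (1 + v))) = (Ln (1 + v) + cnj (Ln (1 + v))) / 2" by simp
  have "complex_of_real (norm (1 + v)) powr (- s) = exp (- s * ((Ln (1 + v) + cnj (Ln (1 + v))) / 2))"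
    using nz by (simp add: powr_def Ln_of_real L[symmetric])
  moreover have "inverse ((1 + v) ^ k) = exp (- of_nat k * Ln (1 + v))"
    using nz by (simp add: exp_minus exp_of_nat_mult)
  moreover have "cnj (1 + v) = exp (cnj (Ln (1 + v)))" using nz' by (simp flip: cL)
  ultimately have "lat_g k s (1 + v) = exp (cnj (Ln (1 + v)) + (- of_nat k * Ln (1 + v)
       + - s * ((Ln (1 + v) + cnj (Ln (1 + v))) / 2)))"
    by (simp only: lat_g_def lat_f_def exp_add)
  also have "\<dots> = exp ((- of_nat k - s / 2) * Ln (1 + v) + (1 - s / 2) * cnj (Ln (1 + v)))"
    by (rule arg_cong[of _ _ exp]) (simp add: algebra_simps add_divide_distrib)
  finally show ?thesis using nz nz' by (simp add: powr_def exp_add cL)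
qed

lemma has_sum_subtract:
  fixes f g :: "'a \<Rightarrow> complex"
  assumes "(f has_sum a) A" "(g has_sum b) A"
  shows "((\<lambda>x. f x - g x) has_sum (a - b)) A"
  using has_sum_add[OF assms(1) has_sum_uminusI[OF assms(2)]] by simp

text \<open>An odd difference has no constant and no quadratic term, so it agrees with its linear
  term up to third order.\<close>

lemma lat_g_odd_taylor:
  fixes R :: real
  shows "\<exists>C\<ge>0. \<forall>s v. norm s \<le> R \<and> norm v \<le> 1/2 \<longrightarrow>
    norm (lat_g k s (1 + v) - lat_g k s (1 - v) - 2 * ((- of_nat k - s / 2) * v + (1 - s / 2) * cnj v)) \<le> C * norm v ^ 3"
proof -
  define R' where "R' = real k + 1 + \<bar>R\<bar>"
  obtain C1 where C1: "C1 \<ge> 0" "\<And>b v :: complex. norm b \<le> R' \<Longrightarrow> norm v \<le> 1/2 \<Longrightarrow>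
      norm ((1 + v) powr b - (1 + b * v + b * (b - 1) / 2 * v ^ 2)) \<le> C1 * norm v ^ 3"
    using powr_1_plus_taylor[of R'] by blast
  obtain M where M: "\<And>b v :: complex. norm b \<le> R' \<Longrightarrow> norm v \<le> 1/2 \<Longrightarrow> norm ((1 + v) powr b) \<le> M"
    using powr_1_plus_bound[of R'] by blast
  have R': "R' \<ge> 0" by (simp add: R'_def)
  have M0: "M \<ge> 0" using order.trans[OF norm_ge_zero M[of 0 0]] R' by simp
  define K where "K = R' * (R' + 1) / 2"
  define C where "C = 4 * R' * K + 2 * (C1 * M + (1 + R' + K) * C1)"
  have K0: "K \<ge> 0" using R' by (simp add: K_def)
  have "norm (lat_g k s (1 + v) - lat_g k s (1 - v) - 2 * ((- of_nat k - s / 2) * v + (1 - s / 2) * cnj v)) \<le> C * norm v ^ 3"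
    if sv: "norm s \<le> R" "norm v \<le> 1/2" for s v
  proof -
    define b c where "b = - of_nat k - s / 2" and "c = 1 - s / 2"
    have "norm b \<le> norm (- of_nat k :: complex) + norm (s / 2)" unfolding b_def by (rule norm_triangle_ineq4)
    then have b: "norm b \<le> R'" using sv by (simp add: R'_def norm_divide)
    have "norm c \<le> norm (1 :: complex) + norm (s / 2)" unfolding c_def by (rule norm_triangle_ineq4)
    then have c: "norm c \<le> R'" using sv by (simp add: R'_def norm_divide)
    define A where "A b v = 1 + b * v + b * (b - 1) / 2 * v ^ 2" for b v :: complex
    have q: "norm (b * (b - 1) / 2) \<le> K" if "norm b \<le> R'" for b :: complex
    proof -
      have "norm (b - 1) \<le> R' + 1" using norm_triangle_ineq4[of b 1] that by simp
      then show ?thesis using that R' unfolding K_def by (auto simp: norm_mult norm_divide intro!: divide_right_mono mult_mono)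
    qed
    have nA: "norm (A b v) \<le> 1 + R' + K" if "norm b \<le> R'" "norm v \<le> 1/2" for b v :: complex
    proof -
      have "norm (b * v) \<le> R' * 1" unfolding norm_mult using that R' by (intro mult_mono) auto
      moreover have "norm (b * (b - 1) / 2 * v ^ 2) \<le> K * 1"
        unfolding norm_mult norm_power using q[OF that(1)] that K0
        by (intro mult_mono) (auto simp: power_le_one)
      ultimately show ?thesis
        unfolding A_def using norm_triangle_ineq[of "1 + b * v" "b * (b - 1) / 2 * v ^ 2"] norm_triangle_ineq[of 1 "b * v"] by simp
    qed
    define E where "E b v = (1 + v) powr b - A b v" for b v :: complex
    have nE: "norm (E b v) \<le> C1 * norm v ^ 3" if "norm b \<le> R'" "norm v \<le> 1/2" for b v
      unfolding E_def A_def using C1(2) that by blast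
    have e1: "lat_g k s (1 + x) = A b x * A c (cnj x) + (E b x * (1 + cnj x) powr c + A b x * E c (cnj x))"
      if "norm x \<le> 1/2" for x
    proof -
      have "norm x < 1" using that by simp
      then show ?thesis
        unfolding lat_g_1_plus[OF \<open>norm x < 1\<close>] b_def[symmetric] c_def[symmetric] E_def
        by (simp add: algebra_simps)
    qed
    define D where "D x = E b x * (1 + cnj x) powr c + A b x * E c (cnj x)" for x
    have nD: "norm (D x) \<le> (C1 * M + (1 + R' + K) * C1) * norm v ^ 3" if x: "norm x = norm v" for x
    proof -
      have "norm (E b x * (1 + cnj x) powr c) \<le> (C1 * norm v ^ 3) * M"
        unfolding norm_mult using nE[OF b, of x] M[OF c, of "cnj x"] sv x C1(1) by (intro mult_mono) auto
      moreover have "norm (A b x * E c (cnj x)) \<le> (1 + R' + K) * (C1 * norm v ^ 3)"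
        unfolding norm_mult using nE[OF c, of "cnj x"] nA[OF b, of x] sv x R' K0 by (intro mult_mono) auto
      ultimately show ?thesis
        unfolding D_def using norm_triangle_ineq[of "E b x * (1 + cnj x) powr c" "A b x * E c (cnj x)"]
        by (simp add: algebra_simps)
    qed
    \<comment> \<open>All products of even degree cancel; beyond the linear terms only the two mixed
      cubic ones survive.\<close>
    have main: "A b v * A c (cnj v) - A b (- v) * A c (- cnj v) - 2 * (b * v + c * cnj v) =
        2 * (b * (c * (c - 1) / 2) * (v * cnj v ^ 2) + b * (b - 1) / 2 * c * (v ^ 2 * cnj v))"
      by (simp add: A_def field_simps power2_eq_square)
    have n1: "norm (b * (c * (c - 1) / 2) * (v * cnj v ^ 2)) \<le> R' * K * norm v ^ 3"
    proof -
      have "norm (b * (c * (c - 1) / 2) * (v * cnj v ^ 2)) = norm b * norm (c * (c - 1) / 2) * norm v ^ 3"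
        by (simp add: norm_mult norm_power power2_eq_square power3_eq_cube)
      also have "\<dots> \<le> R' * K * norm v ^ 3" using b q[OF c] R' K0 by (intro mult_mono) auto
      finally show ?thesis .
    qed
    have n2: "norm (b * (b - 1) / 2 * c * (v ^ 2 * cnj v)) \<le> R' * K * norm v ^ 3"
    proof -
      have "norm (b * (b - 1) / 2 * c * (v ^ 2 * cnj v)) = norm c * norm (b * (b - 1) / 2) * norm v ^ 3"
        by (simp add: norm_mult norm_power power2_eq_square power3_eq_cube)
      also have "\<dots> \<le> R' * K * norm v ^ 3" using c q[OF b] R' K0 by (intro mult_mono) auto
      finally show ?thesis .
    qed
    have "lat_g k s (1 + v) - lat_g k s (1 - v) - 2 * (b * v + c * cnj v) =
        2 * (b * (c * (c - 1) / 2) * (v * cnj v ^ 2) + b * (b - 1) / 2 * c * (v ^ 2 * cnj v)) + (D v - D (- v))"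
      using e1[of v] e1[of "- v"] sv main unfolding D_def by (simp add: algebra_simps)
    also have "norm \<dots> \<le> norm (2 * (b * (c * (c - 1) / 2) * (v * cnj v ^ 2) + b * (b - 1) / 2 * c * (v ^ 2 * cnj v)))
        + (norm (D v) + norm (D (- v)))"
      by (intro order.trans[OF norm_triangle_ineq] add_left_mono norm_triangle_ineq4)
    also have "\<dots> \<le> 2 * (R' * K * norm v ^ 3 + R' * K * norm v ^ 3) +
        ((C1 * M + (1 + R' + K) * C1) * norm v ^ 3 + (C1 * M + (1 + R' + K) * C1) * norm v ^ 3)"
    proof (intro add_mono nD)
      show "norm (2 * (b * (c * (c - 1) / 2) * (v * cnj v ^ 2) + b * (b - 1) / 2 * c * (v ^ 2 * cnj v)))
         \<le> 2 * (R' * K * norm v ^ 3 + R' * K * norm v ^ 3)"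
        unfolding norm_mult[of 2] norm_numeral
        by (intro mult_left_mono order.trans[OF norm_triangle_ineq add_mono[OF n1 n2]]) auto
    qed auto
    also have "\<dots> = C * norm v ^ 3" by (simp add: C_def algebra_simps)
    finally show ?thesis by (simp add: b_def c_def)
  qed
  moreover have "C \<ge> 0" using R' M0 K0 C1(1) by (simp add: C_def)
  ultimately show ?thesis by blast
qed

text \<open>Here \<open>(1 - s / 2) * lat_f k s\<close> is the Wirtinger derivative of \<open>lat_g k s\<close> in \<open>cnj w\<close>, which is a combination of the
  derivatives along the periods \<open>1\<close> and \<open>\<tau>\<close>. Replacing these by central differences leaves an
  error two orders smaller, and the differences telescope.\<close>

definition lat_tele :: "nat \<Rightarrow> complex \<Rightarrow> complex \<Rightarrow> complex \<Rightarrow> complex" where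
  "lat_tele k \<tau> s w = (1 - s / 2) * lat_f k s w -
     (\<tau> * inv_2iy \<tau> / 2 * (lat_g k s (w + 1) - lat_g k s (w - 1)) - inv_2iy \<tau> / 2 * (lat_g k s (w + \<tau>) - lat_g k s (w - \<tau>)))"

text \<open>By multiplicativity the differences at \<open>w\<close> are \<open>lat_g k s w\<close>
  times those at 1 with increments \<open>1 / w\<close> and \<open>\<tau> / w\<close>. In the
  combination chosen, the linear terms in the increments cancel and those in their conjugates add up
  to \<open>(1 - s / 2) * lat_f k s w\<close>. What remains is cubic and gains
  \<open>norm w powr (- 3)\<close> over \<open>lat_g\<close>.\<close>

lemma lat_tele_bound:
  fixes R :: real
  assumes t: "\<tau> \<in> uhp"
  shows "\<exists>C\<ge>0. \<forall>s w. norm s \<le> R \<and> norm w \<ge> 2 * (1 + norm \<tau>) \<longrightarrow>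
    norm (lat_tele k \<tau> s w) \<le> C * norm w powr (- real k - 2 - Re s)"
proof -
  obtain C where C: "C \<ge> 0" "\<And>s v. norm s \<le> R \<Longrightarrow> norm v \<le> 1/2 \<Longrightarrow>
    norm (lat_g k s (1 + v) - lat_g k s (1 - v) - 2 * ((- of_nat k - s / 2) * v + (1 - s / 2) * cnj v)) \<le> C * norm v ^ 3"
    using lat_g_odd_taylor[of R k] by blast
  define u where "u = inv_2iy \<tau>"
  define C' where "C' = norm (\<tau> * u / 2) * C + norm (u / 2) * (C * norm \<tau> ^ 3)"
  have "norm (lat_tele k \<tau> s w) \<le> C' * norm w powr (- real k - 2 - Re s)"
    if sw: "norm s \<le> R" "norm w \<ge> 2 * (1 + norm \<tau>)" for s w
  proof -
    have w: "w \<noteq> 0" "norm w > 0" using sw(2) norm_ge_zero[of \<tau>] by (auto simp del: norm_ge_zero)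
    define b c where "b = - of_nat k - s / 2" and "c = 1 - s / 2"
    define E where "E e = lat_g k s (1 + e / w) - lat_g k s (1 - e / w) - 2 * (b * (e / w) + c * cnj (e / w))" for e
    have nE: "norm (E e) \<le> C * norm e ^ 3 / norm w ^ 3" if "norm e \<le> 1 + norm \<tau>" for e
    proof -
      have "norm (e / w) \<le> 1/2" using that sw(2) w by (simp add: norm_divide field_simps)
      from C(2)[OF sw(1) this] show ?thesis unfolding E_def b_def c_def by (simp add: norm_divide power_divide)
    qed
    have diff: "lat_g k s (w + e) - lat_g k s (w - e) = lat_g k s w * (E e + 2 * (b * (e / w) + c * cnj (e / w)))"
      if "norm e \<le> 1 + norm \<tau>" for e
    proof -
      have "0 < 1 + norm \<tau>" by (simp add: add_pos_nonneg)
      then have "1 + norm \<tau> < 2 * (1 + norm \<tau>)" by (subst mult_2) simp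
      then have "norm e < norm w" using that sw(2) by (meson le_less_trans less_le_trans)
      then have n: "norm (e / w) < 1" using w by (simp add: norm_divide)
      then have "1 + e / w \<noteq> 0" "1 - e / w \<noteq> 0"
        using norm_minus_cancel[of "e / w"] by (auto simp: add_eq_0_iff)
      then have "lat_g k s (w * (1 + e / w)) = lat_g k s w * lat_g k s (1 + e / w)"
        "lat_g k s (w * (1 - e / w)) = lat_g k s w * lat_g k s (1 - e / w)"
        using w by (auto intro: lat_g_mult)
      moreover have "w * (1 + e / w) = w + e" "w * (1 - e / w) = w - e" using w by (auto simp: field_simps)
      ultimately show ?thesis by (simp add: E_def algebra_simps)
    qed
    have u1: "u * (\<tau> - cnj \<tau>) = 1" using diff_cnj_nonzero[OF t] by (simp add: u_def inv_2iy_def)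
    have "lat_tele k \<tau> s w = c * lat_f k s w - (\<tau> * u / 2 * (lat_g k s w * (E 1 + 2 * (b * (1 / w) + c * cnj (1 / w))))
        - u / 2 * (lat_g k s w * (E \<tau> + 2 * (b * (\<tau> / w) + c * cnj (\<tau> / w)))))"
      unfolding lat_tele_def by (subst (1 2) diff) (simp_all add: c_def u_def)
    also have "\<dots> = c * lat_f k s w - c * lat_f k s w * (u * (\<tau> - cnj \<tau>)) - lat_g k s w * (\<tau> * u / 2 * E 1 - u / 2 * E \<tau>)"
      using w by (simp add: lat_g_def field_simps del: complex_diff_cnj)
    also have "\<dots> = - (lat_g k s w * (\<tau> * u / 2 * E 1 - u / 2 * E \<tau>))"
      unfolding u1 by simp
    finally have "norm (lat_tele k \<tau> s w) = norm (lat_g k s w) * norm (\<tau> * u / 2 * E 1 - u / 2 * E \<tau>)"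
      by (simp add: norm_mult)
    also have "\<dots> \<le> norm (lat_g k s w) * (C' / norm w ^ 3)"
    proof (rule mult_left_mono)
      have "norm (\<tau> * u / 2 * E 1) \<le> norm (\<tau> * u / 2) * (C / norm w ^ 3)"
        unfolding norm_mult[of _ "E 1"] using nE[of 1] by (intro mult_left_mono) auto
      moreover have "norm (u / 2 * E \<tau>) \<le> norm (u / 2) * (C * norm \<tau> ^ 3 / norm w ^ 3)"
        unfolding norm_mult[of _ "E \<tau>"] using nE[of \<tau>] by (intro mult_left_mono) auto
      moreover have "norm (\<tau> * u / 2 * E 1 - u / 2 * E \<tau>) \<le> norm (\<tau> * u / 2 * E 1) + norm (u / 2 * E \<tau>)"
        by (rule norm_triangle_ineq4)
      ultimately have "norm (\<tau> * u / 2 * E 1 - u / 2 * E \<tau>) \<le>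
          norm (\<tau> * u / 2) * (C / norm w ^ 3) + norm (u / 2) * (C * norm \<tau> ^ 3 / norm w ^ 3)" by linarith
      also have "\<dots> = C' / norm w ^ 3" by (simp add: C'_def add_divide_distrib)
      finally show "norm (\<tau> * u / 2 * E 1 - u / 2 * E \<tau>) \<le> C' / norm w ^ 3" .
    qed auto
    also have "norm (lat_g k s w) * (C' / norm w ^ 3) = C' * (norm w powr (1 - real k - Re s) * norm w powr (- 3))"
      unfolding norm_lat_g[OF w(1)] using w by (simp add: powr_minus powr_numeral divide_inverse)
    also have "\<dots> = C' * norm w powr (- real k - 2 - Re s)"
    proof -
      have "1 - real k - Re s + - 3 = - real k - 2 - Re s" by simp
      then show ?thesis by (simp only: powr_add[symmetric])
    qed
    finally show ?thesis .
  qed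
  moreover have "C' \<ge> 0" using C(1) by (simp add: C'_def)
  ultimately show ?thesis by blast
qed

lemma lat_f_holomorphic: "w \<noteq> 0 \<Longrightarrow> (\<lambda>s. lat_f k s w) holomorphic_on S"
  unfolding lat_f_def powr_def by (auto intro!: holomorphic_intros)

lemma lat_g_holomorphic: "w \<noteq> 0 \<Longrightarrow> (\<lambda>s. lat_g k s w) holomorphic_on S"
  unfolding lat_g_def by (intro holomorphic_intros lat_f_holomorphic)

section \<open>Sums over a shifted lattice and their continuation\<close>

definition lat_pt :: "real \<Rightarrow> real \<Rightarrow> complex \<Rightarrow> int \<times> int \<Rightarrow> complex" where
  "lat_pt a1 a2 \<tau> x = of_real (a1 + of_int (fst x)) * \<tau> + of_real (a2 + of_int (snd x))"

locale torsion_point =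
  fixes \<tau> :: complex and a1 a2 :: real and N :: nat
  assumes tau: "\<tau> \<in> uhp" and N: "N > 0"
    and a1N: "real N * a1 \<in> \<int>" and a2N: "real N * a2 \<in> \<int>" and not_int: "\<not> (a1 \<in> \<int> \<and> a2 \<in> \<int>)"
begin

abbreviation "W \<equiv> lat_pt a1 a2 \<tau>"
abbreviation "z0 \<equiv> of_real a1 * \<tau> + of_real a2"

text \<open>Multiplied by \<open>N\<close>, both coordinates are integers, and they are not both
  0.\<close>

lemma coords_lower: "1 / real N \<le> \<bar>a1 + of_int m\<bar> + \<bar>a2 + of_int n\<bar>"
proof -
  obtain k l where kl: "real N * a1 = of_int k" "real N * a2 = of_int l" using a1N a2N by (auto elim!: Ints_cases)
  have "k + int N * m \<noteq> 0 \<or> l + int N * n \<noteq> 0"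
  proof (rule ccontr)
    assume "\<not> ?thesis"
    then have "k = int N * (- m)" "l = int N * (- n)" by auto
    then have "real_of_int k = real N * of_int (- m)" "real_of_int l = real N * of_int (- n)"
      by (metis of_int_mult of_int_of_nat_eq)+
    moreover have "real N \<noteq> 0" using N by simp
    ultimately have "a1 = of_int (- m)" "a2 = of_int (- n)" using kl by (metis mult_left_cancel)+
    then show False using not_int by auto
  qed
  then have "1 \<le> \<bar>k + int N * m\<bar> + \<bar>l + int N * n\<bar>" by linarith
  then have "1 \<le> \<bar>real_of_int (k + int N * m)\<bar> + \<bar>real_of_int (l + int N * n)\<bar>"
    by (metis of_int_1_le_iff of_int_abs of_int_add)
  also have "real_of_int (k + int N * m) = real N * (a1 + of_int m)" by (simp add: kl[symmetric] algebra_simps)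
  also have "real_of_int (l + int N * n) = real N * (a2 + of_int n)" by (simp add: kl[symmetric] algebra_simps)
  finally have "1 \<le> real N * (\<bar>a1 + of_int m\<bar> + \<bar>a2 + of_int n\<bar>)"
    unfolding abs_mult abs_of_nat by (simp only: distrib_left)
  then show ?thesis using N by (simp add: field_simps)
qed

text \<open>The imaginary part controls the first coordinate, and then the norm controls the second;
  \<open>coords_lower\<close> absorbs the additive constants.\<close>

lemma W_lower: "\<exists>c>0. \<forall>x. norm (W x) \<ge> c * (1 + \<bar>real_of_int (fst x)\<bar> + \<bar>real_of_int (snd x)\<bar>)"
proof -
  define y where "y = Im \<tau>"
  have y: "y > 0" using tau by (simp add: y_def uhp_iff)
  define K where "K = 1 / y + 1 + norm \<tau> / y"
  define K' where "K' = 1 + real N * (1 + \<bar>a1\<bar> + \<bar>a2\<bar>)"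
  have K: "K > 0" "K' > 0" using y N by (auto simp: K_def K'_def add_pos_nonneg)
  have "1 / (K * K') * (1 + \<bar>real_of_int (fst x)\<bar> + \<bar>real_of_int (snd x)\<bar>) \<le> norm (W x)" for x
  proof -
    define p r where "p = a1 + of_int (fst x)" and "r = a2 + of_int (snd x)"
    have W: "W x = of_real p * \<tau> + of_real r" by (simp add: lat_pt_def p_def r_def)
    have "\<bar>p\<bar> * y \<le> norm (W x)"
      using abs_Im_le_cmod[of "W x"] y by (simp add: W y_def abs_mult)
    then have p: "\<bar>p\<bar> \<le> norm (W x) / y" using y by (simp add: field_simps)
    have "norm (of_real r :: complex) \<le> norm (W x) + norm (of_real p * \<tau>)"
      using norm_triangle_ineq4[of "W x" "of_real p * \<tau>"] by (simp add: W)
    also have "norm (of_real p * \<tau>) \<le> norm (W x) / y * norm \<tau>"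
      unfolding norm_mult using p by (intro mult_right_mono) auto
    finally have "\<bar>r\<bar> \<le> norm (W x) + norm (W x) / y * norm \<tau>" by simp
    with p have pr: "\<bar>p\<bar> + \<bar>r\<bar> \<le> norm (W x) * K" by (simp add: K_def algebra_simps)
    have "1 \<le> (\<bar>p\<bar> + \<bar>r\<bar>) * real N" using coords_lower[of "fst x" "snd x"] N by (simp add: p_def r_def field_simps)
    then have "(1 + \<bar>a1\<bar> + \<bar>a2\<bar>) * 1 \<le> (1 + \<bar>a1\<bar> + \<bar>a2\<bar>) * ((\<bar>p\<bar> + \<bar>r\<bar>) * real N)"
      by (intro mult_left_mono) auto
    moreover have "1 + \<bar>real_of_int (fst x)\<bar> + \<bar>real_of_int (snd x)\<bar> \<le> (\<bar>p\<bar> + \<bar>r\<bar>) + (1 + \<bar>a1\<bar> + \<bar>a2\<bar>)"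
      unfolding p_def r_def by linarith
    ultimately have "1 + \<bar>real_of_int (fst x)\<bar> + \<bar>real_of_int (snd x)\<bar> \<le> (\<bar>p\<bar> + \<bar>r\<bar>) * K'"
      by (simp add: K'_def algebra_simps)
    also have "\<dots> \<le> norm (W x) * K * K'" using pr K by (intro mult_right_mono) auto
    finally show ?thesis using K by (simp add: field_simps)
  qed
  then show ?thesis using K by (intro exI[of _ "1 / (K * K')"]) auto
qed

lemma W_nonzero: "W x \<noteq> 0"
proof -
  obtain c where "c > 0" "norm (W x) \<ge> c * (1 + \<bar>real_of_int (fst x)\<bar> + \<bar>real_of_int (snd x)\<bar>)" using W_lower by blast
  moreover have "1 + \<bar>real_of_int (fst x)\<bar> + \<bar>real_of_int (snd x)\<bar> > 0" by linarith
  ultimately show ?thesis by (metis mult_pos_pos not_less norm_zero)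
qed

lemma W_shift: "W (m, n) + 1 = W (m, n + 1)" "W (m, n) - 1 = W (m, n - 1)"
  "W (m, n) + \<tau> = W (m + 1, n)" "W (m, n) - \<tau> = W (m - 1, n)"
  by (simp_all add: lat_pt_def algebra_simps)

lemma W_inj: "inj (\<lambda>(m::int, n::int). of_int m * \<tau> + of_int n)"
proof (rule injI, clarify)
  fix m n m' n' :: int
  assume eq: "of_int m * \<tau> + of_int n = of_int m' * \<tau> + of_int n'"
  then have "Im (of_int m * \<tau> + of_int n) = Im (of_int m' * \<tau> + of_int n')" by simp
  then have "m = m'" using tau by (simp add: uhp_iff)
  then show "m = m' \<and> n = n'" using eq by simp
qed

lemma phi_sum_eq: "phi_sum k z0 \<tau> s = (\<Sum>\<^sub>\<infinity>x. lat_f k s (W x))"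
proof -
  have W: "z0 + (case x of (m, n) \<Rightarrow> of_int m * \<tau> + of_int n) = W x" for x
    by (cases x) (simp add: lat_pt_def algebra_simps)
  have L: "period_lattice \<tau> = range (\<lambda>(m, n). of_int m * \<tau> + of_int n)"
    by (auto simp: period_lattice_def)
  have "- z0 \<notin> period_lattice \<tau>"
  proof
    assume "- z0 \<in> period_lattice \<tau>"
    then obtain x where "- z0 = (case x of (m, n) \<Rightarrow> of_int m * \<tau> + of_int n)" unfolding L by blast
    then have "W x = 0" using W[of x] by (metis add.right_inverse)
    then show False using W_nonzero by blast
  qed
  then have "period_lattice \<tau> - {- z0} = range (\<lambda>(m, n). of_int m * \<tau> + of_int n)" unfolding L by blast
  then show ?thesis
    unfolding phi_sum_def lat_f_def[symmetric] by (simp add: infsum_reindex[OF W_inj] o_def W)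
qed

lemma summable_W_powr:
  assumes "\<sigma> > 2"
  shows "(\<lambda>x. norm (W x) powr (- \<sigma>)) summable_on UNIV"
proof -
  obtain c where c: "c > 0" "\<And>x. norm (W x) \<ge> c * (1 + \<bar>real_of_int (fst x)\<bar> + \<bar>real_of_int (snd x)\<bar>)" using W_lower by blast
  have "(\<lambda>x. c powr (- \<sigma>) * (case x of (m::int, n::int) \<Rightarrow> (1 + \<bar>real_of_int m\<bar> + \<bar>real_of_int n\<bar>) powr (- \<sigma>))) summable_on UNIV"
    by (intro summable_on_cmult_right summable_on_int2_powr assms)
  then show ?thesis
  proof (rule summable_on_comparison_test)
    fix x :: "int \<times> int"
    obtain m n where x: "x = (m, n)" by (cases x)
    have "norm (W x) powr (- \<sigma>) \<le> (c * (1 + \<bar>real_of_int m\<bar> + \<bar>real_of_int n\<bar>)) powr (- \<sigma>)"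
      using c(2)[of x] c(1) assms by (intro powr_mono2') (auto simp: x intro!: mult_pos_pos)
    also have "\<dots> = c powr (- \<sigma>) * (1 + \<bar>real_of_int m\<bar> + \<bar>real_of_int n\<bar>) powr (- \<sigma>)"
      using c(1) by (simp add: powr_mult)
    finally show "norm (W x) powr (- \<sigma>) \<le> c powr (- \<sigma>) *
        (case x of (m::int, n::int) \<Rightarrow> (1 + \<bar>real_of_int m\<bar> + \<bar>real_of_int n\<bar>) powr (- \<sigma>))" by (simp add: x)
  qed auto
qed

lemma finite_W_small: "finite {x. norm (W x) < B}"
proof -
  obtain c where c: "c > 0" "\<And>x. norm (W x) \<ge> c * (1 + \<bar>real_of_int (fst x)\<bar> + \<bar>real_of_int (snd x)\<bar>)" using W_lower by blast
  define M where "M = \<lceil>B / c\<rceil>"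
  have "{x. norm (W x) < B} \<subseteq> {-M..M} \<times> {-M..M}"
  proof
    fix x assume "x \<in> {x. norm (W x) < B}"
    then have "c * (1 + \<bar>real_of_int (fst x)\<bar> + \<bar>real_of_int (snd x)\<bar>) < B" using c(2)[of x] by simp
    then have "1 + \<bar>real_of_int (fst x)\<bar> + \<bar>real_of_int (snd x)\<bar> < B / c" using c(1) by (simp add: field_simps)
    moreover have "B / c \<le> of_int M" by (simp add: M_def)
    ultimately have "1 + \<bar>real_of_int (fst x)\<bar> + \<bar>real_of_int (snd x)\<bar> < of_int M" by linarith
    then have "1 + \<bar>fst x\<bar> + \<bar>snd x\<bar> < M" by linarith
    then show "x \<in> {-M..M} \<times> {-M..M}" by (cases x) auto
  qed
  then show ?thesis by (rule finite_subset) auto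
qed

lemma powr_W_mono:
  assumes "norm (W x) \<ge> 1" "a \<le> b"
  shows "norm (W x) powr a \<le> norm (W x) powr b"
  using assms by (intro powr_mono)

lemma phi_sum_holomorphic:
  "(\<lambda>s. \<Sum>\<^sub>\<infinity>x. lat_f k s (W x)) holomorphic_on {s. Re s > 2 - real k}"
  "Re s > 2 - real k \<Longrightarrow> (\<lambda>x. norm (lat_f k s (W x))) summable_on UNIV"
proof -
  have op: "open {s. Re s > 2 - real k}" by (rule open_halfspace_Re_gt)
  have bd: "\<exists>r>0. \<exists>F M. finite F \<and> M summable_on UNIV \<and>
        (\<forall>x\<in>UNIV - F. \<forall>s\<in>cball s0 r \<inter> {s. Re s > 2 - real k}. norm (lat_f k s (W x)) \<le> M x)"
    if "s0 \<in> {s. Re s > 2 - real k}" for s0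
  proof -
    define r where "r = (Re s0 - (2 - real k)) / 2"
    have r: "r > 0" using that by (simp add: r_def)
    have "norm (lat_f k s (W x)) \<le> norm (W x) powr (- (2 + r))"
      if x: "norm (W x) \<ge> 1" and s: "s \<in> cball s0 r" for x s
    proof -
      have "\<bar>Re (s0 - s)\<bar> \<le> r" using s abs_Re_le_cmod[of "s0 - s"] by (simp add: dist_norm)
      moreover have "2 * r = Re s0 - 2 + real k" by (simp add: r_def)
      ultimately have "- real k - Re s \<le> - (2 + r)" unfolding minus_complex.sel by linarith
      then show ?thesis unfolding norm_lat_f[OF W_nonzero] using x by (intro powr_W_mono)
    qed
    then show ?thesis
      using r finite_W_small[of 1] summable_W_powr[of "2 + r"]
      by (intro exI[of _ r] exI[of _ "{x. norm (W x) < 1}"] exI[of _ "\<lambda>x. norm (W x) powr (- (2 + r))"] conjI ballI) auto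
  qed
  show "(\<lambda>s. \<Sum>\<^sub>\<infinity>x. lat_f k s (W x)) holomorphic_on {s. Re s > 2 - real k}"
    by (rule holomorphic_infsum(1)[OF op lat_f_holomorphic[OF W_nonzero] bd])
  show "Re s > 2 - real k \<Longrightarrow> (\<lambda>x. norm (lat_f k s (W x))) summable_on UNIV"
    by (rule holomorphic_infsum(2)[OF op lat_f_holomorphic[OF W_nonzero] bd]) simp_all
qed

text \<open>The two powers gained in \<open>lat_tele_bound\<close> over the original summand move
  the half plane from \<open>Re s > 2 - real k\<close> to \<open>Re s > - real k\<close>, which
  contains 0 for every \<open>k > 0\<close>.\<close>

lemma lat_tele_W_holomorphic:
  "(\<lambda>s. \<Sum>\<^sub>\<infinity>x. lat_tele k \<tau> s (W x)) holomorphic_on {s. Re s > - real k}"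
  "Re s > - real k \<Longrightarrow> (\<lambda>x. norm (lat_tele k \<tau> s (W x))) summable_on UNIV"
proof -
  have op: "open {s. Re s > - real k}" by (rule open_halfspace_Re_gt)
  have hol: "(\<lambda>s. lat_tele k \<tau> s (W x)) holomorphic_on {s. Re s > - real k}" for x
    unfolding lat_tele_def
    by (cases x) (auto simp: W_shift intro!: holomorphic_intros lat_f_holomorphic lat_g_holomorphic W_nonzero)
  have bd: "\<exists>r>0. \<exists>F M. finite F \<and> M summable_on UNIV \<and>
        (\<forall>x\<in>UNIV - F. \<forall>s\<in>cball s0 r \<inter> {s. Re s > - real k}. norm (lat_tele k \<tau> s (W x)) \<le> M x)"
    if "s0 \<in> {s. Re s > - real k}" for s0
  proof -
    define r where "r = (Re s0 + real k) / 2"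
    have r: "r > 0" using that by (simp add: r_def)
    obtain C where C: "C \<ge> 0" "\<And>s w. norm s \<le> norm s0 + r \<Longrightarrow> norm w \<ge> 2 * (1 + norm \<tau>) \<Longrightarrow>
      norm (lat_tele k \<tau> s w) \<le> C * norm w powr (- real k - 2 - Re s)" using lat_tele_bound[OF tau, of "norm s0 + r" k] by blast
    have "norm (lat_tele k \<tau> s (W x)) \<le> C * norm (W x) powr (- (2 + r))"
      if x: "norm (W x) \<ge> 2 * (1 + norm \<tau>)" and s: "s \<in> cball s0 r" for x s
    proof -
      have "\<bar>Re (s0 - s)\<bar> \<le> r" using s abs_Re_le_cmod[of "s0 - s"] by (simp add: dist_norm)
      moreover have "2 * r = Re s0 + real k" by (simp add: r_def)
      ultimately have e: "- real k - 2 - Re s \<le> - (2 + r)" unfolding minus_complex.sel by linarith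
      have "norm s \<le> norm s0 + norm (s - s0)" using norm_triangle_sub[of s s0] by simp
      then have "norm s \<le> norm s0 + r" using s by (simp add: dist_norm norm_minus_commute)
      then have "norm (lat_tele k \<tau> s (W x)) \<le> C * norm (W x) powr (- real k - 2 - Re s)" using x by (rule C(2))
      also have "\<dots> \<le> C * norm (W x) powr (- (2 + r))"
        using x e C(1) norm_ge_zero[of \<tau>] by (intro mult_left_mono powr_W_mono) (auto simp del: norm_ge_zero)
      finally show ?thesis .
    qed
    then show ?thesis
      using r finite_W_small[of "2 * (1 + norm \<tau>)"] summable_W_powr[of "2 + r"]
      by (intro exI[of _ r] exI[of _ "{x. norm (W x) < 2 * (1 + norm \<tau>)}"] exI[of _ "\<lambda>x. C * norm (W x) powr (- (2 + r))"] conjI ballI)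
        (auto intro!: summable_on_cmult_right)
  qed
  show "(\<lambda>s. \<Sum>\<^sub>\<infinity>x. lat_tele k \<tau> s (W x)) holomorphic_on {s. Re s > - real k}"
    by (rule holomorphic_infsum(1)[OF op hol bd])
  show "Re s > - real k \<Longrightarrow> (\<lambda>x. norm (lat_tele k \<tau> s (W x))) summable_on UNIV"
    by (rule holomorphic_infsum(2)[OF op hol bd]) auto
qed

text \<open>This far to the right \<open>lat_g\<close> itself is absolutely summable, so its sum is
  invariant under lattice shifts and the four shifted sums cancel in pairs.\<close>

lemma lat_tele_sum_large:
  assumes s: "Re s > 3 - real k"
  shows "(\<Sum>\<^sub>\<infinity>x. lat_tele k \<tau> s (W x)) = (1 - s / 2) * (\<Sum>\<^sub>\<infinity>x. lat_f k s (W x))"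
proof -
  have "1 - real k - Re s = - (Re s + real k - 1)" by simp
  then have "norm (lat_g k s (W x)) = norm (W x) powr (- (Re s + real k - 1))" for x
    by (simp only: norm_lat_g[OF W_nonzero])
  then have "(\<lambda>x. norm (lat_g k s (W x))) summable_on UNIV"
    by (simp only:) (rule summable_W_powr, use s in simp)
  then have g: "(\<lambda>x. lat_g k s (W x)) summable_on UNIV" by (rule abs_summable_summable)
  have f: "(\<lambda>x. lat_f k s (W x)) summable_on UNIV"
    by (rule abs_summable_summable[OF phi_sum_holomorphic(2)]) (use s in simp)
  have shift: "((\<lambda>x. lat_g k s (W (x + d))) has_sum (\<Sum>\<^sub>\<infinity>x. lat_g k s (W x))) UNIV" for d
  proof -
    have "bij (\<lambda>x::int \<times> int. x + d)"
      by (rule bij_betw_byWitness[where f' = "\<lambda>x. x - d"]) auto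
    then show ?thesis using has_sum_reindex_bij_betw[of "\<lambda>x. x + d" UNIV UNIV "\<lambda>x. lat_g k s (W x)"] has_sum_infsum[OF g] by simp
  qed
  have e: "lat_tele k \<tau> s (W x) = (1 - s / 2) * lat_f k s (W x) -
     (\<tau> * inv_2iy \<tau> / 2 * (lat_g k s (W (x + (0, 1))) - lat_g k s (W (x + (0, - 1)))) -
       inv_2iy \<tau> / 2 * (lat_g k s (W (x + (1, 0))) - lat_g k s (W (x + (- 1, 0)))))" for x
    by (cases x) (simp add: lat_tele_def W_shift)
  have "((\<lambda>x. lat_tele k \<tau> s (W x)) has_sum ((1 - s / 2) * (\<Sum>\<^sub>\<infinity>x. lat_f k s (W x)) -
     (\<tau> * inv_2iy \<tau> / 2 * ((\<Sum>\<^sub>\<infinity>x. lat_g k s (W x)) - (\<Sum>\<^sub>\<infinity>x. lat_g k s (W x))) -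
       inv_2iy \<tau> / 2 * ((\<Sum>\<^sub>\<infinity>x. lat_g k s (W x)) - (\<Sum>\<^sub>\<infinity>x. lat_g k s (W x)))))) UNIV"
    unfolding e by (intro has_sum_subtract has_sum_cmult_right has_sum_infsum[OF f] shift)
  then show ?thesis by (simp add: infsumI)
qed

lemma lat_tele_sum:
  assumes s: "Re s > 2 - real k"
  shows "(\<Sum>\<^sub>\<infinity>x. lat_tele k \<tau> s (W x)) = (1 - s / 2) * (\<Sum>\<^sub>\<infinity>x. lat_f k s (W x))"
proof -
  let ?S = "{s. Re s > 2 - real k}" and ?U = "{s. Re s > 3 - real k}"
  let ?F = "\<lambda>s. (\<Sum>\<^sub>\<infinity>x. lat_tele k \<tau> s (W x)) - (1 - s / 2) * (\<Sum>\<^sub>\<infinity>x. lat_f k s (W x))"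
  have "?F s = 0"
  proof (rule analytic_continuation[of ?F ?S ?U "of_real (4 - real k)"])
    show "?F holomorphic_on ?S"
      by (intro holomorphic_intros phi_sum_holomorphic holomorphic_on_subset[OF lat_tele_W_holomorphic(1)]) auto
    show "open ?S" by (rule open_halfspace_Re_gt)
    show "connected ?S" by (rule convex_connected[OF convex_halfspace_Re_gt])
    show "complex_of_real (4 - real k) islimpt ?U"
      by (rule interior_limit_point) (simp add: interior_open open_halfspace_Re_gt)
  qed (use s lat_tele_sum_large in auto)
  then show ?thesis by simp
qed

end

text \<open>Two continuations agree far to the right, hence on their common half plane, which
  contains 0.\<close>

lemma phi_eqI:
  assumes c: "c < 0" and F: "F holomorphic_on {s. Re s > c}"
    and eq: "\<And>s. Re s > c \<Longrightarrow> Re s > 2 - real k \<Longrightarrow> F s = phi_sum k z \<tau> s"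
  shows "phi k z \<tau> = F 0"
  unfolding phi_def
proof (rule the_equality)
  show "\<exists>c<0. \<exists>G. G holomorphic_on {s. c < Re s} \<and> (\<forall>s. c < Re s \<and> 2 - real k < Re s \<longrightarrow> G s = phi_sum k z \<tau> s) \<and> G 0 = F 0"
    using assms by blast
  fix v assume "\<exists>c<0. \<exists>G. G holomorphic_on {s. c < Re s} \<and> (\<forall>s. c < Re s \<and> 2 - real k < Re s \<longrightarrow> G s = phi_sum k z \<tau> s) \<and> G 0 = v"
  then obtain c' G where G: "c' < 0" "G holomorphic_on {s. c' < Re s}"
    "\<And>s. c' < Re s \<Longrightarrow> 2 - real k < Re s \<Longrightarrow> G s = phi_sum k z \<tau> s" "G 0 = v" by blast
  define m where "m = max c c'"
  let ?S = "{s. Re s > m}" and ?U = "{s. Re s > max m (2 - real k)}"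
  have "F 0 - G 0 = 0"
  proof (rule analytic_continuation[of "\<lambda>s. F s - G s" ?S ?U "of_real (max m (2 - real k) + 1)"])
    show "(\<lambda>s. F s - G s) holomorphic_on ?S"
      by (intro holomorphic_intros holomorphic_on_subset[OF F] holomorphic_on_subset[OF G(2)]) (auto simp: m_def)
    show "open ?S" by (rule open_halfspace_Re_gt)
    show "connected ?S" by (rule convex_connected[OF convex_halfspace_Re_gt])
    show "complex_of_real (max m (2 - real k) + 1) islimpt ?U"
      by (rule interior_limit_point) (subst interior_open[OF open_halfspace_Re_gt], auto simp: max_def)
  qed (use c G eq in \<open>auto simp: m_def\<close>)
  then show "v = F 0" using G by simp
qed

context torsion_point
begin

text \<open>\<open>1 - s / 2\<close> vanishes at \<open>s = 2\<close>, so the telescoped expression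
  serves only to the left of that point; for \<open>Re s \<ge> 2\<close> and \<open>k > 0\<close>
  the original series converges.\<close>

definition phi_cont :: "nat \<Rightarrow> complex \<Rightarrow> complex" where
  "phi_cont k s = (if Re s < 2 then (\<Sum>\<^sub>\<infinity>x. lat_tele k \<tau> s (W x)) / (1 - s / 2) else (\<Sum>\<^sub>\<infinity>x. lat_f k s (W x)))"

lemma phi_cont_eq: "Re s > 2 - real k \<Longrightarrow> phi_cont k s = phi_sum k z0 \<tau> s"
proof -
  assume s: "Re s > 2 - real k"
  have "1 - s / 2 \<noteq> 0" if "Re s < 2" using that by (auto simp: complex_eq_iff)
  then show ?thesis using lat_tele_sum[OF s] by (auto simp: phi_cont_def phi_sum_eq)
qed

lemma phi_cont_holomorphic:
  assumes k: "k > 0"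
  shows "phi_cont k holomorphic_on {s. Re s > - 1}"
proof -
  let ?A = "{s. Re s > - 1} \<inter> {s. Re s < 2}" and ?B = "{s. Re s > 2 - real k} \<inter> {s. Re s > - 1}"
  have nz: "1 - s / 2 \<noteq> 0" if "Re s < 2" for s using that by (auto simp: complex_eq_iff)
  have "(\<lambda>s. (\<Sum>\<^sub>\<infinity>x. lat_tele k \<tau> s (W x)) / (1 - s / 2)) holomorphic_on ?A"
    by (intro holomorphic_intros holomorphic_on_subset[OF lat_tele_W_holomorphic(1)]) (use k nz in auto)
  then have "phi_cont k holomorphic_on ?A" by (rule holomorphic_transform) (auto simp: phi_cont_def)
  moreover have "phi_cont k holomorphic_on ?B"
    by (rule holomorphic_transform[OF holomorphic_on_subset[OF phi_sum_holomorphic(1)[of k]]])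
      (auto simp: phi_cont_eq phi_sum_eq)
  ultimately have "phi_cont k holomorphic_on (?A \<union> ?B)"
    by (intro holomorphic_on_Un open_Int open_halfspace_Re_gt open_halfspace_Re_lt)
  moreover have "?A \<union> ?B = {s. Re s > - 1}" using k by auto
  ultimately show ?thesis by simp
qed

lemma phi_eq_phi_cont: "k > 0 \<Longrightarrow> phi k z0 \<tau> = phi_cont k 0"
  by (rule phi_eqI[of "- 1", OF _ phi_cont_holomorphic]) (auto simp: phi_cont_eq)

lemma phi_eq_tele: "k > 0 \<Longrightarrow> phi k z0 \<tau> = (\<Sum>\<^sub>\<infinity>x. lat_tele k \<tau> 0 (W x))"
  by (simp add: phi_eq_phi_cont phi_cont_def)

lemma phi_eq_sum:
  assumes "k \<ge> 3"
  shows "phi k z0 \<tau> = (\<Sum>\<^sub>\<infinity>x. inverse (W x ^ k))" "(\<lambda>x. inverse (W x ^ k)) summable_on UNIV"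
proof -
  have e: "lat_f k 0 (W x) = inverse (W x ^ k)" for x
    using W_nonzero[of x] by (simp add: lat_f_def)
  have "phi_cont k 0 = phi_sum k z0 \<tau> 0" using assms by (intro phi_cont_eq) auto
  then show "phi k z0 \<tau> = (\<Sum>\<^sub>\<infinity>x. inverse (W x ^ k))"
    using assms by (simp add: phi_eq_phi_cont phi_sum_eq e)
  show "(\<lambda>x. inverse (W x ^ k)) summable_on UNIV"
    unfolding e[symmetric] by (rule abs_summable_summable[OF phi_sum_holomorphic(2)]) (use assms in simp)
qed

end

section \<open>Modular behaviour of the Eisenstein series\<close>

lemma period_lattice_shift:
  assumes "w \<in> period_lattice \<tau>"
  shows "(\<lambda>x. x + w) ` period_lattice \<tau> = period_lattice \<tau>"
proof -
  obtain m n :: int where w: "w = of_int m * \<tau> + of_int n" using assms by (auto simp: period_lattice_def)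
  have plus: "x + w \<in> period_lattice \<tau>" if x: "x \<in> period_lattice \<tau>" for x
  proof -
    obtain m' n' :: int where "x = of_int m' * \<tau> + of_int n'" using x by (auto simp: period_lattice_def)
    then have "x + w = of_int (m' + m) * \<tau> + of_int (n' + n)" by (simp add: w algebra_simps)
    then show ?thesis unfolding period_lattice_def by blast
  qed
  have minus: "x - w \<in> period_lattice \<tau>" if x: "x \<in> period_lattice \<tau>" for x
  proof -
    obtain m' n' :: int where "x = of_int m' * \<tau> + of_int n'" using x by (auto simp: period_lattice_def)
    then have "x - w = of_int (m' - m) * \<tau> + of_int (n' - n)" by (simp add: w algebra_simps)
    then show ?thesis unfolding period_lattice_def by blast
  qed
  show ?thesis
  proof (intro equalityI subsetI)
    fix x assume "x \<in> period_lattice \<tau>"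
    then show "x \<in> (\<lambda>x. x + w) ` period_lattice \<tau>" using minus by (intro image_eqI[of _ _ "x - w"]) auto
  qed (use plus in auto)
qed

lemma phi_shift:
  assumes "w \<in> period_lattice \<tau>"
  shows "phi k (z + w) \<tau> = phi k z \<tau>"
proof -
  have "phi_sum k (z + w) \<tau> s = phi_sum k z \<tau> s" for s
  proof -
    have "(\<lambda>x. x + w) ` (period_lattice \<tau> - {- (z + w)}) = (\<lambda>x. x + w) ` period_lattice \<tau> - {- z}"
      by (subst image_set_diff) (auto simp: inj_def)
    then have "(\<lambda>x. x + w) ` (period_lattice \<tau> - {- (z + w)}) = period_lattice \<tau> - {- z}"
      by (simp only: period_lattice_shift[OF assms])
    then have "phi_sum k z \<tau> s = infsum ((\<lambda>\<omega>. inverse ((z + \<omega>) ^ k) * complex_of_real (norm (z + \<omega>)) powr (- s)) \<circ> (\<lambda>x. x + w))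
        (period_lattice \<tau> - {- (z + w)})"
      unfolding phi_sum_def by (subst infsum_reindex[symmetric]) (auto simp: inj_on_def)
    then show ?thesis by (simp add: phi_sum_def o_def add_ac)
  qed
  then show ?thesis by (simp add: phi_def)
qed

lemma period_lattice_moebius:
  assumes A: "A \<in> carrier SL2Z" and t: "\<tau> \<in> uhp"
  shows "period_lattice (moebius A \<tau>) = (\<lambda>\<omega>. \<omega> / automorphy_factor A \<tau>) ` period_lattice \<tau>"
proof -
  let ?j = "automorphy_factor A \<tau>"
  have j: "?j \<noteq> 0" by (rule automorphy_factor_nonzero[OF A t])
  have e: "of_int m * moebius A \<tau> + of_int n =
      (of_int (m * A$1$1 + n * A$2$1) * \<tau> + of_int (m * A$1$2 + n * A$2$2)) / ?j" for m n :: int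
  proof -
    have "(of_int m * moebius A \<tau> + of_int n) * ?j = of_int m * (moebius A \<tau> * ?j) + of_int n * ?j"
      by (simp add: algebra_simps)
    also have "moebius A \<tau> * ?j = of_int (A$1$1) * \<tau> + of_int (A$1$2)" using j by (simp add: moebius_def)
    finally have "(of_int m * moebius A \<tau> + of_int n) * ?j =
        of_int (m * A$1$1 + n * A$2$1) * \<tau> + of_int (m * A$1$2 + n * A$2$2)"
      by (simp add: automorphy_factor_def algebra_simps)
    then show ?thesis using j by (simp add: field_simps)
  qed
  show ?thesis
  proof (intro equalityI subsetI)
    fix x assume "x \<in> period_lattice (moebius A \<tau>)"
    then obtain m n :: int where "x = of_int m * moebius A \<tau> + of_int n" by (auto simp: period_lattice_def)
    then show "x \<in> (\<lambda>\<omega>. \<omega> / ?j) ` period_lattice \<tau>" unfolding e period_lattice_def by blast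
  next
    fix x assume "x \<in> (\<lambda>\<omega>. \<omega> / ?j) ` period_lattice \<tau>"
    then obtain m n :: int where x: "x = (of_int m * \<tau> + of_int n) / ?j" by (auto simp: period_lattice_def)
    have d: "A$1$1 * A$2$2 = 1 + A$1$2 * A$2$1" using A by (simp add: carrier_SL2Z)
    define m' n' where "m' = m * A$2$2 - n * A$2$1" and "n' = n * A$1$1 - m * A$1$2"
    have "m' * A$1$1 + n' * A$2$1 = m * (A$1$1 * A$2$2) - m * (A$1$2 * A$2$1)"
      by (simp add: m'_def n'_def algebra_simps)
    then have 1: "m' * A$1$1 + n' * A$2$1 = m" by (simp add: d distrib_left)
    have "m' * A$1$2 + n' * A$2$2 = n * (A$1$1 * A$2$2) - n * (A$1$2 * A$2$1)"
      by (simp add: m'_def n'_def algebra_simps)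
    then have 2: "m' * A$1$2 + n' * A$2$2 = n" by (simp add: d distrib_left)
    have "x = of_int m' * moebius A \<tau> + of_int n'" unfolding e 1 2 x ..
    then show "x \<in> period_lattice (moebius A \<tau>)" unfolding period_lattice_def by blast
  qed
qed

lemma phi_sum_moebius:
  assumes A: "A \<in> carrier SL2Z" and t: "\<tau> \<in> uhp"
  defines "j \<equiv> automorphy_factor A \<tau>"
  shows "phi_sum k (z / j) (moebius A \<tau>) s = j ^ k * complex_of_real (norm j) powr s * phi_sum k z \<tau> s"
proof -
  have j: "j \<noteq> 0" unfolding j_def by (rule automorphy_factor_nonzero[OF A t])
  have inj: "inj (\<lambda>\<omega>. \<omega> / j)" using j by (auto simp: inj_def)
  have S: "period_lattice (moebius A \<tau>) - {- (z / j)} = (\<lambda>\<omega>. \<omega> / j) ` (period_lattice \<tau> - {- z})"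
    unfolding period_lattice_moebius[OF A t] j_def[symmetric] using inj by (subst image_set_diff) auto
  have "inverse ((z / j + \<omega> / j) ^ k) * complex_of_real (norm (z / j + \<omega> / j)) powr (- s) =
      j ^ k * complex_of_real (norm j) powr s * (inverse ((z + \<omega>) ^ k) * complex_of_real (norm (z + \<omega>)) powr (- s))"
    if "\<omega> \<in> period_lattice \<tau> - {- z}" for \<omega>
  proof -
    have nz: "z + \<omega> \<noteq> 0" using that by (auto simp: add_eq_0_iff2 minus_equation_iff)
    have "z / j + \<omega> / j = (z + \<omega>) / j" by (simp add: add_divide_distrib)
    moreover have "complex_of_real (norm ((z + \<omega>) / j)) powr (- s) =
        complex_of_real (norm (z + \<omega>)) powr (- s) * complex_of_real (norm j) powr s"
    proof -
      have "complex_of_real (norm ((z + \<omega>) / j)) = complex_of_real (norm (z + \<omega>)) * complex_of_real (inverse (norm j))"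
        by (simp add: norm_mult norm_inverse divide_inverse)
      then have "complex_of_real (norm ((z + \<omega>) / j)) powr (- s) =
          complex_of_real (norm (z + \<omega>)) powr (- s) * complex_of_real (inverse (norm j)) powr (- s)"
        by (simp only:) (rule powr_times_real, auto)
      also have "complex_of_real (inverse (norm j)) powr (- s) = complex_of_real (norm j) powr s"
        using j by (simp add: powr_def Ln_of_real ln_inverse flip: of_real_inverse)
      finally show ?thesis .
    qed
    moreover have "inverse (((z + \<omega>) / j) ^ k) = j ^ k * inverse ((z + \<omega>) ^ k)"
      by (simp only: power_divide inverse_divide divide_inverse[of "j ^ k"])
    ultimately show ?thesis by (simp add: mult_ac)
  qed
  then have "phi_sum k (z / j) (moebius A \<tau>) s = (\<Sum>\<^sub>\<infinity>\<omega>\<in>period_lattice \<tau> - {- z}.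
      j ^ k * complex_of_real (norm j) powr s * (inverse ((z + \<omega>) ^ k) * complex_of_real (norm (z + \<omega>)) powr (- s)))"
    unfolding phi_sum_def S
    by (subst infsum_reindex) (auto simp: o_def intro!: inj_on_subset[OF inj] infsum_cong)
  then show ?thesis by (simp add: phi_sum_def infsum_cmult_right')
qed

text \<open>Besides the weight factor the series picks up the power \<open>s\<close> of the norm of
  the automorphy factor. That power is entire in \<open>s\<close> and equals 1 at
  \<open>s = 0\<close>, so it disappears from the continued value.\<close>

lemma (in torsion_point) phi_moebius:
  assumes A: "A \<in> carrier SL2Z" and k: "k > 0"
  shows "phi k (z0 / automorphy_factor A \<tau>) (moebius A \<tau>) = automorphy_factor A \<tau> ^ k * phi k z0 \<tau>"
proof -
  let ?j = "automorphy_factor A \<tau>"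
  have j: "?j \<noteq> 0" by (rule automorphy_factor_nonzero[OF A tau])
  have "phi k (z0 / ?j) (moebius A \<tau>) = (\<lambda>s. ?j ^ k * complex_of_real (norm ?j) powr s * phi_cont k s) 0"
  proof (rule phi_eqI[of "- 1"])
    show "(\<lambda>s. ?j ^ k * complex_of_real (norm ?j) powr s * phi_cont k s) holomorphic_on {s. - 1 < Re s}"
      unfolding powr_def using j by (auto intro!: holomorphic_intros phi_cont_holomorphic k)
  qed (auto simp: phi_sum_moebius[OF A tau] phi_cont_eq)
  then show ?thesis using j by (simp add: phi_eq_phi_cont[OF k])
qed

definition row_act :: "rat \<times> rat \<Rightarrow> int^2^2 \<Rightarrow> rat \<times> rat" where
  "row_act a A = (fst a * of_int (A$1$1) + snd a * of_int (A$2$1), fst a * of_int (A$1$2) + snd a * of_int (A$2$2))"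

lemma row_act_torsion:
  assumes "of_nat N * fst a \<in> \<int>" "of_nat N * snd a \<in> \<int>"
  shows "of_nat N * fst (row_act a A) \<in> \<int>" "of_nat N * snd (row_act a A) \<in> \<int>"
proof -
  have "of_nat N * fst (row_act a A) = of_nat N * fst a * of_int (A$1$1) + of_nat N * snd a * of_int (A$2$1)"
    "of_nat N * snd (row_act a A) = of_nat N * fst a * of_int (A$1$2) + of_nat N * snd a * of_int (A$2$2)"
    by (simp_all add: row_act_def algebra_simps)
  then show "of_nat N * fst (row_act a A) \<in> \<int>" "of_nat N * snd (row_act a A) \<in> \<int>"
    using assms by (auto intro!: Ints_add Ints_mult)
qed

lemma row_act_not_int:
  assumes A: "A \<in> carrier SL2Z" and a: "a \<notin> \<int> \<times> \<int>"
  shows "row_act a A \<notin> \<int> \<times> \<int>"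
proof
  assume "row_act a A \<in> \<int> \<times> \<int>"
  then have i: "fst (row_act a A) \<in> \<int>" "snd (row_act a A) \<in> \<int>" by (auto simp: mem_Times_iff)
  have d: "of_int (A$1$1) * of_int (A$2$2) - of_int (A$1$2) * of_int (A$2$1) = (1::rat)" by (rule SL2Z_det_of_int[OF A])
  have "fst a * (of_int (A$1$1) * of_int (A$2$2) - of_int (A$1$2) * of_int (A$2$1)) =
      fst (row_act a A) * of_int (A$2$2) - snd (row_act a A) * of_int (A$2$1)"
    by (simp add: row_act_def algebra_simps)
  then have 1: "fst a \<in> \<int>" using i unfolding d by (auto intro!: Ints_diff Ints_mult)
  have "snd a * (of_int (A$1$1) * of_int (A$2$2) - of_int (A$1$2) * of_int (A$2$1)) =
      snd (row_act a A) * of_int (A$1$1) - fst (row_act a A) * of_int (A$1$2)"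
    by (simp add: row_act_def algebra_simps)
  then have 2: "snd a \<in> \<int>" using i unfolding d by (auto intro!: Ints_diff Ints_mult)
  show False using 1 2 a by (auto simp: mem_Times_iff)
qed

lemma of_rat_eq_of_real: "(of_rat r :: complex) = of_real (of_rat r)"
proof -
  obtain p q where "r = of_int p / of_int q" by (metis Rat_cases Fract_of_int_quotient)
  then show ?thesis by (simp add: of_rat_divide)
qed

lemma Ints_of_rat_iff: "(of_rat r :: real) \<in> \<int> \<longleftrightarrow> r \<in> \<int>"
proof
  assume "(of_rat r :: real) \<in> \<int>"
  then obtain n where "of_rat r = real_of_int n" by (auto elim: Ints_cases)
  then have "(of_rat r :: real) = of_rat (of_int n)" by simp
  then have "r = of_int n" by (simp only: of_rat_eq_iff)
  then show "r \<in> \<int>" by simp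
next
  assume "r \<in> \<int>"
  then show "(of_rat r :: real) \<in> \<int>" by (auto elim!: Ints_cases)
qed

lemma torsion_point_rat:
  assumes "\<tau> \<in> uhp" "N > 0" "of_nat N * fst a \<in> \<int>" "of_nat N * snd a \<in> \<int>" "a \<notin> \<int> \<times> \<int>"
  shows "torsion_point \<tau> (of_rat (fst a)) (of_rat (snd a)) N"
proof
  have "real N * of_rat (fst a) = of_rat (of_nat N * fst a)" "real N * of_rat (snd a) = of_rat (of_nat N * snd a)"
    by (simp_all add: of_rat_mult)
  then show "real N * of_rat (fst a) \<in> \<int>" "real N * of_rat (snd a) \<in> \<int>"
    using assms by (simp_all only: Ints_of_rat_iff)
  show "\<not> ((of_rat (fst a) :: real) \<in> \<int> \<and> (of_rat (snd a) :: real) \<in> \<int>)"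
    using assms(5) by (auto simp: Ints_of_rat_iff mem_Times_iff)
qed (use assms in auto)

lemma eisenstein_slash:
  assumes A: "A \<in> carrier SL2Z" and t: "\<tau> \<in> uhp" and k: "k > 0" and N: "N > 0"
    "of_nat N * fst a \<in> \<int>" "of_nat N * snd a \<in> \<int>" "a \<notin> \<int> \<times> \<int>"
  shows "slash k (eisenstein k a) A \<tau> = eisenstein k (row_act a A) \<tau>"
proof -
  let ?b = "row_act a A" and ?j = "automorphy_factor A \<tau>"
  interpret torsion_point \<tau> "of_rat (fst ?b)" "of_rat (snd ?b)" N
    by (rule torsion_point_rat[OF t N(1) row_act_torsion[OF N(2,3)] row_act_not_int[OF A N(4)]])
  have j: "?j \<noteq> 0" by (rule automorphy_factor_nonzero[OF A t])
  have "(of_rat (fst a) * moebius A \<tau> + of_rat (snd a)) * ?j =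
     of_rat (fst a) * (moebius A \<tau> * ?j) + of_rat (snd a) * ?j" by (simp add: algebra_simps)
  also have "moebius A \<tau> * ?j = of_int (A$1$1) * \<tau> + of_int (A$1$2)" using j by (simp add: moebius_def)
  finally have "(of_rat (fst a) * moebius A \<tau> + of_rat (snd a)) * ?j = z0"
    by (simp add: row_act_def of_rat_add of_rat_mult of_rat_eq_of_real automorphy_factor_def algebra_simps)
  then have z: "of_rat (fst a) * moebius A \<tau> + of_rat (snd a) = z0 / ?j" using j by (simp add: field_simps)
  have "slash k (eisenstein k a) A \<tau> = phi k (z0 / ?j) (moebius A \<tau>) / ?j ^ k"
    using moebius_uhp[OF A t] by (simp add: slash_def eisenstein_def z)
  also have "\<dots> = phi k z0 \<tau>" unfolding phi_moebius[OF A k] using j by simp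
  finally show ?thesis using t by (simp add: eisenstein_def of_rat_eq_of_real)
qed

lemma eisenstein_shift:
  assumes "m \<in> \<int>" "n \<in> \<int>"
  shows "eisenstein k (fst a + m, snd a + n) = eisenstein k a"
proof
  fix \<tau>
  obtain m' n' :: int where mn: "m = of_int m'" "n = of_int n'" using assms by (auto elim!: Ints_cases)
  have "of_int m' * \<tau> + of_int n' \<in> period_lattice \<tau>" unfolding period_lattice_def by blast
  from phi_shift[OF this, of k "of_rat (fst a) * \<tau> + of_rat (snd a)"]
  show "eisenstein k (fst a + m, snd a + n) \<tau> = eisenstein k a \<tau>"
    by (simp add: eisenstein_def mn of_rat_add algebra_simps)
qed

text \<open>A matrix congruent to 1 modulo \<open>N\<close> moves \<open>a\<close> by an integer
  vector, which \<open>eisenstein_shift\<close> absorbs.\<close>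

lemma eisenstein_slash_invariant:
  assumes k: "k > 0" and N: "N > 0" "of_nat N * fst a \<in> \<int>" "of_nat N * snd a \<in> \<int>" "a \<notin> \<int> \<times> \<int>"
  shows "slash_invariant (principal_congruence_subgroup N) k (eisenstein k a)"
  unfolding slash_invariant_def
proof (intro ballI)
  fix A \<tau> assume A: "A \<in> principal_congruence_subgroup N" and t: "\<tau> \<in> uhp"
  obtain p q r s where e: "A$1$1 - 1 = int N * p" "A$1$2 = int N * q" "A$2$1 = int N * r" "A$2$2 - 1 = int N * s"
    using A unfolding principal_congruence_subgroup_iff by (auto elim!: dvdE)
  have e': "A$1$1 = 1 + int N * p" "A$2$2 = 1 + int N * s" using e by linarith+
  have "row_act a A = (fst a + (of_nat N * fst a * of_int p + of_nat N * snd a * of_int r),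
      snd a + (of_nat N * fst a * of_int q + of_nat N * snd a * of_int s))"
    by (simp add: row_act_def e(2,3) e' algebra_simps)
  then have "eisenstein k (row_act a A) = eisenstein k a"
    by (simp only:) (intro eisenstein_shift Ints_add Ints_mult[OF N(2) Ints_of_int] Ints_mult[OF N(3) Ints_of_int])
  moreover have "A \<in> carrier SL2Z" using A by (simp add: principal_congruence_subgroup_iff)
  ultimately show "slash k (eisenstein k a) A \<tau> = eisenstein k a \<tau>"
    using eisenstein_slash[OF _ t k N] by simp
qed

section \<open>Summation over rows\<close>

definition cexp2 :: "complex \<Rightarrow> complex" where
  "cexp2 z = exp (2 * of_real pi * \<i> * z)"

lemma cexp2_add: "cexp2 (z + w) = cexp2 z * cexp2 w"
  by (simp add: cexp2_def distrib_left exp_add)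

lemma cexp2_nonzero [simp]: "cexp2 z \<noteq> 0"
  by (simp add: cexp2_def)

lemma cexp2_eq_1_iff: "cexp2 z = 1 \<longleftrightarrow> z \<in> \<int>"
proof -
  have "cexp2 z = 1 \<longleftrightarrow> (\<exists>n::int. 2 * of_real pi * \<i> * z = of_int (2 * n) * of_real pi * \<i>)"
    unfolding cexp2_def exp_eq_1 by (auto simp: complex_eq_iff)
  also have "\<dots> \<longleftrightarrow> (\<exists>n::int. z = of_int n)" by auto
  finally show ?thesis by (auto elim!: Ints_cases)
qed

lemma cexp2_1 [simp]: "cexp2 1 = 1" "cexp2 0 = 1" "cexp2 (of_int n) = 1" "cexp2 (- 1) = 1"
  by (simp_all add: cexp2_eq_1_iff)

lemma norm_cexp2: "norm (cexp2 z) = exp (- 2 * pi * Im z)"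
  by (simp add: cexp2_def norm_exp_eq_Re)

text \<open>\<open>lam n\<close> is \<open>(x d/dx) ^ n\<close> applied to \<open>x / (1 - x)\<close>, that is, the sum of \<open>j ^ n x ^ j\<close> for \<open>norm x < 1\<close>.\<close>

primrec lam :: "nat \<Rightarrow> complex \<Rightarrow> complex" where
  "lam 0 = (\<lambda>x. x / (1 - x))"
| "lam (Suc n) = (\<lambda>x. x * deriv (lam n) x)"

lemma lam_holomorphic: "lam n holomorphic_on - {1}"
  by (induction n) (auto intro!: holomorphic_intros holomorphic_deriv)

lemma lam_0 [simp]: "lam n 0 = 0"
  by (cases n) auto

lemma lam_has_deriv: "x \<noteq> 1 \<Longrightarrow> (lam n has_field_derivative deriv (lam n) x) (at x)"
  by (rule holomorphic_derivI[OF lam_holomorphic]) auto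

lemma lam_comp_has_deriv:
  assumes "(f has_field_derivative c * f t) (at t)" "f t \<noteq> 1"
  shows "((\<lambda>t. lam n (f t)) has_field_derivative c * lam (Suc n) (f t)) (at t)"
  using DERIV_chain2[OF lam_has_deriv[OF assms(2)] assms(1)] by (simp add: mult_ac)

lemma lam_cexp2_has_deriv:
  assumes "cexp2 (a * t + b) \<noteq> 1"
  shows "((\<lambda>t. lam n (cexp2 (a * t + b))) has_field_derivative
     2 * of_real pi * \<i> * a * lam (Suc n) (cexp2 (a * t + b))) (at t)"
proof (rule lam_comp_has_deriv[where f = "\<lambda>t. cexp2 (a * t + b)"])
  show "((\<lambda>t. cexp2 (a * t + b)) has_field_derivative 2 * of_real pi * \<i> * a * cexp2 (a * t + b)) (at t)"
    unfolding cexp2_def by (auto intro!: derivative_eq_intros)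
qed (rule assms)

lemma lam_inverse:
  assumes "x \<noteq> 0" "x \<noteq> 1"
  shows "lam n (1 / x) = - (if n = 0 then 1 else 0) - (- 1) ^ n * lam n x"
  using assms
proof (induction n arbitrary: x)
  case 0
  then show ?case by (simp add: field_simps)
next
  case (Suc n)
  have x1: "1 / x \<noteq> 1" using Suc by auto
  have "((\<lambda>x. 1 / x) has_field_derivative (- (1 / x)) * (1 / x)) (at x)"
    using Suc.prems by (auto intro!: derivative_eq_intros simp: power2_eq_square)
  from DERIV_chain2[OF lam_has_deriv[OF x1, of n] this]
  have 1: "((\<lambda>x. lam n (1 / x)) has_field_derivative - (lam (Suc n) (1 / x) / x)) (at x)"
    by (simp add: mult_ac)
  have "((\<lambda>x. - (if n = 0 then 1 else 0) - (- 1) ^ n * lam n x) has_field_derivative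
      0 - (- 1) ^ n * deriv (lam n) x) (at x)"
    by (intro derivative_intros DERIV_cmult lam_has_deriv Suc.prems)
  then have "((\<lambda>x. lam n (1 / x)) has_field_derivative 0 - (- 1) ^ n * deriv (lam n) x) (at x)"
    by (rule has_field_derivative_transform_within_open[of _ _ _ "- {0, 1}"]) (use Suc in auto)
  with 1 have "- (lam (Suc n) (1 / x) / x) = 0 - (- 1) ^ n * deriv (lam n) x" by (rule DERIV_unique)
  then show ?case using Suc.prems by (simp add: field_simps)
qed

lemma lam_bound:
  assumes "\<rho> < 1"
  shows "\<exists>C\<ge>0. \<forall>x. norm x \<le> \<rho> \<longrightarrow> norm (lam n x) \<le> C * norm x"
proof -
  have "\<exists>g. continuous_on (cball 0 \<rho>) g \<and> (\<forall>x. lam n x = x * g x)"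
  proof (cases n)
    case 0
    then show ?thesis using assms
      by (intro exI[of _ "\<lambda>x. 1 / (1 - x)"]) (auto intro!: continuous_intros)
  next
    case (Suc m)
    have "deriv (lam m) holomorphic_on - {1}" by (intro holomorphic_deriv lam_holomorphic) auto
    then have "continuous_on (cball 0 \<rho>) (deriv (lam m))"
      using assms by (auto intro!: holomorphic_on_imp_continuous_on elim: holomorphic_on_subset)
    then show ?thesis using Suc by auto
  qed
  then obtain g where g: "continuous_on (cball 0 \<rho>) g" "\<And>x. lam n x = x * g x" by blast
  have "bounded (g ` cball 0 \<rho>)" using g by (intro compact_imp_bounded compact_continuous_image) auto
  then obtain C where "\<forall>y\<in>g ` cball 0 \<rho>. norm y \<le> C" unfolding bounded_iff by blast
  then have C: "norm (g x) \<le> C" if "norm x \<le> \<rho>" for x using that by auto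
  have "norm (lam n x) \<le> \<bar>C\<bar> * norm x" if "norm x \<le> \<rho>" for x
    unfolding g(2) norm_mult using C[OF that] by (subst mult.commute) (intro mult_right_mono, auto)
  then show ?thesis by (intro exI[of _ "\<bar>C\<bar>"]) auto
qed

lemma lam_1: "x \<noteq> 1 \<Longrightarrow> lam 1 x = x / (1 - x)\<^sup>2"
proof -
  assume x: "x \<noteq> 1"
  then have "((\<lambda>x. x / (1 - x)) has_field_derivative 1 / (1 - x)\<^sup>2) (at x)"
    by (auto intro!: derivative_eq_intros simp: power2_eq_square)
  then show ?thesis by (simp add: DERIV_imp_deriv)
qed

section \<open>Reflection formulas and the sum over one row\<close>

lemma not_Ints_reflect: "\<xi> \<notin> \<int> \<Longrightarrow> \<xi> \<notin> \<int>\<^sub>\<le>\<^sub>0 \<and> 1 - \<xi> \<notin> \<int>\<^sub>\<le>\<^sub>0" for \<xi> :: complex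
proof -
  assume x: "\<xi> \<notin> \<int>"
  have "1 - \<xi> \<notin> \<int>"
  proof
    assume "1 - \<xi> \<in> \<int>"
    from Ints_diff[OF Ints_1 this] show False using x by simp
  qed
  then show ?thesis using x nonpos_Ints_Int by blast
qed

text \<open>The logarithmic derivative of the reflection formula for \<open>Gamma\<close>, with the
  cotangent rewritten in exponentials.\<close>

lemma Digamma_reflection:
  assumes x: "\<xi> \<notin> \<int>"
  shows "Digamma \<xi> - Digamma (1 - \<xi>) = 2 * of_real pi * \<i> * (lam 0 (cexp2 \<xi>) + 1 / 2)"
proof -
  have np: "\<xi> \<notin> \<int>\<^sub>\<le>\<^sub>0" "1 - \<xi> \<notin> \<int>\<^sub>\<le>\<^sub>0" using not_Ints_reflect[OF x] by auto
  have s: "sin (of_real pi * \<xi>) \<noteq> 0"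
    using x sin_eq_0[of "of_real pi * \<xi>"] by (auto simp: mult.commute)
  have "((\<lambda>z. Gamma z * Gamma (1 - z)) has_field_derivative
      Gamma \<xi> * (Gamma (1 - \<xi>) * Digamma (1 - \<xi>) * (- 1)) + Gamma \<xi> * Digamma \<xi> * Gamma (1 - \<xi>)) (at \<xi>)"
    using np by (auto intro!: derivative_eq_intros)
  moreover have "(\<lambda>z::complex. Gamma z * Gamma (1 - z)) = (\<lambda>z. of_real pi / sin (of_real pi * z))"
    by (simp add: Gamma_reflection_complex)
  moreover have "((\<lambda>z. of_real pi / sin (of_real pi * z)) has_field_derivative
      - (of_real pi * (of_real pi * cos (of_real pi * \<xi>))) / (sin (of_real pi * \<xi>))\<^sup>2) (at \<xi>)"
    using s by (auto intro!: derivative_eq_intros simp: power2_eq_square)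
  ultimately have "Gamma \<xi> * (Gamma (1 - \<xi>) * Digamma (1 - \<xi>) * (- 1)) + Gamma \<xi> * Digamma \<xi> * Gamma (1 - \<xi>)
      = - (of_real pi * (of_real pi * cos (of_real pi * \<xi>))) / (sin (of_real pi * \<xi>))\<^sup>2"
    using DERIV_unique by metis
  then have "(Gamma \<xi> * Gamma (1 - \<xi>)) * (Digamma \<xi> - Digamma (1 - \<xi>)) =
      - (of_real pi * (of_real pi * cos (of_real pi * \<xi>))) / (sin (of_real pi * \<xi>))\<^sup>2"
    by (simp add: algebra_simps)
  then have D: "Digamma \<xi> - Digamma (1 - \<xi>) = - (of_real pi * cos (of_real pi * \<xi>) / sin (of_real pi * \<xi>))"
  proof -
    have *: "D = - (P * C / S)" if "P / S * D = - (P * (P * C)) / S\<^sup>2" "P \<noteq> 0" "S \<noteq> 0" for D P C S :: complex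
    proof -
      have "D = (P / S * D) * (S / P)" using that(2,3) by simp
      also have "\<dots> = (- (P * (P * C)) / S\<^sup>2) * (S / P)" by (simp only: that(1))
      also have "\<dots> = - (P * C / S)" using that(2,3) by (simp add: power2_eq_square)
      finally show ?thesis .
    qed
    from \<open>(Gamma \<xi> * Gamma (1 - \<xi>)) * (Digamma \<xi> - Digamma (1 - \<xi>)) = _\<close>
    show ?thesis unfolding Gamma_reflection_complex by (rule *) (use s in auto)
  qed
  define t where "t = exp (\<i> * (of_real pi * \<xi>))"
  have t: "t \<noteq> 0" by (simp add: t_def)
  have tt: "cexp2 \<xi> = t * t" unfolding cexp2_def t_def by (simp flip: exp_add) (simp add: algebra_simps)
  have t1: "t * t \<noteq> 1" using x tt cexp2_eq_1_iff by metis
  have i: "exp (- (\<i> * (of_real pi * \<xi>))) = 1 / t" by (simp add: t_def exp_minus inverse_eq_divide)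
  have sn: "sin (of_real pi * \<xi>) = (t - 1 / t) / (2 * \<i>)" and cs: "cos (of_real pi * \<xi>) = (t + 1 / t) / 2"
    unfolding sin_exp_eq cos_exp_eq t_def[symmetric] by (simp_all add: i)
  have "cos (of_real pi * \<xi>) / sin (of_real pi * \<xi>) = \<i> * (t * t + 1) / (t * t - 1)"
    unfolding sn cs using t t1 by (simp add: field_simps)
  then have "Digamma \<xi> - Digamma (1 - \<xi>) = - (of_real pi * (\<i> * (t * t + 1) / (t * t - 1)))"
    unfolding D by (simp only: times_divide_eq_right[symmetric])
  also have "\<dots> = 2 * of_real pi * \<i> * (lam 0 (cexp2 \<xi>) + 1 / 2)"
  proof -
    have "t * t - 1 \<noteq> 0" "1 - t * t \<noteq> 0" using t1 by auto
    then show ?thesis unfolding tt by (simp add: divide_simps) (simp add: algebra_simps)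
  qed
  finally show ?thesis .
qed

lemma Polygamma_reflection:
  assumes x: "\<xi> \<notin> \<int>"
  shows "Polygamma n \<xi> - (- 1) ^ n * Polygamma n (1 - \<xi>) =
     (2 * of_real pi * \<i>) ^ Suc n * (lam n (cexp2 \<xi>) + (if n = 0 then 1 / 2 else 0))"
  using x
proof (induction n arbitrary: \<xi>)
  case 0
  then show ?case using Digamma_reflection by simp
next
  case (Suc n)
  have op: "open (- \<int> :: complex set)" by (simp add: closed_Ints open_Compl)
  have np: "\<xi> \<notin> \<int>\<^sub>\<le>\<^sub>0" "1 - \<xi> \<notin> \<int>\<^sub>\<le>\<^sub>0" using not_Ints_reflect[OF Suc.prems] by auto
  have 1: "((\<lambda>\<xi>. Polygamma n \<xi> - (- 1) ^ n * Polygamma n (1 - \<xi>)) has_field_derivative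
      Polygamma (Suc n) \<xi> - (- 1) ^ n * (Polygamma (Suc n) (1 - \<xi>) * (- 1))) (at \<xi>)"
    using np by (auto intro!: derivative_eq_intros)
  have "cexp2 (1 * \<xi> + 0) \<noteq> 1" using Suc.prems by (simp add: cexp2_eq_1_iff)
  from lam_cexp2_has_deriv[OF this, of n]
  have "((\<lambda>\<xi>. (2 * of_real pi * \<i>) ^ Suc n * (lam n (cexp2 \<xi>) + (if n = 0 then 1 / 2 else 0))) has_field_derivative
     (2 * of_real pi * \<i>) ^ Suc n * (2 * of_real pi * \<i> * lam (Suc n) (cexp2 \<xi>) + 0)) (at \<xi>)"
    by (intro DERIV_cmult DERIV_add DERIV_const) simp
  then have "((\<lambda>\<xi>. Polygamma n \<xi> - (- 1) ^ n * Polygamma n (1 - \<xi>)) has_field_derivative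
     (2 * of_real pi * \<i>) ^ Suc n * (2 * of_real pi * \<i> * lam (Suc n) (cexp2 \<xi>) + 0)) (at \<xi>)"
    by (rule has_field_derivative_transform_within_open[OF _ op]) (use Suc in auto)
  with 1 have "Polygamma (Suc n) \<xi> - (- 1) ^ n * (Polygamma (Suc n) (1 - \<xi>) * (- 1)) =
     (2 * of_real pi * \<i>) ^ Suc n * (2 * of_real pi * \<i> * lam (Suc n) (cexp2 \<xi>) + 0)" by (rule DERIV_unique)
  then show ?case by (simp add: mult_ac del: lam.simps)
qed

lemma sum_int_symmetric:
  fixes f :: "int \<Rightarrow> 'a::comm_monoid_add"
  shows "(\<Sum>n\<in>{- int K..int K}. f n) = (\<Sum>n<Suc K. f (int n)) + (\<Sum>n<K. f (- 1 - int n))"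
proof (induction K)
  case (Suc K)
  have "{- int (Suc K)..int (Suc K)} = insert (int (Suc K)) (insert (- 1 - int K) {- int K..int K})" by auto
  then show ?case by (simp add: Suc add_ac)
qed auto

text \<open>The terms with \<open>n \<ge> 0\<close> form a Polygamma series at \<open>\<xi>\<close>,
  those with \<open>n < 0\<close> one at \<open>1 - \<xi>\<close>, and reflection combines them into
  the Lipschitz formula. For \<open>k = 1\<close> convergence is only conditional, hence the
  symmetric range.\<close>

lemma row_sum_limit:
  assumes k: "k > 0" and x: "\<xi> \<notin> \<int>"
  shows "(\<lambda>K. \<Sum>n\<in>{- int K..int K}. inverse ((\<xi> + of_int n) ^ k)) \<longlonglongrightarrow>
     (- 2 * of_real pi * \<i>) ^ k / fact (k - 1) * (lam (k - 1) (cexp2 \<xi>) + (if k = 1 then 1 / 2 else 0))"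
proof -
  have x0: "\<xi> \<noteq> 0" "1 - \<xi> \<noteq> 0" using x by (auto simp: Ints_def)
  define a b where "a n = inverse ((\<xi> + of_nat n) ^ k)" and "b n = inverse ((1 - \<xi> + of_nat n) ^ k)" for n
  have S: "(\<Sum>n\<in>{- int K..int K}. inverse ((\<xi> + of_int n) ^ k)) = (\<Sum>n<Suc K. a n) + (- 1) ^ k * (\<Sum>n<K. b n)" for K
  proof -
    have "inverse ((\<xi> + of_int (- 1 - int n)) ^ k) = (- 1) ^ k * b n" for n
    proof -
      have "\<xi> + of_int (- 1 - int n) = (- 1) * (1 - \<xi> + of_nat n)" by (simp add: algebra_simps)
      then have "inverse ((\<xi> + of_int (- 1 - int n)) ^ k) = inverse ((- 1) ^ k * (1 - \<xi> + of_nat n) ^ k)"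
        by (simp only: power_mult_distrib)
      also have "\<dots> = (- 1) ^ k * b n" by (cases "even k") (simp_all add: b_def)
      finally show ?thesis .
    qed
    then show ?thesis unfolding sum_int_symmetric sum_distrib_left by (simp add: a_def)
  qed
  obtain m where m: "k = Suc m" using k by (cases k) auto
  have c: "(- 2 * of_real pi * \<i>) ^ k = (- 1) ^ k * (2 * of_real pi * \<i>) ^ k"
    by (simp only: power_mult_distrib[symmetric]) simp
  note refl = Polygamma_reflection[OF x, of m]
  show ?thesis
  proof (cases "m = 0")
    case True
    then have k1: "k = 1" using m by simp
    have A: "(\<lambda>K. of_real (ln (real (Suc K))) - (\<Sum>n<Suc K. a n)) \<longlonglongrightarrow> Digamma \<xi>"
      using LIMSEQ_Suc[OF Digamma_LIMSEQ[OF x0(1)]] by (simp add: a_def k1)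
    have B: "(\<lambda>K. of_real (ln (real (Suc K))) - (\<Sum>n<Suc K. b n)) \<longlonglongrightarrow> Digamma (1 - \<xi>)"
      using LIMSEQ_Suc[OF Digamma_LIMSEQ[OF x0(2)]] by (simp add: b_def k1)
    have b0: "b \<longlonglongrightarrow> 0"
    proof -
      have "filterlim (\<lambda>n. of_nat n + (1 - \<xi>)) at_infinity sequentially"
        by (rule tendsto_add_filterlim_at_infinity'[OF tendsto_of_nat tendsto_const])
      then have "(\<lambda>n. inverse (of_nat n + (1 - \<xi>))) \<longlonglongrightarrow> 0" by (rule filterlim_compose[OF tendsto_inverse_0])
      then show ?thesis by (simp add: b_def[abs_def] k1 add_ac)
    qed
    \<comment> \<open>The two halves have \<open>K + 1\<close> and \<open>K\<close> terms. Padding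
      the second one gives both the same logarithm, which cancels, at the cost of the null sequence
      \<open>b\<close>.\<close>
    have "(\<lambda>K. (of_real (ln (real (Suc K))) - (\<Sum>n<Suc K. b n)) - (of_real (ln (real (Suc K))) - (\<Sum>n<Suc K. a n)) + b K)
        \<longlonglongrightarrow> Digamma (1 - \<xi>) - Digamma \<xi> + 0"
      by (intro tendsto_add tendsto_diff A B b0)
    moreover have "Digamma (1 - \<xi>) - Digamma \<xi> + 0 =
       (- 2 * of_real pi * \<i>) ^ k / fact (k - 1) * (lam (k - 1) (cexp2 \<xi>) + (if k = 1 then 1 / 2 else 0))"
      using Digamma_reflection[OF x] unfolding k1 by (simp del: lam.simps add: algebra_simps)
    moreover have "(\<Sum>n<Suc K. a n) + (- 1) ^ k * (\<Sum>n<K. b n) =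
        (of_real (ln (real (Suc K))) - (\<Sum>n<Suc K. b n)) - (of_real (ln (real (Suc K))) - (\<Sum>n<Suc K. a n)) + b K" for K
      by (simp add: k1)
    ultimately show ?thesis unfolding S by (simp only:)
  next
    case False
    have A: "a sums (Polygamma m \<xi> / ((- 1) ^ k * fact m))"
      and B: "b sums (Polygamma m (1 - \<xi>) / ((- 1) ^ k * fact m))"
    proof -
      have P: "Polygamma m z / ((- 1) ^ k * fact m) = (\<Sum>n. inverse ((z + of_nat n) ^ Suc m))" for z :: complex
        using False m by (simp add: Polygamma_def)
      have sm: "summable (\<lambda>n. inverse ((z + of_nat n) ^ Suc m))" if "z \<noteq> 0" for z :: complex
        using Polygamma_converges'[OF that, of "Suc m"] False by simp
      show "a sums (Polygamma m \<xi> / ((- 1) ^ k * fact m))" "b sums (Polygamma m (1 - \<xi>) / ((- 1) ^ k * fact m))"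
        unfolding P unfolding a_def[abs_def] b_def[abs_def] m by (intro summable_sums sm x0)+
    qed
    have "(\<lambda>K. (\<Sum>n<Suc K. a n) + (- 1) ^ k * (\<Sum>n<K. b n)) \<longlonglongrightarrow>
        Polygamma m \<xi> / ((- 1) ^ k * fact m) + (- 1) ^ k * (Polygamma m (1 - \<xi>) / ((- 1) ^ k * fact m))"
      using A B by (intro tendsto_add tendsto_mult tendsto_const LIMSEQ_Suc) (auto simp: sums_def)
    also have "Polygamma m \<xi> / ((- 1) ^ k * fact m) + (- 1) ^ k * (Polygamma m (1 - \<xi>) / ((- 1) ^ k * fact m))
       = (- 1) ^ k / fact m * (Polygamma m \<xi> - (- 1) ^ m * Polygamma m (1 - \<xi>))"
      by (cases "even m") (simp_all add: m field_simps)
    also have "\<dots> = (- 2 * of_real pi * \<i>) ^ k / fact (k - 1) * (lam (k - 1) (cexp2 \<xi>) + (if k = 1 then 1 / 2 else 0))"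
      unfolding refl c using m False by simp
    finally show ?thesis unfolding S .
  qed
qed

lemma has_sum_int_symmetric:
  assumes "(f has_sum S) (UNIV :: int set)"
  shows "(\<lambda>K. \<Sum>n\<in>{- int K..int K}. f n) \<longlonglongrightarrow> S"
proof -
  have "filterlim (\<lambda>K. {- int K..int K}) (finite_subsets_at_top UNIV) sequentially"
    unfolding filterlim_finite_subsets_at_top
  proof safe
    fix X :: "int set" assume X: "finite X"
    obtain M where M: "\<And>x. x \<in> X \<Longrightarrow> \<bar>x\<bar> \<le> M"
      using finite_imageI[OF X, of abs] by (metis Max_ge imageI)
    show "\<forall>\<^sub>F K in sequentially. finite {- int K..int K} \<and> X \<subseteq> {- int K..int K} \<and> {- int K..int K} \<subseteq> UNIV"
      using eventually_ge_at_top[of "nat M"]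
    proof eventually_elim
      case (elim K)
      have "\<bar>x\<bar> \<le> int K" if "x \<in> X" for x using M[OF that] elim by linarith
      then show ?case by (auto simp: abs_le_iff minus_le_iff)
    qed
  qed
  from filterlim_compose[OF assms[unfolded has_sum_def] this] show ?thesis .
qed

text \<open>The telescoped summand is absolutely summable, but the inverse powers of which it is
  composed need not be. Symmetric partial sums give each of these pieces a limit of its own.\<close>

lemma double_sum_limit:
  fixes f :: "int \<times> int \<Rightarrow> complex"
  assumes sm: "f summable_on UNIV"
    and row: "\<And>m. (\<lambda>K. \<Sum>n\<in>{- int K..int K}. f (m, n)) \<longlonglongrightarrow> r m"
    and col: "(\<lambda>K. \<Sum>m\<in>{- int K..int K}. r m) \<longlonglongrightarrow> S"
  shows "infsum f UNIV = S"
proof -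
  have sm': "(\<lambda>(m, n). f (m, n)) summable_on UNIV \<times> UNIV" using sm by simp
  have r: "infsum (\<lambda>n. f (m, n)) UNIV = r m" for m
  proof -
    have "(\<lambda>n. f (m, n)) summable_on UNIV" using summable_on_SigmaD1[OF sm'] by simp
    from has_sum_int_symmetric[OF has_sum_infsum[OF this]] row[of m] show ?thesis by (rule LIMSEQ_unique)
  qed
  have "r summable_on UNIV" using summable_on_Sigma_banach[OF sm'] by (simp add: r)
  from has_sum_int_symmetric[OF has_sum_infsum[OF this]] col have "infsum r UNIV = S" by (rule LIMSEQ_unique)
  moreover have "infsum r UNIV = infsum f UNIV" using infsum_Sigma'_banach[OF sm'] by (simp add: r)
  ultimately show ?thesis by simp
qed

section \<open>Lambert series\<close>

text \<open>One statement for both variables: \<open>g t = 1 / t\<close> and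
  \<open>\<kappa> m = 1\<close> give the derivative in \<open>x\<close>, while
  \<open>g t = 1\<close> and \<open>\<kappa> m = 2 * pi * \<i> * (\<alpha> + m + 1)\<close> give the
  one in \<open>\<tau>\<close>. The geometric bound is local, and it tolerates weights
  \<open>c m\<close> of linear growth.\<close>

lemma lam_series_has_deriv:
  fixes c \<kappa> :: "nat \<Rightarrow> complex" and f :: "nat \<Rightarrow> complex \<Rightarrow> complex"
  assumes S: "open S"
    and der: "\<And>m t. t \<in> S \<Longrightarrow> (f m has_field_derivative \<kappa> m * g t * f m t) (at t)"
    and g: "\<And>t. t \<in> S \<Longrightarrow> g t \<noteq> 0"
    and bd: "\<And>t. t \<in> S \<Longrightarrow> \<exists>d>0. \<exists>\<rho> r. \<rho> < 1 \<and> 0 \<le> r \<and> r < 1 \<and> (\<forall>m. \<forall>y\<in>ball t d \<inter> S. norm (f m y) \<le> \<rho> * r ^ m)"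
    and c: "\<And>m. norm (c m) \<le> real (Suc m)" and t: "t \<in> S"
  shows "summable (\<lambda>m. c m * lam n (f m t))" "summable (\<lambda>m. c m * \<kappa> m * lam (Suc n) (f m t))"
    "((\<lambda>t. \<Sum>m. c m * lam n (f m t)) has_field_derivative g t * (\<Sum>m. c m * \<kappa> m * lam (Suc n) (f m t))) (at t)"
proof -
  have small: "norm (f m y) < 1" if "y \<in> S" for m y
  proof -
    obtain d \<rho> r where b: "d > 0" "\<rho> < 1" "0 \<le> r" "r < 1" "\<And>m z. z \<in> ball y d \<inter> S \<Longrightarrow> norm (f m z) \<le> \<rho> * r ^ m"
      using bd[OF \<open>y \<in> S\<close>] by blast
    have f: "norm (f m y) \<le> \<rho> * r ^ m" using b \<open>y \<in> S\<close> by simp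
    also have "\<dots> < 1"
    proof (cases "\<rho> \<ge> 0")
      case True
      have "\<rho> * r ^ m \<le> \<rho> * 1" using b True by (intro mult_left_mono power_le_one) auto
      then show ?thesis using b by simp
    next
      case False
      then have "\<rho> * r ^ m \<le> 0" using b by (simp add: mult_nonpos_nonneg)
      then show ?thesis by simp
    qed
    finally show ?thesis .
  qed
  have "\<exists>G G'. \<forall>x\<in>S. ((\<lambda>m. c m * lam n (f m x)) sums G x) \<and> ((\<lambda>m. c m * (\<kappa> m * g x * lam (Suc n) (f m x))) sums G' x) \<and>
      (G has_field_derivative G' x) (at x)"
  proof (rule series_and_derivative_comparison_local[OF S])
    fix m x assume x: "x \<in> S"
    have "f m x \<noteq> 1" using small[OF x, of m] by auto
    then show "((\<lambda>x. c m * lam n (f m x)) has_field_derivative c m * (\<kappa> m * g x * lam (Suc n) (f m x))) (at x)"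
      by (intro DERIV_cmult lam_comp_has_deriv der x)
  next
    fix x assume x: "x \<in> S"
    obtain d \<rho> r where b: "d > 0" "\<rho> < 1" "0 \<le> r" "r < 1" "\<And>m z. z \<in> ball x d \<inter> S \<Longrightarrow> norm (f m z) \<le> \<rho> * r ^ m"
      using bd[OF x] by blast
    define \<rho>' where "\<rho>' = max \<rho> 0"
    obtain C where C: "C \<ge> 0" "\<And>z. norm z \<le> \<rho>' \<Longrightarrow> norm (lam n z) \<le> C * norm z"
      using lam_bound[of \<rho>' n] b by (auto simp: \<rho>'_def)
    define h where "h m = real (Suc m) * (C * (\<rho>' * r ^ m))" for m
    have "summable (\<lambda>m. real (Suc m) * r ^ m)"
      using b geometric_deriv_sums[of r] by (simp add: sums_iff)
    then have "summable h"
      unfolding h_def using summable_mult[of _ "C * \<rho>'"] by (simp add: mult_ac)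
    moreover have "norm (c m * lam n (f m y)) \<le> h m" if y: "y \<in> ball x d \<inter> S" for m y
    proof -
      have 1: "norm (f m y) \<le> \<rho>' * r ^ m"
        using b(5)[OF y, of m] mult_right_mono[of \<rho> \<rho>' "r ^ m"] b(3) by (simp add: \<rho>'_def)
      also have "\<dots> \<le> \<rho>' * 1" using b by (intro mult_left_mono power_le_one) (auto simp: \<rho>'_def)
      finally have "norm (lam n (f m y)) \<le> C * norm (f m y)" by (intro C) simp
      also have "\<dots> \<le> C * (\<rho>' * r ^ m)" using 1 C(1) by (rule mult_left_mono)
      finally show ?thesis unfolding norm_mult h_def using c by (intro mult_mono) auto
    qed
    ultimately show "\<exists>d h. 0 < d \<and> summable h \<and> (\<forall>\<^sub>F m in sequentially. \<forall>y\<in>ball x d \<inter> S. norm (c m * lam n (f m y)) \<le> h m)"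
      using b(1) by (intro exI[of _ d] exI[of _ h]) auto
  qed
  then obtain G G' where G: "\<And>x. x \<in> S \<Longrightarrow> (\<lambda>m. c m * lam n (f m x)) sums G x"
    "\<And>x. x \<in> S \<Longrightarrow> (\<lambda>m. c m * (\<kappa> m * g x * lam (Suc n) (f m x))) sums G' x"
    "\<And>x. x \<in> S \<Longrightarrow> (G has_field_derivative G' x) (at x)" by blast
  show "summable (\<lambda>m. c m * lam n (f m t))" using G(1)[OF t] by (simp add: sums_iff)
  have e: "(\<lambda>m. c m * (\<kappa> m * g t * lam (Suc n) (f m t))) = (\<lambda>m. g t * (c m * \<kappa> m * lam (Suc n) (f m t)))"
    by (auto simp: mult_ac)
  have "(\<lambda>m. c m * \<kappa> m * lam (Suc n) (f m t)) sums (G' t / g t)"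
    using G(2)[OF t] unfolding e using g[OF t] sums_mult_D[of "g t"] by fastforce
  then show sm: "summable (\<lambda>m. c m * \<kappa> m * lam (Suc n) (f m t))"
    and "((\<lambda>t. \<Sum>m. c m * lam n (f m t)) has_field_derivative g t * (\<Sum>m. c m * \<kappa> m * lam (Suc n) (f m t))) (at t)"
    using has_field_derivative_transform_within_open[OF G(3)[OF t] S t, of "\<lambda>t. \<Sum>m. c m * lam n (f m t)"] G(1) g[OF t]
    by (auto simp: sums_iff simp del: lam.simps)
qed

text \<open>With the weights \<open>wt1\<close> the terms are the rows of the lattice with index
  \<open>m + 1\<close>. The weights \<open>wtS\<close> arise when \<open>q\<close> is
  differentiated.\<close>

definition LA :: "(nat \<Rightarrow> complex) \<Rightarrow> nat \<Rightarrow> complex \<Rightarrow> complex \<Rightarrow> complex" where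
  "LA c n q x = (\<Sum>m. c m * lam n (x * q ^ Suc m))"

abbreviation "wt1 \<equiv> (\<lambda>m. 1 :: complex)"
abbreviation "wtS \<equiv> (\<lambda>m. of_nat (Suc m) :: complex)"

locale nome =
  fixes q :: complex
  assumes q: "q \<noteq> 0" "norm q < 1"
begin

lemma LA_facts:
  assumes c: "\<And>m. norm (c m) \<le> real (Suc m)" and x: "x \<noteq> 0" "norm (x * q) < 1"
  shows "summable (\<lambda>m. c m * lam n (x * q ^ Suc m))"
    "(LA c n q has_field_derivative LA c (Suc n) q x / x) (at x)"
proof -
  let ?S = "{x. norm (x * q) < 1} - {0}"
  have S: "open ?S"
    by (intro open_Diff open_Collect_less continuous_intros closed_singleton)
  have bd: "\<exists>d>0. \<exists>\<rho> r. \<rho> < 1 \<and> 0 \<le> r \<and> r < 1 \<and> (\<forall>m. \<forall>y\<in>ball t d \<inter> ?S. norm (y * q ^ Suc m) \<le> \<rho> * r ^ m)"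
    if t: "t \<in> ?S" for t
  proof -
    define \<rho> where "\<rho> = (norm (t * q) + 1) / 2"
    have \<rho>: "norm (t * q) < \<rho>" "\<rho> < 1" using t by (auto simp: \<rho>_def)
    define d where "d = (\<rho> - norm (t * q)) / norm q"
    have "norm (y * q ^ Suc m) \<le> \<rho> * norm q ^ m" if "y \<in> ball t d" for y m
    proof -
      have "norm (y - t) \<le> d" using that by (simp add: dist_norm norm_minus_commute)
      then have "norm (y - t) * norm q \<le> \<rho> - norm (t * q)" using q by (simp add: d_def field_simps)
      moreover have "y * q = t * q + (y - t) * q" by (simp add: algebra_simps)
      then have "norm (y * q) \<le> norm (t * q) + norm (y - t) * norm q"
        by (metis norm_mult norm_triangle_ineq)
      ultimately have "norm (y * q) \<le> \<rho>" by linarith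
      then have "norm (y * q) * norm q ^ m \<le> \<rho> * norm q ^ m" by (rule mult_right_mono) auto
      then show ?thesis by (simp add: norm_mult norm_power)
    qed
    moreover have "d > 0" using \<rho> q by (simp add: d_def)
    ultimately show ?thesis using \<rho> q
      by (intro exI[of _ d] exI[of _ \<rho>] exI[of _ "norm q"] conjI allI ballI) auto
  qed
  have der: "((\<lambda>x. x * q ^ Suc m) has_field_derivative 1 * (1 / t) * (t * q ^ Suc m)) (at t)" if "t \<in> ?S" for m t
    using that by (auto intro!: derivative_eq_intros)
  have xS: "x \<in> ?S" using x by auto
  note L = lam_series_has_deriv[OF S der _ bd c xS]
  show "summable (\<lambda>m. c m * lam n (x * q ^ Suc m))" by (rule L) auto
  have "((\<lambda>t. \<Sum>m. c m * lam n (t * q ^ Suc m)) has_field_derivative 1 / x * (\<Sum>m. c m * 1 * lam (Suc n) (x * q ^ Suc m))) (at x)"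
    by (rule L) auto
  then show "(LA c n q has_field_derivative LA c (Suc n) q x / x) (at x)"
    by (simp add: LA_def[abs_def] del: lam.simps power_Suc)
qed

lemma wt_bounds: "norm (wt1 m) \<le> real (Suc m)" "norm (wtS m) \<le> real (Suc m)"
  by (simp_all del: of_nat_Suc)

lemmas LA1 = LA_facts[of wt1, OF wt_bounds(1)]
lemmas LAS = LA_facts[of wtS, OF wt_bounds(2)]

lemma LA_inverse_deriv:
  assumes c: "\<And>m. norm (c m) \<le> real (Suc m)" and x: "x \<noteq> 0" "norm (q / x) < 1"
  shows "((\<lambda>x. LA c n q (1 / x)) has_field_derivative - (LA c (Suc n) q (1 / x) / x)) (at x)"
proof -
  have d: "((\<lambda>x. 1 / x) has_field_derivative - (1 / x) * (1 / x)) (at x)"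
    using x by (auto intro!: derivative_eq_intros simp: power2_eq_square)
  have "1 / x \<noteq> 0" "norm (1 / x * q) < 1" using x by (auto simp: norm_divide norm_mult)
  from DERIV_chain2[OF LA_facts(2)[OF c this] d] show ?thesis using x by (simp add: divide_simps)
qed

lemma LA_shift:
  assumes x: "x \<noteq> 0" "norm (x * q) < 1"
  shows "LA wt1 n q (q * x) = LA wt1 n q x - lam n (x * q)"
    "LA wtS n q (q * x) = LA wtS n q x - LA wt1 n q x"
proof -
  have e: "q * x * q ^ Suc m = x * q ^ Suc (Suc m)" for m by simp
  show "LA wt1 n q (q * x) = LA wt1 n q x - lam n (x * q)"
    unfolding LA_def e using suminf_split_head[OF LA1(1)[OF x, of n]] by simp
  have S: "summable (\<lambda>m. of_nat m * lam n (x * q ^ Suc m))"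
    using summable_diff[OF LAS(1)[OF x, of n] LA1(1)[OF x, of n]] by (simp add: algebra_simps)
  have "LA wtS n q (q * x) = (\<Sum>m. of_nat m * lam n (x * q ^ Suc m))"
    unfolding LA_def e using suminf_split_head[OF S] by simp
  also have "\<dots> = LA wtS n q x - LA wt1 n q x"
    unfolding LA_def suminf_diff[OF LAS(1)[OF x, of n] LA1(1)[OF x, of n]] by (simp add: algebra_simps)
  finally show "LA wtS n q (q * x) = LA wtS n q x - LA wt1 n q x" .
qed

text \<open>The region where the series in \<open>x\<close> and the one in \<open>1 / x\<close> both
  converge.\<close>

definition annulus :: "complex set" where
  "annulus = {x. norm q < norm x \<and> norm (x * q) < 1}"

lemma annulus_iff: "x \<in> annulus \<longleftrightarrow> x \<noteq> 0 \<and> norm (x * q) < 1 \<and> norm (q / x) < 1"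
proof -
  have "norm q < norm x \<longleftrightarrow> x \<noteq> 0 \<and> norm (q / x) < 1"
    by (cases "x = 0") (auto simp: norm_divide divide_less_eq_1)
  then show ?thesis by (auto simp: annulus_def)
qed

lemma open_annulus: "open annulus"
  unfolding annulus_def by (intro open_Collect_conj open_Collect_less continuous_intros)

lemma connected_annulus': "connected annulus"
proof -
  have "annulus = {x. norm q < norm (x - 0) \<and> norm (x - 0) < 1 / norm q}"
    using q by (auto simp: annulus_def norm_mult field_simps)
  then show ?thesis using connected_annulus(1)[of "norm q" "0::complex" "1 / norm q"] by simp
qed

text \<open>\<open>J 0\<close> is minus the logarithmic derivative \<open>x d/dx\<close> of the
  theta product of \<open>x ^ (1/2) - x ^ (- 1/2)\<close> and all
  \<open>(1 - x * q ^ m) * (1 - q ^ m / x)\<close> with \<open>m \<ge> 1\<close>; further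
  derivatives \<open>x d/dx\<close> give the other \<open>J n\<close>.\<close>

definition J :: "nat \<Rightarrow> complex \<Rightarrow> complex" where
  "J n x = (if n = 0 then 1 / 2 else 0) + lam n x + LA wt1 n q x - (- 1) ^ n * LA wt1 n q (1 / x)"

text \<open>\<open>Psi 0\<close> is minus the logarithmic derivative \<open>q d/dq\<close> of the
  same theta product.\<close>

definition Psi :: "nat \<Rightarrow> complex \<Rightarrow> complex" where
  "Psi n x = LA wtS n q x + (- 1) ^ n * LA wtS n q (1 / x)"

lemma J_has_deriv:
  assumes "x \<in> annulus" "x \<noteq> 1"
  shows "(J n has_field_derivative J (Suc n) x / x) (at x)"
proof -
  have x: "x \<noteq> 0" "norm (x * q) < 1" "norm (q / x) < 1" using assms by (auto simp: annulus_iff)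
  have l: "(lam n has_field_derivative lam (Suc n) x / x) (at x)"
    using lam_has_deriv[OF assms(2)] x by simp
  have "(J n has_field_derivative 0 + lam (Suc n) x / x + LA wt1 (Suc n) q x / x
      - (- 1) ^ n * - (LA wt1 (Suc n) q (1 / x) / x)) (at x)"
    unfolding J_def[abs_def]
    by (intro DERIV_add DERIV_diff DERIV_cmult DERIV_const l LA1(2) LA_inverse_deriv wt_bounds x)
  also have "0 + lam (Suc n) x / x + LA wt1 (Suc n) q x / x - (- 1) ^ n * - (LA wt1 (Suc n) q (1 / x) / x) = J (Suc n) x / x"
    by (simp add: J_def add_divide_distrib del: lam.simps)
  finally show ?thesis .
qed

lemma Psi_has_deriv:
  assumes "x \<in> annulus"
  shows "(Psi n has_field_derivative Psi (Suc n) x / x) (at x)"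
proof -
  have x: "x \<noteq> 0" "norm (x * q) < 1" "norm (q / x) < 1" using assms by (auto simp: annulus_iff)
  have "(Psi n has_field_derivative LA wtS (Suc n) q x / x + (- 1) ^ n * - (LA wtS (Suc n) q (1 / x) / x)) (at x)"
    unfolding Psi_def[abs_def]
    by (intro DERIV_add DERIV_cmult LAS(2) LA_inverse_deriv wt_bounds x)
  also have "LA wtS (Suc n) q x / x + (- 1) ^ n * - (LA wtS (Suc n) q (1 / x) / x) = Psi (Suc n) x / x"
    by (simp add: Psi_def diff_divide_distrib)
  finally show ?thesis .
qed

section \<open>A quasi-elliptic combination that is constant\<close>

definition B :: "complex \<Rightarrow> complex" where "B x = LA wt1 0 q x - LA wt1 0 q (1 / x)"
text \<open>\<open>B\<close> vanishes at 1, so its product with the polar part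
  \<open>1 / 2 + x / (1 - x)\<close> of \<open>J 0\<close> has no pole there; twice that product is
  \<open>- (1 + x) * quot_B x\<close>.\<close>

definition quot_B :: "complex \<Rightarrow> complex" where
  "quot_B x = (if x = 1 then deriv B 1 else (B x - B 1) / (x - 1))"
text \<open>This is \<open>J 0 x ^ 2 - J 1 x + 2 * Psi 0 x\<close> with the pole at 1 removed: the
  square of the polar part of \<open>J 0\<close> is \<open>1 / 4\<close> plus the polar part
  \<open>lam 1\<close> of \<open>J 1\<close>.\<close>

definition K :: "complex \<Rightarrow> complex" where
  "K x = 1 / 4 - (1 + x) * quot_B x + B x ^ 2 - (LA wt1 1 q x + LA wt1 1 q (1 / x)) + 2 * Psi 0 x"

lemma one_in_annulus: "1 \<in> annulus" using q by (simp add: annulus_iff)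

lemma B_has_deriv:
  assumes "x \<in> annulus"
  shows "(B has_field_derivative (LA wt1 1 q x + LA wt1 1 q (1 / x)) / x) (at x)"
proof -
  have x: "x \<noteq> 0" "norm (x * q) < 1" "norm (q / x) < 1" using assms by (auto simp: annulus_iff)
  have "(B has_field_derivative LA wt1 (Suc 0) q x / x - - (LA wt1 (Suc 0) q (1 / x) / x)) (at x)"
    unfolding B_def[abs_def] by (intro DERIV_diff LA1(2) LA_inverse_deriv wt_bounds x)
  then show ?thesis by (simp add: add_divide_distrib)
qed

lemma B_1: "B 1 = 0" by (simp add: B_def)

lemma K_holomorphic: "K holomorphic_on annulus"
proof -
  define P where "P x = LA wt1 1 q x + LA wt1 1 q (1 / x)" for x
  have B: "B holomorphic_on annulus"
    using B_has_deriv open_annulus by (auto simp: holomorphic_on_open)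
  have "quot_B holomorphic_on annulus"
    unfolding quot_B_def[abs_def] using B one_in_annulus open_annulus
    by (intro pole_lemma) (auto simp: interior_open)
  moreover have "P holomorphic_on annulus"
  proof -
    have "(\<lambda>x. deriv B x * x) holomorphic_on annulus"
      by (intro holomorphic_intros holomorphic_deriv B open_annulus)
    then show ?thesis
      by (rule holomorphic_transform) (auto simp: DERIV_imp_deriv[OF B_has_deriv] annulus_iff P_def)
  qed
  moreover have "Psi 0 holomorphic_on annulus"
    using Psi_has_deriv open_annulus by (auto simp: holomorphic_on_open)
  ultimately show ?thesis
    unfolding K_def[abs_def] P_def[symmetric]
    by (intro holomorphic_on_add holomorphic_on_diff holomorphic_on_mult holomorphic_on_power holomorphic_on_const
        holomorphic_on_ident B)
qed

lemma K_eq: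
  assumes "x \<noteq> 1"
  shows "K x = J 0 x ^ 2 - J 1 x + 2 * Psi 0 x"
proof -
  define A where "A = 1 / 2 + lam 0 x"
  have J0: "J 0 x = A + B x" by (simp add: J_def A_def B_def)
  have J1: "J 1 x = lam 1 x + (LA wt1 1 q x + LA wt1 1 q (1 / x))" by (simp add: J_def del: lam.simps One_nat_def)
  have AA: "A ^ 2 = 1 / 4 + lam 1 x"
  proof -
    have d: "1 - x \<noteq> 0" using assms by simp
    have "A = (1 + x) / (2 * (1 - x))" using d by (simp add: A_def divide_simps)
    then have "A ^ 2 = (1 + x)\<^sup>2 / (4 * (1 - x)\<^sup>2)" by (simp only: power_divide power_mult_distrib) simp
    moreover have "1 / 4 + x / (1 - x)\<^sup>2 = ((1 - x)\<^sup>2 + 4 * x) / (4 * (1 - x)\<^sup>2)"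
      using d by (simp add: divide_simps)
    moreover have "(1 - x)\<^sup>2 + 4 * x = (1 + x)\<^sup>2" by (simp add: power2_eq_square algebra_simps)
    ultimately show ?thesis unfolding lam_1[OF assms] by simp
  qed
  have AB: "2 * (A * B x) = - ((1 + x) * quot_B x)"
    using assms by (simp add: A_def quot_B_def B_1 divide_simps) (simp add: algebra_simps)
  have "J 0 x ^ 2 = A ^ 2 + 2 * (A * B x) + B x ^ 2" unfolding J0 by (simp add: power2_eq_square algebra_simps)
  then show ?thesis unfolding AA AB J1 K_def by simp
qed

lemma K_1: "K 1 = 1 / 4 - 6 * LA wt1 1 q 1 + 4 * LA wtS 0 q 1"
proof -
  have "deriv B 1 = 2 * LA wt1 1 q 1" using DERIV_imp_deriv[OF B_has_deriv[OF one_in_annulus]] by simp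
  then show ?thesis by (simp add: K_def quot_B_def B_1 Psi_def)
qed

text \<open>Passing from \<open>x\<close> to \<open>q * x\<close>, the function \<open>J 0\<close>
  grows by 1, \<open>J 1\<close> is unchanged, and \<open>Psi 0\<close> drops by
  \<open>J 0 x + 1 / 2\<close>; these changes cancel in \<open>K\<close>.\<close>

lemma K_periodic:
  assumes x: "norm x > 1" "norm (x * q) < 1"
  shows "K (q * x) = K x"
proof -
  have nz: "x \<noteq> 0" "x \<noteq> 1" "q * x \<noteq> 1" using x by (auto simp: mult.commute)
  have inv: "1 / (q * x) \<noteq> 0" "norm (1 / (q * x) * q) < 1" using x nz q by (auto simp: norm_divide norm_mult)
  have qi: "q * (1 / (q * x)) = 1 / x" "1 / (q * x) * q = 1 / x" using q by auto
  have a: "LA wt1 n q (1 / (q * x)) = LA wt1 n q (1 / x) + lam n (1 / x)" for n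
    using LA_shift(1)[OF inv, of n] unfolding qi by simp
  have b: "LA wtS n q (1 / (q * x)) = LA wtS n q (1 / x) + LA wt1 n q (1 / x) + lam n (1 / x)" for n
    using LA_shift(2)[OF inv, of n] a[of n] unfolding qi by simp
  have l0: "lam 0 (1 / x) = - 1 - lam 0 x" using lam_inverse[OF nz(1,2), of 0] by (simp del: lam.simps)
  have l1: "lam 1 (1 / x) = lam 1 x" using lam_inverse[OF nz(1,2), of 1] by (simp del: lam.simps One_nat_def)
  have J0: "J 0 (q * x) = J 0 x + 1"
    unfolding J_def a LA_shift(1)[OF nz(1) x(2)] l0 by (simp add: mult.commute del: lam.simps)
  have J1: "J 1 (q * x) = J 1 x"
    unfolding J_def a LA_shift(1)[OF nz(1) x(2)] l1 by (simp add: mult.commute del: lam.simps One_nat_def)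
  have P: "Psi 0 (q * x) = Psi 0 x - J 0 x - 1 / 2"
    unfolding Psi_def J_def b LA_shift(2)[OF nz(1) x(2)] l0 by (simp del: lam.simps)
  show ?thesis
    unfolding K_eq[OF nz(2)] K_eq[OF nz(3)] J0 J1 P by (simp add: power2_eq_square algebra_simps)
qed

text \<open>The closed annulus between the radii \<open>s\<close> and \<open>1 / s\<close> is a
  fundamental domain for multiplication by \<open>q\<close>, so by periodicity the maximum of the
  modulus on it is a maximum on the whole open annulus, and the maximum principle applies.\<close>

lemma K_constant:
  assumes "x \<in> annulus"
  shows "K x = K 1"
proof -
  define s where "s = sqrt (norm q)"
  have s: "0 < s" "s < 1" "s * s = norm q" using q by (auto simp: s_def)
  have sq: "norm q < s" using s mult_strict_left_mono[OF s(2,1)] by simp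
  define C where "C = cball 0 (1 / s) \<inter> - ball (0::complex) s"
  have CA: "C \<subseteq> annulus"
  proof
    fix x assume "x \<in> C"
    then have x: "s \<le> norm x" "norm x \<le> 1 / s" by (auto simp: C_def)
    have "norm x * norm q \<le> 1 / s * norm q" using x by (intro mult_right_mono) auto
    also have "1 / s * norm q = s" using s by (simp flip: s(3))
    finally have "norm (x * q) < 1" using s by (simp add: norm_mult)
    then show "x \<in> annulus" using x sq by (auto simp: annulus_def)
  qed
  have "compact C" unfolding C_def by (intro compact_Int_closed compact_cball) (auto intro: closed_Compl)
  moreover have "1 \<in> C" using s by (simp add: C_def)
  then have "C \<noteq> {}" by blast
  moreover have "continuous_on C (\<lambda>x. norm (K x))"
    using K_holomorphic CA by (intro continuous_on_norm holomorphic_on_imp_continuous_on) (rule holomorphic_on_subset)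
  ultimately obtain \<xi> where \<xi>: "\<xi> \<in> C" "\<And>y. y \<in> C \<Longrightarrow> norm (K y) \<le> norm (K \<xi>)"
    using continuous_attains_sup[of C "\<lambda>x. norm (K x)"] by blast
  have max: "norm (K y) \<le> norm (K \<xi>)" if y: "y \<in> annulus" for y
  proof -
    have yn: "norm q < norm y" "norm y * norm q < 1" using y by (auto simp: annulus_def norm_mult)
    have "y \<in> C \<longleftrightarrow> norm y \<le> 1 / s \<and> s \<le> norm y" by (auto simp: C_def)
    then consider "y \<in> C" | "norm y > 1 / s" | "norm y < s" by (metis not_le_imp_less)
    then show ?thesis
    proof cases
      case 1
      then show ?thesis by (rule \<xi>)
    next
      case 2
      have "1 < 1 / s" using s by simp
      then have "norm y > 1" using 2 by linarith
      have "s = 1 / s * norm q" using s by (simp flip: s(3))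
      also have "\<dots> \<le> norm y * norm q" using 2 by (intro mult_right_mono) auto
      finally have "q * y \<in> C" using yn \<open>1 < 1 / s\<close> by (auto simp: C_def norm_mult mult.commute)
      then show ?thesis using \<xi>(2) K_periodic[of y] \<open>norm y > 1\<close> yn by (metis norm_mult)
    next
      case 3
      define z where "z = y / q"
      have nz: "norm z = norm y / norm q" by (simp add: z_def norm_divide)
      have z1: "norm z > 1" unfolding nz using yn q by (simp add: field_simps)
      have "norm z \<le> s / norm q" unfolding nz using 3 q by (intro divide_right_mono) auto
      also have "s / norm q = 1 / s" using s by (simp flip: s(3))
      finally have "z \<in> C" using z1 s by (auto simp: C_def)
      moreover have "norm (z * q) < 1" using 3 s q by (simp add: z_def)
      then have "K y = K z" using K_periodic[OF z1] q by (simp add: z_def)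
      ultimately show ?thesis using \<xi>(2) by simp
    qed
  qed
  have "K constant_on annulus"
    by (rule maximum_modulus_principle[OF K_holomorphic open_annulus connected_annulus' open_annulus order_refl, of \<xi>])
      (use \<xi>(1) CA max in auto)
  then show ?thesis using assms one_in_annulus by (auto simp: constant_on_def)
qed

text \<open>This is the heat equation in disguise: \<open>J 0 x ^ 2 - J 1 x\<close> is the second
  derivative \<open>x d/dx\<close> of the theta product divided by that product, and
  \<open>- Psi 0\<close> is its logarithmic derivative in \<open>q\<close>.\<close>

lemma J_square:
  assumes "x \<in> annulus" "x \<noteq> 1"
  shows "J 0 x ^ 2 = J 1 x - 2 * Psi 0 x + (1 / 4 - 6 * LA wt1 1 q 1 + 4 * LA wtS 0 q 1)"
  using K_constant[OF assms(1)] unfolding K_eq[OF assms(2)] K_1 by (simp add: algebra_simps)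

end

lemma binomial_convolution_Suc:
  fixes a b :: "nat \<Rightarrow> 'a::comm_ring_1"
  shows "(\<Sum>i\<le>Suc n. of_nat (Suc n choose i) * a i * b (Suc n - i)) =
    (\<Sum>i\<le>n. of_nat (n choose i) * (a (Suc i) * b (n - i) + a i * b (Suc n - i)))"
proof -
  have "(\<Sum>i\<le>Suc n. of_nat (Suc n choose i) * a i * b (Suc n - i)) =
      a 0 * b (Suc n) + (\<Sum>i\<le>n. of_nat (Suc n choose Suc i) * a (Suc i) * b (n - i))"
    by (simp only: sum.atMost_Suc_shift) simp
  also have "(\<Sum>i\<le>n. of_nat (Suc n choose Suc i) * a (Suc i) * b (n - i)) =
      (\<Sum>i\<le>n. of_nat (n choose i) * a (Suc i) * b (n - i)) + (\<Sum>i\<le>n. of_nat (n choose Suc i) * a (Suc i) * b (n - i))"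
    by (simp add: sum.distrib[symmetric] algebra_simps)
  also have "a 0 * b (Suc n) + ((\<Sum>i\<le>n. of_nat (n choose i) * a (Suc i) * b (n - i)) +
      (\<Sum>i\<le>n. of_nat (n choose Suc i) * a (Suc i) * b (n - i))) =
      (\<Sum>i\<le>n. of_nat (n choose i) * a (Suc i) * b (n - i)) +
      (a 0 * b (Suc n) + (\<Sum>i\<le>n. of_nat (n choose Suc i) * a (Suc i) * b (n - i)))" by (simp only: add_ac)
  also have "a 0 * b (Suc n) + (\<Sum>i\<le>n. of_nat (n choose Suc i) * a (Suc i) * b (n - i)) =
      (\<Sum>i\<le>Suc n. of_nat (n choose i) * a i * b (Suc n - i))"
    by (simp only: sum.atMost_Suc_shift) simp
  also have "\<dots> = (\<Sum>i\<le>n. of_nat (n choose i) * a i * b (Suc n - i))" by (simp add: binomial_eq_0)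
  finally show ?thesis by (simp add: sum.distrib[symmetric] algebra_simps)
qed

text \<open>Apply \<open>x d/dx\<close> repeatedly to \<open>J_square\<close>: Leibniz gives the
  binomial convolution, and the constant disappears at the first step.\<close>

lemma (in nome) J_convolution:
  assumes "x \<in> annulus" "x \<noteq> 1"
  shows "(\<Sum>i\<le>n. of_nat (n choose i) * J i x * J (n - i) x) =
    J (Suc n) x - 2 * Psi n x + (if n = 0 then 1 / 4 - 6 * LA wt1 1 q 1 + 4 * LA wtS 0 q 1 else 0)"
  using assms
proof (induction n arbitrary: x)
  case 0
  then show ?case using J_square[OF 0] by (simp add: power2_eq_square)
next
  case (Suc n)
  define c where "c = (if n = 0 then 1 / 4 - 6 * LA wt1 1 q 1 + 4 * LA wtS 0 q 1 else 0)"
  have x: "x \<noteq> 0" using Suc.prems by (simp add: annulus_iff)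
  have "((\<lambda>x. \<Sum>i\<le>n. of_nat (n choose i) * (J i x * J (n - i) x)) has_field_derivative
      (\<Sum>i\<le>n. of_nat (n choose i) * (J i x * (J (Suc (n - i)) x / x) + J (Suc i) x / x * J (n - i) x))) (at x)"
    by (intro DERIV_sum DERIV_cmult DERIV_mult' J_has_deriv Suc.prems)
  moreover have "((\<lambda>x. \<Sum>i\<le>n. of_nat (n choose i) * (J i x * J (n - i) x)) has_field_derivative
      J (Suc (Suc n)) x / x - 2 * (Psi (Suc n) x / x) + 0) (at x)"
  proof (rule has_field_derivative_transform_within_open[of "\<lambda>x. J (Suc n) x - 2 * Psi n x + c" _ _ "annulus - {1}"])
    show "((\<lambda>x. J (Suc n) x - 2 * Psi n x + c) has_field_derivative
        J (Suc (Suc n)) x / x - 2 * (Psi (Suc n) x / x) + 0) (at x)"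
      by (intro DERIV_add DERIV_diff DERIV_cmult DERIV_const J_has_deriv Psi_has_deriv Suc.prems)
    show "open (annulus - {1})" by (intro open_Diff open_annulus) auto
    show "J (Suc n) y - 2 * Psi n y + c = (\<Sum>i\<le>n. of_nat (n choose i) * (J i y * J (n - i) y))"
      if "y \<in> annulus - {1}" for y
      using Suc.IH[of y] that by (simp add: c_def mult.assoc)
  qed (use Suc.prems in auto)
  ultimately have "(\<Sum>i\<le>n. of_nat (n choose i) * (J i x * (J (Suc (n - i)) x / x) + J (Suc i) x / x * J (n - i) x)) =
      J (Suc (Suc n)) x / x - 2 * (Psi (Suc n) x / x) + 0" by (rule DERIV_unique)
  then have "x * (\<Sum>i\<le>n. of_nat (n choose i) * (J i x * (J (Suc (n - i)) x / x) + J (Suc i) x / x * J (n - i) x)) =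
      J (Suc (Suc n)) x - 2 * Psi (Suc n) x" using x by (simp add: field_simps)
  moreover have "x * (\<Sum>i\<le>n. of_nat (n choose i) * (J i x * (J (Suc (n - i)) x / x) + J (Suc i) x / x * J (n - i) x)) =
      (\<Sum>i\<le>n. of_nat (n choose i) * (J (Suc i) x * J (n - i) x + J i x * J (Suc n - i) x))"
    unfolding sum_distrib_left using x by (intro sum.cong refl) (simp add: Suc_diff_le field_simps)
  ultimately show ?case
    using binomial_convolution_Suc[of n "\<lambda>i. J i x" "\<lambda>i. J i x"] by simp
qed

section \<open>Lambert series expansion of the Eisenstein series\<close>

lemma sum_int_symmetric_telescope:
  fixes d :: "int \<Rightarrow> 'a::ab_group_add"
  shows "(\<Sum>m\<in>{- int K..int K}. d (m + 1) - d (m - 1)) =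
    (d (int (Suc K)) - d (- int (Suc K))) + (d (int K) - d (- int K))"
proof (induction K)
  case (Suc K)
  have "{- int (Suc K)..int (Suc K)} = insert (int (Suc K)) (insert (- int (Suc K)) {- int K..int K})" by auto
  moreover have "- int (Suc K) \<notin> {- int K..int K}" "int (Suc K) \<notin> insert (- int (Suc K)) {- int K..int K}" by auto
  ultimately have "(\<Sum>m\<in>{- int (Suc K)..int (Suc K)}. d (m + 1) - d (m - 1)) =
     (d (int (Suc K) + 1) - d (int (Suc K) - 1)) + ((d (- int (Suc K) + 1) - d (- int (Suc K) - 1)) +
       (\<Sum>m\<in>{- int K..int K}. d (m + 1) - d (m - 1)))"
    by simp
  also have "\<dots> = (d (int (Suc (Suc K))) - d (- int (Suc (Suc K)))) + (d (int (Suc K)) - d (- int (Suc K)))"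
    unfolding Suc by (simp add: algebra_simps)
  finally show ?case .
qed simp

lemma lam_power_limit:
  assumes q: "norm q < 1"
  shows "(\<lambda>K. of_nat K * lam n (v * q ^ K)) \<longlonglongrightarrow> 0" "(\<lambda>K. lam n (v * q ^ K)) \<longlonglongrightarrow> 0"
proof -
  obtain C where C: "C \<ge> 0" "\<And>x. norm x \<le> 1/2 \<Longrightarrow> norm (lam n x) \<le> C * norm x" using lam_bound[of "1/2" n] by auto
  have "(\<lambda>K. v * q ^ K) \<longlonglongrightarrow> v * 0" by (intro tendsto_mult tendsto_const LIMSEQ_power_zero q)
  then have "(\<lambda>K. norm (v * q ^ K)) \<longlonglongrightarrow> 0" using tendsto_norm by fastforce
  then have ev: "\<forall>\<^sub>F K in sequentially. norm (v * q ^ K) < 1/2" by (rule order_tendstoD) simp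
  have a: "(\<lambda>K. C * norm v * norm (of_nat K * q ^ K)) \<longlonglongrightarrow> C * norm v * 0"
    using tendsto_norm[OF powser_times_n_limit_0[OF q]] by (intro tendsto_mult tendsto_const) simp
  have b: "(\<lambda>K. C * norm v * norm (q ^ K)) \<longlonglongrightarrow> C * norm v * 0"
    using tendsto_norm[OF LIMSEQ_power_zero[OF q]] by (intro tendsto_mult tendsto_const) simp
  show "(\<lambda>K. of_nat K * lam n (v * q ^ K)) \<longlonglongrightarrow> 0"
  proof (rule Lim_null_comparison)
    show "\<forall>\<^sub>F K in sequentially. norm (of_nat K * lam n (v * q ^ K)) \<le> C * norm v * norm (of_nat K * q ^ K)"
      using ev
    proof eventually_elim
      case (elim K)
      have "real K * norm (lam n (v * q ^ K)) \<le> real K * (C * norm (v * q ^ K))" using elim C by (intro mult_left_mono) auto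
      then show ?case by (simp add: norm_mult mult_ac)
    qed
  qed (use a in simp)
  show "(\<lambda>K. lam n (v * q ^ K)) \<longlonglongrightarrow> 0"
  proof (rule Lim_null_comparison)
    show "\<forall>\<^sub>F K in sequentially. norm (lam n (v * q ^ K)) \<le> C * norm v * norm (q ^ K)"
      using ev
    proof eventually_elim
      case (elim K)
      have "norm (lam n (v * q ^ K)) \<le> C * norm (v * q ^ K)" using elim C by auto
      then show ?case by (simp add: norm_mult mult_ac)
    qed
  qed (use b in simp)
qed

text \<open>The bounds on \<open>a1\<close> place \<open>xx\<close> in \<open>annulus\<close>, where
  the Lambert series converge.\<close>

locale torsion_point_strip = torsion_point +
  assumes a1: "0 \<le> a1" "a1 < 1"
begin

abbreviation "qq \<equiv> cexp2 \<tau>"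
abbreviation "xx \<equiv> cexp2 z0"

sublocale nome qq
proof
  show "norm qq < 1" using tau by (simp add: norm_cexp2 uhp_iff)
qed simp

definition xi :: "int \<Rightarrow> complex" where "xi m = of_real (a1 + of_int m) * \<tau> + of_real a2"

lemma W_xi: "W (m, n) = xi m + of_int n"
  by (simp add: lat_pt_def xi_def)

lemma xi_not_Ints: "xi m \<notin> \<int>" "xi m + 1 \<notin> \<int>" "xi m - 1 \<notin> \<int>"
proof -
  have *: "xi m + of_int l \<notin> \<int>" for l :: int
  proof
    assume "xi m + of_int l \<in> \<int>"
    then obtain n where "xi m + of_int l = of_int n" by (rule Ints_cases)
    then have "W (m, l - n) = 0" by (simp add: W_xi algebra_simps)
    then show False using W_nonzero by blast
  qed
  show "xi m \<notin> \<int>" "xi m + 1 \<notin> \<int>" "xi m - 1 \<notin> \<int>" using *[of 0] *[of 1] *[of "- 1"] by auto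
qed

lemma xx_annulus: "xx \<in> annulus" "xx \<noteq> 1"
proof -
  have y: "Im \<tau> > 0" using tau by (simp add: uhp_iff)
  have "norm (xx * qq) = exp (- 2 * pi * (a1 * Im \<tau> + Im \<tau>))"
    unfolding cexp2_add[symmetric] norm_cexp2 by simp
  moreover have "a1 * Im \<tau> + Im \<tau> > 0" using y a1 by (simp add: add_nonneg_pos)
  ultimately have 1: "norm (xx * qq) < 1" by simp
  have "norm qq < norm xx" unfolding norm_cexp2 using y a1 by simp
  with 1 show "xx \<in> annulus" by (simp add: annulus_def)
  have "z0 = xi 0" by (simp add: xi_def)
  then show "xx \<noteq> 1" using xi_not_Ints(1)[of 0] by (simp add: cexp2_eq_1_iff)
qed

lemma xx_facts: "xx \<noteq> 0" "norm (xx * qq) < 1" "1 / xx \<noteq> 0" "norm (1 / xx * qq) < 1"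
  using xx_annulus(1) by (auto simp: annulus_iff norm_divide norm_mult)

lemma qq_power: "cexp2 (of_nat j * \<tau>) = qq ^ j"
  unfolding cexp2_def by (simp flip: exp_of_nat_mult) (simp add: mult_ac)

lemma cexp2_xi: "cexp2 (xi (int j)) = xx * qq ^ j" "cexp2 (xi (- int j)) = 1 / (1 / xx * qq ^ j)"
proof -
  have "xi (int j) = z0 + of_nat j * \<tau>" by (simp add: xi_def algebra_simps)
  then show "cexp2 (xi (int j)) = xx * qq ^ j" by (simp add: cexp2_add qq_power)
  have "xi (- int j) + of_nat j * \<tau> = z0" by (simp add: xi_def algebra_simps)
  then have "cexp2 (xi (- int j)) * qq ^ j = xx" by (metis cexp2_add qq_power)
  then show "cexp2 (xi (- int j)) = 1 / (1 / xx * qq ^ j)" using q by (simp add: field_simps)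
qed

lemma lam_xi_minus: "lam n (cexp2 (xi (- int j))) = - (if n = 0 then 1 else 0) - (- 1) ^ n * lam n (1 / xx * qq ^ j)"
proof -
  have "1 / (1 / xx * qq ^ j) \<noteq> 1" using xi_not_Ints(1)[of "- int j"] unfolding cexp2_xi[symmetric] by (simp add: cexp2_eq_1_iff)
  then have "1 / xx * qq ^ j \<noteq> 1" by auto
  then show ?thesis unfolding cexp2_xi using q by (intro lam_inverse) auto
qed

definition rc :: "nat \<Rightarrow> complex" where "rc k = (- 2 * of_real pi * \<i>) ^ k / fact (k - 1)"

text \<open>The limit of the symmetric sums over row \<open>m\<close>; \<open>rc k\<close> is the
  constant of the Lipschitz formula.\<close>

definition rv :: "nat \<Rightarrow> int \<Rightarrow> complex" where
  "rv k m = rc k * (lam (k - 1) (cexp2 (xi m)) + (if k = 1 then 1 / 2 else 0))"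

lemma row_limit:
  assumes "k > 0"
  shows "(\<lambda>K. \<Sum>n\<in>{- int K..int K}. inverse (W (m, n) ^ k)) \<longlonglongrightarrow> rv k m"
    "(\<lambda>K. \<Sum>n\<in>{- int K..int K}. inverse (W (m, n + 1) ^ k)) \<longlonglongrightarrow> rv k m"
    "(\<lambda>K. \<Sum>n\<in>{- int K..int K}. inverse (W (m, n - 1) ^ k)) \<longlonglongrightarrow> rv k m"
proof -
  have e: "W (m, n + 1) = xi m + 1 + of_int n" "W (m, n - 1) = xi m - 1 + of_int n" for n
    by (simp_all add: W_xi)
  have c: "cexp2 (xi m + 1) = cexp2 (xi m)" "cexp2 (xi m - 1) = cexp2 (xi m)"
    using cexp2_add[of "xi m" 1] cexp2_add[of "xi m" "- 1"] by simp_all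
  show "(\<lambda>K. \<Sum>n\<in>{- int K..int K}. inverse (W (m, n) ^ k)) \<longlonglongrightarrow> rv k m"
    using row_sum_limit[OF assms xi_not_Ints(1)[of m]] unfolding W_xi rv_def rc_def .
  show "(\<lambda>K. \<Sum>n\<in>{- int K..int K}. inverse (W (m, n + 1) ^ k)) \<longlonglongrightarrow> rv k m"
    using row_sum_limit[OF assms xi_not_Ints(2)[of m]] unfolding e rv_def rc_def c .
  show "(\<lambda>K. \<Sum>n\<in>{- int K..int K}. inverse (W (m, n - 1) ^ k)) \<longlonglongrightarrow> rv k m"
    using row_sum_limit[OF assms xi_not_Ints(3)[of m]] unfolding e rv_def rc_def c .
qed

text \<open>For \<open>k = 1\<close> every row of positive index carries a constant
  \<open>1 / 2\<close> and every row of negative index \<open>- 1 / 2\<close>, since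
  \<open>lam_inverse\<close> contributes \<open>- 1\<close>. In a symmetric sum only the half of row
  0 remains, which is the constant in \<open>J 0\<close>.\<close>

lemma col_limit:
  assumes "k > 0"
  shows "(\<lambda>K. \<Sum>m\<in>{- int K..int K}. rv k m) \<longlonglongrightarrow> rc k * J (k - 1) xx"
proof -
  obtain n where n: "k = Suc n" using assms by (cases k) auto
  have s: "(\<Sum>m\<in>{- int K..int K}. rv k m) = rc k * ((if n = 0 then 1 / 2 else 0) + lam n xx
      + (\<Sum>j<K. wt1 j * lam n (xx * qq ^ Suc j)) - (- 1) ^ n * (\<Sum>j<K. wt1 j * lam n (1 / xx * qq ^ Suc j)))" for K
  proof -
    have "(\<Sum>m\<in>{- int K..int K}. rv k m) = (\<Sum>j<Suc K. rv k (int j)) + (\<Sum>j<K. rv k (- int (Suc j)))"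
      unfolding sum_int_symmetric by (simp add: minus_diff_commute)
    also have "(\<Sum>j<Suc K. rv k (int j)) = rv k 0 + (\<Sum>j<K. rv k (int (Suc j)))"
      by (simp only: sum.lessThan_Suc_shift) simp
    also have "rv k 0 = rc k * ((if n = 0 then 1 / 2 else 0) + lam n xx)"
      using cexp2_xi(1)[of 0] by (simp add: rv_def n del: lam.simps)
    also have "(\<Sum>j<K. rv k (int (Suc j))) = (\<Sum>j<K. rc k * (lam n (xx * qq ^ Suc j) + (if n = 0 then 1 / 2 else 0)))"
      unfolding rv_def cexp2_xi n by (simp del: lam.simps)
    also have "(\<Sum>j<K. rv k (- int (Suc j))) = (\<Sum>j<K. rc k * (- ((- 1) ^ n * lam n (1 / xx * qq ^ Suc j)) - (if n = 0 then 1 / 2 else 0)))"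
      unfolding rv_def lam_xi_minus n by (intro sum.cong refl) (simp add: algebra_simps del: lam.simps power_Suc)
    finally show ?thesis
      by (simp add: sum_distrib_left sum.distrib sum_subtractf algebra_simps sum_negf del: lam.simps power_Suc)
  qed
  have A: "(\<lambda>K. \<Sum>j<K. wt1 j * lam n (xx * qq ^ Suc j)) \<longlonglongrightarrow> LA wt1 n qq xx"
    unfolding LA_def by (rule summable_LIMSEQ[OF LA1(1)[OF xx_facts(1,2)]])
  have B: "(\<lambda>K. \<Sum>j<K. wt1 j * lam n (1 / xx * qq ^ Suc j)) \<longlonglongrightarrow> LA wt1 n qq (1 / xx)"
    unfolding LA_def by (rule summable_LIMSEQ[OF LA1(1)[OF xx_facts(3,4)]])
  have "k - 1 = n" using n by simp
  then show ?thesis unfolding s J_def by (simp only:) (intro tendsto_intros A B)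
qed

text \<open>Boundary terms of the telescoping. For \<open>k = 1\<close> the rows tend to
  \<open>rc 1 / 2\<close> and \<open>- rc 1 / 2\<close>, so their difference survives; with the
  weight \<open>a1 + m\<close> the growing parts \<open>K\<close> and \<open>- K\<close> cancel and
  \<open>a1\<close> remains. For \<open>k = 2\<close> exponential decay wins.\<close>

lemma rv_limits:
  "(\<lambda>K. rv 1 (int K) - rv 1 (- int K)) \<longlonglongrightarrow> rc 1"
  "(\<lambda>K. of_real (a1 + of_int (int K)) * rv 1 (int K) - of_real (a1 + of_int (- int K)) * rv 1 (- int K)) \<longlonglongrightarrow> rc 1 * of_real a1"
  "(\<lambda>K. of_real (a1 + of_int (int K)) * rv 2 (int K) - of_real (a1 + of_int (- int K)) * rv 2 (- int K)) \<longlonglongrightarrow> 0"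
proof -
  define e e' where "e n K = lam n (xx * qq ^ K)" and "e' n K = lam n (1 / xx * qq ^ K)" for n K
  note L = lam_power_limit[OF q(2)]
  have l: "(\<lambda>K. of_nat K * e n K) \<longlonglongrightarrow> 0" "e n \<longlonglongrightarrow> 0" "(\<lambda>K. of_nat K * e' n K) \<longlonglongrightarrow> 0" "e' n \<longlonglongrightarrow> 0" for n
    unfolding e_def e'_def by (rule L)+
  have r1: "rv 1 (int K) = rc 1 * (1 / 2 + e 0 K)" "rv 1 (- int K) = - (rc 1 * (1 / 2 + e' 0 K))" for K
    unfolding rv_def lam_xi_minus unfolding cexp2_xi(1) e_def e'_def by (simp_all add: algebra_simps del: lam.simps)
  have r2: "rv 2 (int K) = rc 2 * e 1 K" "rv 2 (- int K) = rc 2 * e' 1 K" for K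
    unfolding rv_def lam_xi_minus unfolding cexp2_xi(1) e_def e'_def by (simp_all del: lam.simps)
  have "(\<lambda>K. rc 1 * (1 + e 0 K + e' 0 K)) \<longlonglongrightarrow> rc 1 * (1 + 0 + 0)" by (intro tendsto_intros l)
  moreover have "rv 1 (int K) - rv 1 (- int K) = rc 1 * (1 + e 0 K + e' 0 K)" for K
    unfolding r1 by (simp add: algebra_simps)
  ultimately show "(\<lambda>K. rv 1 (int K) - rv 1 (- int K)) \<longlonglongrightarrow> rc 1" by simp
  have "(\<lambda>K. rc 1 * (of_real a1 + of_real a1 * e 0 K + of_nat K * e 0 K + of_real a1 * e' 0 K - of_nat K * e' 0 K))
      \<longlonglongrightarrow> rc 1 * (of_real a1 + of_real a1 * 0 + 0 + of_real a1 * 0 - 0)" by (intro tendsto_intros l)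
  moreover have "of_real (a1 + of_int (int K)) * rv 1 (int K) - of_real (a1 + of_int (- int K)) * rv 1 (- int K) =
      rc 1 * (of_real a1 + of_real a1 * e 0 K + of_nat K * e 0 K + of_real a1 * e' 0 K - of_nat K * e' 0 K)" for K
    unfolding r1 by (simp add: field_simps)
  ultimately show "(\<lambda>K. of_real (a1 + of_int (int K)) * rv 1 (int K) - of_real (a1 + of_int (- int K)) * rv 1 (- int K)) \<longlonglongrightarrow> rc 1 * of_real a1"
    by simp
  have "(\<lambda>K. rc 2 * (of_real a1 * e 1 K + of_nat K * e 1 K - of_real a1 * e' 1 K + of_nat K * e' 1 K))
      \<longlonglongrightarrow> rc 2 * (of_real a1 * 0 + 0 - of_real a1 * 0 + 0)" by (intro tendsto_intros l)
  moreover have "of_real (a1 + of_int (int K)) * rv 2 (int K) - of_real (a1 + of_int (- int K)) * rv 2 (- int K) =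
      rc 2 * (of_real a1 * e 1 K + of_nat K * e 1 K - of_real a1 * e' 1 K + of_nat K * e' 1 K)" for K
    unfolding r2 by (simp add: algebra_simps)
  ultimately show "(\<lambda>K. of_real (a1 + of_int (int K)) * rv 2 (int K) - of_real (a1 + of_int (- int K)) * rv 2 (- int K)) \<longlonglongrightarrow> 0"
    by simp
qed

text \<open>A lattice point \<open>w\<close> satisfies
  \<open>cnj w = w - (a1 + m) * (\<tau> - cnj \<tau>)\<close>. This turns the non-holomorphic
  summand into inverse powers of \<open>w\<close>, whose row sums are known.\<close>

lemma inv_2iy_lat_g:
  "inv_2iy \<tau> * lat_g (Suc k) 0 (W (m, n)) =
     inv_2iy \<tau> * inverse (W (m, n) ^ k) - of_real (a1 + of_int m) * inverse (W (m, n) ^ Suc k)"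
proof -
  let ?w = "W (m, n)" and ?p = "complex_of_real (a1 + of_int m)"
  have u: "inv_2iy \<tau> * (\<tau> - cnj \<tau>) = 1" using diff_cnj_nonzero[OF tau] by (simp add: inv_2iy_def)
  have c: "cnj ?w = ?w - ?p * (\<tau> - cnj \<tau>)" by (simp add: lat_pt_def algebra_simps del: complex_diff_cnj)
  have "inv_2iy \<tau> * lat_g (Suc k) 0 ?w = inv_2iy \<tau> * cnj ?w * inverse (?w ^ Suc k)"
    using W_nonzero[of "(m, n)"] by (simp add: lat_g_def lat_f_def mult_ac)
  also have "\<dots> = inv_2iy \<tau> * (?w * inverse (?w ^ Suc k)) - ?p * inverse (?w ^ Suc k) * (inv_2iy \<tau> * (\<tau> - cnj \<tau>))"
    unfolding c by (simp add: algebra_simps del: complex_diff_cnj power_Suc)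
  also have "?w * inverse (?w ^ Suc k) = inverse (?w ^ k)" using W_nonzero[of "(m, n)"] by simp
  finally show ?thesis unfolding u by simp
qed

lemma lat_tele_0:
  "lat_tele (Suc k) \<tau> 0 (W (m, n)) = inverse (W (m, n) ^ Suc k) -
     (\<tau> / 2 * ((inv_2iy \<tau> * inverse (W (m, n + 1) ^ k) - of_real (a1 + of_int m) * inverse (W (m, n + 1) ^ Suc k)) -
        (inv_2iy \<tau> * inverse (W (m, n - 1) ^ k) - of_real (a1 + of_int m) * inverse (W (m, n - 1) ^ Suc k))) -
      1 / 2 * ((inv_2iy \<tau> * inverse (W (m + 1, n) ^ k) - of_real (a1 + of_int (m + 1)) * inverse (W (m + 1, n) ^ Suc k)) -
        (inv_2iy \<tau> * inverse (W (m - 1, n) ^ k) - of_real (a1 + of_int (m - 1)) * inverse (W (m - 1, n) ^ Suc k))))"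
proof -
  have "lat_f (Suc k) 0 (W (m, n)) = inverse (W (m, n) ^ Suc k)"
    using W_nonzero[of "(m, n)"] by (simp add: lat_f_def)
  moreover have "lat_tele (Suc k) \<tau> 0 (W (m, n)) = lat_f (Suc k) 0 (W (m, n)) -
     (\<tau> / 2 * (inv_2iy \<tau> * lat_g (Suc k) 0 (W (m, n + 1)) - inv_2iy \<tau> * lat_g (Suc k) 0 (W (m, n - 1))) -
      1 / 2 * (inv_2iy \<tau> * lat_g (Suc k) 0 (W (m + 1, n)) - inv_2iy \<tau> * lat_g (Suc k) 0 (W (m - 1, n))))"
    unfolding lat_tele_def W_shift by (simp add: algebra_simps)
  ultimately show ?thesis unfolding inv_2iy_lat_g by simp
qed

lemma tele_summable: "k > 0 \<Longrightarrow> (\<lambda>x. lat_tele k \<tau> 0 (W x)) summable_on UNIV"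
  by (rule abs_summable_summable[OF lat_tele_W_holomorphic(2)]) simp

text \<open>The differences within a row have equal limits and cancel. Those between rows telescope
  and leave the second limit of \<open>rv_limits\<close>, which is the correction by
  \<open>a1\<close>.\<close>

lemma phi_1: "phi 1 z0 \<tau> = rc 1 * (J 0 xx - of_real a1)"
proof -
  define p where "p m = complex_of_real (a1 + of_int m)" for m :: int
  define r where "r m = rv 1 m - 1 / 2 * (p (m - 1) * rv 1 (m - 1) - p (m + 1) * rv 1 (m + 1)) * (- 1)" for m
  have "(\<lambda>K. \<Sum>n\<in>{- int K..int K}. lat_tele 1 \<tau> 0 (W (m, n))) \<longlonglongrightarrow> r m" for m
  proof -
    \<comment> \<open>In \<open>lat_tele_0\<close> the terms with \<open>inv_2iy\<close> carry the
      power 0, so they are constant and drop out of the differences.\<close>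
    have e: "lat_tele 1 \<tau> 0 (W (m, n)) = inverse (W (m, n) ^ 1) -
        (\<tau> / 2 * (p m * inverse (W (m, n - 1) ^ 1) - p m * inverse (W (m, n + 1) ^ 1)) -
         1 / 2 * (p (m - 1) * inverse (W (m - 1, n) ^ 1) - p (m + 1) * inverse (W (m + 1, n) ^ 1)))" for n
      using lat_tele_0[of 0 m n] by (simp add: p_def algebra_simps)
    have "(\<lambda>K. (\<Sum>n\<in>{- int K..int K}. inverse (W (m, n) ^ 1)) -
        (\<tau> / 2 * (p m * (\<Sum>n\<in>{- int K..int K}. inverse (W (m, n - 1) ^ 1)) - p m * (\<Sum>n\<in>{- int K..int K}. inverse (W (m, n + 1) ^ 1))) -
         1 / 2 * (p (m - 1) * (\<Sum>n\<in>{- int K..int K}. inverse (W (m - 1, n) ^ 1)) - p (m + 1) * (\<Sum>n\<in>{- int K..int K}. inverse (W (m + 1, n) ^ 1)))))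
      \<longlonglongrightarrow> rv 1 m - (\<tau> / 2 * (p m * rv 1 m - p m * rv 1 m) - 1 / 2 * (p (m - 1) * rv 1 (m - 1) - p (m + 1) * rv 1 (m + 1)))"
      by (intro tendsto_diff tendsto_mult tendsto_const row_limit zero_less_one)
    then show ?thesis
      unfolding e by (simp add: r_def sum_subtractf sum.distrib sum_distrib_left algebra_simps)
  qed
  moreover have "(\<lambda>K. \<Sum>m\<in>{- int K..int K}. r m) \<longlonglongrightarrow> rc 1 * (J 0 xx - of_real a1)"
  proof -
    define d where "d m = p m * rv 1 m" for m
    have l: "(\<lambda>K. d (int K) - d (- int K)) \<longlonglongrightarrow> rc 1 * of_real a1" unfolding d_def p_def by (rule rv_limits(2))
    have "(\<lambda>K. (\<Sum>m\<in>{- int K..int K}. rv 1 m) - 1 / 2 * ((d (int (Suc K)) - d (- int (Suc K))) + (d (int K) - d (- int K))))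
      \<longlonglongrightarrow> rc 1 * J (1 - 1) xx - 1 / 2 * (rc 1 * of_real a1 + rc 1 * of_real a1)"
      by (intro tendsto_diff tendsto_mult tendsto_add tendsto_const col_limit LIMSEQ_Suc[OF l] l zero_less_one)
    moreover have "(\<Sum>m\<in>{- int K..int K}. r m) = (\<Sum>m\<in>{- int K..int K}. rv 1 m) -
        1 / 2 * ((d (int (Suc K)) - d (- int (Suc K))) + (d (int K) - d (- int K)))" for K
      unfolding sum_int_symmetric_telescope[symmetric] sum_distrib_left sum_subtractf[symmetric]
      by (intro sum.cong refl) (simp add: r_def d_def algebra_simps)
    moreover have "rc 1 * J (1 - 1) xx - 1 / 2 * (rc 1 * of_real a1 + rc 1 * of_real a1) = rc 1 * (J 0 xx - of_real a1)"
      by (simp add: algebra_simps)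
    ultimately show ?thesis by (simp only:)
  qed
  ultimately have "infsum (\<lambda>x. lat_tele 1 \<tau> 0 (W x)) UNIV = rc 1 * (J 0 xx - of_real a1)"
    by (rule double_sum_limit[OF tele_summable[OF zero_less_one]])
  then show ?thesis by (simp add: phi_eq_tele)
qed

text \<open>As in weight 1, but now the boundary value that survives is that of
  \<open>inv_2iy \<tau> * rv 1\<close>, while \<open>(a1 + m) * rv 2\<close> decays.\<close>

lemma phi_2: "phi 2 z0 \<tau> = rc 2 * J 1 xx + inv_2iy \<tau> * rc 1"
proof -
  define p where "p m = complex_of_real (a1 + of_int m)" for m :: int
  define u where "u = inv_2iy \<tau>"
  define r where "r m = rv 2 m + 1 / 2 * ((u * rv 1 (m + 1) - p (m + 1) * rv 2 (m + 1)) - (u * rv 1 (m - 1) - p (m - 1) * rv 2 (m - 1)))" for m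
  have "(\<lambda>K. \<Sum>n\<in>{- int K..int K}. lat_tele 2 \<tau> 0 (W (m, n))) \<longlonglongrightarrow> r m" for m
  proof -
    let ?s = "\<lambda>K k m. \<Sum>n\<in>{- int K..int K}. inverse (W (m, n) ^ k)"
    let ?sp = "\<lambda>K k. \<Sum>n\<in>{- int K..int K}. inverse (W (m, n + 1) ^ k)"
    let ?sm = "\<lambda>K k. \<Sum>n\<in>{- int K..int K}. inverse (W (m, n - 1) ^ k)"
    have e: "lat_tele 2 \<tau> 0 (W (m, n)) = inverse (W (m, n) ^ 2) -
     (\<tau> / 2 * ((u * inverse (W (m, n + 1) ^ 1) - p m * inverse (W (m, n + 1) ^ 2)) -
        (u * inverse (W (m, n - 1) ^ 1) - p m * inverse (W (m, n - 1) ^ 2))) -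
      1 / 2 * ((u * inverse (W (m + 1, n) ^ 1) - p (m + 1) * inverse (W (m + 1, n) ^ 2)) -
        (u * inverse (W (m - 1, n) ^ 1) - p (m - 1) * inverse (W (m - 1, n) ^ 2))))" for n
      using lat_tele_0[of 1 m n] unfolding p_def u_def numeral_2_eq_2 One_nat_def .
    have "(\<lambda>K. ?s K 2 m - (\<tau> / 2 * ((u * ?sp K 1 - p m * ?sp K 2) - (u * ?sm K 1 - p m * ?sm K 2)) -
         1 / 2 * ((u * ?s K 1 (m + 1) - p (m + 1) * ?s K 2 (m + 1)) - (u * ?s K 1 (m - 1) - p (m - 1) * ?s K 2 (m - 1)))))
      \<longlonglongrightarrow> rv 2 m - (\<tau> / 2 * ((u * rv 1 m - p m * rv 2 m) - (u * rv 1 m - p m * rv 2 m)) -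
         1 / 2 * ((u * rv 1 (m + 1) - p (m + 1) * rv 2 (m + 1)) - (u * rv 1 (m - 1) - p (m - 1) * rv 2 (m - 1))))"
      by (intro tendsto_diff tendsto_mult tendsto_const row_limit zero_less_one zero_less_numeral)
    also have "rv 2 m - (\<tau> / 2 * ((u * rv 1 m - p m * rv 2 m) - (u * rv 1 m - p m * rv 2 m)) -
         1 / 2 * ((u * rv 1 (m + 1) - p (m + 1) * rv 2 (m + 1)) - (u * rv 1 (m - 1) - p (m - 1) * rv 2 (m - 1)))) = r m"
      by (simp add: r_def)
    finally show ?thesis
      unfolding e by (simp only: sum_subtractf sum_distrib_left[symmetric])
  qed
  moreover have "(\<lambda>K. \<Sum>m\<in>{- int K..int K}. r m) \<longlonglongrightarrow> rc 2 * J 1 xx + u * rc 1"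
  proof -
    define d where "d m = u * rv 1 m - p m * rv 2 m" for m
    have "(\<lambda>K. u * (rv 1 (int K) - rv 1 (- int K)) - (p (int K) * rv 2 (int K) - p (- int K) * rv 2 (- int K))) \<longlonglongrightarrow> u * rc 1 - 0"
      unfolding p_def by (intro tendsto_diff tendsto_mult tendsto_const rv_limits)
    moreover have "u * (rv 1 (int K) - rv 1 (- int K)) - (p (int K) * rv 2 (int K) - p (- int K) * rv 2 (- int K)) =
        d (int K) - d (- int K)" for K by (simp add: d_def algebra_simps)
    ultimately have l: "(\<lambda>K. d (int K) - d (- int K)) \<longlonglongrightarrow> u * rc 1" by simp
    have "(\<lambda>K. (\<Sum>m\<in>{- int K..int K}. rv 2 m) + 1 / 2 * ((d (int (Suc K)) - d (- int (Suc K))) + (d (int K) - d (- int K))))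
      \<longlonglongrightarrow> rc 2 * J (2 - 1) xx + 1 / 2 * (u * rc 1 + u * rc 1)"
      by (intro tendsto_diff tendsto_mult tendsto_add tendsto_const col_limit LIMSEQ_Suc[OF l] l zero_less_numeral)
    moreover have "(\<Sum>m\<in>{- int K..int K}. r m) = (\<Sum>m\<in>{- int K..int K}. rv 2 m) +
        1 / 2 * ((d (int (Suc K)) - d (- int (Suc K))) + (d (int K) - d (- int K)))" for K
      unfolding sum_int_symmetric_telescope[symmetric] sum_distrib_left sum.distrib[symmetric]
      by (intro sum.cong refl) (simp add: r_def d_def)
    ultimately show ?thesis by simp
  qed
  ultimately have "infsum (\<lambda>x. lat_tele 2 \<tau> 0 (W x)) UNIV = rc 2 * J 1 xx + u * rc 1"
    by (rule double_sum_limit[OF tele_summable[OF zero_less_numeral]])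
  then show ?thesis by (simp add: phi_eq_tele u_def)
qed

lemma phi_ge_3:
  assumes k: "k \<ge> 3"
  shows "phi k z0 \<tau> = rc k * J (k - 1) xx"
  unfolding phi_eq_sum(1)[OF k]
  by (rule double_sum_limit[OF phi_eq_sum(2)[OF k] row_limit(1) col_limit]) (use k in auto)

end

section \<open>The convolution identity in weight at least 3\<close>

lemma LA_tau_arg: "cexp2 (of_real \<alpha> * t + \<beta>) * cexp2 t ^ Suc m = cexp2 ((of_real \<alpha> + of_nat (Suc m)) * t + \<beta>)"
proof -
  have "cexp2 t ^ Suc m = cexp2 (of_nat (Suc m) * t)"
    unfolding cexp2_def by (simp only: exp_of_nat_mult[symmetric]) (simp add: mult_ac)
  then show ?thesis by (simp only: cexp2_add[symmetric]) (simp add: algebra_simps)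
qed

text \<open>The \<open>m\<close>-th argument is
  \<open>cexp2 ((\<alpha> + m + 1) * t + \<beta>)\<close>, and differentiating it brings down
  \<open>\<alpha>\<close> with the weights \<open>wt1\<close> and \<open>m + 1\<close> as the
  weights \<open>wtS\<close>. The condition on \<open>\<alpha>\<close> makes all arguments decay; it
  holds for \<open>r1\<close> and for \<open>- r1\<close>.\<close>

lemma LA_tau_deriv:
  fixes \<alpha> :: real
  assumes al: "1 + \<alpha> > 0" and be: "Im \<beta> = 0" and t: "t \<in> uhp"
  shows "((\<lambda>t. LA wt1 n (cexp2 t) (cexp2 (of_real \<alpha> * t + \<beta>))) has_field_derivative
    2 * of_real pi * \<i> * (of_real \<alpha> * LA wt1 (Suc n) (cexp2 t) (cexp2 (of_real \<alpha> * t + \<beta>)) +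
      LA wtS (Suc n) (cexp2 t) (cexp2 (of_real \<alpha> * t + \<beta>)))) (at t)"
    and "\<exists>C. \<forall>t. Im t > 1 \<longrightarrow> norm (LA wt1 n (cexp2 t) (cexp2 (of_real \<alpha> * t + \<beta>))) \<le> C"
proof -
  define f where "f m t = cexp2 ((of_real \<alpha> + of_nat (Suc m)) * t + \<beta>)" for m t
  define \<kappa> :: "nat \<Rightarrow> complex" where "\<kappa> m = 2 * of_real pi * \<i> * (of_real \<alpha> + of_nat (Suc m))" for m
  have der: "(f m has_field_derivative \<kappa> m * 1 * f m t) (at t)" for m t
    unfolding f_def[abs_def] cexp2_def \<kappa>_def by (auto intro!: derivative_eq_intros)
  have nf: "norm (f m t) = exp (- 2 * pi * ((\<alpha> + 1) * Im t)) * exp (- 2 * pi * Im t) ^ m" for m t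
  proof -
    have "norm (f m t) = exp (- 2 * pi * ((\<alpha> + 1) * Im t) + real m * (- 2 * pi * Im t))"
      unfolding f_def norm_cexp2 using be by (simp add: algebra_simps)
    then show ?thesis by (simp only: exp_add exp_of_nat_mult)
  qed
  have nb: "exp (- 2 * pi * ((\<alpha> + 1) * h)) < 1" "exp (- 2 * pi * h) < 1"
    "norm (f m y) \<le> exp (- 2 * pi * ((\<alpha> + 1) * h)) * exp (- 2 * pi * h) ^ m"
    if h: "h > 0" "Im y \<ge> h" for m y h
  proof -
    have "(\<alpha> + 1) * h > 0" using al h by (intro mult_pos_pos) auto
    then show "exp (- 2 * pi * ((\<alpha> + 1) * h)) < 1" "exp (- 2 * pi * h) < 1" using h by auto
    have "(\<alpha> + 1) * h \<le> (\<alpha> + 1) * Im y" using al h by (intro mult_left_mono) auto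
    then show "norm (f m y) \<le> exp (- 2 * pi * ((\<alpha> + 1) * h)) * exp (- 2 * pi * h) ^ m"
      unfolding nf using h by (intro mult_mono power_mono) auto
  qed
  have bd: "\<exists>d>0. \<exists>\<rho> r. \<rho> < 1 \<and> 0 \<le> r \<and> r < 1 \<and> (\<forall>m. \<forall>y\<in>ball t d \<inter> uhp. norm (f m y) \<le> \<rho> * r ^ m)"
    if t: "t \<in> uhp" for t
  proof -
    define h where "h = Im t / 2"
    have h: "h > 0" using t by (simp add: h_def uhp_iff)
    have "Im y \<ge> h" if "y \<in> ball t h" for y
      using that abs_Im_le_cmod[of "t - y"] by (simp add: dist_norm h_def)
    then show ?thesis
      using h nb(1,2)[OF h, of "of_real h * \<i>"] nb(3)[OF h]
      by (intro exI[of _ h] exI[of _ "exp (- 2 * pi * ((\<alpha> + 1) * h))"] exI[of _ "exp (- 2 * pi * h)"] conjI allI ballI) auto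
  qed
  have fx: "f m t = cexp2 (of_real \<alpha> * t + \<beta>) * cexp2 t ^ Suc m" for m t
    unfolding f_def LA_tau_arg ..
  let ?x = "cexp2 (of_real \<alpha> * t + \<beta>)" and ?q = "cexp2 t"
  interpret nome ?q using t by unfold_locales (simp_all add: norm_cexp2 uhp_iff)
  have y: "Im t > 0" using t by (simp add: uhp_iff)
  have "norm (f 0 t) \<le> exp (- 2 * pi * ((\<alpha> + 1) * Im t))" using nb(3)[OF y order_refl, of 0] by simp
  also have "\<dots> < 1" by (rule nb(1)[OF y order_refl])
  finally have "norm (f 0 t) < 1" .
  then have x: "?x \<noteq> 0" "norm (?x * ?q) < 1" unfolding fx by simp_all
  have "((\<lambda>t. \<Sum>m. 1 * lam n (f m t)) has_field_derivative 1 * (\<Sum>m. 1 * \<kappa> m * lam (Suc n) (f m t))) (at t)"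
    by (rule lam_series_has_deriv(3)[OF open_uhp der _ bd _ t]) auto
  moreover have "(\<Sum>m. 1 * \<kappa> m * lam (Suc n) (f m t)) = 2 * of_real pi * \<i> * (of_real \<alpha> * LA wt1 (Suc n) ?q ?x + LA wtS (Suc n) ?q ?x)"
  proof -
    have "(\<lambda>m. 2 * of_real pi * \<i> * (of_real \<alpha> * (wt1 m * lam (Suc n) (?x * ?q ^ Suc m)) + wtS m * lam (Suc n) (?x * ?q ^ Suc m)))
       sums (2 * of_real pi * \<i> * (of_real \<alpha> * LA wt1 (Suc n) ?q ?x + LA wtS (Suc n) ?q ?x))"
      unfolding LA_def by (intro sums_mult sums_add summable_sums LA1(1) LAS(1) x)
    moreover have "2 * of_real pi * \<i> * (of_real \<alpha> * (wt1 m * lam (Suc n) (?x * ?q ^ Suc m)) + wtS m * lam (Suc n) (?x * ?q ^ Suc m))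
        = 1 * \<kappa> m * lam (Suc n) (f m t)" for m
      unfolding fx \<kappa>_def by (simp add: algebra_simps del: lam.simps power_Suc of_nat_Suc)
    ultimately show ?thesis by (simp only: sums_iff)
  qed
  ultimately show "((\<lambda>t. LA wt1 n (cexp2 t) (cexp2 (of_real \<alpha> * t + \<beta>))) has_field_derivative
    2 * of_real pi * \<i> * (of_real \<alpha> * LA wt1 (Suc n) ?q ?x + LA wtS (Suc n) ?q ?x)) (at t)"
    unfolding LA_def fx[symmetric] by simp
  define \<rho> r where "\<rho> = exp (- 2 * pi * ((\<alpha> + 1) * 1))" and "r = exp (- 2 * pi * 1)"
  have \<rho>: "\<rho> < 1" "0 \<le> \<rho>" "r < 1" "0 \<le> r" using nb(1,2)[of 1 \<i>] by (auto simp: \<rho>_def r_def)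
  obtain C where C: "C \<ge> 0" "\<And>z. norm z \<le> \<rho> \<Longrightarrow> norm (lam n z) \<le> C * norm z" using lam_bound[OF \<rho>(1)] by blast
  have "norm (LA wt1 n (cexp2 t) (cexp2 (of_real \<alpha> * t + \<beta>))) \<le> (\<Sum>m. C * (\<rho> * r ^ m))" if "Im t > 1" for t
    unfolding LA_def fx[symmetric]
  proof (rule norm_suminf_le)
    show "summable (\<lambda>m. C * (\<rho> * r ^ m))" using \<rho> by (intro summable_mult summable_geometric) auto
    fix m
    have 1: "norm (f m t) \<le> \<rho> * r ^ m" unfolding \<rho>_def r_def using that by (intro nb(3)) auto
    also have "\<dots> \<le> \<rho> * 1" using \<rho> by (intro mult_left_mono power_le_one) auto
    finally have "norm (lam n (f m t)) \<le> C * norm (f m t)" by (intro C(2)) simp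
    also have "\<dots> \<le> C * (\<rho> * r ^ m)" using 1 C(1) by (rule mult_left_mono)
    finally show "norm (1 * lam n (f m t)) \<le> C * (\<rho> * r ^ m)" by simp
  qed
  then show "\<exists>C. \<forall>t. Im t > 1 \<longrightarrow> norm (LA wt1 n (cexp2 t) (cexp2 (of_real \<alpha> * t + \<beta>))) \<le> C" by blast
qed

section \<open>The Eisenstein series of one torsion point as functions on the upper half
  plane\<close>

locale eis_point =
  fixes a :: "rat \<times> rat" and N :: nat
  assumes N: "N > 0" and aN: "of_nat N * fst a \<in> \<int>" "of_nat N * snd a \<in> \<int>" and a: "a \<notin> \<int> \<times> \<int>"
    and a1: "0 \<le> fst a" "fst a < 1"
begin

abbreviation "r1 \<equiv> (of_rat (fst a) :: real)"
abbreviation "r2 \<equiv> (of_rat (snd a) :: real)"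
abbreviation "xt t \<equiv> cexp2 (of_real r1 * t + of_real r2)"

lemma r1: "0 \<le> r1" "r1 < 1" using a1 by auto

lemma strip: "t \<in> uhp \<Longrightarrow> torsion_point_strip t r1 r2 N"
  using torsion_point_rat[OF _ N aN a] r1 by (simp add: torsion_point_strip_def torsion_point_strip_axioms_def)

lemma nome_t: "t \<in> uhp \<Longrightarrow> nome (cexp2 t)"
  by unfold_locales (simp_all add: norm_cexp2 uhp_iff)

text \<open>\<open>J\<close> at the torsion point as a function of \<open>t\<close> alone. Writing
  \<open>1 / xt t\<close> as an exponential with \<open>- r1\<close> and \<open>- r2\<close> makes
  \<open>LA_tau_deriv\<close> apply to both halves.\<close>

definition Jt :: "nat \<Rightarrow> complex \<Rightarrow> complex" where
  "Jt n t = (if n = 0 then 1 / 2 else 0) + lam n (xt t) + LA wt1 n (cexp2 t) (xt t)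
     - (- 1) ^ n * LA wt1 n (cexp2 t) (cexp2 (of_real (- r1) * t + of_real (- r2)))"

definition Pt :: "nat \<Rightarrow> complex \<Rightarrow> complex" where
  "Pt n t = LA wtS n (cexp2 t) (xt t) + (- 1) ^ n * LA wtS n (cexp2 t) (cexp2 (of_real (- r1) * t + of_real (- r2)))"

lemma inverse_xt: "cexp2 (of_real (- r1) * t + of_real (- r2)) = 1 / xt t"
proof -
  have "cexp2 (of_real (- r1) * t + of_real (- r2)) * xt t = cexp2 0"
    unfolding cexp2_add[symmetric] by (simp add: algebra_simps)
  then show ?thesis by (simp add: field_simps)
qed

lemma Jt_eq: "t \<in> uhp \<Longrightarrow> Jt n t = nome.J (cexp2 t) n (xt t)"
  and Pt_eq: "t \<in> uhp \<Longrightarrow> Pt n t = nome.Psi (cexp2 t) n (xt t)"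
  unfolding Jt_def Pt_def inverse_xt by (simp_all add: nome.J_def[OF nome_t] nome.Psi_def[OF nome_t])

lemma xt_facts: "t \<in> uhp \<Longrightarrow> xt t \<in> nome.annulus (cexp2 t)" "t \<in> uhp \<Longrightarrow> xt t \<noteq> 1"
  using torsion_point_strip.xx_annulus[OF strip] by auto

text \<open>The dependence through \<open>x\<close> gives \<open>r1 * Jt (Suc n)\<close>, the
  dependence through \<open>q\<close> gives \<open>Pt (Suc n)\<close>.\<close>

lemma Jt_has_deriv:
  assumes t: "t \<in> uhp"
  shows "(Jt n has_field_derivative 2 * of_real pi * \<i> * (of_real r1 * Jt (Suc n) t + Pt (Suc n) t)) (at t)"
proof -
  have p: "1 + r1 > 0" "1 + (- r1) > 0" using r1 by linarith+
  have "(Jt n has_field_derivative 0 + 2 * of_real pi * \<i> * of_real r1 * lam (Suc n) (xt t)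
     + 2 * of_real pi * \<i> * (of_real r1 * LA wt1 (Suc n) (cexp2 t) (xt t) + LA wtS (Suc n) (cexp2 t) (xt t))
     - (- 1) ^ n * (2 * of_real pi * \<i> * (of_real (- r1) * LA wt1 (Suc n) (cexp2 t) (cexp2 (of_real (- r1) * t + of_real (- r2))) +
        LA wtS (Suc n) (cexp2 t) (cexp2 (of_real (- r1) * t + of_real (- r2)))))) (at t)"
    unfolding Jt_def[abs_def]
    by (intro DERIV_add DERIV_diff DERIV_cmult DERIV_const lam_cexp2_has_deriv LA_tau_deriv(1) p t xt_facts(2)) auto
  then show ?thesis
    by (rule DERIV_cong) (simp add: Jt_def Pt_def algebra_simps del: lam.simps)
qed

lemma Jt_holomorphic: "Jt n holomorphic_on uhp"
  using Jt_has_deriv open_uhp by (auto simp: holomorphic_on_open)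

lemma Jt_bounded: "\<exists>C. \<forall>t. Im t > 1 \<longrightarrow> norm (Jt n t) \<le> C"
proof -
  have p: "1 + r1 > 0" "1 + (- r1) > 0" using r1 by linarith+
  obtain C1 where C1: "\<And>t. Im t > 1 \<Longrightarrow> norm (LA wt1 n (cexp2 t) (xt t)) \<le> C1"
    using LA_tau_deriv(2)[OF p(1), of "of_real r2" \<i> n] by (auto simp: uhp_iff)
  obtain C2 where C2: "\<And>t. Im t > 1 \<Longrightarrow> norm (LA wt1 n (cexp2 t) (cexp2 (of_real (- r1) * t + of_real (- r2)))) \<le> C2"
    using LA_tau_deriv(2)[OF p(2), of "of_real (- r2)" \<i> n] by (auto simp: uhp_iff)
  have "\<exists>C3. \<forall>t. Im t > 1 \<longrightarrow> norm (lam n (xt t)) \<le> C3"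
  proof (cases "r1 = 0")
    case True
    then show ?thesis by (intro exI[of _ "norm (lam n (cexp2 (of_real r2)))"]) auto
  next
    case False
    then have rp: "r1 > 0" using r1 by simp
    define \<rho> where "\<rho> = exp (- 2 * pi * r1)"
    have "\<rho> < 1" using rp by (simp add: \<rho>_def)
    then obtain C where C: "C \<ge> 0" "\<And>z. norm z \<le> \<rho> \<Longrightarrow> norm (lam n z) \<le> C * norm z" using lam_bound by blast
    have "norm (lam n (xt t)) \<le> C * \<rho>" if "Im t > 1" for t
    proof -
      have "norm (xt t) \<le> \<rho>" unfolding norm_cexp2 \<rho>_def using that rp by simp
      then show ?thesis using C by (meson mult_left_mono order_trans)
    qed
    then show ?thesis by blast
  qed
  then obtain C3 where C3: "\<And>t. Im t > 1 \<Longrightarrow> norm (lam n (xt t)) \<le> C3" by blast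
  have "norm (Jt n t) \<le> 1 + C3 + C1 + C2" if t: "Im t > 1" for t
  proof -
    have "norm (Jt n t) \<le> norm (if n = 0 then 1 / 2 else 0 :: complex) + norm (lam n (xt t)) + norm (LA wt1 n (cexp2 t) (xt t))
        + norm ((- 1) ^ n * LA wt1 n (cexp2 t) (cexp2 (of_real (- r1) * t + of_real (- r2))))"
      unfolding Jt_def by (intro order.trans[OF norm_triangle_ineq4] order.trans[OF norm_triangle_ineq] add_mono order_refl)
    also have "\<dots> \<le> 1 + C3 + C1 + C2"
      using C1[OF t] C2[OF t] C3[OF t] by (intro add_mono) (auto simp: norm_mult norm_power)
    finally show ?thesis .
  qed
  then show ?thesis by blast
qed

abbreviation "rR \<equiv> - 2 * of_real pi * \<i>"

definition g0 :: "nat \<Rightarrow> complex \<Rightarrow> complex" where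
  "g0 k t = rR ^ k / fact (k - 1) * (Jt (k - 1) t - (if k = 1 then of_real r1 else 0))"
definition g1 :: "nat \<Rightarrow> complex" where
  "g1 k = (if k = 2 then rR else 0)"

lemma eisenstein_q:
  assumes t: "t \<in> uhp" and k: "k > 0"
  shows "eisenstein k a t = g0 k t + g1 k * inv_2iy t"
proof -
  interpret torsion_point_strip t r1 r2 N by (rule strip[OF t])
  have e: "eisenstein k a t = phi k z0 t" using t by (simp add: eisenstein_def of_rat_eq_of_real)
  have rc: "rc k = rR ^ k / fact (k - 1)" "rc 1 = rR" by (simp_all add: rc_def)
  consider "k = 1" | "k = 2" | "k \<ge> 3" using k by linarith
  then show ?thesis
  proof cases
    case 1
    then show ?thesis unfolding e using phi_1 rc by (simp add: g0_def g1_def Jt_eq[OF t])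
  next
    case 2
    then show ?thesis unfolding e using phi_2 rc by (simp add: g0_def g1_def Jt_eq[OF t])
  next
    case 3
    then show ?thesis unfolding e using phi_ge_3 rc by (simp add: g0_def g1_def Jt_eq[OF t])
  qed
qed

lemma g0_holomorphic: "g0 k holomorphic_on uhp"
  unfolding g0_def[abs_def] by (intro holomorphic_intros Jt_holomorphic) auto

lemma eisenstein_coeffs:
  "k > 0 \<Longrightarrow> near_hol_coeffs 1 (\<lambda>j. if j = 0 then g0 k else (\<lambda>_. g1 k)) (eisenstein k a)"
  unfolding near_hol_coeffs_def using g0_holomorphic by (auto simp: eisenstein_q)

lemma eisenstein_bounded: "k > 0 \<Longrightarrow> \<exists>C. \<forall>t. Im t > 1 \<longrightarrow> norm (eisenstein k a t) \<le> C"
proof -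
  assume k: "k > 0"
  obtain C where C: "\<And>t. Im t > 1 \<Longrightarrow> norm (Jt (k - 1) t) \<le> C" using Jt_bounded by blast
  have "norm (eisenstein k a t) \<le> norm (rR ^ k / fact (k - 1)) * (C + \<bar>r1\<bar>) + norm (g1 k)" if t: "Im t > 1" for t
  proof -
    have u: "norm (inv_2iy t) \<le> 1"
    proof -
      have "norm (t - cnj t) = 2 * \<bar>Im t\<bar>" unfolding complex_diff_cnj by (simp add: norm_mult)
      then show ?thesis unfolding inv_2iy_def norm_divide using t by simp
    qed
    have "norm (g0 k t) \<le> norm (rR ^ k / fact (k - 1)) * (C + \<bar>r1\<bar>)"
      unfolding g0_def norm_mult[of "rR ^ k / fact (k - 1)"] using C[OF t]
      by (intro mult_left_mono order.trans[OF norm_triangle_ineq4] add_mono) auto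
    moreover have "norm (g1 k * inv_2iy t) \<le> norm (g1 k) * 1"
      unfolding norm_mult using u by (intro mult_left_mono) auto
    moreover have "eisenstein k a t = g0 k t + g1 k * inv_2iy t" using t k by (intro eisenstein_q) (auto simp: uhp_iff)
    ultimately show ?thesis using norm_triangle_ineq[of "g0 k t" "g1 k * inv_2iy t"] by simp
  qed
  then show ?thesis by blast
qed

text \<open>Up to a power of \<open>R\<close> and a factorial the sum is the binomial convolution of
  \<open>J' + e\<close> with itself, where \<open>e\<close> holds the corrections in weights 1 and
  2. The term \<open>- 2 * Q\<close> of \<open>J_convolution\<close> and
  \<open>- 2 * r1 * J' n\<close> from the weight 1 correction together form a multiple of the
  derivative of \<open>Jt (n - 1)\<close>; the weight 2 correction supplies the term with
  \<open>u\<close> in \<open>delta_op\<close>.\<close>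

lemma eisenstein_convolution:
  assumes t: "t \<in> uhp" and n: "n \<ge> 1"
  shows "(\<Sum>i\<le>n. eisenstein (i + 1) a t * eisenstein (n - i + 1) a t) =
    of_nat (n + 1) * eisenstein (n + 2) a t + 2 * rR / of_nat n * delta_op n (eisenstein n a) t"
proof -
  interpret nome "cexp2 t" by (rule nome_t[OF t])
  define u where "u = inv_2iy t"
  define R where "R = rR"
  have R: "R \<noteq> 0" by (simp add: R_def)
  define J' where "J' i = J i (xt t)" for i
  define Q where "Q = Psi n (xt t)"
  define e where "e i = (if i = 0 then - of_real r1 else if i = 1 then u / R else 0)" for i :: nat
  have E: "eisenstein (i + 1) a t = R ^ (i + 1) / fact i * (J' i + e i)" for i
  proof -
    have G: "g0 (i + 1) t = R ^ (i + 1) / fact i * (J' i - (if i = 0 then of_real r1 else 0))"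
      unfolding g0_def R_def J'_def by (simp add: Jt_eq[OF t])
    have G1: "g1 (i + 1) = (if i = 1 then R else 0)" unfolding g1_def R_def by simp
    have "eisenstein (i + 1) a t = g0 (i + 1) t + g1 (i + 1) * u" using eisenstein_q[OF t, of "i + 1"] by (simp add: u_def)
    then show ?thesis unfolding G G1 using R by (auto simp: e_def field_simps)
  qed
  have conv: "(\<Sum>i\<le>n. of_nat (n choose i) * J' i * J' (n - i)) = J' (Suc n) - 2 * Q"
    using J_convolution[OF xt_facts[OF t], of n] n by (simp add: J'_def Q_def)
  have two: "(\<Sum>i\<le>n. h i) = h 0 + h 1" if "\<And>i. i \<ge> 2 \<Longrightarrow> h i = 0" for h :: "nat \<Rightarrow> complex"
  proof -
    have "(\<Sum>i\<le>n. h i) = (\<Sum>i\<in>{0, 1}. h i)" using n that by (intro sum.mono_neutral_right) auto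
    then show ?thesis by simp
  qed
  have eJ: "(\<Sum>i\<le>n. of_nat (n choose i) * e i * J' (n - i)) = - of_real r1 * J' n + of_nat n * (u / R) * J' (n - 1)"
    by (subst two) (auto simp: e_def)
  have "(\<Sum>i\<le>n. of_nat (n choose i) * J' i * e (n - i)) = (\<Sum>i\<le>n. of_nat (n choose (n - i)) * J' (n - i) * e (n - (n - i)))"
    by (rule sum.reindex_bij_witness[of _ "\<lambda>i. n - i" "\<lambda>i. n - i"]) auto
  also have "\<dots> = (\<Sum>i\<le>n. of_nat (n choose i) * e i * J' (n - i))"
    by (intro sum.cong refl) (auto simp: binomial_symmetric[symmetric] mult_ac)
  finally have Je: "(\<Sum>i\<le>n. of_nat (n choose i) * J' i * e (n - i)) = (\<Sum>i\<le>n. of_nat (n choose i) * e i * J' (n - i))" .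
  define ee where "ee = (\<Sum>i\<le>n. of_nat (n choose i) * e i * e (n - i))"
  \<comment> \<open>\<open>e\<close> vanishes from index 2 on, so its convolution with itself
    survives for \<open>n = 1\<close> and \<open>n = 2\<close> only.\<close>
  have ee: "ee = (if n = 1 then - 2 * of_real r1 * (u / R) else if n = 2 then 2 * (u / R)\<^sup>2 else 0)"
  proof -
    have "ee = e 0 * e n + of_nat n * e 1 * e (n - 1)" unfolding ee_def by (subst two) (auto simp: e_def)
    then show ?thesis using n by (auto simp: e_def power2_eq_square)
  qed
  have "(\<Sum>i\<le>n. eisenstein (i + 1) a t * eisenstein (n - i + 1) a t) =
      (\<Sum>i\<le>n. R ^ (n + 2) / fact n * (of_nat (n choose i) * (J' i + e i) * (J' (n - i) + e (n - i))))"
  proof (intro sum.cong refl)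
    fix i assume "i \<in> {..n}"
    then have i: "i \<le> n" by simp
    have bin: "of_nat (n choose i) = (fact n / (fact i * fact (n - i)) :: complex)" by (rule binomial_fact[OF i])
    have "(i + 1) + (n - i + 1) = n + 2" using i by simp
    then have pw: "R ^ (i + 1) * R ^ (n - i + 1) = R ^ (n + 2)" by (simp only: power_add[symmetric])
    have sp: "R ^ (i + 1) / fact i * X * (R ^ (n - i + 1) / fact (n - i) * Y) =
        (R ^ (i + 1) * R ^ (n - i + 1)) / (fact i * fact (n - i)) * (X * Y)" for X Y by simp
    show "eisenstein (i + 1) a t * eisenstein (n - i + 1) a t =
        R ^ (n + 2) / fact n * (of_nat (n choose i) * (J' i + e i) * (J' (n - i) + e (n - i)))"
      unfolding E sp pw bin by simp
  qed
  also have "\<dots> = R ^ (n + 2) / fact n * ((\<Sum>i\<le>n. of_nat (n choose i) * J' i * J' (n - i)) +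
      (\<Sum>i\<le>n. of_nat (n choose i) * J' i * e (n - i)) + (\<Sum>i\<le>n. of_nat (n choose i) * e i * J' (n - i)) + ee)"
    unfolding sum_distrib_left[symmetric] ee_def sum.distrib[symmetric] by (simp add: algebra_simps)
  also have "\<dots> = R ^ (n + 2) / fact n * (J' (Suc n) - 2 * Q + 2 * (- of_real r1 * J' n + of_nat n * (u / R) * J' (n - 1)) + ee)"
    unfolding conv Je eJ by simp
  finally have lhs: "(\<Sum>i\<le>n. eisenstein (i + 1) a t * eisenstein (n - i + 1) a t) = R ^ (n + 2) / fact n *
      (J' (Suc n) - 2 * Q + 2 * (- of_real r1 * J' n + of_nat n * (u / R) * J' (n - 1)) + ee)" .
  obtain m where m: "n = Suc m" using n by (cases n) auto
  have "(g0 n has_field_derivative R ^ n / fact m * (2 * of_real pi * \<i> * (of_real r1 * Jt (Suc m) t + Pt (Suc m) t) - 0)) (at t)"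
    unfolding g0_def[abs_def] R_def m by (simp only: diff_Suc_1) (intro DERIV_cmult DERIV_diff DERIV_const Jt_has_deriv t)
  then have dg: "deriv (g0 n) t = R ^ n / fact m * (- R * (of_real r1 * J' n + Q))"
    unfolding J'_def Q_def m by (simp add: DERIV_imp_deriv R_def Jt_eq[OF t] Pt_eq[OF t])
  have "d_tau (eisenstein n a) t = deriv (g0 n) t - g1 n * u\<^sup>2"
    using d_tau_near_hol(1)[OF eisenstein_coeffs t, of n] n by (simp add: u_def power2_eq_square)
  then have "delta_op n (eisenstein n a) t = deriv (g0 n) t - g1 n * u\<^sup>2 + of_nat n * u * eisenstein n a t"
    using t by (simp add: delta_op_def u_def inv_2iy_def del: complex_diff_cnj)
  also have "eisenstein n a t = R ^ n / fact m * (J' (n - 1) + e (n - 1))" using E[of m] m by simp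
  finally have del: "delta_op n (eisenstein n a) t = R ^ n / fact m * (- R * (of_real r1 * J' n + Q)) - g1 n * u\<^sup>2
      + of_nat n * u * (R ^ n / fact m * (J' (n - 1) + e (n - 1)))" unfolding dg .
  have E2: "of_nat (n + 1) * eisenstein (n + 2) a t = R ^ (n + 2) / fact n * J' (Suc n)"
  proof -
    have e: "eisenstein (n + 2) a t = R ^ (n + 2) / fact (Suc n) * J' (Suc n)" using E[of "Suc n"] n by (simp add: e_def)
    have f: "fact (Suc n) = of_nat (n + 1) * (fact n :: complex)" by simp
    have "c * (X / (c * F) * Y) = X / F * Y" if "c \<noteq> 0" for c X F Y :: complex using that by simp
    then show ?thesis unfolding e f by (metis Suc_eq_plus1 of_nat_neq_0)
  qed
  \<comment> \<open>This convolution has to match the part of \<open>delta_op\<close> that does not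
    involve \<open>J'\<close>: it comes from \<open>r1\<close> for \<open>n = 1\<close> and from
    \<open>inv_2iy\<close> and its derivative for \<open>n = 2\<close>.\<close>
  have extra: "R ^ (n + 2) / fact n * ee = 2 * R / of_nat n * (- g1 n * u\<^sup>2 + of_nat n * u * (R ^ n / fact m * e (n - 1)))"
  proof -
    have g1n: "g1 2 = R" unfolding g1_def R_def by simp
    consider "n = 1" | "n = 2" | "n \<ge> 3" using n by linarith
    then show ?thesis
    proof cases
      case 1
      then have "m = 0" using m by simp
      then show ?thesis unfolding ee using 1 R by (simp add: e_def g1_def power2_eq_square)
    next
      case 2
      then have "m = 1" using m by simp
      then show ?thesis unfolding ee using 2 R by (simp add: e_def g1n power2_eq_square power4_eq_xxxx field_simps)
    next
      case 3
      then show ?thesis unfolding ee by (auto simp: e_def g1_def)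
    qed
  qed
  have "of_nat n \<noteq> (0::complex)" using n by simp
  moreover have "fact n = of_nat n * (fact m :: complex)" using m by simp
  ultimately have nz: "of_nat n \<noteq> (0::complex)" "fact n = of_nat n * (fact m :: complex)" .
  have main: "R ^ (n + 2) / fact n * (- 2 * Q + 2 * (- of_real r1 * J' n + of_nat n * (u / R) * J' (n - 1))) =
      2 * R / of_nat n * (R ^ n / fact m * (- R * (of_real r1 * J' n + Q)) + of_nat n * u * (R ^ n / fact m * J' (n - 1)))"
    unfolding nz(2) using nz(1) R by (simp add: field_simps)
  have "R ^ (n + 2) / fact n * (J' (Suc n) - 2 * Q + 2 * (- of_real r1 * J' n + of_nat n * (u / R) * J' (n - 1)) + ee) =
      R ^ (n + 2) / fact n * J' (Suc n) + R ^ (n + 2) / fact n * (- 2 * Q + 2 * (- of_real r1 * J' n + of_nat n * (u / R) * J' (n - 1)))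
      + R ^ (n + 2) / fact n * ee" by (simp only: distrib_left[symmetric]) (simp add: algebra_simps)
  also have "\<dots> = of_nat (n + 1) * eisenstein (n + 2) a t + 2 * R / of_nat n * delta_op n (eisenstein n a) t"
    unfolding main extra E2 del by (simp add: algebra_simps)
  finally show ?thesis unfolding lhs R_def .
qed

end

section \<open>The square of the weight 1 series\<close>

lemma lam_0_sums: "norm v < 1 \<Longrightarrow> (\<lambda>m. (if m > 0 then v ^ m else 0)) sums lam 0 v"
proof -
  assume v: "norm v < 1"
  have "(\<lambda>m. v * v ^ m) sums (v * (1 / (1 - v)))" by (intro sums_mult geometric_sums v)
  then have "(\<lambda>m. (if Suc m > 0 then v ^ Suc m else 0)) sums lam 0 v" by simp
  from sums_Suc_imp[OF _ this] show ?thesis by simp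
qed

lemma lam_1_sums: "norm v < 1 \<Longrightarrow> (\<lambda>j. of_nat j * v ^ j) sums lam 1 v"
proof -
  assume v: "norm v < 1"
  have "v \<noteq> 1" using v by auto
  have "(\<lambda>j. v * (of_nat (Suc j) * v ^ j)) sums (v * (1 / (1 - v)\<^sup>2))" by (intro sums_mult geometric_deriv_sums v)
  then have "(\<lambda>j. of_nat (Suc j) * v ^ Suc j) sums lam 1 v"
    unfolding lam_1[OF \<open>v \<noteq> 1\<close>] by (simp add: mult_ac)
  from sums_Suc_imp[OF _ this] show ?thesis by simp
qed

lemma suminf_double_swap:
  fixes F :: "nat \<Rightarrow> nat \<Rightarrow> complex"
  assumes sm: "(\<lambda>(m, j). F m j) summable_on UNIV"
  shows "summable (\<lambda>m. \<Sum>j. F m j)" "(\<Sum>m. \<Sum>j. F m j) = (\<Sum>j. \<Sum>m. F m j)"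
proof -
  have sm': "(\<lambda>(m, j). F m j) summable_on UNIV \<times> UNIV" using sm by simp
  have sw: "(\<lambda>(j, m). F m j) summable_on UNIV \<times> UNIV" using summable_on_swap[of "\<lambda>(m, j). F m j" UNIV UNIV] sm' by simp
  have conv: "suminf f = infsum f UNIV" if "f summable_on UNIV" for f :: "nat \<Rightarrow> complex"
    using has_sum_imp_sums[OF has_sum_infsum[OF that]] by (simp add: sums_iff)
  have inner: "(\<lambda>m. \<Sum>j. F m j) = (\<lambda>m. \<Sum>\<^sub>\<infinity>j. F m j)"
    using summable_on_SigmaD1[OF sm'] by (simp add: conv fun_eq_iff)
  show "summable (\<lambda>m. \<Sum>j. F m j)" unfolding inner
    using has_sum_imp_sums[OF has_sum_infsum[OF summable_on_Sigma_banach[OF sm']]] by (simp add: sums_iff)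
  have "(\<Sum>m. \<Sum>j. F m j) = (\<Sum>\<^sub>\<infinity>m. \<Sum>\<^sub>\<infinity>j. F m j)"
    using summable_on_Sigma_banach[OF sm'] summable_on_SigmaD1[OF sm'] by (simp add: conv)
  also have "\<dots> = (\<Sum>\<^sub>\<infinity>j. \<Sum>\<^sub>\<infinity>m. F m j)" by (rule infsum_swap_banach[OF sm'])
  also have "\<dots> = (\<Sum>j. \<Sum>m. F m j)"
    using summable_on_Sigma_banach[OF sw] summable_on_SigmaD1[OF sw] by (simp add: conv)
  finally show "(\<Sum>m. \<Sum>j. F m j) = (\<Sum>j. \<Sum>m. F m j)" .
qed

lemma suminf_progression:
  fixes f :: "nat \<Rightarrow> complex"
  assumes "N > 0" "r < N" "\<And>m. m mod N \<noteq> r \<Longrightarrow> f m = 0"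
  shows "suminf f = (\<Sum>i. f (r + N * i))"
proof -
  have "strict_mono (\<lambda>i. r + N * i)" using assms(1) by (auto simp: strict_mono_def)
  moreover have "f n = 0" if "n \<notin> range (\<lambda>i. r + N * i)" for n
  proof (rule assms(3))
    show "n mod N \<noteq> r"
    proof
      assume "n mod N = r"
      then have "n = r + N * (n div N)" by (metis mod_mult_div_eq)
      then show False using that by blast
    qed
  qed
  ultimately show ?thesis using suminf_mono_reindex[of "\<lambda>i. r + N * i" f] by simp
qed

section \<open>Finite Fourier duality over the N-torsion\<close>

locale level =
  fixes N :: nat and t :: complex
  assumes N: "N > 0" and t: "t \<in> uhp"
begin

definition ze :: "int \<Rightarrow> complex" where "ze i = cexp2 (of_int i / of_nat N)"
definition qn :: complex where "qn = cexp2 (t / of_nat N)"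

sublocale nome "cexp2 t" using t by unfold_locales (simp_all add: norm_cexp2 uhp_iff)

lemma ze_add: "ze (i + j) = ze i * ze j"
  by (simp add: ze_def add_divide_distrib cexp2_add)

lemma ze_0 [simp]: "ze 0 = 1" by (simp add: ze_def)

lemma ze_eq_1_iff: "ze i = 1 \<longleftrightarrow> int N dvd i"
proof -
  have "ze i = 1 \<longleftrightarrow> (\<exists>n::int. of_int i = (of_int (int N * n) :: complex))"
    unfolding ze_def cexp2_eq_1_iff using N by (auto simp: Ints_def field_simps)
  also have "\<dots> \<longleftrightarrow> int N dvd i" unfolding of_int_eq_iff dvd_def ..
  finally show ?thesis .
qed

lemma ze_cong: "i mod int N = j mod int N \<Longrightarrow> ze i = ze j"
proof -
  assume "i mod int N = j mod int N"
  then have "ze (i - j) = 1" by (simp add: ze_eq_1_iff mod_eq_dvd_iff)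
  then show ?thesis using ze_add[of "i - j" j] by simp
qed

lemma norm_ze [simp]: "norm (ze i) = 1"
  by (simp add: ze_def norm_cexp2)

lemma ze_power: "ze (i * int m) = ze i ^ m"
  by (induction m) (simp_all add: ze_add distrib_left)

lemma qn_facts: "qn \<noteq> 0" "norm qn < 1" "qn ^ N = cexp2 t"
proof -
  show "norm qn < 1" using t N by (simp add: qn_def norm_cexp2 uhp_iff)
  have "qn ^ N = exp (of_nat N * (2 * of_real pi * \<i> * (t / of_nat N)))"
    unfolding qn_def cexp2_def by (simp only: exp_of_nat_mult)
  then show "qn ^ N = cexp2 t" using N by (simp add: cexp2_def mult_ac)
qed (simp add: qn_def)

lemma ze_sum: "(\<Sum>b\<in>{0..<int N}. ze (b * i)) = (if int N dvd i then of_nat N else 0)"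
proof -
  have "{0..<int N} = int ` {..<N}" by (metis atLeast0LessThan image_int_atLeastLessThan of_nat_0)
  then have "(\<Sum>b\<in>{0..<int N}. ze (b * i)) = (\<Sum>b<N. ze i ^ b)"
    by (simp add: sum.reindex o_def ze_power[symmetric] mult.commute)
  also have "\<dots> = (if int N dvd i then of_nat N else 0)"
  proof (cases "int N dvd i")
    case True
    then have "ze i = 1" by (simp add: ze_eq_1_iff)
    then show ?thesis using True by simp
  next
    case False
    then have "ze i \<noteq> 1" by (simp add: ze_eq_1_iff)
    moreover have "ze i ^ N = 1" unfolding ze_power[symmetric] by (simp add: ze_eq_1_iff)
    ultimately show ?thesis using False by (simp add: geometric_sum)
  qed
  finally show ?thesis .
qed

text \<open>Expanding \<open>lam\<close> geometrically, \<open>U\<close> and \<open>V\<close> are both sums over pairs \<open>(m, j)\<close> of \<open>j * qn ^ (m * j)\<close> times a root of unity;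
  in \<open>U\<close> the congruence is on \<open>m\<close>, in \<open>V\<close> on \<open>j\<close>, which is why a finite Fourier transform exchanges them.\<close>

definition U :: "int \<Rightarrow> complex \<Rightarrow> complex" where
  "U r v = (\<Sum>m. if m > 0 \<and> int m mod int N = r mod int N then lam 1 (v * qn ^ m) else 0)"

definition V :: "int \<Rightarrow> complex \<Rightarrow> complex" where
  "V r v = (\<Sum>j. if int j mod int N = r mod int N then of_nat j / of_nat N * lam 0 (v * qn ^ j) else 0)"

lemma norm_v_qn: "norm v = 1 \<Longrightarrow> m > 0 \<Longrightarrow> norm (v * qn ^ m) \<le> norm qn"
proof -
  assume "norm v = 1" "m > 0"
  moreover have "norm qn ^ m \<le> norm qn ^ 1" using \<open>m > 0\<close> qn_facts by (intro power_decreasing) auto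
  ultimately show ?thesis by (simp add: norm_mult norm_power)
qed

lemma lam_qn_bound:
  "\<exists>C\<ge>0. \<forall>v m. norm v = 1 \<and> m > 0 \<longrightarrow> norm (lam n (v * qn ^ m)) \<le> C * norm qn ^ m"
proof -
  obtain C where C: "C \<ge> 0" "\<And>x. norm x \<le> norm qn \<Longrightarrow> norm (lam n x) \<le> C * norm x" using lam_bound[OF qn_facts(2)] by blast
  have "norm (lam n (v * qn ^ m)) \<le> C * norm qn ^ m" if "norm v = 1" "m > 0" for v m
    using C(2)[OF norm_v_qn[OF that]] that by (simp add: norm_mult norm_power)
  then show ?thesis using C(1) by blast
qed

lemma U_summable:
  assumes "norm v = 1"
  shows "summable (\<lambda>m. if m > 0 \<and> P m then lam 1 (v * qn ^ m) else 0)"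
proof -
  obtain C where C: "C \<ge> 0" "\<And>v m. norm v = 1 \<Longrightarrow> m > 0 \<Longrightarrow> norm (lam 1 (v * qn ^ m)) \<le> C * norm qn ^ m"
    using lam_qn_bound[of 1] by blast
  have "summable (\<lambda>m. C * norm qn ^ m)" using qn_facts by (intro summable_mult summable_geometric) auto
  then show ?thesis
    by (rule summable_comparison_test') (use C assms in \<open>auto simp del: lam.simps\<close>)
qed

lemma V_summable:
  assumes "norm v = 1"
  shows "summable (\<lambda>j. if P j then of_nat j / of_nat N * lam 0 (v * qn ^ j) else 0)"
proof -
  obtain C where C: "C \<ge> 0" "\<And>v m. norm v = 1 \<Longrightarrow> m > 0 \<Longrightarrow> norm (lam 0 (v * qn ^ m)) \<le> C * norm qn ^ m"
    using lam_qn_bound[of 0] by blast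
  have "summable (\<lambda>m. real m * norm qn ^ m)"
  proof -
    have "summable (\<lambda>j. norm qn * (real (Suc j) * norm qn ^ j))"
      using geometric_deriv_sums[of "norm qn"] qn_facts by (intro summable_mult) (auto simp: sums_iff)
    then have "summable (\<lambda>j. real (Suc j) * norm qn ^ Suc j)" by (simp add: mult_ac)
    then show ?thesis by (simp only: summable_Suc_iff[of "\<lambda>m. real m * norm qn ^ m"])
  qed
  then have s: "summable (\<lambda>m. C * (real m * norm qn ^ m))" by (rule summable_mult)
  show ?thesis
  proof (rule summable_comparison_test'[OF s])
    fix m :: nat
    have "norm (of_nat m / of_nat N * lam 0 (v * qn ^ m)) \<le> real m * (C * norm qn ^ m)"
    proof (cases "m = 0")
      case False
      have "real m / real N * norm (lam 0 (v * qn ^ m)) \<le> real m * (C * norm qn ^ m)"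
        using C(2)[OF assms, of m] False N by (intro mult_mono) (auto simp: field_simps simp del: lam.simps)
      then show ?thesis by (simp add: norm_mult norm_divide del: lam.simps)
    qed simp
    then show "norm (if P m then of_nat m / of_nat N * lam 0 (v * qn ^ m) else 0) \<le> C * (real m * norm qn ^ m)"
      using C(1) by (auto simp: mult_ac simp del: lam.simps)
  qed
qed

text \<open>Orthogonality of the \<open>N\<close>-th roots of unity picks the exponents congruent to
  \<open>k\<close> out of the power series of \<open>lam 1\<close>.\<close>

lemma fourier_filter:
  assumes "norm v < 1"
  shows "(\<Sum>b\<in>{0..<int N}. ze (- k * b) * lam 1 (ze b * v)) =
    of_nat N * (\<Sum>j. if int j mod int N = k mod int N then of_nat j * v ^ j else 0)"
    "summable (\<lambda>j. if int j mod int N = k mod int N then of_nat j * v ^ j else 0)"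
proof -
  have s: "(\<lambda>j. of_nat j * (ze b * v) ^ j) sums lam 1 (ze b * v)" for b
    using assms by (intro lam_1_sums) (simp add: norm_mult)
  have "(\<lambda>j. \<Sum>b\<in>{0..<int N}. ze (- k * b) * (of_nat j * (ze b * v) ^ j)) sums (\<Sum>b\<in>{0..<int N}. ze (- k * b) * lam 1 (ze b * v))"
    by (intro sums_sum sums_mult s)
  moreover have "(\<Sum>b\<in>{0..<int N}. ze (- k * b) * (of_nat j * (ze b * v) ^ j)) =
      of_nat N * (if int j mod int N = k mod int N then of_nat j * v ^ j else 0)" for j
  proof -
    have "ze (- k * b) * (of_nat j * (ze b * v) ^ j) = of_nat j * v ^ j * ze (b * (int j - k))" for b
    proof -
      have "b * (int j - k) = - k * b + b * int j" by (simp add: algebra_simps)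
      then have "ze (b * (int j - k)) = ze (- k * b) * ze b ^ j" by (simp only: ze_add ze_power)
      then show ?thesis by (simp add: power_mult_distrib mult_ac)
    qed
    then have "(\<Sum>b\<in>{0..<int N}. ze (- k * b) * (of_nat j * (ze b * v) ^ j)) = of_nat j * v ^ j * (\<Sum>b\<in>{0..<int N}. ze (b * (int j - k)))"
      by (simp only: sum_distrib_left)
    also have "\<dots> = of_nat N * (if int j mod int N = k mod int N then of_nat j * v ^ j else 0)"
      unfolding ze_sum mod_eq_dvd_iff by simp
    finally show ?thesis .
  qed
  ultimately have S: "(\<lambda>j. of_nat N * (if int j mod int N = k mod int N then of_nat j * v ^ j else 0)) sums
      (\<Sum>b\<in>{0..<int N}. ze (- k * b) * lam 1 (ze b * v))" by (simp only:)
  show sm: "summable (\<lambda>j. if int j mod int N = k mod int N then of_nat j * v ^ j else 0)"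
    using sums_summable[OF S] N unfolding summable_cmult_iff by simp
  show "(\<Sum>b\<in>{0..<int N}. ze (- k * b) * lam 1 (ze b * v)) =
    of_nat N * (\<Sum>j. if int j mod int N = k mod int N then of_nat j * v ^ j else 0)"
    unfolding suminf_mult[OF sm, symmetric] by (rule sums_unique[OF S])
qed

lemma double_summable:
  "(\<lambda>(m, j). if m > 0 \<and> int j mod int N = k mod int N then ze (l * int m) * (of_nat j * (qn ^ m) ^ j) else 0) summable_on (UNIV :: (nat \<times> nat) set)"
proof -
  \<comment> \<open>For positive \<open>m\<close> and \<open>j\<close> one has
    \<open>m + j \<le> 2 * (m * j)\<close>, so with this square root the summand is dominated by a
    product of a series in \<open>m\<close> and one in \<open>j\<close>.\<close>
  define s where "s = sqrt (norm qn)"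
  have s: "0 < s" "s < 1" "s * s = norm qn" using qn_facts by (auto simp: s_def)
  define h where "h m = s ^ m" for m :: nat
  define h' where "h' j = real j * s ^ j" for j :: nat
  have h: "h summable_on UNIV" unfolding h_def using s by (intro summable_nonneg_imp_summable_on summable_geometric) auto
  have "summable (\<lambda>j. s * (real (Suc j) * s ^ j))" using geometric_deriv_sums[of s] s by (intro summable_mult) (auto simp: sums_iff)
  then have "summable (\<lambda>j. h' (Suc j))" by (simp add: h'_def mult_ac)
  then have "summable h'" by (simp only: summable_Suc_iff)
  then have h': "h' summable_on UNIV" using s by (intro summable_nonneg_imp_summable_on) (auto simp: h'_def)
  have "(\<lambda>(m, j). h m * h' j) summable_on UNIV \<times> UNIV"
  proof (rule summable_on_SigmaI)
    show "((\<lambda>j. (case (m, j) of (m, j) \<Rightarrow> h m * h' j)) has_sum h m * infsum h' UNIV) UNIV" for m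
      using has_sum_cmult_right[OF has_sum_infsum[OF h'], of "h m"] by simp
    show "(\<lambda>m. h m * infsum h' UNIV) summable_on UNIV" by (intro summable_on_cmult_left h)
  qed (use s in \<open>auto simp: h_def h'_def\<close>)
  then have "(\<lambda>(m, j). h m * h' j) summable_on UNIV" by simp
  then show ?thesis
  proof (rule abs_summable_summable[OF summable_on_comparison_test], goal_cases)
    case (1 x)
    obtain m j where x: "x = (m, j)" by (cases x)
    have "norm (ze (l * int m) * (of_nat j * (qn ^ m) ^ j)) \<le> h m * h' j" if m: "m > 0"
    proof (cases "j = 0")
      case False
      have "m + j \<le> 2 * (m * j)"
      proof -
        have "m \<le> m * j" "j \<le> m * j" using m False by auto
        then show ?thesis by linarith
      qed
      then have "s ^ (2 * (m * j)) \<le> s ^ (m + j)" using s by (intro power_decreasing) auto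
      moreover have "s ^ (2 * (m * j)) = norm qn ^ (m * j)" using s by (simp add: power_mult power2_eq_square)
      ultimately have "norm qn ^ (m * j) \<le> s ^ m * s ^ j" by (simp add: power_add)
      then have "real j * norm qn ^ (m * j) \<le> real j * (s ^ m * s ^ j)" by (rule mult_left_mono) auto
      then show ?thesis by (simp add: norm_mult norm_power h_def h'_def mult_ac power_mult[symmetric])
    qed (use s in \<open>auto simp: h_def h'_def\<close>)
    moreover have "0 \<le> h m * h' j" using s by (simp add: h_def h'_def)
    ultimately show ?case by (auto simp: x)
  qed auto
qed

text \<open>The sum over \<open>b1\<close> trades the congruence on \<open>m\<close> for a phase,
  and the sum over \<open>b2\<close> filters \<open>j\<close>. After exchanging the series, the one
  in \<open>m\<close> is geometric and gives \<open>lam 0\<close>. One factor \<open>N\<close> comes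
  from the filter, the other undoes the denominator in \<open>V\<close>.\<close>

lemma U_V_fourier:
  "(\<Sum>b2\<in>{0..<int N}. \<Sum>b1\<in>{0..<int N}. ze (l * b1 - k * b2) * U b1 (ze b2)) = of_nat N ^ 2 * V k (ze l)"
proof -
  let ?I = "{0..<int N}"
  let ?F = "\<lambda>m j. if m > 0 \<and> int j mod int N = k mod int N then ze (l * int m) * (of_nat j * (qn ^ m) ^ j) else 0"
  have "(\<Sum>b2\<in>?I. \<Sum>b1\<in>?I. ze (l * b1 - k * b2) * U b1 (ze b2)) =
      (\<Sum>b2\<in>?I. \<Sum>b1\<in>?I. \<Sum>m. ze (l * b1 - k * b2) * (if m > 0 \<and> int m mod int N = b1 mod int N then lam 1 (ze b2 * qn ^ m) else 0))"
    unfolding U_def by (intro sum.cong refl suminf_mult[symmetric] U_summable) simp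
  also have "\<dots> = (\<Sum>m. \<Sum>b2\<in>?I. \<Sum>b1\<in>?I. ze (l * b1 - k * b2) * (if m > 0 \<and> int m mod int N = b1 mod int N then lam 1 (ze b2 * qn ^ m) else 0))"
    by (subst suminf_sum[symmetric], intro summable_sum summable_mult U_summable, simp)+ simp
  also have "\<dots> = (\<Sum>m. of_nat N * (\<Sum>j. ?F m j))"
  proof (intro suminf_cong)
    fix m :: nat
    show "(\<Sum>b2\<in>?I. \<Sum>b1\<in>?I. ze (l * b1 - k * b2) * (if m > 0 \<and> int m mod int N = b1 mod int N then lam 1 (ze b2 * qn ^ m) else 0)) =
      of_nat N * (\<Sum>j. ?F m j)"
    proof (cases "m > 0")
      case True
      have inner: "(\<Sum>b1\<in>?I. ze (l * b1 - k * b2) * (if m > 0 \<and> int m mod int N = b1 mod int N then lam 1 (ze b2 * qn ^ m) else 0)) =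
          ze (l * int m) * (ze (- k * b2) * lam 1 (ze b2 * qn ^ m))" for b2
      proof -
        have "(\<Sum>b1\<in>?I. ze (l * b1 - k * b2) * (if m > 0 \<and> int m mod int N = b1 mod int N then lam 1 (ze b2 * qn ^ m) else 0)) =
            (\<Sum>b1\<in>?I. if b1 = int m mod int N then ze (l * b1 - k * b2) * lam 1 (ze b2 * qn ^ m) else 0)"
          using True by (intro sum.cong refl) auto
        also have "\<dots> = ze (l * (int m mod int N) - k * b2) * lam 1 (ze b2 * qn ^ m)" using N by simp
        also have "ze (l * (int m mod int N) - k * b2) = ze (l * int m - k * b2)"
          by (rule ze_cong, rule mod_diff_cong, rule mod_mult_right_eq, rule refl)
        also have "l * int m - k * b2 = l * int m + - k * b2" by simp
        finally show ?thesis by (simp only: ze_add mult.assoc)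
      qed
      have v: "norm (qn ^ m) < 1" using True qn_facts by (simp add: norm_power power_less_one_iff)
      have "(\<Sum>b2\<in>?I. \<Sum>b1\<in>?I. ze (l * b1 - k * b2) * (if m > 0 \<and> int m mod int N = b1 mod int N then lam 1 (ze b2 * qn ^ m) else 0)) =
          ze (l * int m) * (of_nat N * (\<Sum>j. if int j mod int N = k mod int N then of_nat j * (qn ^ m) ^ j else 0))"
        unfolding inner sum_distrib_left[symmetric] fourier_filter(1)[OF v] ..
      also have "\<dots> = of_nat N * (ze (l * int m) * (\<Sum>j. if int j mod int N = k mod int N then of_nat j * (qn ^ m) ^ j else 0))"
        by (rule mult.left_commute)
      also have "ze (l * int m) * (\<Sum>j. if int j mod int N = k mod int N then of_nat j * (qn ^ m) ^ j else 0) = (\<Sum>j. ?F m j)"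
        unfolding suminf_mult[OF fourier_filter(2)[OF v], symmetric] using True by (intro suminf_cong) simp
      finally show ?thesis .
    qed simp
  qed
  also have "\<dots> = of_nat N * (\<Sum>j. \<Sum>m. ?F m j)"
    unfolding suminf_mult[OF suminf_double_swap(1)[OF double_summable]] suminf_double_swap(2)[OF double_summable] ..
  also have "(\<lambda>j. \<Sum>m. ?F m j) = (\<lambda>j. of_nat N * (if int j mod int N = k mod int N then of_nat j / of_nat N * lam 0 (ze l * qn ^ j) else 0))"
  proof
    fix j :: nat
    show "(\<Sum>m. ?F m j) = of_nat N * (if int j mod int N = k mod int N then of_nat j / of_nat N * lam 0 (ze l * qn ^ j) else 0)"
    proof (cases "j > 0 \<and> int j mod int N = k mod int N")
      case True
      have v: "norm (ze l * qn ^ j) < 1" using norm_v_qn[of "ze l" j] qn_facts True by simp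
      have "?F m j = of_nat j * (if m > 0 then (ze l * qn ^ j) ^ m else 0)" for m
        using True by (simp add: ze_power power_mult_distrib power_mult[symmetric] mult_ac)
      then have "(\<Sum>m. ?F m j) = of_nat j * lam 0 (ze l * qn ^ j)"
        using sums_mult[OF lam_0_sums[OF v], of "of_nat j"] by (simp only: sums_iff)
      then show ?thesis using True N by (simp del: lam.simps)
    next
      case False
      then have z: "?F m j = 0" for m by auto
      show ?thesis unfolding z using False by (auto simp del: lam.simps)
    qed
  qed
  also have "(\<Sum>j. of_nat N * (if int j mod int N = k mod int N then of_nat j / of_nat N * lam 0 (ze l * qn ^ j) else 0)) = of_nat N * V k (ze l)"
    unfolding V_def by (rule suminf_mult[OF V_summable]) simp
  finally show ?thesis by (simp add: power2_eq_square mult_ac)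
qed

lemma qn_power_shift: "v * qn ^ (r + N * Suc m) = v * qn ^ r * cexp2 t ^ Suc m"
  unfolding qn_facts(3)[symmetric] by (simp add: power_add power_mult mult_ac)

lemma qn_arg:
  assumes "norm v = 1"
  shows "v * qn ^ r \<noteq> 0" "norm (v * qn ^ r * cexp2 t) < 1"
proof -
  show "v * qn ^ r \<noteq> 0" using assms qn_facts by auto
  have "norm qn ^ r * norm (cexp2 t) \<le> 1 * norm (cexp2 t)"
    using qn_facts by (intro mult_right_mono power_le_one) auto
  then show "norm (v * qn ^ r * cexp2 t) < 1" using q(2) unfolding norm_mult norm_power assms mult_1_left by linarith
qed

lemma mod_int_progression: "r < N \<Longrightarrow> (int m mod int N = int r mod int N) = (m mod N = r)"
  by (metis mod_less of_nat_eq_iff zmod_int)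

text \<open>Run through \<open>m = r + N * i\<close> and use \<open>qn ^ N = cexp2 t\<close>. The
  term \<open>i = 0\<close> stands apart because \<open>LA\<close> starts at exponent 1; for
  \<open>r = 0\<close> it is excluded by \<open>m > 0\<close>.\<close>

lemma U_eq:
  assumes v: "norm v = 1" and r: "r < N"
  shows "U (int r) v = (if r > 0 then lam 1 (v * qn ^ r) else 0) + LA wt1 1 (cexp2 t) (v * qn ^ r)"
proof -
  define f where "f m = (if m > 0 \<and> m mod N = r then lam 1 (v * qn ^ m) else 0)" for m
  have "U (int r) v = suminf f" unfolding U_def f_def mod_int_progression[OF r] ..
  also have "\<dots> = (\<Sum>i. f (r + N * i))" by (rule suminf_progression[OF N r]) (simp add: f_def)
  also have "\<dots> = f r + (\<Sum>m. f (r + N * Suc m))"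
  proof -
    have e: "f (r + N * Suc m) = lam 1 (v * qn ^ r * cexp2 t ^ Suc m)" for m
      unfolding f_def qn_power_shift using N r by (simp del: lam.simps power_Suc mult_Suc_right)
    have "summable (\<lambda>m. f (r + N * Suc m))" unfolding e using LA1(1)[OF qn_arg[OF v], of 1 r] by simp
    then have "summable (\<lambda>m. f (r + N * m))" by (rule summable_Suc_iff[of "\<lambda>m. f (r + N * m)", THEN iffD1])
    then show ?thesis using suminf_split_head[of "\<lambda>m. f (r + N * m)"] by simp
  qed
  also have "(\<Sum>m. f (r + N * Suc m)) = LA wt1 1 (cexp2 t) (v * qn ^ r)"
    unfolding f_def qn_power_shift LA_def using N r by (simp del: lam.simps power_Suc mult_Suc_right)
  also have "f r = (if r > 0 then lam 1 (v * qn ^ r) else 0)" using r by (simp add: f_def del: lam.simps)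
  finally show ?thesis .
qed

text \<open>An index \<open>j = r + N * i\<close> has \<open>j / N = r / N + i\<close>, so the
  series splits into \<open>r / N\<close> times one with weights \<open>wt1\<close> and one with
  weights \<open>wtS\<close>. This is the origin of the division by \<open>N\<close> in
  \<open>V\<close>, and it is how \<open>a1 * J 0\<close> joins \<open>Psi 0\<close>.\<close>

lemma V_eq:
  assumes v: "norm v = 1" and r: "r < N"
  shows "V (int r) v = of_nat r / of_nat N * (lam 0 (v * qn ^ r) + LA wt1 0 (cexp2 t) (v * qn ^ r))
    + LA wtS 0 (cexp2 t) (v * qn ^ r)"
proof -
  let ?x = "v * qn ^ r"
  define f where "f m = (if m mod N = r then of_nat m / of_nat N * lam 0 (v * qn ^ m) else 0)" for m
  have "V (int r) v = suminf f" unfolding V_def f_def mod_int_progression[OF r] ..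
  also have "\<dots> = (\<Sum>i. f (r + N * i))" by (rule suminf_progression[OF N r]) (simp add: f_def)
  also have "\<dots> = f r + of_nat r / of_nat N * LA wt1 0 (cexp2 t) ?x + LA wtS 0 (cexp2 t) ?x"
  proof -
    have e: "f (r + N * Suc m) = of_nat r / of_nat N * (wt1 m * lam 0 (?x * cexp2 t ^ Suc m)) + wtS m * lam 0 (?x * cexp2 t ^ Suc m)" for m
    proof -
      have "f (r + N * Suc m) = of_nat (r + N * Suc m) / of_nat N * lam 0 (?x * cexp2 t ^ Suc m)"
        unfolding f_def qn_power_shift using N r by (simp del: lam.simps power_Suc mult_Suc_right)
      also have "of_nat (r + N * Suc m) / of_nat N = of_nat r / of_nat N + wtS m"
        using N by (simp add: field_simps)
      finally show ?thesis by (simp only: distrib_right mult_1_left mult.assoc)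
    qed
    have "(\<lambda>m. f (r + N * Suc m)) sums (of_nat r / of_nat N * LA wt1 0 (cexp2 t) ?x + LA wtS 0 (cexp2 t) ?x)"
      unfolding e LA_def by (intro sums_add sums_mult summable_sums LA1(1) LAS(1) qn_arg[OF v])
    from sums_Suc[OF this] show ?thesis by (simp add: sums_iff add_ac)
  qed
  also have "f r = of_nat r / of_nat N * lam 0 ?x" using r by (simp add: f_def del: lam.simps)
  finally show ?thesis by (simp only: distrib_left add_ac)
qed

lemma U_cong: "r mod int N = r' mod int N \<Longrightarrow> U r v = U r' v" by (simp add: U_def)
lemma V_cong: "r mod int N = r' mod int N \<Longrightarrow> V r v = V r' v" by (simp add: V_def)

lemma reflected_arg:
  assumes "0 < r" "r < N"
  shows "(- int r) mod int N = int (N - r) mod int N" "w * qn ^ (N - r) = cexp2 t * (w / qn ^ r)"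
proof -
  have "int (N - r) = - int r + int N" using assms by simp
  then show "(- int r) mod int N = int (N - r) mod int N" by simp
  have "qn ^ (N - r) * qn ^ r = cexp2 t" using assms by (simp add: power_add[symmetric] qn_facts)
  then show "w * qn ^ (N - r) = cexp2 t * (w / qn ^ r)" using qn_facts(1) by (simp add: field_simps)
qed

lemma qn_inverse_arg:
  assumes "norm w = 1" "r < N"
  shows "w / qn ^ r \<noteq> 0" "norm (w / qn ^ r * cexp2 t) < 1"
proof -
  show "w / qn ^ r \<noteq> 0" using assms qn_facts by auto
  have "w / qn ^ r * cexp2 t = w * qn ^ (N - r)"
  proof (cases "r = 0")
    case False
    then show ?thesis using reflected_arg(2)[of r w] assms by simp
  qed (use qn_facts in simp)
  then show "norm (w / qn ^ r * cexp2 t) < 1" using norm_v_qn[of w "N - r"] assms qn_facts by simp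
qed

text \<open>For \<open>r > 0\<close> the residue \<open>- r\<close> is represented by
  \<open>N - r\<close>, whose argument is \<open>cexp2 t\<close> times \<open>w / qn ^ r\<close>;
  \<open>LA_shift\<close> undoes that factor and absorbs the separate first term.\<close>

lemma U_minus_eq:
  assumes w: "norm w = 1" and r: "r < N"
  shows "U (- int r) w = LA wt1 1 (cexp2 t) (w / qn ^ r)"
proof (cases "r = 0")
  case True
  then show ?thesis using U_eq[OF w, of 0] N by simp
next
  case False
  then have "U (- int r) w = U (int (N - r)) w" using r by (intro U_cong reflected_arg) auto
  also have "\<dots> = lam 1 (cexp2 t * (w / qn ^ r)) + LA wt1 1 (cexp2 t) (cexp2 t * (w / qn ^ r))"
    using U_eq[OF w, of "N - r"] False r reflected_arg(2)[of r w] by (simp del: lam.simps)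
  also have "\<dots> = LA wt1 1 (cexp2 t) (w / qn ^ r)"
    unfolding LA_shift(1)[OF qn_inverse_arg[OF w r]] by (simp add: mult.commute del: lam.simps)
  finally show ?thesis .
qed

lemma V_minus_eq:
  assumes w: "norm w = 1" and r: "r < N"
  shows "V (- int r) w = LA wtS 0 (cexp2 t) (w / qn ^ r) - of_nat r / of_nat N * LA wt1 0 (cexp2 t) (w / qn ^ r)"
proof (cases "r = 0")
  case True
  then show ?thesis using V_eq[OF w, of 0] N by simp
next
  case False
  then have "V (- int r) w = V (int (N - r)) w" using r by (intro V_cong reflected_arg) auto
  also have "\<dots> = of_nat (N - r) / of_nat N * (lam 0 (cexp2 t * (w / qn ^ r)) + LA wt1 0 (cexp2 t) (cexp2 t * (w / qn ^ r)))
      + LA wtS 0 (cexp2 t) (cexp2 t * (w / qn ^ r))"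
    using V_eq[OF w, of "N - r"] False r reflected_arg(2)[of r w] by (simp del: lam.simps)
  also have "\<dots> = of_nat (N - r) / of_nat N * LA wt1 0 (cexp2 t) (w / qn ^ r)
      + (LA wtS 0 (cexp2 t) (w / qn ^ r) - LA wt1 0 (cexp2 t) (w / qn ^ r))"
    unfolding LA_shift[OF qn_inverse_arg[OF w r]] by (simp add: mult.commute del: lam.simps)
  also have "of_nat (N - r) / of_nat N = 1 - of_nat r / (of_nat N :: complex)" using r by (simp add: of_nat_diff field_simps)
  finally show ?thesis by (simp add: algebra_simps)
qed

text \<open>Symmetrised under negation of the torsion point, to match \<open>J 1\<close> and
  \<open>Psi 0\<close>, which combine \<open>x\<close> with \<open>1 / x\<close>.\<close>

definition T :: "int \<Rightarrow> int \<Rightarrow> complex" where "T b1 b2 = U b1 (ze b2) + U (- b1) (ze (- b2))"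
definition G :: "int \<Rightarrow> int \<Rightarrow> complex" where "G k l = V k (ze l) + V (- k) (ze (- l))"

lemma ze_nonzero [simp]: "ze i \<noteq> 0" by (simp add: ze_def)

lemma ze_minus: "ze (- i) = 1 / ze i"
  using ze_add[of "- i" i] by (simp add: eq_divide_eq)

lemma T_eq:
  assumes "r < N"
  shows "J 1 (ze b * qn ^ r) = T (int r) b + (if r = 0 then lam 1 (ze b) else 0)"
  unfolding T_def J_def using U_eq[OF norm_ze assms, of b] U_minus_eq[OF norm_ze assms, of "- b"]
  by (auto simp add: ze_minus del: lam.simps)

lemma G_eq:
  assumes "r < N"
  shows "G (int r) b = Psi 0 (ze b * qn ^ r) + of_nat r / of_nat N * (J 0 (ze b * qn ^ r) - 1 / 2)"
  unfolding G_def Psi_def J_def using V_eq[OF norm_ze assms, of b] V_minus_eq[OF norm_ze assms, of "- b"]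
  by (simp add: ze_minus algebra_simps del: lam.simps)

text \<open>Both sides are the sum of \<open>j * q ^ (m * j)\<close>; this is the level 1 case of the Fourier duality.\<close>

lemma lambert_swap: "LA wt1 1 (cexp2 t) 1 = LA wtS 0 (cexp2 t) 1"
proof -
  interpret one: level 1 t using t by unfold_locales auto
  have "{0..<1} = {0::int}" by auto
  then have "one.U 0 1 = one.V 0 1" using one.U_V_fourier[of 0 0] one.ze_0 by (simp del: One_nat_def)
  then show ?thesis using one.U_eq[of 1 0] one.V_eq[of 1 0] by (simp del: One_nat_def)
qed

lemma T_0: "T 0 0 = 2 * LA wt1 1 (cexp2 t) 1" and G_0: "G 0 0 = T 0 0"
proof -
  show T0: "T 0 0 = 2 * LA wt1 1 (cexp2 t) 1"
    unfolding T_def using U_eq[of 1 0] N by simp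
  show "G 0 0 = T 0 0" unfolding T0 lambert_swap G_def using V_eq[of 1 0] N by simp
qed

lemma sum_reflect:
  fixes f :: "int \<Rightarrow> complex"
  assumes "\<And>i j. i mod int N = j mod int N \<Longrightarrow> f i = f j"
  shows "(\<Sum>b\<in>{0..<int N}. f (- b)) = (\<Sum>b\<in>{0..<int N}. f b)"
proof (rule sum.reindex_bij_witness[of _ "\<lambda>b. (- b) mod int N" "\<lambda>b. (- b) mod int N"])
  fix b assume b: "b \<in> {0..<int N}"
  show "(- ((- b) mod int N)) mod int N = b" using b by (simp add: mod_minus_eq)
  then show "(- ((- b) mod int N)) mod int N = b" .
  show "(- b) mod int N \<in> {0..<int N}" using N by simp
  then show "(- b) mod int N \<in> {0..<int N}" .
  show "f ((- b) mod int N) = f (- b)" by (rule assms) simp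
qed

lemma T_fourier:
  "(\<Sum>b2\<in>{0..<int N}. \<Sum>b1\<in>{0..<int N}. ze (l * b1 - k * b2) * T b1 b2) = of_nat N ^ 2 * G k l"
proof -
  let ?I = "{0..<int N}"
  have "(\<Sum>b2\<in>?I. \<Sum>b1\<in>?I. ze (l * b1 - k * b2) * U (- b1) (ze (- b2))) =
      (\<Sum>b2\<in>?I. \<Sum>b1\<in>?I. ze (- l * (- b1) - - k * (- b2)) * U (- b1) (ze (- b2)))" by simp
  also have "\<dots> = (\<Sum>b2\<in>?I. \<Sum>b1\<in>?I. ze (- l * b1 - - k * (- b2)) * U b1 (ze (- b2)))"
    by (intro sum.cong refl sum_reflect arg_cong2[where f = "(*)"] ze_cong U_cong mod_diff_cong mod_mult_cong)
  also have "\<dots> = (\<Sum>b2\<in>?I. \<Sum>b1\<in>?I. ze (- l * b1 - - k * b2) * U b1 (ze b2))"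
  proof (rule sum_reflect, intro sum.cong refl)
    fix i j b1 assume ij: "i mod int N = j mod int N"
    have "ze (- l * b1 - - k * i) = ze (- l * b1 - - k * j)"
      by (intro ze_cong mod_diff_cong mod_mult_cong refl ij)
    then show "ze (- l * b1 - - k * i) * U b1 (ze i) = ze (- l * b1 - - k * j) * U b1 (ze j)"
      using ze_cong[OF ij] by simp
  qed
  also have "\<dots> = of_nat N ^ 2 * V (- k) (ze (- l))" by (rule U_V_fourier)
  finally show ?thesis unfolding T_def G_def distrib_left sum.distrib U_V_fourier by simp
qed

end

section \<open>The weight 1 square in terms of weight 2 series at N-torsion points\<close>

definition level_point :: "nat \<Rightarrow> int \<times> int \<Rightarrow> rat \<times> rat" where
  "level_point N b = (of_int (fst b) / of_nat N, of_int (snd b) / of_nat N)"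

definition level_index :: "nat \<Rightarrow> (int \<times> int) set" where
  "level_index N = {0..<int N} \<times> {0..<int N} - {(0, 0)}"

lemma level_coord_int:
  assumes "N > 0" "i \<in> {0..<int N}" "of_int i / of_nat N \<in> (\<int> :: rat set)"
  shows "i = 0"
proof -
  obtain m where "of_int i / of_nat N = (of_int m :: rat)" using assms(3) by (auto elim: Ints_cases)
  then have "(of_int i :: rat) = of_int (m * int N)" using assms(1) by (simp add: field_simps)
  then have "i = m * int N" by (simp only: of_int_eq_iff)
  then have "i mod int N = 0" by simp
  then show ?thesis using assms(2) by simp
qed

lemma eis_point_level:
  assumes N: "N > 0" and b: "b \<in> level_index N"
  shows "eis_point (level_point N b) N"
proof
  show "level_point N b \<notin> \<int> \<times> \<int>"
  proof
    assume "level_point N b \<in> \<int> \<times> \<int>"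
    then have "fst b = 0" "snd b = 0" using b level_coord_int[OF N]
      by (auto simp: level_point_def level_index_def mem_Times_iff)
    then show False using b by (auto simp: level_index_def prod_eq_iff)
  qed
qed (use N b in \<open>auto simp: level_point_def level_index_def\<close>)

lemma level_point_inj: "N > 0 \<Longrightarrow> inj (level_point N)"
  by (auto simp: inj_def level_point_def prod_eq_iff)

context level
begin

abbreviation "rR \<equiv> - 2 * of_real pi * \<i> :: complex"

text \<open>The coefficients are chosen so that they sum to \<open>- 1\<close>, which cancels the \<open>1/(\<tau> - cnj \<tau>)\<close> terms, and so
  that the Fourier transform of \<open>T\<close> produces \<open>- 2 * G\<close>; the second summand then fixes the multiple of \<open>T 0 0\<close>.\<close>

definition kap :: "int \<times> int \<Rightarrow> int \<times> int \<Rightarrow> complex" where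
  "kap a b = 2 / of_nat N ^ 2 * (1 - ze (snd a * fst b - fst a * snd b)) - 3 / (of_nat N ^ 2 - 1)"

text \<open>What is left independent of \<open>t\<close>: with \<open>c = fst a / N\<close>, the
  constants from expanding \<open>(J 0 x - c) ^ 2\<close>, and the \<open>lam 1\<close> terms which
  \<open>T\<close> omits when the first coordinate is 0.\<close>

definition kap_const :: "int \<times> int \<Rightarrow> complex" where
  "kap_const a = rR ^ 2 * ((of_int (fst a) / of_nat N) ^ 2 - of_int (fst a) / of_nat N + 1 / 4
     - (\<Sum>b\<in>level_index N. kap a b * (if fst b = 0 then lam 1 (ze (snd b)) else 0)))"

lemma eisenstein_level:
  assumes b: "(b1, b2) \<in> level_index N"
  defines "x \<equiv> ze b2 * qn ^ nat b1"
  shows "x \<in> annulus" "x \<noteq> 1"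
    "eisenstein 1 (level_point N (b1, b2)) t = rR * (J 0 x - of_int b1 / of_nat N)"
    "eisenstein 2 (level_point N (b1, b2)) t = rR ^ 2 * J 1 x + rR * inv_2iy t"
proof -
  interpret eis_point "level_point N (b1, b2)" N by (rule eis_point_level[OF N b])
  have b1: "b1 \<ge> 0" using b by (auto simp: level_index_def)
  have r: "of_real r1 = (of_int b1 / of_nat N :: complex)" "of_real r2 = (of_int b2 / of_nat N :: complex)"
    by (simp_all add: level_point_def of_rat_divide)
  have "qn ^ nat b1 = exp (of_nat (nat b1) * (2 * of_real pi * \<i> * (t / of_nat N)))"
    unfolding qn_def cexp2_def by (simp only: exp_of_nat_mult)
  also have "\<dots> = cexp2 (of_int b1 / of_nat N * t)" using b1 by (simp add: cexp2_def mult_ac)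
  finally have x: "x = xt t" unfolding r cexp2_add by (simp add: x_def ze_def mult_ac)
  have Jx: "Jt n t = J n x" for n unfolding x by (rule Jt_eq[OF t])
  show "x \<in> annulus" "x \<noteq> 1" unfolding x using xt_facts[OF t] by auto
  show "eisenstein 1 (level_point N (b1, b2)) t = rR * (J 0 x - of_int b1 / of_nat N)"
    using eisenstein_q[OF t, of 1] by (simp add: g0_def g1_def r Jx)
  show "eisenstein 2 (level_point N (b1, b2)) t = rR ^ 2 * J 1 x + rR * inv_2iy t"
    using eisenstein_q[OF t, of 2] by (simp add: g0_def g1_def Jx)
qed

lemma sum_level_index:
  fixes F :: "int \<times> int \<Rightarrow> complex"
  shows "(\<Sum>b\<in>level_index N. F b) = (\<Sum>b\<in>{0..<int N} \<times> {0..<int N}. F b) - F (0, 0)"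
  unfolding level_index_def using N by (subst sum_diff1) auto

lemma kap_sum:
  "(\<Sum>b\<in>level_index N. kap a b * F b) =
     2 / of_nat N ^ 2 * ((\<Sum>b\<in>{0..<int N} \<times> {0..<int N}. F b)
       - (\<Sum>b\<in>{0..<int N} \<times> {0..<int N}. ze (snd a * fst b - fst a * snd b) * F b))
     - 3 / (of_nat N ^ 2 - 1) * ((\<Sum>b\<in>{0..<int N} \<times> {0..<int N}. F b) - F (0, 0))"
proof -
  have "kap a b * F b = 2 / of_nat N ^ 2 * (F b - ze (snd a * fst b - fst a * snd b) * F b) - 3 / (of_nat N ^ 2 - 1) * F b" for b
    unfolding kap_def by (simp only: left_diff_distrib right_diff_distrib mult_1_left mult_1_right mult.assoc)
  then have "(\<Sum>b\<in>level_index N. kap a b * F b) =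
      2 / of_nat N ^ 2 * (\<Sum>b\<in>level_index N. F b - ze (snd a * fst b - fst a * snd b) * F b) - 3 / (of_nat N ^ 2 - 1) * (\<Sum>b\<in>level_index N. F b)"
    by (simp only: sum_subtractf sum_distrib_left[symmetric])
  also have "(\<Sum>b\<in>level_index N. F b - ze (snd a * fst b - fst a * snd b) * F b) =
      (\<Sum>b\<in>{0..<int N} \<times> {0..<int N}. F b) - (\<Sum>b\<in>{0..<int N} \<times> {0..<int N}. ze (snd a * fst b - fst a * snd b) * F b)"
    unfolding sum_level_index by (simp add: sum_subtractf)
  finally show ?thesis unfolding sum_level_index .
qed

lemma ze_sum_product:
  assumes a: "a \<in> level_index N"
  shows "(\<Sum>b\<in>{0..<int N} \<times> {0..<int N}. ze (snd a * fst b - fst a * snd b)) = 0"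
proof -
  have e: "ze (snd a * i - fst a * j) = ze (i * snd a) * ze (j * (- fst a))" for i j
    unfolding ze_add[symmetric] by (simp add: algebra_simps)
  have "(\<Sum>b\<in>{0..<int N} \<times> {0..<int N}. ze (snd a * fst b - fst a * snd b)) =
      (\<Sum>i\<in>{0..<int N}. ze (i * snd a)) * (\<Sum>j\<in>{0..<int N}. ze (j * (- fst a)))"
    unfolding sum_product sum.cartesian_product by (simp add: e case_prod_beta)
  also have "\<dots> = 0"
  proof -
    have "\<not> (int N dvd fst a \<and> int N dvd snd a)"
      using a zdvd_not_zless[of "fst a" "int N"] zdvd_not_zless[of "snd a" "int N"]
      by (auto simp: level_index_def prod_eq_iff dest: order.not_eq_order_implies_strict)
    then show ?thesis unfolding ze_sum by auto
  qed
  finally show ?thesis .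
qed

lemma T_sum:
  "(\<Sum>b\<in>{0..<int N} \<times> {0..<int N}. ze (snd a * fst b - fst a * snd b) * T (fst b) (snd b)) =
     of_nat N ^ 2 * G (fst a) (snd a)"
  using T_fourier[of "snd a" "fst a"]
  by (subst (asm) sum.swap) (simp add: sum.cartesian_product case_prod_beta)

lemma level_index_nontrivial: "a \<in> level_index N \<Longrightarrow> (of_nat N ^ 2 :: complex) \<noteq> 1"
proof -
  assume "a \<in> level_index N"
  then have "N \<noteq> 1" by (cases a) (auto simp: level_index_def)
  then have "N ^ 2 \<noteq> 1" by simp
  then show ?thesis by (metis of_nat_1_eq_iff of_nat_power)
qed

text \<open>In \<open>(J 0 x - c) ^ 2\<close> the terms linear in \<open>J 0\<close> cancel once
  \<open>Psi 0 x\<close> is replaced by \<open>G k l - c * (J 0 x - 1 / 2)\<close>. There remains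
  \<open>J 1 x - T 0 0 - 2 * G k l\<close> plus constants, and the weights \<open>kap\<close> are
  made to produce \<open>- T 0 0 - 2 * G k l\<close>.\<close>

lemma eisenstein_1_square_const:
  assumes a: "a \<in> level_index N"
  shows "eisenstein 1 (level_point N a) t ^ 2 = eisenstein 2 (level_point N a) t
    + (\<Sum>b\<in>level_index N. kap a b * eisenstein 2 (level_point N b) t) + kap_const a"
proof -
  obtain k l where kl: "a = (k, l)" by (cases a)
  define x where "x = ze l * qn ^ nat k"
  define c where "c = (of_int k / of_nat N :: complex)"
  define R where "R = rR"
  define u where "u = inv_2iy t"
  define S where "S = (\<Sum>b\<in>level_index N. kap a b * (if fst b = 0 then lam 1 (ze (snd b)) else 0))"
  note E = eisenstein_level[OF a[unfolded kl], folded x_def c_def R_def u_def]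
  have k: "k \<ge> 0" "nat k < N" using a kl by (auto simp: level_index_def)
  have n: "(of_nat N ^ 2 :: complex) \<noteq> 0" "(of_nat N ^ 2 :: complex) - 1 \<noteq> 0" using N level_index_nontrivial[OF a] by auto
  have cancel: "z / w * w = z" if "w \<noteq> 0" for z w :: complex using that by simp
  have "(\<Sum>b\<in>level_index N. kap a b * 1) = 2 / of_nat N ^ 2 * of_nat N ^ 2 - 3 / (of_nat N ^ 2 - 1) * (of_nat N ^ 2 - 1)"
    using kap_sum[of a "\<lambda>_. 1"] ze_sum_product[OF a] by (simp add: power2_eq_square)
  also have "\<dots> = 2 - 3" unfolding cancel[OF n(1)] cancel[OF n(2)] ..
  finally have "(\<Sum>b\<in>level_index N. kap a b * 1) = - 1" by simp
  then have k1: "(\<Sum>b\<in>level_index N. kap a b) = - 1" by simp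
  have kT: "(\<Sum>b\<in>level_index N. kap a b * T (fst b) (snd b)) = - T 0 0 - 2 * G k l"
  proof -
    have "(\<Sum>b\<in>{0..<int N} \<times> {0..<int N}. T (fst b) (snd b)) = of_nat N ^ 2 * T 0 0"
      using T_sum[of "(0, 0)"] G_0 by simp
    then have "(\<Sum>b\<in>level_index N. kap a b * T (fst b) (snd b)) =
        2 / of_nat N ^ 2 * (of_nat N ^ 2 * T 0 0 - of_nat N ^ 2 * G k l) - 3 / (of_nat N ^ 2 - 1) * (of_nat N ^ 2 * T 0 0 - T 0 0)"
      unfolding kap_sum T_sum by (simp add: kl)
    also have "of_nat N ^ 2 * T 0 0 - T 0 0 = (of_nat N ^ 2 - 1) * T 0 0" by (simp add: algebra_simps)
    also have "2 / of_nat N ^ 2 * (of_nat N ^ 2 * T 0 0 - of_nat N ^ 2 * G k l) = 2 * (T 0 0 - G k l)"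
      unfolding right_diff_distrib mult.assoc[symmetric] cancel[OF n(1)] ..
    also have "3 / (of_nat N ^ 2 - 1) * ((of_nat N ^ 2 - 1) * T 0 0) = 3 * T 0 0"
      unfolding mult.assoc[symmetric] cancel[OF n(2)] ..
    finally show ?thesis by (simp add: algebra_simps)
  qed
  have E2: "eisenstein 2 (level_point N b) t = R ^ 2 * (T (fst b) (snd b) + (if fst b = 0 then lam 1 (ze (snd b)) else 0)) + R * u"
    if b: "b \<in> level_index N" for b
  proof -
    obtain b1 b2 where bb: "b = (b1, b2)" by (cases b)
    have *: "b1 \<ge> 0" "nat b1 < N" "nat b1 = 0 \<longleftrightarrow> b1 = 0" using b bb by (auto simp: level_index_def)
    show ?thesis unfolding bb eisenstein_level(4)[OF b[unfolded bb]] T_eq[OF *(2)] R_def u_def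
      using * by (simp del: lam.simps)
  qed
  have "(\<Sum>b\<in>level_index N. kap a b * eisenstein 2 (level_point N b) t) =
      (\<Sum>b\<in>level_index N. R ^ 2 * (kap a b * T (fst b) (snd b)) + R ^ 2 * (kap a b * (if fst b = 0 then lam 1 (ze (snd b)) else 0)) + R * u * kap a b)"
    by (intro sum.cong refl) (simp only: E2 distrib_left mult_ac)
  also have "\<dots> = R ^ 2 * (- T 0 0 - 2 * G k l) + R ^ 2 * S - R * u"
    by (simp only: sum.distrib sum_distrib_left[symmetric] k1 kT S_def) simp
  finally have sum: "(\<Sum>b\<in>level_index N. kap a b * eisenstein 2 (level_point N b) t) = R ^ 2 * (- T 0 0 - 2 * G k l) + R ^ 2 * S - R * u" .
  have const: "kap_const a = R ^ 2 * (c ^ 2 - c + 1 / 4 - S)" by (simp add: kap_const_def S_def c_def R_def kl)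
  \<comment> \<open>With this the constant
    \<open>1 / 4 - 6 * LA wt1 1 q 1 + 4 * LA wtS 0 q 1\<close> of \<open>J_square\<close> at
    \<open>q = cexp2 t\<close> collapses to \<open>1 / 4 - T 0 0\<close>.\<close>
  have "LA wtS 0 (cexp2 t) 1 = LA wt1 1 (cexp2 t) 1" by (rule lambert_swap[symmetric])
  then have J0: "J 0 x ^ 2 = J 1 x - 2 * Psi 0 x + 1 / 4 - T 0 0"
    using J_square[OF E(1,2)] T_0 by (simp only:) simp
  have "G k l = Psi 0 x + c * (J 0 x - 1 / 2)" using G_eq[OF k(2), of l] k(1) by (simp add: x_def c_def)
  then have Psi: "Psi 0 x = G k l - c * (J 0 x - 1 / 2)" by simp
  have "(R * (J 0 x - c)) ^ 2 = R ^ 2 * (J 0 x ^ 2 - 2 * c * J 0 x + c ^ 2)"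
    by (simp add: power2_eq_square algebra_simps)
  also have "\<dots> = R ^ 2 * J 1 x + R * u + (R ^ 2 * (- T 0 0 - 2 * G k l) + R ^ 2 * S - R * u) + R ^ 2 * (c ^ 2 - c + 1 / 4 - S)"
    unfolding J0 Psi by (simp add: algebra_simps)
  finally show ?thesis unfolding sum const unfolding kl E(3,4) .
qed

end

lemma slash_invariant_at:
  assumes "slash_invariant (principal_congruence_subgroup N) k f" "A \<in> principal_congruence_subgroup N" "\<tau> \<in> uhp"
  shows "f (moebius A \<tau>) = automorphy_factor A \<tau> ^ k * f \<tau>"
proof -
  have "A \<in> carrier SL2Z" using assms(2) by (simp add: principal_congruence_subgroup_iff)
  then have "automorphy_factor A \<tau> \<noteq> 0" by (rule automorphy_factor_nonzero[OF _ assms(3)])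
  moreover have "slash k f A \<tau> = f \<tau>" using assms by (simp add: slash_invariant_def)
  ultimately show ?thesis by (simp add: slash_def field_simps)
qed

text \<open>The difference \<open>D\<close> of the two sides is a constant \<open>C\<close>, yet it
  transforms with weight 2 under the principal subgroup; only 0 does both.\<close>

lemma eisenstein_1_square:
  assumes N: "N > 0" and a: "a \<in> level_index N" and t: "t \<in> uhp"
  shows "eisenstein 1 (level_point N a) t ^ 2 = eisenstein 2 (level_point N a) t
    + (\<Sum>b\<in>level_index N. level.kap N a b * eisenstein 2 (level_point N b) t)"
proof -
  define \<kappa> where "\<kappa> = level.kap N a"
  define C where "C = level.kap_const N a"
  define D where "D t = eisenstein 1 (level_point N a) t ^ 2 - eisenstein 2 (level_point N a) t
    - (\<Sum>b\<in>level_index N. \<kappa> b * eisenstein 2 (level_point N b) t)" for t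
  have D: "D t = C" if "t \<in> uhp" for t
  proof -
    interpret level N t using N that by unfold_locales
    show ?thesis using eisenstein_1_square_const[OF a] by (simp add: D_def \<kappa>_def C_def)
  qed
  \<comment> \<open>A lower triangular matrix, since translations have automorphy factor 1. Its
    factor at \<open>\<i>\<close> is \<open>N * \<i> + 1\<close>, whose square is not real.\<close>
  define A where "A = mat2 1 0 (int N) 1"
  have A: "A \<in> principal_congruence_subgroup N" by (simp add: A_def principal_congruence_subgroup_iff carrier_SL2Z)
  have i: "\<i> \<in> uhp" by (simp add: uhp_iff)
  let ?j = "automorphy_factor A \<i>"
  have inv: "eisenstein k (level_point N b) (moebius A \<i>) = ?j ^ k * eisenstein k (level_point N b) \<i>"
    if "k > 0" "b \<in> level_index N" for k b
  proof -
    interpret eis_point "level_point N b" N by (rule eis_point_level[OF N that(2)])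
    show ?thesis by (rule slash_invariant_at[OF eisenstein_slash_invariant[OF that(1) N aN a] A i])
  qed
  have "D (moebius A \<i>) = ?j ^ 2 * D \<i>"
    unfolding D_def right_diff_distrib sum_distrib_left
    by (simp add: inv a power_mult_distrib mult_ac cong: sum.cong)
  moreover have "moebius A \<i> \<in> uhp" using A i by (intro moebius_uhp) (simp_all add: principal_congruence_subgroup_iff)
  ultimately have "C = ?j ^ 2 * C" using D i by simp
  moreover have "?j ^ 2 \<noteq> 1"
  proof -
    have "Im (?j ^ 2) = 2 * real N" by (simp add: A_def automorphy_factor_def power2_eq_square)
    then show ?thesis using N by auto
  qed
  ultimately have "C = 0" by simp
  then show ?thesis using D[OF t] by (simp add: D_def \<kappa>_def algebra_simps)
qed

section \<open>Holomorphic projection of the squared series\<close>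

text \<open>Reduction modulo 1 brings both coordinates into the range that \<open>eis_point\<close>
  demands.\<close>

lemma level_point_representative:
  assumes N: "N > 0" and a: "of_nat N * fst a \<in> \<int>" "of_nat N * snd a \<in> \<int>" "a \<notin> \<int> \<times> \<int>"
  obtains b where "b \<in> level_index N" "\<And>k. eisenstein k a = eisenstein k (level_point N b)"
proof -
  obtain p q where pq: "of_nat N * fst a = of_int p" "of_nat N * snd a = of_int q"
    using a(1,2) by (auto elim!: Ints_cases)
  define b where "b = (p mod int N, q mod int N)"
  have c: "x = of_int (m mod int N) / of_nat N + of_int (m div int N)" if "of_nat N * x = of_int m" for x :: rat and m
  proof -
    have "of_nat N * x = of_int (int N * (m div int N) + m mod int N)" using that by simp
    then show ?thesis using N by (simp only: of_int_add of_int_mult of_int_of_nat_eq) (simp add: field_simps)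
  qed
  have e: "a = (fst (level_point N b) + of_int (p div int N), snd (level_point N b) + of_int (q div int N))"
    using c[OF pq(1)] c[OF pq(2)] by (simp add: level_point_def b_def prod_eq_iff)
  have E: "eisenstein k a = eisenstein k (level_point N b)" for k
    by (subst e, rule eisenstein_shift) auto
  have "b \<noteq> (0, 0)"
  proof
    assume "b = (0, 0)"
    then have "a = (of_int (p div int N), of_int (q div int N))" using e by (simp add: level_point_def)
    then show False using a(3) by auto
  qed
  then have "b \<in> level_index N" using N by (auto simp: level_index_def b_def)
  then show thesis using that E by blast
qed

locale torsion_index =
  fixes a :: "rat \<times> rat" and N :: nat
  assumes N: "N > 0" and aN: "of_nat N * fst a \<in> \<int>" "of_nat N * snd a \<in> \<int>" and a: "a \<notin> \<int> \<times> \<int>"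
begin

abbreviation "\<Gamma> \<equiv> principal_congruence_subgroup N"

lemma row_act_index: "A \<in> carrier SL2Z \<Longrightarrow> torsion_index (row_act a A) N"
  using N row_act_torsion[OF aN] row_act_not_int[OF _ a] by (simp add: torsion_index_def)

lemma eisenstein_bounded_near_infinity: "k > 0 \<Longrightarrow> \<exists>C. \<forall>t. Im t > 1 \<longrightarrow> norm (eisenstein k a t) \<le> C"
proof -
  assume k: "k > 0"
  obtain b where b: "b \<in> level_index N" "\<And>k. eisenstein k a = eisenstein k (level_point N b)"
    using level_point_representative[OF N aN a] by blast
  interpret eis_point "level_point N b" N by (rule eis_point_level[OF N b(1)])
  show ?thesis using eisenstein_bounded[OF k] b(2) by simp
qed

text \<open>The slash by \<open>A\<close> replaces \<open>a\<close> by \<open>row_act a A\<close>,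
  again a torsion point of level \<open>N\<close>. So boundedness near infinity at every such point
  gives boundedness at every cusp.\<close>

lemma bounded_at_cusps_eisenstein:
  assumes k: "k > 0"
  shows "bounded_at_cusps k (eisenstein k a)"
  unfolding bounded_at_cusps_def
proof
  fix A assume A: "A \<in> carrier SL2Z"
  obtain C where C: "\<And>t. Im t > 1 \<Longrightarrow> norm (eisenstein k (row_act a A) t) \<le> C"
    using torsion_index.eisenstein_bounded_near_infinity[OF row_act_index[OF A] k] by blast
  have "norm (slash k (eisenstein k a) A t) \<le> C" if "Im t > 1" for t
    using C[OF that] eisenstein_slash[OF A _ k N aN a, of t] that by (simp add: uhp_iff)
  then show "\<exists>B>0. \<exists>C. \<forall>\<tau>. B < Im \<tau> \<longrightarrow> norm (slash k (eisenstein k a) A \<tau>) \<le> C"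
    by (intro exI[of _ 1]) auto
qed

lemma vanishes_off_uhp_eisenstein: "vanishes_off_uhp (eisenstein k a)"
  by (simp add: vanishes_off_uhp_def eisenstein_def)

lemma near_hol_eisenstein: "k > 0 \<Longrightarrow> near_hol (eisenstein k a)"
  and holomorphic_eisenstein: "k > 0 \<Longrightarrow> k \<noteq> 2 \<Longrightarrow> eisenstein k a holomorphic_on uhp"
proof -
  obtain b where b: "b \<in> level_index N" "\<And>k. eisenstein k a = eisenstein k (level_point N b)"
    using level_point_representative[OF N aN a] by blast
  interpret eis_point "level_point N b" N by (rule eis_point_level[OF N b(1)])
  show "near_hol (eisenstein k a)" if "k > 0" unfolding b(2) near_hol_def using eisenstein_coeffs[OF that] by blast
  show "eisenstein k a holomorphic_on uhp" if "k > 0" "k \<noteq> 2"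
  proof (rule holomorphic_transform[OF g0_holomorphic])
    show "g0 k t = eisenstein k a t" if "t \<in> uhp" for t
      unfolding b(2) using eisenstein_q[OF that \<open>k > 0\<close>] \<open>k \<noteq> 2\<close> by (simp add: g1_def)
  qed
qed

lemma eisenstein_modular: "k > 0 \<Longrightarrow> k \<noteq> 2 \<Longrightarrow> eisenstein k a \<in> modular_forms \<Gamma> k"
  unfolding modular_forms_def mem_Collect_eq
  by (intro conjI vanishes_off_uhp_eisenstein holomorphic_eisenstein bounded_at_cusps_eisenstein
      eisenstein_slash_invariant N aN a)

lemma eisenstein_nearly_holomorphic:
  assumes "k > 0"
  shows "eisenstein k a \<in> nearly_holomorphic_forms \<Gamma> k"
proof -
  have "poly_growth (slash k (eisenstein k a) A)" if A: "A \<in> carrier SL2Z" for A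
  proof -
    obtain B C where "B > 0" "\<And>\<tau>. B < Im \<tau> \<Longrightarrow> norm (slash k (eisenstein k a) A \<tau>) \<le> C"
      using bounded_at_cusps_eisenstein[OF assms] A unfolding bounded_at_cusps_def by meson
    then show ?thesis unfolding poly_growth_def
      by (intro exI[of _ B] conjI exI[of _ C] exI[of _ 0]) auto
  qed
  then show ?thesis unfolding nearly_holomorphic_forms_iff
    using vanishes_off_uhp_eisenstein near_hol_eisenstein[OF assms] eisenstein_slash_invariant[OF assms N aN a] by blast
qed

lemma series_square_nth:
  "fps_nth ((eisenstein_series a t)\<^sup>2) n = (- 1) ^ n * (\<Sum>i\<le>n. eisenstein (i + 1) a t * eisenstein (n - i + 1) a t)"
proof -
  have "fps_nth ((eisenstein_series a t)\<^sup>2) n =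
      (\<Sum>i=0..n. eisenstein (i + 1) a t * (- 1) ^ i * (eisenstein (n - i + 1) a t * (- 1) ^ (n - i)))"
    unfolding power2_eq_square fps_mult_nth by (simp add: eisenstein_series_def)
  also have "\<dots> = (\<Sum>i\<le>n. (- 1) ^ n * (eisenstein (i + 1) a t * eisenstein (n - i + 1) a t))"
  proof (rule sum.cong)
    fix i assume "i \<in> {..n}"
    then have "(- 1) ^ n = (- 1) ^ i * (- 1 :: complex) ^ (n - i)" by (simp add: power_add[symmetric])
    then show "eisenstein (i + 1) a t * (- 1) ^ i * (eisenstein (n - i + 1) a t * (- 1) ^ (n - i)) =
        (- 1) ^ n * (eisenstein (i + 1) a t * eisenstein (n - i + 1) a t)" by (simp add: mult_ac)
  qed auto
  finally show ?thesis by (simp only: sum_distrib_left)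
qed

lemma hol_proj_square_nth_pos:
  assumes n: "n \<ge> 1"
  shows "hol_proj \<Gamma> (n + 2) (\<lambda>t. fps_nth ((eisenstein_series a t)\<^sup>2) n) \<in> eisenstein_space \<Gamma> (n + 2)"
proof -
  obtain b where b: "b \<in> level_index N" "\<And>k. eisenstein k a = eisenstein k (level_point N b)"
    using level_point_representative[OF N aN a] by blast
  interpret p: eis_point "level_point N b" N by (rule eis_point_level[OF N b(1)])
  define c where "c = (- 1) ^ n * (of_nat (n + 1) :: complex)"
  define f where "f = (\<lambda>t. c * eisenstein (n + 2) a t)"
  have f: "f \<in> modular_forms \<Gamma> (n + 2)" unfolding f_def using n by (intro modular_forms_scale eisenstein_modular) auto
  have "(\<lambda>t. eisenstein (i + 1) a t * eisenstein (n - i + 1) a t) \<in> nearly_holomorphic_forms \<Gamma> (n + 2)" if "i \<le> n" for i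
  proof -
    have "i + 1 + (n - i + 1) = n + 2" using that by simp
    then show ?thesis
      using nearly_holomorphic_forms_mult[OF eisenstein_nearly_holomorphic[of "i + 1"] eisenstein_nearly_holomorphic[of "n - i + 1"]]
      by simp
  qed
  then have F: "(\<lambda>t. fps_nth ((eisenstein_series a t)\<^sup>2) n) \<in> nearly_holomorphic_forms \<Gamma> (n + 2)"
    unfolding series_square_nth by (intro nearly_holomorphic_forms_scale nearly_holomorphic_forms_sum) auto
  define d where "d = (- 1) ^ n * (2 * (- 2 * of_real pi * \<i>) / of_nat n :: complex)"
  have eq: "(\<lambda>t. fps_nth ((eisenstein_series a t)\<^sup>2) n) = (\<lambda>t. f t + d * delta_op n (eisenstein n a) t)"
  proof
    fix t
    show "fps_nth ((eisenstein_series a t)\<^sup>2) n = f t + d * delta_op n (eisenstein n a) t"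
    proof (cases "t \<in> uhp")
      case True
      have "(\<Sum>i\<le>n. eisenstein (i + 1) a t * eisenstein (n - i + 1) a t) =
          of_nat (n + 1) * eisenstein (n + 2) a t + 2 * (- 2 * of_real pi * \<i>) / of_nat n * delta_op n (eisenstein n a) t"
        unfolding b(2) by (rule p.eisenstein_convolution[OF True n])
      then show ?thesis unfolding series_square_nth f_def c_def d_def by (simp only: distrib_left mult.assoc)
    next
      case False
      then show ?thesis unfolding series_square_nth f_def by (simp add: eisenstein_def delta_op_def)
    qed
  qed
  have "hol_proj \<Gamma> (n + 2) (\<lambda>t. fps_nth ((eisenstein_series a t)\<^sup>2) n) = f"
    using n by (intro hol_proj_add_delta[OF N n F f eisenstein_nearly_holomorphic eq]) auto
  moreover have "f \<in> eisenstein_space \<Gamma> (n + 2)"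
    unfolding eisenstein_space_def using f
    by (intro CollectI conjI exI[of _ "{a}"] exI[of _ "\<lambda>_. c"]) (auto simp: f_def)
  ultimately show ?thesis by simp
qed

lemma hol_proj_square_nth_0:
  "hol_proj \<Gamma> 2 (\<lambda>t. fps_nth ((eisenstein_series a t)\<^sup>2) 0) \<in> eisenstein_space \<Gamma> 2"
proof -
  obtain b where b: "b \<in> level_index N" "\<And>k. eisenstein k a = eisenstein k (level_point N b)"
    using level_point_representative[OF N aN a] by blast
  define f where "f = (\<lambda>t. fps_nth ((eisenstein_series a t)\<^sup>2) 0)"
  have f1: "f = (\<lambda>t. eisenstein 1 a t * eisenstein 1 a t)" unfolding f_def series_square_nth by simp
  have f: "f \<in> modular_forms \<Gamma> 2"
    unfolding f1 using modular_forms_mult[OF eisenstein_modular[of 1] eisenstein_modular[of 1]] by (simp add: numeral_2_eq_2)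
  \<comment> \<open>The summand 1 at \<open>b\<close> accounts for the weight 2 series at the point
    itself, which stands outside the sum in \<open>eisenstein_1_square\<close>.\<close>
  let ?p = "level_point N" and ?\<kappa> = "\<lambda>c. level.kap N b c + (if c = b then 1 else 0)"
  have inj: "inj_on ?p (level_index N)" using level_point_inj[OF N] by (rule inj_on_subset) simp
  have fin: "finite (level_index N)" by (simp add: level_index_def)
  have "f = (\<lambda>t. \<Sum>c\<in>?p ` level_index N. ?\<kappa> (inv_into UNIV ?p c) * eisenstein 2 c t)"
  proof
    fix t
    have "(\<Sum>c\<in>?p ` level_index N. ?\<kappa> (inv_into UNIV ?p c) * eisenstein 2 c t) = (\<Sum>c\<in>level_index N. ?\<kappa> c * eisenstein 2 (?p c) t)"
      unfolding sum.reindex[OF inj] by (simp add: inv_f_f[OF level_point_inj[OF N]])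
    also have "\<dots> = (\<Sum>c\<in>level_index N. level.kap N b c * eisenstein 2 (?p c) t) + eisenstein 2 (?p b) t"
      using b(1) fin by (simp add: distrib_right sum.distrib if_distrib[of "\<lambda>x. x * _"] cong: if_cong)
    also have "\<dots> = f t"
    proof (cases "t \<in> uhp")
      case True
      show ?thesis unfolding f1 b(2) using eisenstein_1_square[OF N b(1) True] by (simp add: power2_eq_square)
    next
      case False
      then show ?thesis unfolding f1 by (simp add: eisenstein_def)
    qed
    finally show "f t = (\<Sum>c\<in>?p ` level_index N. ?\<kappa> (inv_into UNIV ?p c) * eisenstein 2 c t)" ..
  qed
  then have "f \<in> eisenstein_space \<Gamma> 2" unfolding eisenstein_space_def using f fin
    by (intro CollectI conjI exI[of _ "?p ` level_index N"] exI[of _ "\<lambda>c. ?\<kappa> (inv_into UNIV ?p c)"] finite_imageI)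
  then have "hol_proj \<Gamma> 2 f \<in> eisenstein_space \<Gamma> 2" unfolding hol_proj_modular_form[OF N f] .
  then show ?thesis unfolding f_def .
qed

end

theorem theorem4p3:
  fixes a :: "rat \<times> rat" and N :: nat
  assumes "a \<notin> \<int> \<times> \<int>"
    and "N > 0" and "of_nat N * fst a \<in> \<int>" and "of_nat N * snd a \<in> \<int>"
  shows "hol_proj_series (principal_congruence_subgroup N) (\<lambda>\<tau>. (eisenstein_series a \<tau>)\<^sup>2)
           \<in> eisenstein_series_space"
proof -
  interpret torsion_index a N using assms by unfold_locales
  have "hol_proj \<Gamma> (n + 2) (\<lambda>t. fps_nth ((eisenstein_series a t)\<^sup>2) n) \<in> eisenstein_space \<Gamma> (n + 2)" for n
  proof (cases "n = 0")
    case True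
    then show ?thesis using hol_proj_square_nth_0 by (simp add: numeral_2_eq_2)
  qed (simp add: hol_proj_square_nth_pos del: add_2_eq_Suc')
  then show ?thesis
    unfolding eisenstein_series_space_def hol_proj_series_def
    using congruence_subgroup_principal[OF N] by (auto intro!: exI[of _ \<Gamma>])
qed

end
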